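(* For every $1\le r\le k$ (and every $0\le t\le1$), $$\mathbb{E}\bigl\langle \Delta(R_{1,2},q_{\alpha\wedge\beta})\,I(\alpha\wedge\beta=r)\bigr\rangle=(m_r-m_{r-1})\,\mu_r\bigl(\Delta(R_{1,2},q_r)\bigr),$$ where $\langle\cdot\rangle$ on the left denotes the average of functions of $\bigl((\vec\sigma^1,\alpha),(\vec\sigma^2,\beta)\bigr)$ with respect to $\Gamma^{\otimes2}$, and $I$ denotes an indicator.
   Context: Setting. Let $N\ge1$, $\Sigma_N=\{-1,+1\}^N$, and for $\vec\sigma^1,\vec\sigma^2\in\Sigma_N$ let $R_{1,2}=\frac1N\sum_{i\le N}\sigma^1_i\sigma^2_i$. Let $\xi$ be a smooth convex function with $\xi(0)=0$, and let $(H_N(\vec\sigma))_{\vec\sigma\in\Sigma_N}$ be a centered Gaussian process with $\mathbb{E}H_N(\vec\sigma^1)H_N(\vec\sigma^2)=N\xi(R_{1,2})$. Put $\theta(x)=x\xi'(x)-\xi(x)$ and $\Delta(a,b)=\xi(a)-a\xi'(b)+\theta(b)$. Let $k\ge1$, $0=m_0<m_1<\dots<m_k<1$ and $0=q_0<q_1<\dots<q_k<q_{k+1}=1$. Let $Z=(z_{il})$, $1\le i\le N$, $0\le l\le k$, be a matrix of independent centered Gaussian variables with $\mathbb{E}z_{il}^2=\xi'(q_{l+1})-\xi'(q_l)$, with columns $z_l=(z_{il})_{i\le N}$, independent of $H_N$. Definition of $\Gamma$. Derrida-Ruelle cascade with parameters $m_1,\dots,m_k$: $(u_{n_1})_{n_1\ge1}$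 is the decreasing enumeration of a Poisson point process on $(0,\infty)$ with intensity $x^{-1-m_1}dx$; recursively for $2\le l\le k$, for all $(n_1,\dots,n_{l-1})\in\mathbb{N}^{l-1}$, $(u_{n_1\dots n_{l-1}n_l})_{n_l\ge1}$ are (decreasing enumerations of) independent Poisson point processes with intensity $x^{-1-m_l}dx$, independent of all previously constructed processes. For $\alpha=(n_1,\dots,n_k)\in\mathbb{N}^k$, $v_\alpha=\prod_{1\le l\le k}u_{n_1\dots n_l}$ and $w_\alpha=v_\alpha/\sum_{\gamma\in\mathbb{N}^k} v_\gamma$ (the sum is a.s. finite). Let $(z_{n_1})_{n_1\ge1}$ be i.i.d. copies of the column $z_1$ and, for $2\le l\le k$ and all $(n_1,\dots,n_{l-1})$, let $(z_{n_1\dots n_l})_{n_l\ge1}$ be independent sequences of i.i.d. copies of $z_l$, independent of everything constructed at earlier levels and of $z_0$. For $\alpha=(n_1,\dots,n_k)$ let $(z^\alpha_{il})$ be the matrix with columns $(z_0,z_{n_1},z_{n_1n_2},\dots,z_{n_1\dots n_k})$ (indexed by $l=0,\dots,k$; $z_0$ is common to all $\alpha$), and $s^\alpha=(s_i^\alpha)_{i\le N}$ with $s_i^\alpha=\sum_{0\le l\le k}z_{il}^\alpha$. The process $H_N$, the Gaussian columns and the cascade are mutually independent. For $0\le t\le1$ let $H_t(\vec\sigma,\alpha)=\sqrt t\,H_N(\vec\sigma)+\sqrt{1-t}\,s^\alpha\cdot\vec\sigma$, and let $\Gamma$ be the random probability measure on $\Sigma_N\times\mathbb{N}^k$ with $\Gamma\{(\vec\sigma,\alpha)\}$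 proportional to $w_\alpha\exp H_t(\vec\sigma,\alpha)$. For $\alpha,\beta\in\mathbb{N}^k$, $\alpha\wedge\beta=\min\{l\ge1:\alpha_l\ne\beta_l\}$ if $\alpha\ne\beta$, and $\alpha\wedge\beta=k+1$ if $\alpha=\beta$. Definition of $\mu_r$ (for the same $t$). With $s=(s_1,\dots,s_N)$, $s_i=\sum_{0\le l\le k}z_{il}$, let $H_t(\vec\sigma)=\sqrt t\,H_N(\vec\sigma)+\sqrt{1-t}\,s\cdot\vec\sigma$, $X_k=\log\sum_{\vec\sigma\in\Sigma_N}\exp H_t(\vec\sigma)$, and recursively for $1\le l\le k$, $X_{l-1}=\frac1{m_l}\log\mathbb{E}_l\exp m_lX_l$, where $\mathbb{E}_l$ is expectation in $(z_{ip})$ for $1\le i\le N$, $l\le p\le k$ (all else fixed). Let $W_l=\exp m_l(X_l-X_{l-1})$ for $1\le l\le k$. Fix $1\le r\le k$ and let $Z^1,Z^2$ be two copies of $Z$ such that for all $i\le N$, $z^1_{il}=z^2_{il}$ for $l\le r-1$ and $z^1_{il},z^2_{il}$ are independent for $l\ge r$ (i.e. columns $0,\dots,r-1$ coincide and all other columns are independent). For $j=1,2$ (with the same $H_N$ for both), let $s^j=(s^j_1,\dots,s^j_N)$ with $s^j_i=\sum_{0\le l\le k}z^j_{il}$, let $H_t^j(\vec\sigma)=\sqrt t\,H_N(\vec\sigma)+\sqrt{1-t}\,s^j\cdot\vec\sigma$, $X_k^j=\log\sum_{\vec\sigma\in\Sigma_N}\exp H_t^j(\vec\sigma)$, and recursively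 for $1\le l\le k$, $X_{l-1}^j=\frac1{m_l}\log\mathbb{E}_l^j\exp m_lX_l^j$, where $\mathbb{E}_l^j$ is expectation in $(z^j_{ip})$ for $1\le i\le N$, $l\le p\le k$ (all else fixed), and let $W_l^j=\exp m_l(X_l^j-X_{l-1}^j)$ for $1\le l\le k$. For $f:\Sigma_N^2\to\mathbb{R}$, $$\mu_r(f)=\mathbb{E}\prod_{1\le l<r}W_l^1\prod_{r\le l\le k}W_l^1W_l^2\,\langle f\rangle,$$ where here $\langle\cdot\rangle$ is the Gibbs average on $\Sigma_N^2$ with weights proportional to $\exp\bigl(H_t^1(\vec\sigma^1)+H_t^2(\vec\sigma^2)\bigr)$. *)

theory Defs
  imports "HOL-Probability.Probability"
begin

definition smooth :: "(real \<Rightarrow> real) \<Rightarrow> bool" where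
  "smooth f \<longleftrightarrow> (\<forall>n x. (deriv ^^ n) f differentiable at x)"

definition theta :: "(real \<Rightarrow> real) \<Rightarrow> real \<Rightarrow> real" where
  "theta \<xi> x = x * deriv \<xi> x - \<xi> x"

definition Delta :: "(real \<Rightarrow> real) \<Rightarrow> real \<Rightarrow> real \<Rightarrow> real" where
  "Delta \<xi> a b = \<xi> a - a * deriv \<xi> b + theta \<xi> b"

definition spins :: "nat \<Rightarrow> (nat \<Rightarrow> real) set" where
  "spins N = {..<N} \<rightarrow>\<^sub>E {-1, 1}"

definition overlap :: "nat \<Rightarrow> (nat \<Rightarrow> real) \<Rightarrow> (nat \<Rightarrow> real) \<Rightarrow> real" where
  "overlap N \<sigma>1 \<sigma>2 = (\<Sum>i<N. \<sigma>1 i * \<sigma>2 i) / real N"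


subsection \<open>Gaussian families\<close>

(* Law of a centered Gaussian variable with variance v. The scaled standard normal law
   covers the degenerate case v = 0, which occurs when \<xi>' is constant on some
   interval [q l, q (l+1)]. *)
definition centered_gaussian :: "real \<Rightarrow> real measure" where
  "centered_gaussian v = distr std_normal_distribution borel (\<lambda>x. sqrt v * x)"

definition centered_gaussian_process ::
    "'w measure \<Rightarrow> 'i set \<Rightarrow> ('i \<Rightarrow> 'w \<Rightarrow> real) \<Rightarrow> bool" where
  "centered_gaussian_process M I X \<longleftrightarrow>
     (\<forall>i\<in>I. X i \<in> borel_measurable M) \<and>
     (\<forall>J c. finite J \<and> J \<subseteq> I \<longrightarrow>
        (\<exists>v\<ge>0. distr M borel (\<lambda>\<omega>. \<Sum>j\<in>J. c j * X j \<omega>) = centered_gaussian v))"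

definition independent_gaussians ::
    "'w measure \<Rightarrow> 'i set \<Rightarrow> ('i \<Rightarrow> real) \<Rightarrow> ('i \<Rightarrow> 'w \<Rightarrow> real) \<Rightarrow> bool" where
  "independent_gaussians M I v X \<longleftrightarrow>
     (\<forall>i\<in>I. X i \<in> borel_measurable M \<and> distr M borel (X i) = centered_gaussian (v i)) \<and>
     prob_space.indep_vars M (\<lambda>_. borel) X I"

definition generated_events ::
    "'w measure \<Rightarrow> 'i set \<Rightarrow> ('i \<Rightarrow> 'w \<Rightarrow> real) \<Rightarrow> 'w set set" where
  "generated_events M I X =
     sets (vimage_algebra (space M) (\<lambda>\<omega>. \<lambda>i\<in>I. X i \<omega>) (PiM I (\<lambda>_. borel)))"

definition column_var :: "(real \<Rightarrow> real) \<Rightarrow> (nat \<Rightarrow> real) \<Rightarrow> nat \<Rightarrow> real" where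
  "column_var \<xi> q l = deriv \<xi> (q (Suc l)) - deriv \<xi> (q l)"


subsection \<open>Poisson point processes and the Derrida--Ruelle cascade\<close>

(* poisson_pmf is only specified for positive rates, so rate 0 is a separate case. *)
definition poisson_law :: "ennreal \<Rightarrow> ennreal measure" where
  "poisson_law c =
     (if c = \<infinity> then return borel \<infinity>
      else if c = 0 then return borel 0
      else distr (measure_pmf (poisson_pmf (enn2real c))) borel of_nat)"

definition point_count :: "(nat \<Rightarrow> 'w \<Rightarrow> real) \<Rightarrow> real set \<Rightarrow> 'w \<Rightarrow> ennreal" where
  "point_count x A \<omega> = emeasure (count_space UNIV) {n. x n \<omega> \<in> A}"

(* The random points x 0, x 1, ..., counted with multiplicity, form a Poisson point process
   with intensity measure \<mu>. *)
definition poisson_points :: "'w measure \<Rightarrow> real measure \<Rightarrow> (nat \<Rightarrow> 'w \<Rightarrow> real) \<Rightarrow> bool" where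
  "poisson_points M \<mu> x \<longleftrightarrow>
     (\<forall>n. x n \<in> borel_measurable M) \<and>
     (\<forall>A\<in>sets \<mu>. distr M borel (point_count x A) = poisson_law (emeasure \<mu> A)) \<and>
     (\<forall>F. finite F \<and> F \<subseteq> sets \<mu> \<and> disjoint F \<longrightarrow>
        prob_space.indep_vars M (\<lambda>_. borel) (point_count x) F)"

definition power_intensity :: "real \<Rightarrow> real measure" where
  "power_intensity a = density lborel (\<lambda>x. ennreal (indicator {0<..} x * x powr (-1 - a)))"

(* The variable with multi-index (n_1, ..., n_l) is u [n_1, ..., n_l]. Labels n_j start at 0
   rather than 1. The sequence attached to a prefix p of length l - 1 is n \<mapsto> u (p @ [n]),
   with parameter m l. *)
definition derrida_ruelle_cascade ::
    "'w measure \<Rightarrow> nat \<Rightarrow> (nat \<Rightarrow> real) \<Rightarrow> (nat list \<Rightarrow> 'w \<Rightarrow> real) \<Rightarrow> bool" where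
  "derrida_ruelle_cascade M k m u \<longleftrightarrow>
     (\<forall>p. length p < k \<longrightarrow>
        poisson_points M (power_intensity (m (Suc (length p)))) (\<lambda>n. u (p @ [n])) \<and>
        (AE \<omega> in M. decseq (\<lambda>n. u (p @ [n]) \<omega>))) \<and>
     prob_space.indep_vars M (\<lambda>_. PiM UNIV (\<lambda>_. borel)) (\<lambda>p \<omega> n. u (p @ [n]) \<omega>)
       {p. length p < k}"

(* All multi-indices carrying a cascade variable. *)
definition nodes :: "nat \<Rightarrow> nat list set" where
  "nodes k = {p. 1 \<le> length p \<and> length p \<le> k}"

definition leaves :: "nat \<Rightarrow> nat list set" where
  "leaves k = {\<alpha>. length \<alpha> = k}"

definition cascade_v :: "nat \<Rightarrow> (nat list \<Rightarrow> real) \<Rightarrow> nat list \<Rightarrow> real" where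
  "cascade_v k u \<alpha> = (\<Prod>l=1..k. u (take l \<alpha>))"

definition cascade_w :: "nat \<Rightarrow> (nat list \<Rightarrow> real) \<Rightarrow> nat list \<Rightarrow> real" where
  "cascade_w k u \<alpha> = cascade_v k u \<alpha> / (\<Sum>\<^sub>\<infinity>\<gamma>\<in>leaves k. cascade_v k u \<gamma>)"

(* Lists are indexed from 0, so the l-th coordinate of \<alpha> is \<alpha> ! (l - 1). *)
definition wedge :: "nat \<Rightarrow> nat list \<Rightarrow> nat list \<Rightarrow> nat" where
  "wedge k \<alpha> \<beta> = (if \<alpha> = \<beta> then k + 1 else (LEAST l. 1 \<le> l \<and> \<alpha> ! (l - 1) \<noteq> \<beta> ! (l - 1)))"


subsection \<open>The Gibbs measure on spins and leaves\<close>

(* h is a realization of H_N and s an external field. *)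
definition hamiltonian ::
    "nat \<Rightarrow> real \<Rightarrow> ((nat \<Rightarrow> real) \<Rightarrow> real) \<Rightarrow> (nat \<Rightarrow> real) \<Rightarrow> (nat \<Rightarrow> real) \<Rightarrow> real" where
  "hamiltonian N t h s \<sigma> = sqrt t * h \<sigma> + sqrt (1 - t) * (\<Sum>i<N. s i * \<sigma> i)"

(* z (p, i) is the i-th entry of the column attached to the tree node p; the root [] carries
   the column z_0 common to all leaves. *)
definition leaf_field :: "nat \<Rightarrow> (nat list \<times> nat \<Rightarrow> real) \<Rightarrow> nat list \<Rightarrow> nat \<Rightarrow> real" where
  "leaf_field k z \<alpha> i = (\<Sum>l\<le>k. z (take l \<alpha>, i))"

definition tree_entries :: "nat \<Rightarrow> nat \<Rightarrow> (nat list \<times> nat) set" where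
  "tree_entries N k = {p. length p \<le> k} \<times> {..<N}"

definition gibbs_weight ::
    "nat \<Rightarrow> nat \<Rightarrow> real \<Rightarrow> ((nat \<Rightarrow> real) \<Rightarrow> real) \<Rightarrow> (nat list \<times> nat \<Rightarrow> real) \<Rightarrow>
     (nat list \<Rightarrow> real) \<Rightarrow> (nat \<Rightarrow> real) \<times> nat list \<Rightarrow> real" where
  "gibbs_weight N k t h z u =
     (\<lambda>(\<sigma>, \<alpha>). cascade_w k u \<alpha> * exp (hamiltonian N t h (leaf_field k z \<alpha>) \<sigma>))"

definition gibbs_measure ::
    "nat \<Rightarrow> nat \<Rightarrow> real \<Rightarrow> ((nat \<Rightarrow> real) \<Rightarrow> real) \<Rightarrow> (nat list \<times> nat \<Rightarrow> real) \<Rightarrow>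
     (nat list \<Rightarrow> real) \<Rightarrow> ((nat \<Rightarrow> real) \<times> nat list) measure" where
  "gibbs_measure N k t h z u =
     point_measure (spins N \<times> leaves k)
       (\<lambda>x. ennreal (gibbs_weight N k t h z u x /
                      (\<Sum>\<^sub>\<infinity>y\<in>spins N \<times> leaves k. gibbs_weight N k t h z u y)))"


subsection \<open>The functionals $X_l$, $W_l$ and $\mu_r$\<close>

(* Here a matrix is a function z with entries z (i, l), i < N, l \<le> k. *)
definition matrix_field :: "nat \<Rightarrow> (nat \<times> nat \<Rightarrow> real) \<Rightarrow> nat \<Rightarrow> real" where
  "matrix_field k z i = (\<Sum>l\<le>k. z (i, l))"

(* The expectation E_l: columns l, ..., k are integrated with respect to their law, everything
   else is kept fixed. *)
definition expect_from ::
    "nat \<Rightarrow> nat \<Rightarrow> (real \<Rightarrow> real) \<Rightarrow> (nat \<Rightarrow> real) \<Rightarrow> nat \<Rightarrow>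
     ((nat \<times> nat \<Rightarrow> real) \<Rightarrow> real) \<Rightarrow> (nat \<times> nat \<Rightarrow> real) \<Rightarrow> real" where
  "expect_from N k \<xi> q l F z =
     (\<integral>y. F (override_on z y ({..<N} \<times> {l..k}))
        \<partial>PiM ({..<N} \<times> {l..k}) (\<lambda>(i, p). centered_gaussian (column_var \<xi> q p)))"

function X_fun ::
    "nat \<Rightarrow> nat \<Rightarrow> (real \<Rightarrow> real) \<Rightarrow> (nat \<Rightarrow> real) \<Rightarrow> (nat \<Rightarrow> real) \<Rightarrow> real \<Rightarrow>
     ((nat \<Rightarrow> real) \<Rightarrow> real) \<Rightarrow> nat \<Rightarrow> (nat \<times> nat \<Rightarrow> real) \<Rightarrow> real" where
  "X_fun N k \<xi> q m t h l z =
     (if k \<le> l then ln (\<Sum>\<sigma>\<in>spins N. exp (hamiltonian N t h (matrix_field k z) \<sigma>))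
      else 1 / m (Suc l) *
        ln (expect_from N k \<xi> q (Suc l)
              (\<lambda>z'. exp (m (Suc l) * X_fun N k \<xi> q m t h (Suc l) z')) z))"
  by pat_completeness auto
termination
  by (relation "Wellfounded.measure (\<lambda>(N, k, \<xi>, q, m, t, h, l, z). k - l)") auto

declare X_fun.simps [simp del]

definition W_fun ::
    "nat \<Rightarrow> nat \<Rightarrow> (real \<Rightarrow> real) \<Rightarrow> (nat \<Rightarrow> real) \<Rightarrow> (nat \<Rightarrow> real) \<Rightarrow> real \<Rightarrow>
     ((nat \<Rightarrow> real) \<Rightarrow> real) \<Rightarrow> nat \<Rightarrow> (nat \<times> nat \<Rightarrow> real) \<Rightarrow> real" where
  "W_fun N k \<xi> q m t h l z =
     exp (m l * (X_fun N k \<xi> q m t h l z - X_fun N k \<xi> q m t h (l - 1) z))"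

definition gibbs2 ::
    "nat \<Rightarrow> real \<Rightarrow> ((nat \<Rightarrow> real) \<Rightarrow> real) \<Rightarrow> (nat \<Rightarrow> real) \<Rightarrow> (nat \<Rightarrow> real) \<Rightarrow>
     ((nat \<Rightarrow> real) \<Rightarrow> (nat \<Rightarrow> real) \<Rightarrow> real) \<Rightarrow> real" where
  "gibbs2 N t h s1 s2 f =
     (\<Sum>\<sigma>1\<in>spins N. \<Sum>\<sigma>2\<in>spins N.
        f \<sigma>1 \<sigma>2 * exp (hamiltonian N t h s1 \<sigma>1 + hamiltonian N t h s2 \<sigma>2)) /
     (\<Sum>\<sigma>1\<in>spins N. \<Sum>\<sigma>2\<in>spins N.
        exp (hamiltonian N t h s1 \<sigma>1 + hamiltonian N t h s2 \<sigma>2))"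

(* Z (j, i, l), j = 1, 2, are the entries of the matrices Z^1, Z^2: columns 0, ..., r - 1
   coincide, and all remaining entries are independent. *)
definition coupled_copies ::
    "'w measure \<Rightarrow> nat \<Rightarrow> nat \<Rightarrow> (real \<Rightarrow> real) \<Rightarrow> (nat \<Rightarrow> real) \<Rightarrow> nat \<Rightarrow>
     (nat \<times> nat \<times> nat \<Rightarrow> 'w \<Rightarrow> real) \<Rightarrow> bool" where
  "coupled_copies M N k \<xi> q r Z \<longleftrightarrow>
     independent_gaussians M ({1} \<times> {..<N} \<times> {..k} \<union> {2} \<times> {..<N} \<times> {r..k})
       (\<lambda>(j, i, l). column_var \<xi> q l) Z \<and>
     (\<forall>i<N. \<forall>l<r. \<forall>\<omega>\<in>space M. Z (2, i, l) \<omega> = Z (1, i, l) \<omega>)"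

definition copy_entries :: "nat \<Rightarrow> nat \<Rightarrow> (nat \<times> nat \<times> nat) set" where
  "copy_entries N k = {1, 2} \<times> {..<N} \<times> {..k}"

definition mu ::
    "'w measure \<Rightarrow> nat \<Rightarrow> nat \<Rightarrow> (real \<Rightarrow> real) \<Rightarrow> (nat \<Rightarrow> real) \<Rightarrow> (nat \<Rightarrow> real) \<Rightarrow> real \<Rightarrow>
     ((nat \<Rightarrow> real) \<Rightarrow> 'w \<Rightarrow> real) \<Rightarrow> (nat \<times> nat \<times> nat \<Rightarrow> 'w \<Rightarrow> real) \<Rightarrow> nat \<Rightarrow>
     ((nat \<Rightarrow> real) \<Rightarrow> (nat \<Rightarrow> real) \<Rightarrow> real) \<Rightarrow> real" where
  "mu M N k \<xi> q m t H Z r f =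
     (\<integral>\<omega>. (let h = (\<lambda>\<sigma>. H \<sigma> \<omega>);
               z1 = (\<lambda>(i, l). Z (1, i, l) \<omega>);
               z2 = (\<lambda>(i, l). Z (2, i, l) \<omega>);
               W = W_fun N k \<xi> q m t h
           in (\<Prod>l\<in>{1..<r}. W l z1) * (\<Prod>l\<in>{r..k}. W l z1 * W l z2) *
              gibbs2 N t h (matrix_field k z1) (matrix_field k z2) f) \<partial>M)"

end

theory Submission
  imports Defs
begin

text \<open>By linearity it suffices to treat indicators of \<open>(\<sigma>1, \<sigma>2) = (a, b)\<close>, so that every integrand is nonnegative.
Let \<open>T\<close> be the partition function summed over the leaves and \<open>D\<close> the corresponding sum over pairs of
leaves that separate at level \<open>r\<close>; the left-hand side is the expectation of \<open>D / T\<^sup>2\<close>. As \<open>1 / T\<^sup>2\<close> is the integral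
of \<open>\<tau> exp (- \<tau> T)\<close> over \<open>\<tau> > 0\<close>, one needs the expectation of \<open>D exp (- \<tau> T)\<close>. For the subtree at a
node of depth \<open>l\<close>, the Laplace functional and the Mecke formulas of the Poisson processes show, by
induction from the leaves to the root, that the expectations of \<open>exp (- \<tau> T)\<close>, \<open>A exp (- \<tau> T)\<close> and
\<open>D exp (- \<tau> T)\<close> keep the form of a constant times \<open>(\<tau> Y)\<^sup>s \<tau>\<^sup>-\<^sup>w exp (- C (\<tau> Y)\<^sup>m) Q\<close> with \<open>Y = exp X_l\<close> and
\<open>m = m_(l+1)\<close>, where \<open>Q\<close> at depth \<open>l\<close> is the average of \<open>W_(l+1) Q\<close> over column \<open>l + 1\<close>. The constants telescope
to \<open>m_r - m_(r-1)\<close>, and integrating the columns of the two coupled matrices one at a time, starting from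
the last, turns \<open>\<mu>_r\<close> into the same iterated average.\<close>

text \<open>The recursion closes because the intensity \<open>x powr (-1 - a)\<close> is
  homogeneous: rescaling points by c multiplies integrals by \<open>c powr a\<close>. A random
  column thus enters a subtree only through the moment of \<open>Y (Suc l)\<close> of order
  \<open>m (Suc l)\<close>, which is how \<open>X_l\<close> is defined, and an extra factor Q in
  that moment is averaged with the density \<open>W_(l+1)\<close>. The difference of the m's has a
  single origin: the two-point formula at the branching node, of depth r say, doubles the exponent,
  so the next integration towards the root produces
  \<open>Gamma (2 - \<rho>) = (1 - \<rho>) * Gamma (1 - \<rho>)\<close> with
  \<open>\<rho> = m r / m (Suc r)\<close>, and \<open>m (Suc r) * (1 - \<rho>)\<close> is the
  difference. The integral over \<tau> acts as a further level of parameter \<open>m 0 = 0\<close>: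
  its intensity dx / x is scale invariant, so \<open>Y 0\<close> drops out and no constant remains.
  Finiteness of T is not known beforehand; sums therefore live in \<open>ennreal\<close>, with
  exp(-infinity) = 0, and both T < infinity and T > 0 are read off afterwards from the Laplace
  transform.\<close>

section \<open>Exponential decay on the extended half-line\<close>

definition ee :: "ennreal \<Rightarrow> ennreal" where
  "ee x = (if x = \<infinity> then 0 else ennreal (exp (- enn2real x)))"

lemma ee_0[simp]: "ee 0 = 1"
  by (simp add: ee_def)

lemma ee_top[simp]: "ee top = 0"
  by (simp add: ee_def)

lemma ee_ennreal: "0 \<le> r \<Longrightarrow> ee (ennreal r) = ennreal (exp (- r))"
  by (simp add: ee_def)

lemma ee_le_1[simp]: "ee x \<le> 1"
  by (cases x) (auto simp: ee_def)

lemma ee_less_top[simp]: "ee x < top" "ee x \<noteq> top"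
  by (auto simp: ee_def)

lemma ee_add: "ee (x + y) = ee x * ee y"
  by (cases x; cases y) (auto simp: ee_ennreal exp_add[symmetric] ennreal_mult[symmetric] simp flip: ennreal_plus)

lemma ee_antimono: "x \<le> y \<Longrightarrow> ee y \<le> ee x"
  by (cases x; cases y) (auto simp: ee_ennreal top_unique)

lemma ee_eq_0_iff: "ee x = 0 \<longleftrightarrow> x = top"
  by (cases x) (auto simp: ee_ennreal)

lemma ee_measurable[measurable]: "ee \<in> borel_measurable borel"
  unfolding ee_def[abs_def] by measurable

lemma ee_sum: "finite A \<Longrightarrow> ee (\<Sum>i\<in>A. f i) = (\<Prod>i\<in>A. ee (f i))"
  by (induction A rule: finite_induct) (auto simp: ee_add)

text \<open>Antitonicity turns suprema into infima. For a finite supremum this is continuity of exp;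
  for an infinite one every level \<open>- ln r\<close> is exceeded, which pushes the infimum below
  any positive e.\<close>

lemma ee_SUP:
  assumes "incseq f"
  shows "(INF i. ee (f i)) = ee (SUP i. f i)"
proof (cases "SUP i. f i")
  case (real r)
  have lim: "f \<longlonglongrightarrow> ennreal r"
    using LIMSEQ_SUP[OF assms] real by simp
  have fin: "f i < top" for i
    using real by (metis SUP_upper UNIV_I ennreal_less_top order_le_less_trans)
  have "(\<lambda>i. enn2real (f i)) \<longlonglongrightarrow> r"
    by (rule tendsto_enn2real[OF lim real(1)])
  then have "(\<lambda>i. ennreal (exp (- enn2real (f i)))) \<longlonglongrightarrow> ennreal (exp (- r))"
    by (intro tendsto_ennrealI tendsto_exp tendsto_minus)
  moreover have "ennreal (exp (- enn2real (f i))) = ee (f i)" for i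
    using fin[of i] by (simp add: ee_def)
  ultimately have "(\<lambda>i. ee (f i)) \<longlonglongrightarrow> ennreal (exp (- r))" by simp
  moreover have "(\<lambda>i. ee (f i)) \<longlonglongrightarrow> (INF i. ee (f i))"
    by (intro LIMSEQ_INF) (auto simp: decseq_def intro!: ee_antimono incseqD[OF assms])
  ultimately show ?thesis
    using real by (simp add: ee_ennreal LIMSEQ_unique)
next
  case top
  have "(INF i. ee (f i)) \<le> e" if "0 < e" for e
  proof -
    \<comment> \<open>A value below 1 keeps \<open>- ln r\<close> positive, so that
      \<open>ennreal\<close> does not truncate it and \<open>ee\<close> returns r.\<close>
    obtain r where r: "0 < r" "ennreal r \<le> e" "r < 1"
    proof (cases e)
      case (real r)
      then show ?thesis using that(1) \<open>0 < e\<close>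
        by (intro that[of "min r (1/2)"]) (auto simp: ennreal_less_zero_iff)
    next
      case top then show ?thesis by (intro that[of "1/2"]) auto
    qed
    have "ennreal (- ln r) < (SUP i. f i)" by (simp add: top)
    then obtain i where i: "ennreal (- ln r) < f i" by (auto simp: less_SUP_iff)
    have "ee (f i) \<le> ee (ennreal (- ln r))" using i by (intro ee_antimono) auto
    also have "\<dots> = ennreal r" using r by (simp add: ee_ennreal)
    finally show ?thesis using r(2) by (meson INF_lower2 UNIV_I order_trans)
  qed
  then have "(INF i. ee (f i)) = 0"
    by (meson dense linorder_not_less not_gr_zero)
  then show ?thesis by (simp only: top ee_top)
qed

lemma ee_suminf: "ee (\<Sum>j. f j) = (INF n. \<Prod>j<n. ee (f j))"
proof -
  have "incseq (\<lambda>n. \<Sum>j<n. f j)" by (auto simp: incseq_def intro!: sum_mono2)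
  from ee_SUP[OF this] show ?thesis
    by (simp add: ee_sum suminf_eq_SUP)
qed

text \<open>Decreasing monotone convergence needs a finite integral; \<open>ee\<close> is at most 1,
  so finiteness of the measure provides it.\<close>

lemma nn_integral_ee_SUP:
  assumes "finite_measure M" "incseq f" and [measurable]: "\<And>i. f i \<in> borel_measurable M"
  shows "(INF i. \<integral>\<^sup>+x. ee (f i x) \<partial>M) = (\<integral>\<^sup>+x. ee (SUP i. f i x) \<partial>M)"
proof -
  interpret finite_measure M by fact
  have inc: "incseq (\<lambda>i. f i x)" for x
    using assms(2) by (auto simp: incseq_def le_fun_def)
  have "(\<integral>\<^sup>+x. ee (SUP i. f i x) \<partial>M) = (\<integral>\<^sup>+x. (INF i. ee (f i x)) \<partial>M)"
    by (simp add: ee_SUP[OF inc])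
  also have "\<dots> = (INF i. \<integral>\<^sup>+x. ee (f i x) \<partial>M)"
  proof (rule nn_integral_monotone_convergence_INF_decseq)
    show "decseq (\<lambda>i x. ee (f i x))"
      by (intro monotoneI) (auto simp: le_fun_def intro!: ee_antimono incseqD[OF inc])
    fix i
    have "(\<integral>\<^sup>+x. ee (f i x) \<partial>M) \<le> (\<integral>\<^sup>+x. 1 \<partial>M)" by (intro nn_integral_mono) auto
    also have "\<dots> < \<infinity>" by (simp add: less_top[symmetric])
    finally show "(\<integral>\<^sup>+x. ee (f i x) \<partial>M) < \<infinity>" .
  qed auto
  finally show ?thesis by simp
qed

subsection \<open>Poisson point processes\<close>

text \<open>The Laplace transform of a Poisson variable is an exponential series evaluated at
  \<open>s * exp (- r)\<close>. Rates 0 and infinity are treated apart because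
  \<open>poisson_law\<close> is then a point mass.\<close>

lemma nn_integral_poisson_law:
  assumes "0 < c" "c < top"
  shows "(\<integral>\<^sup>+x. ee (c * x) \<partial>poisson_law a) = ee ((1 - ee c) * a)"
proof -
  obtain r where r: "c = ennreal r" "0 < r"
    using assms by (cases c) auto
  have e: "ee c = ennreal (exp (-r))" "1 - ee c = ennreal (1 - exp (-r))"
    using r by (auto simp: ee_ennreal ennreal_minus simp flip: ennreal_1)
  consider "a = \<infinity>" | "a = 0" | s where "a = ennreal s" "0 < s"
    by (cases a) (auto simp: zero_less_iff_neq_zero, metis ennreal_0 less_eq_real_def)
  then show ?thesis
  proof cases
    case 1
    then show ?thesis
      using r e by (simp add: poisson_law_def nn_integral_return ennreal_mult_top)
  next
    case 2
    then show ?thesis by (simp add: poisson_law_def nn_integral_return)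
  next
    case (3 s)
    have "(\<integral>\<^sup>+x. ee (c * x) \<partial>poisson_law a) = (\<integral>\<^sup>+n. ee (c * of_nat n) \<partial>measure_pmf (poisson_pmf s))"
      using 3 by (simp add: poisson_law_def nn_integral_distr)
    also have "\<dots> = (\<integral>\<^sup>+n. ennreal (pmf (poisson_pmf s) n) * ee (c * of_nat n) \<partial>count_space UNIV)"
      by (simp add: nn_integral_measure_pmf)
    also have "\<dots> = (\<Sum>n. ennreal (s ^ n / fact n * exp (-s)) * ee (c * of_nat n))"
      using 3 by (simp add: nn_integral_count_space_nat)
    also have "\<dots> = (\<Sum>n. ennreal (exp (-s) * ((s * exp (-r)) ^ n /\<^sub>R fact n)))"
    proof (intro suminf_cong)
      fix n
      have "ee (c * of_nat n) = ennreal (exp (- (r * real n)))"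
        using r by (simp add: ennreal_of_nat_eq_real_of_nat ennreal_mult[symmetric] ee_ennreal)
      also have "exp (- (r * real n)) = exp (-r) ^ n"
        by (simp add: exp_of_nat_mult[symmetric] mult.commute)
      finally show "ennreal (s ^ n / fact n * exp (-s)) * ee (c * of_nat n) =
        ennreal (exp (-s) * ((s * exp (-r)) ^ n /\<^sub>R fact n))"
        using 3 by (simp add: ennreal_mult[symmetric] power_mult_distrib field_simps)
    qed
    also have "\<dots> = ennreal (exp (-s) * exp (s * exp (-r)))"
    proof (rule suminf_ennreal_eq)
      show "(\<lambda>n. exp (- s) * ((s * exp (- r)) ^ n /\<^sub>R fact n)) sums (exp (- s) * exp (s * exp (- r)))"
        by (intro sums_mult exp_converges)
    qed (use 3 in auto)
    also have "\<dots> = ee ((1 - ee c) * a)"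
      unfolding e(2) 3(1) using 3 r by (simp add: ennreal_mult[symmetric] ee_ennreal exp_add[symmetric] algebra_simps)
    finally show ?thesis .
  qed
qed

text \<open>As a series of indicators the count is measurable, and the sum of a step function over
  the points becomes a combination of counts.\<close>

lemma point_count_eq_suminf: "point_count x A \<omega> = (\<Sum>n. indicator A (x n \<omega>))"
proof -
  have "point_count x A \<omega> = (\<integral>\<^sup>+n. indicator {n. x n \<omega> \<in> A} n \<partial>count_space UNIV)"
    unfolding point_count_def by (subst nn_integral_indicator) auto
  also have "\<dots> = (\<Sum>n. indicator {n. x n \<omega> \<in> A} n)"
    by (simp add: nn_integral_count_space_nat)
  also have "\<dots> = (\<Sum>n. indicator A (x n \<omega>))"
    by (intro suminf_cong) (auto split: split_indicator)
  finally show ?thesis .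
qed

locale ppp = prob_space R for R :: "'r measure" +
  fixes \<mu> :: "real measure" and X :: "nat \<Rightarrow> 'r \<Rightarrow> real"
  assumes points: "poisson_points R \<mu> X" and sets_\<mu>: "sets \<mu> = sets borel"
begin

lemma X_measurable[measurable]: "X n \<in> borel_measurable R"
  using points by (auto simp: poisson_points_def)

lemma meas_\<mu>: "f \<in> borel_measurable borel \<Longrightarrow> f \<in> borel_measurable \<mu>"
  using measurable_cong_sets[OF sets_\<mu> refl] by auto

lemma point_count_measurable: "A \<in> sets borel \<Longrightarrow> point_count X A \<in> borel_measurable R"
  unfolding point_count_eq_suminf[abs_def]
  by (intro borel_measurable_suminf_order measurable_compose[OF X_measurable] borel_measurable_indicator)

text \<open>A step function has finitely many nonzero values; the counts of their level sets are
  independent Poisson variables, so the expectation factorises into Laplace transforms of Poisson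
  laws.\<close>

lemma laplace_simple:
  assumes f: "simple_function borel f" "\<And>x. f x < top"
  shows "(\<integral>\<^sup>+\<omega>. ee (\<Sum>n. f (X n \<omega>)) \<partial>R) = ee (\<integral>\<^sup>+x. (1 - ee (f x)) \<partial>\<mu>)"
proof -
  \<comment> \<open>The value 0 contributes nothing to either side, and omitting it keeps every
    remaining c positive.\<close>
  define V where "V = range f - {0}"
  have fin: "finite V" using f(1) by (auto simp: V_def simple_function_def)
  define A where "A c = f -` {c}" for c
  have A[measurable]: "A c \<in> sets borel" for c
    using f(1) borel_measurable_simple_function[OF f(1)] measurable_sets_borel[of f borel "{c}"]
    by (simp add: A_def)
  have A\<mu>: "A c \<in> sets \<mu>" for c using A sets_\<mu> by simp
  have rep: "g (f x) = (\<Sum>c\<in>V. g c * indicator (A c) x)" if "g 0 = 0" for g :: "ennreal \<Rightarrow> ennreal" and x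
  proof (cases "f x = 0")
    case True
    then have "indicator (A c) x = (0::ennreal)" if "c \<in> V" for c
      using that by (auto simp: A_def V_def)
    then show ?thesis using True \<open>g 0 = 0\<close> by simp
  next
    case False
    then have fx: "f x \<in> V" by (auto simp: V_def)
    have "(\<Sum>c\<in>V. g c * indicator (A c) x) = (\<Sum>c\<in>V. if c = f x then g c else 0)"
      by (intro sum.cong) (auto simp: A_def split: split_indicator)
    then show ?thesis using fx fin by simp
  qed
  have injA: "inj_on A V"
    by (rule inj_onI) (auto simp: A_def V_def)
  have S: "(\<Sum>n. f (X n \<omega>)) = (\<Sum>c\<in>V. c * point_count X (A c) \<omega>)" for \<omega>
  proof -
    have "(\<Sum>n. f (X n \<omega>)) = (\<Sum>n. \<Sum>c\<in>V. c * indicator (A c) (X n \<omega>))"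
      by (subst rep[of "\<lambda>c. c", OF refl]) (rule refl)
    also have "\<dots> = (\<Sum>c\<in>V. \<Sum>n. c * indicator (A c) (X n \<omega>))"
      by (simp add: suminf_sum)
    also have "\<dots> = (\<Sum>c\<in>V. c * point_count X (A c) \<omega>)"
      by (simp add: point_count_eq_suminf)
    finally show ?thesis .
  qed
  have ind: "indep_vars (\<lambda>_. borel) (point_count X) (A ` V)"
  proof -
    have "finite (A ` V)" "A ` V \<subseteq> sets \<mu>" "disjoint (A ` V)"
      using A\<mu> fin by (auto simp: disjoint_def A_def)
    then show ?thesis
      using points unfolding poisson_points_def by simp
  qed
  \<comment> \<open>Independence is indexed by the level sets themselves, so the value c belonging
    to a set is recovered by \<open>the_inv_into\<close>.\<close>
  have ind2: "indep_vars (\<lambda>_. borel) (\<lambda>B. (\<lambda>y. ee (the_inv_into V A B * y)) \<circ> point_count X B) (A ` V)"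
    by (rule indep_vars_compose[OF ind]) auto
  have "(\<integral>\<^sup>+\<omega>. ee (\<Sum>n. f (X n \<omega>)) \<partial>R) = (\<integral>\<^sup>+\<omega>. (\<Prod>c\<in>V. ee (c * point_count X (A c) \<omega>)) \<partial>R)"
    by (simp add: S ee_sum[OF fin])
  also have "\<dots> = (\<integral>\<^sup>+\<omega>. (\<Prod>B\<in>A ` V. ((\<lambda>y. ee (the_inv_into V A B * y)) \<circ> point_count X B) \<omega>) \<partial>R)"
    by (subst prod.reindex[OF injA]) (simp add: the_inv_into_f_f[OF injA])
  also have "\<dots> = (\<Prod>B\<in>A ` V. \<integral>\<^sup>+\<omega>. ((\<lambda>y. ee (the_inv_into V A B * y)) \<circ> point_count X B) \<omega> \<partial>R)"
    by (rule indep_vars_nn_integral[OF _ ind2]) (use fin in auto)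
  also have "\<dots> = (\<Prod>c\<in>V. \<integral>\<^sup>+\<omega>. ee (c * point_count X (A c) \<omega>) \<partial>R)"
    by (subst prod.reindex[OF injA]) (simp add: the_inv_into_f_f[OF injA] comp_def)
  also have "\<dots> = (\<Prod>c\<in>V. ee ((1 - ee c) * emeasure \<mu> (A c)))"
  proof (intro prod.cong refl)
    fix c assume c: "c \<in> V"
    have law: "distr R borel (point_count X (A c)) = poisson_law (emeasure \<mu> (A c))"
      using points A\<mu> unfolding poisson_points_def by auto
    have "(\<integral>\<^sup>+\<omega>. ee (c * point_count X (A c) \<omega>) \<partial>R) = (\<integral>\<^sup>+x. ee (c * x) \<partial>distr R borel (point_count X (A c)))"
      by (subst nn_integral_distr) (auto intro: point_count_measurable)
    also have "\<dots> = ee ((1 - ee c) * emeasure \<mu> (A c))"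
      unfolding law using c f(2)
      by (intro nn_integral_poisson_law) (auto simp: V_def zero_less_iff_neq_zero)
    finally show "(\<integral>\<^sup>+\<omega>. ee (c * point_count X (A c) \<omega>) \<partial>R) = ee ((1 - ee c) * emeasure \<mu> (A c))" .
  qed
  also have "\<dots> = ee (\<Sum>c\<in>V. (1 - ee c) * emeasure \<mu> (A c))"
    by (simp add: ee_sum[OF fin])
  also have "(\<Sum>c\<in>V. (1 - ee c) * emeasure \<mu> (A c)) = (\<Sum>c\<in>V. \<integral>\<^sup>+x. (1 - ee c) * indicator (A c) x \<partial>\<mu>)"
    using A\<mu> by (simp add: nn_integral_cmult)
  also have "\<dots> = (\<integral>\<^sup>+x. (\<Sum>c\<in>V. (1 - ee c) * indicator (A c) x) \<partial>\<mu>)"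
    using A\<mu> by (subst nn_integral_sum) (auto intro!: meas_\<mu>)
  also have "\<dots> = (\<integral>\<^sup>+x. (1 - ee (f x)) \<partial>\<mu>)"
    by (intro nn_integral_cong rep[of "\<lambda>c. 1 - ee c", symmetric]) simp
  finally show ?thesis .
qed

text \<open>Simple functions increase to f; the sums over the points and the exponent both pass to
  the supremum, and \<open>ee\<close> turns these suprema into infima.\<close>

lemma laplace:
  assumes [measurable]: "f \<in> borel_measurable borel"
  shows "(\<integral>\<^sup>+\<omega>. ee (\<Sum>n. f (X n \<omega>)) \<partial>R) = ee (\<integral>\<^sup>+x. (1 - ee (f x)) \<partial>\<mu>)"
proof -
  obtain F where F: "\<And>i. simple_function borel (F i)" "incseq F" "\<And>i x. F i x < top"
    "\<And>x. (SUP i. F i x) = f x"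
    using borel_measurable_implies_simple_function_sequence'[OF assms] by metis
  have [measurable]: "F i \<in> borel_measurable borel" for i
    using F(1) by (rule borel_measurable_simple_function)
  have inc: "incseq (\<lambda>i. F i x)" for x
    using F(2) by (auto simp: incseq_def le_fun_def)
  have S: "(\<Sum>n. f (X n \<omega>)) = (SUP i. \<Sum>n. F i (X n \<omega>))" for \<omega>
    unfolding F(4)[symmetric] by (rule ennreal_suminf_SUP_eq[OF inc])
  have "(\<integral>\<^sup>+\<omega>. ee (\<Sum>n. f (X n \<omega>)) \<partial>R) = (INF i. \<integral>\<^sup>+\<omega>. ee (\<Sum>n. F i (X n \<omega>)) \<partial>R)"
    unfolding S
    by (rule nn_integral_ee_SUP[symmetric])
       (auto simp: incseq_def le_fun_def intro!: suminf_le finite_measure_axioms incseqD[OF inc])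
  also have "\<dots> = (INF i. ee (\<integral>\<^sup>+x. (1 - ee (F i x)) \<partial>\<mu>))"
    by (simp add: laplace_simple[OF F(1) F(3)])
  also have "\<dots> = ee (SUP i. \<integral>\<^sup>+x. (1 - ee (F i x)) \<partial>\<mu>)"
    by (rule ee_SUP)
       (auto simp: incseq_def intro!: nn_integral_mono ennreal_minus_mono ee_antimono incseqD[OF inc])
  also have "(SUP i. \<integral>\<^sup>+x. (1 - ee (F i x)) \<partial>\<mu>) = (\<integral>\<^sup>+x. (SUP i. 1 - ee (F i x)) \<partial>\<mu>)"
    by (intro nn_integral_monotone_convergence_SUP[symmetric])
       (auto simp: incseq_def le_fun_def intro!: ennreal_minus_mono ee_antimono incseqD[OF inc] meas_\<mu>)
  also have "\<dots> = (\<integral>\<^sup>+x. (1 - ee (f x)) \<partial>\<mu>)"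
  proof (intro nn_integral_cong)
    fix x
    have "(SUP i. 1 - ee (F i x)) = 1 - (INF i. ee (F i x))"
      by (rule SUP_const_minus_ennreal) auto
    then show "(SUP i. 1 - ee (F i x)) = 1 - ee (f x)"
      by (simp add: ee_SUP[OF inc] F(4))
  qed
  finally show ?thesis .
qed

end

section \<open>Differentiation of Laplace functionals and the Mecke formulas\<close>

lemma one_minus_ee_le: "1 - ee x \<le> x"
proof (cases x)
  case (real r)
  then show ?thesis
    using exp_ge_add_one_self[of "- r"]
    by (auto simp: ee_ennreal ennreal_minus simp flip: ennreal_1 intro!: ennreal_leI)
qed simp

text \<open>Difference quotients of \<open>ee\<close> at \<open>0\<close>. Inserting \<open>V / Suc n\<close> into a Laplace functional and passing to the
limit of \<open>dq n V\<close> differentiates it, which turns the Laplace functional into the Mecke formulas.\<close>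

definition dq :: "nat \<Rightarrow> ennreal \<Rightarrow> ennreal" where
  "dq n v = of_nat (Suc n) * (1 - ee (ennreal (1 / Suc n) * v))"

lemma of_nat_Suc_mult_inverse: "of_nat (Suc n) * (ennreal (1 / real (Suc n)) * v) = v"
proof -
  have "of_nat (Suc n) * ennreal (1 / real (Suc n)) = 1"
    by (simp add: ennreal_of_nat_eq_real_of_nat ennreal_mult[symmetric] del: of_nat_Suc)
  then show ?thesis by (simp add: mult.assoc[symmetric])
qed

lemma dq_measurable[measurable]: "dq n \<in> borel_measurable borel"
  unfolding dq_def[abs_def] by measurable

lemma dq_le: "dq n v \<le> v"
proof -
  have "dq n v \<le> of_nat (Suc n) * (ennreal (1 / Suc n) * v)"
    unfolding dq_def by (intro mult_left_mono one_minus_ee_le) auto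
  then show ?thesis by (simp only: of_nat_Suc_mult_inverse)
qed

text \<open>Sandwich between \<open>\<delta> / (1 + \<delta>)\<close> and \<open>\<delta>\<close>:
  the scaling hypothesis forces \<open>\<delta>\<close> to 0, so both bounds have the limit K after
  scaling.\<close>

lemma scaled_exp_diff_tendsto:
  assumes nn: "\<And>n. 0 \<le> \<delta> n" and lim: "(\<lambda>n. real (Suc n) * \<delta> n) \<longlonglongrightarrow> K"
  shows "(\<lambda>n. real (Suc n) * (1 - exp (- \<delta> n))) \<longlonglongrightarrow> K"
proof -
  have "(\<lambda>n. (real (Suc n) * \<delta> n) * inverse (real (Suc n))) \<longlonglongrightarrow> K * 0"
    by (intro tendsto_mult lim LIMSEQ_inverse_real_of_nat)
  moreover have "(real (Suc n) * \<delta> n) * inverse (real (Suc n)) = \<delta> n" for n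
    by (simp del: of_nat_Suc)
  ultimately have \<delta>0: "\<delta> \<longlonglongrightarrow> 0" by (simp del: of_nat_Suc)
  have "(\<lambda>n. (real (Suc n) * \<delta> n) / (1 + \<delta> n)) \<longlonglongrightarrow> K / (1 + 0)"
    by (intro tendsto_divide lim tendsto_add \<delta>0 tendsto_const) auto
  then have lo: "(\<lambda>n. real (Suc n) * (\<delta> n / (1 + \<delta> n))) \<longlonglongrightarrow> K" by simp
  have b1: "\<delta> n / (1 + \<delta> n) \<le> 1 - exp (- \<delta> n)" for n
  proof -
    have "exp (- \<delta> n) \<le> 1 / (1 + \<delta> n)"
      using nn[of n] exp_ge_add_one_self[of "\<delta> n"] by (simp add: exp_minus field_simps)
    then show ?thesis using nn[of n] by (simp add: field_simps)
  qed
  have b2: "1 - exp (- \<delta> n) \<le> \<delta> n" for n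
    using exp_ge_add_one_self[of "- \<delta> n"] by simp
  show ?thesis
    by (rule tendsto_sandwich[OF _ _ lo lim]; intro always_eventually allI mult_left_mono b1 b2 of_nat_0_le_iff)
qed

lemma scaled_ee_diff_tendsto:
  assumes "\<And>n. \<delta> n < top" and lim: "(\<lambda>n. of_nat (Suc n) * \<delta> n) \<longlonglongrightarrow> K" and "K < top"
  shows "(\<lambda>n. of_nat (Suc n) * (1 - ee (\<delta> n))) \<longlonglongrightarrow> K"
proof -
  obtain r where r: "K = ennreal r" "0 \<le> r" using assms(3) by (cases K) auto
  define d where "d n = enn2real (\<delta> n)" for n
  have d: "\<delta> n = ennreal (d n)" "0 \<le> d n" for n using assms(1)[of n] by (auto simp: d_def)
  have "(\<lambda>n. ennreal (real (Suc n) * d n)) \<longlonglongrightarrow> ennreal r"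
    using lim r d by (simp add: ennreal_of_nat_eq_real_of_nat ennreal_mult[symmetric] del: of_nat_Suc)
  then have "(\<lambda>n. real (Suc n) * d n) \<longlonglongrightarrow> r"
    by (rule tendsto_ennrealD) (use r d in auto)
  from scaled_exp_diff_tendsto[OF d(2) this]
  have "(\<lambda>n. ennreal (real (Suc n) * (1 - exp (- d n)))) \<longlonglongrightarrow> ennreal r"
    by (rule tendsto_ennrealI)
  moreover have "ennreal (real (Suc n) * (1 - exp (- d n))) = of_nat (Suc n) * (1 - ee (\<delta> n))" for n
    using d[of n] by (simp add: ee_ennreal ennreal_of_nat_eq_real_of_nat ennreal_mult ennreal_minus
        flip: ennreal_1 del: of_nat_Suc)
  ultimately show ?thesis using r by simp
qed

lemma dq_tendsto: "(\<lambda>n. dq n v) \<longlonglongrightarrow> v"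
proof (cases v)
  case (real r)
  show ?thesis
    unfolding dq_def
  proof (rule scaled_ee_diff_tendsto)
    show "(\<lambda>n. of_nat (Suc n) * (ennreal (1 / real (Suc n)) * v)) \<longlonglongrightarrow> v"
      by (simp only: of_nat_Suc_mult_inverse tendsto_const)
  qed (use real in \<open>auto simp: ennreal_mult_less_top\<close>)
next
  case top
  have "dq n v = of_nat (Suc n)" for n
    by (simp add: dq_def top ennreal_mult_top)
  moreover have "(\<lambda>n. of_nat (Suc n) :: ennreal) \<longlonglongrightarrow> top"
    by (rule LIMSEQ_Suc) (rule of_nat_tendsto_top_ennreal)
  ultimately show ?thesis using top by simp
qed

text \<open>No dominating function is assumed and the limit may be infinite: \<open>dq_le\<close>
  bounds the limsup, Fatou's lemma the liminf.\<close>

lemma nn_integral_dq_tendsto: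
  assumes [measurable]: "U \<in> borel_measurable M" "V \<in> borel_measurable M" and U: "\<And>x. U x < top"
  shows "(\<lambda>n. \<integral>\<^sup>+x. U x * dq n (V x) \<partial>M) \<longlonglongrightarrow> (\<integral>\<^sup>+x. U x * V x \<partial>M)"
proof -
  have le: "(\<integral>\<^sup>+x. U x * dq n (V x) \<partial>M) \<le> (\<integral>\<^sup>+x. U x * V x \<partial>M)" for n
    by (intro nn_integral_mono mult_left_mono dq_le) auto
  have "(\<lambda>n. U x * dq n (V x)) \<longlonglongrightarrow> U x * V x" for x
    by (intro ennreal_tendsto_cmult U dq_tendsto)
  then have "liminf (\<lambda>n. U x * dq n (V x)) = U x * V x" for x
    by (intro lim_imp_Liminf) auto
  then have "(\<integral>\<^sup>+x. U x * V x \<partial>M) = (\<integral>\<^sup>+x. liminf (\<lambda>n. U x * dq n (V x)) \<partial>M)" by simp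
  also have "\<dots> \<le> liminf (\<lambda>n. \<integral>\<^sup>+x. U x * dq n (V x) \<partial>M)"
    by (intro nn_integral_liminf) auto
  finally have 1: "(\<integral>\<^sup>+x. U x * V x \<partial>M) \<le> liminf (\<lambda>n. \<integral>\<^sup>+x. U x * dq n (V x) \<partial>M)" .
  have 2: "limsup (\<lambda>n. \<integral>\<^sup>+x. U x * dq n (V x) \<partial>M) \<le> (\<integral>\<^sup>+x. U x * V x \<partial>M)"
    by (intro Limsup_bounded) (auto intro: le always_eventually)
  have 3: "liminf (\<lambda>n. \<integral>\<^sup>+x. U x * dq n (V x) \<partial>M) \<le> limsup (\<lambda>n. \<integral>\<^sup>+x. U x * dq n (V x) \<partial>M)"
    by (intro Liminf_le_Limsup) auto
  show ?thesis
    by (rule Liminf_eq_Limsup) (use 1 2 3 in auto)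
qed

text \<open>Both sides of \<open>eq\<close> are Laplace transforms in a small parameter
  \<open>1 / Suc n\<close>. Subtracting them from their value c at parameter 0 and dividing by the
  parameter gives difference quotients; the left side tends to the integral of
  \<open>U x * V x\<close>, the right side to c times the derivative K of the exponent.\<close>

lemma nn_integral_ee_derivative:
  assumes [measurable]: "U \<in> borel_measurable M" "V \<in> borel_measurable M"
      "G \<in> borel_measurable N" "b \<in> borel_measurable N"
    and U: "\<And>x. U x < top" and G: "\<And>x. G x < top"
    and c: "(\<integral>\<^sup>+x. U x \<partial>M) = c" "c < top"
    and eq: "\<And>n. (\<integral>\<^sup>+x. U x * ee (ennreal (1 / Suc n) * V x) \<partial>M) =
               c * ee (\<integral>\<^sup>+y. G y * (1 - ee (ennreal (1 / Suc n) * b y)) \<partial>N)"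
    and K: "(\<integral>\<^sup>+y. G y * b y \<partial>N) = K" "K < top"
  shows "(\<integral>\<^sup>+x. U x * V x \<partial>M) = c * K"
proof -
  define \<delta> where "\<delta> n = (\<integral>\<^sup>+y. G y * (1 - ee (ennreal (1 / Suc n) * b y)) \<partial>N)" for n :: nat
  have \<delta>: "of_nat (Suc n) * \<delta> n = (\<integral>\<^sup>+y. G y * dq n (b y) \<partial>N)" for n
    unfolding \<delta>_def dq_def by (subst nn_integral_cmult[symmetric]) (auto simp: mult.left_commute)
  have \<delta>lim: "(\<lambda>n. of_nat (Suc n) * \<delta> n) \<longlonglongrightarrow> K"
    unfolding \<delta> K(1)[symmetric] by (intro nn_integral_dq_tendsto G) auto
  have \<delta>fin: "\<delta> n < top" for n
  proof -
    have "\<delta> n \<le> of_nat (Suc n) * \<delta> n"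
      by (simp add: distrib_right)
    also have "\<dots> \<le> K" unfolding \<delta> K(1)[symmetric]
      by (intro nn_integral_mono mult_left_mono dq_le) auto
    finally show ?thesis using K(2) by simp
  qed
  have "(\<integral>\<^sup>+x. U x * dq n (V x) \<partial>M) = c * (of_nat (Suc n) * (1 - ee (\<delta> n)))" for n
  proof -
    have "(\<integral>\<^sup>+x. U x * dq n (V x) \<partial>M) = of_nat (Suc n) * (\<integral>\<^sup>+x. U x * (1 - ee (ennreal (1 / Suc n) * V x)) \<partial>M)"
      unfolding dq_def by (subst nn_integral_cmult[symmetric]) (auto simp: mult.left_commute)
    also have "(\<integral>\<^sup>+x. U x * (1 - ee (ennreal (1 / Suc n) * V x)) \<partial>M) =
        (\<integral>\<^sup>+x. U x - U x * ee (ennreal (1 / Suc n) * V x) \<partial>M)"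
      using U by (intro nn_integral_cong) (simp add: ennreal_right_diff_distrib less_top[symmetric])
    also have "\<dots> = c - c * ee (\<delta> n)"
    proof -
      have "(\<integral>\<^sup>+x. U x * ee (ennreal (1 / Suc n) * V x) \<partial>M) \<noteq> \<infinity>"
        using c(2) eq[of n] by (simp add: ennreal_mult_eq_top_iff less_top[symmetric] flip: \<delta>_def)
      moreover have "U x * ee y \<le> U x" for x y
        using mult_left_mono[OF ee_le_1, of "U x" y] by simp
      ultimately show ?thesis
        using c eq[of n] unfolding \<delta>_def by (subst nn_integral_diff) auto
    qed
    also have "of_nat (Suc n) * (c - c * ee (\<delta> n)) = c * (of_nat (Suc n) * (1 - ee (\<delta> n)))"
      using c(2) by (simp add: ennreal_right_diff_distrib less_top[symmetric] mult_ac del: of_nat_Suc)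
    finally show ?thesis .
  qed
  moreover have "(\<lambda>n. c * (of_nat (Suc n) * (1 - ee (\<delta> n)))) \<longlonglongrightarrow> c * K"
    by (intro ennreal_tendsto_cmult c scaled_ee_diff_tendsto \<delta>fin \<delta>lim K)
  ultimately have "(\<lambda>n. \<integral>\<^sup>+x. U x * dq n (V x) \<partial>M) \<longlonglongrightarrow> c * K" by simp
  moreover have "(\<lambda>n. \<integral>\<^sup>+x. U x * dq n (V x) \<partial>M) \<longlonglongrightarrow> (\<integral>\<^sup>+x. U x * V x \<partial>M)"
    by (intro nn_integral_dq_tendsto U) auto
  ultimately show ?thesis by (rule LIMSEQ_unique[symmetric])
qed

text \<open>Adding y to x increases the exponent by \<open>1 - ee y\<close> damped by
  \<open>ee x\<close>. With x = f and y a small multiple of a, this produces the weight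
  \<open>ee (f x)\<close> in the Mecke formulas.\<close>

lemma one_minus_ee_add: "1 - ee (x + y) = (1 - ee x) + ee x * (1 - ee y)"
proof (cases x)
  case x: (real a)
  show ?thesis
  proof (cases y)
    case (real b)
    then show ?thesis using x
      by (simp add: ee_ennreal ennreal_minus ennreal_mult[symmetric] exp_add[symmetric] algebra_simps
        flip: ennreal_1 ennreal_plus)
  qed (use x in \<open>simp add: diff_add_cancel_ennreal\<close>)
qed simp

lemma suminf_remove_ennreal:
  fixes f :: "nat \<Rightarrow> ennreal"
  shows "(\<Sum>j. f j) = f n + (\<Sum>j. if j = n then 0 else f j)"
proof -
  have "(\<Sum>j. f j) = (\<Sum>j. (if j = n then f j else 0) + (if j = n then 0 else f j))"
    by (intro suminf_cong) auto
  also have "\<dots> = (\<Sum>j. if j = n then f j else 0) + (\<Sum>j. if j = n then 0 else f j)"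
    by (intro suminf_add[symmetric]) auto
  also have "(\<Sum>j. if j = n then f j else 0) = f n"
    by (subst suminf_finite[of "{n}"]) auto
  finally show ?thesis .
qed

context ppp
begin

text \<open>The one-point Mecke formula, as the derivative at 0 of the Laplace functional of f plus
  a small multiple of a. The selected point brings its own factor \<open>ee (f x)\<close>, which is
  why it stands under the intensity integral.\<close>

lemma sum_functional:
  assumes [measurable]: "f \<in> borel_measurable borel" "a \<in> borel_measurable borel"
    and I: "(\<integral>\<^sup>+x. (1 - ee (f x)) \<partial>\<mu>) < top" and K: "(\<integral>\<^sup>+x. ee (f x) * a x \<partial>\<mu>) < top"
  shows "(\<integral>\<^sup>+\<omega>. ee (\<Sum>n. f (X n \<omega>)) * (\<Sum>n. a (X n \<omega>)) \<partial>R) =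
    ee (\<integral>\<^sup>+x. (1 - ee (f x)) \<partial>\<mu>) * (\<integral>\<^sup>+x. ee (f x) * a x \<partial>\<mu>)"
proof (rule nn_integral_ee_derivative[where G="\<lambda>x. ee (f x)" and b=a and N=\<mu>])
  fix n :: nat
  let ?s = "ennreal (1 / Suc n)"
  have "(\<integral>\<^sup>+\<omega>. ee (\<Sum>n. f (X n \<omega>)) * ee (?s * (\<Sum>n. a (X n \<omega>))) \<partial>R) =
      (\<integral>\<^sup>+\<omega>. ee (\<Sum>n. f (X n \<omega>) + ?s * a (X n \<omega>)) \<partial>R)"
    by (subst suminf_add[OF summableI summableI, symmetric]) (simp only: ennreal_suminf_cmult ee_add)
  also have "\<dots> = ee (\<integral>\<^sup>+x. (1 - ee (f x + ?s * a x)) \<partial>\<mu>)"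
    by (rule laplace) measurable
  also have "\<dots> = ee ((\<integral>\<^sup>+x. (1 - ee (f x)) \<partial>\<mu>) + (\<integral>\<^sup>+x. ee (f x) * (1 - ee (?s * a x)) \<partial>\<mu>))"
    by (subst nn_integral_add[symmetric]) (auto intro!: meas_\<mu> simp: one_minus_ee_add)
  finally show "(\<integral>\<^sup>+\<omega>. ee (\<Sum>n. f (X n \<omega>)) * ee (?s * (\<Sum>n. a (X n \<omega>))) \<partial>R) =
    ee (\<integral>\<^sup>+x. (1 - ee (f x)) \<partial>\<mu>) * ee (\<integral>\<^sup>+x. ee (f x) * (1 - ee (?s * a x)) \<partial>\<mu>)"
    by (simp add: ee_add)
qed (use K in \<open>auto intro!: meas_\<mu> laplace\<close>)

text \<open>The two-point Mecke formula, as the derivative of the one-point formula in a second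
  direction b. Only pairs of different points may be counted, so the perturbation must not act on
  the point selected by a; this is arranged by dividing a by the factor that the perturbation would
  add there.\<close>

lemma sum_functional_distinct:
  assumes [measurable]: "f \<in> borel_measurable borel" "a \<in> borel_measurable borel" "b \<in> borel_measurable borel"
    and fin: "\<And>x. a x < top" "\<And>x. b x < top"
    and I: "(\<integral>\<^sup>+x. (1 - ee (f x)) \<partial>\<mu>) < top"
    and K: "(\<integral>\<^sup>+x. ee (f x) * a x \<partial>\<mu>) < top" "(\<integral>\<^sup>+x. ee (f x) * b x \<partial>\<mu>) < top"
  shows "(\<integral>\<^sup>+\<omega>. (\<Sum>n. a (X n \<omega>) * ee (\<Sum>j. f (X j \<omega>)) * (\<Sum>j. if j = n then 0 else b (X j \<omega>))) \<partial>R) =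
    ee (\<integral>\<^sup>+x. (1 - ee (f x)) \<partial>\<mu>) * (\<integral>\<^sup>+x. ee (f x) * a x \<partial>\<mu>) * (\<integral>\<^sup>+x. ee (f x) * b x \<partial>\<mu>)"
proof -
  let ?I = "\<integral>\<^sup>+x. (1 - ee (f x)) \<partial>\<mu>" and ?A = "\<integral>\<^sup>+x. ee (f x) * a x \<partial>\<mu>"
  let ?M = "count_space UNIV \<Otimes>\<^sub>M R"
  \<comment> \<open>The selected index becomes a second integration variable, so that the sum over n
    is an integral to which the differentiation lemma applies.\<close>
  interpret P: pair_sigma_finite "count_space (UNIV::nat set)" R
    by (intro pair_sigma_finite.intro sigma_finite_measure_count_space sigma_finite_measure_axioms)
  define U where "U = (\<lambda>(n, \<omega>). a (X n \<omega>) * ee (\<Sum>j. f (X j \<omega>)))"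
  define V where "V = (\<lambda>(n, \<omega>). (\<Sum>j. if j = n then 0 else b (X j \<omega>)))"
  have [measurable]: "U \<in> borel_measurable ?M" "V \<in> borel_measurable ?M"
    unfolding U_def V_def by (auto intro!: measurable_pair_measure_countable1)
  have int: "(\<integral>\<^sup>+x. F x \<partial>?M) = (\<integral>\<^sup>+\<omega>. (\<Sum>n. F (n, \<omega>)) \<partial>R)" if [measurable]: "F \<in> borel_measurable ?M" for F
  proof -
    have "(\<integral>\<^sup>+x. F x \<partial>?M) = (\<integral>\<^sup>+n. \<integral>\<^sup>+\<omega>. F (n, \<omega>) \<partial>R \<partial>count_space UNIV)"
      by (rule nn_integral_fst[symmetric]) fact
    also have "\<dots> = (\<integral>\<^sup>+\<omega>. (\<Sum>n. F (n, \<omega>)) \<partial>R)"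
      by (simp add: nn_integral_count_space_nat nn_integral_suminf)
    finally show ?thesis .
  qed
  have "(\<integral>\<^sup>+x. U x * V x \<partial>?M) = (ee ?I * ?A) * (\<integral>\<^sup>+x. ee (f x) * b x \<partial>\<mu>)"
  proof (rule nn_integral_ee_derivative[where G="\<lambda>x. ee (f x)" and b=b and N=\<mu>])
    show "U x < top" for x
      using fin by (auto simp: U_def ennreal_mult_less_top split: prod.split)
    have "(\<integral>\<^sup>+x. U x \<partial>?M) = (\<integral>\<^sup>+\<omega>. ee (\<Sum>n. f (X n \<omega>)) * (\<Sum>n. a (X n \<omega>)) \<partial>R)"
      by (subst int) (auto simp: U_def mult.commute)
    then show "(\<integral>\<^sup>+x. U x \<partial>?M) = ee ?I * ?A"
      by (simp add: sum_functional[OF _ _ I K(1)])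
    show "ee ?I * ?A < top"
      using K by (simp add: ennreal_mult_less_top)
    fix n :: nat
    let ?s = "ennreal (1 / Suc n)"
    \<comment> \<open>Cancels the factor of the selected point in \<open>ee\<close> of the perturbed
      sum, leaving the perturbation on all other points only.\<close>
    define as where "as x = a x * inverse (ee (?s * b x))" for x
    have [measurable]: "as \<in> borel_measurable borel" unfolding as_def by measurable
    have nz: "ee (?s * b x) \<noteq> 0" for x
      using fin(2)[of x] by (auto simp: ee_eq_0_iff ennreal_mult_eq_top_iff)
    have inv: "ee (?s * b x) * inverse (ee (?s * b x)) = 1" for x
      using nz[of x] ee_less_top(1) by (metis ennreal_divide_self divide_ennreal_def)
    have as: "ee (f x + ?s * b x) * as x = ee (f x) * a x" for x
    proof -
      have "ee (f x + ?s * b x) * as x = ee (f x) * a x * (ee (?s * b x) * inverse (ee (?s * b x)))"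
        by (simp add: as_def ee_add mult_ac)
      then show ?thesis using inv by simp
    qed
    have I': "(\<integral>\<^sup>+x. (1 - ee (f x + ?s * b x)) \<partial>\<mu>) = ?I + (\<integral>\<^sup>+x. ee (f x) * (1 - ee (?s * b x)) \<partial>\<mu>)"
      by (subst nn_integral_add[symmetric]) (auto intro!: meas_\<mu> simp: one_minus_ee_add)
    have "(\<integral>\<^sup>+x. ee (f x) * (1 - ee (?s * b x)) \<partial>\<mu>) \<le> (\<integral>\<^sup>+x. ee (f x) * b x \<partial>\<mu>)"
    proof (intro nn_integral_mono mult_left_mono)
      fix x
      have "?s * b x \<le> 1 * b x" by (intro mult_right_mono) auto
      then show "1 - ee (?s * b x) \<le> b x"
        using one_minus_ee_le[of "?s * b x"] by simp
    qed auto
    then have I'fin: "(\<integral>\<^sup>+x. (1 - ee (f x + ?s * b x)) \<partial>\<mu>) < top"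
      unfolding I' using I K by (auto simp: ennreal_add_less_top intro: le_less_trans)
    have "U (i, \<omega>) * ee (?s * V (i, \<omega>)) = ee (\<Sum>j. f (X j \<omega>) + ?s * b (X j \<omega>)) * as (X i \<omega>)" for i \<omega>
    proof -
      have "(\<Sum>j. f (X j \<omega>) + ?s * b (X j \<omega>)) = (\<Sum>j. f (X j \<omega>)) + ?s * (\<Sum>j. b (X j \<omega>))"
        by (simp add: suminf_add[OF summableI summableI, symmetric])
      also have "(\<Sum>j. b (X j \<omega>)) = b (X i \<omega>) + V (i, \<omega>)"
        by (subst suminf_remove_ennreal[of _ i]) (simp add: V_def)
      finally have "ee (\<Sum>j. f (X j \<omega>) + ?s * b (X j \<omega>)) * as (X i \<omega>) =
        U (i, \<omega>) * ee (?s * V (i, \<omega>)) * (ee (?s * b (X i \<omega>)) * inverse (ee (?s * b (X i \<omega>))))"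
        by (simp add: as_def U_def ee_add distrib_left mult_ac)
      then show ?thesis using inv by simp
    qed
    then have "(\<integral>\<^sup>+x. U x * ee (?s * V x) \<partial>?M) =
        (\<integral>\<^sup>+\<omega>. ee (\<Sum>n. f (X n \<omega>) + ?s * b (X n \<omega>)) * (\<Sum>n. as (X n \<omega>)) \<partial>R)"
      by (subst int) auto
    also have "\<dots> = ee (\<integral>\<^sup>+x. (1 - ee (f x + ?s * b x)) \<partial>\<mu>) * (\<integral>\<^sup>+x. ee (f x + ?s * b x) * as x \<partial>\<mu>)"
      by (rule sum_functional) (use I'fin K in \<open>simp_all only: as, auto\<close>)
    also have "\<dots> = ee ?I * ?A * ee (\<integral>\<^sup>+x. ee (f x) * (1 - ee (?s * b x)) \<partial>\<mu>)"
      unfolding I' as by (simp add: ee_add mult_ac)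
    finally show "(\<integral>\<^sup>+x. U x * ee (?s * V x) \<partial>?M) = \<dots>" .
  qed (use K in \<open>auto intro!: meas_\<mu>\<close>)
  then show ?thesis
    by (subst (asm) int) (auto simp: U_def V_def)
qed

end

section \<open>Infinite products over the points\<close>

text \<open>The product over all \<open>j \<notin> K\<close>, meaningful for factors at most \<open>1\<close>.\<close>

definition iprod :: "nat set \<Rightarrow> (nat \<Rightarrow> ennreal) \<Rightarrow> ennreal" where
  "iprod K g = (INF N. \<Prod>j<N. if j \<in> K then 1 else g j)"

text \<open>Inverse of \<open>ee\<close> on [0, 1], infinite at 0. It presents a product of factors
  as \<open>ee\<close> of a series, the form treated by the Laplace functional.\<close>

definition neg_ln :: "ennreal \<Rightarrow> ennreal" where
  "neg_ln x = (if x = 0 then top else ennreal (- ln (enn2real x)))"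

lemma neg_ln_measurable[measurable]: "neg_ln \<in> borel_measurable borel"
  unfolding neg_ln_def[abs_def] by measurable

lemma ee_neg_ln: "x \<le> 1 \<Longrightarrow> ee (neg_ln x) = x"
  by (cases x) (auto simp: neg_ln_def ee_ennreal ln_le_zero_iff top_unique simp flip: ennreal_1)

lemma iprod_eq_ee:
  assumes "\<And>j. g j \<le> 1"
  shows "iprod K g = ee (\<Sum>j. if j \<in> K then 0 else neg_ln (g j))"
  unfolding iprod_def ee_suminf
  by (intro INF_cong refl prod.cong) (auto simp: ee_neg_ln assms)

lemma iprod_remove:
  assumes "\<And>j. g j \<le> 1" "n \<notin> K"
  shows "iprod K g = g n * iprod (insert n K) g"
proof -
  have "(\<Sum>j. if j \<in> K then 0 else neg_ln (g j)) = neg_ln (g n) + (\<Sum>j. if j \<in> insert n K then 0 else neg_ln (g j))"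
    by (subst suminf_remove_ennreal[of _ n]) (use assms(2) in \<open>auto intro!: arg_cong2[where f="(+)"] suminf_cong\<close>)
  then show ?thesis
    by (simp add: iprod_eq_ee assms ee_add ee_neg_ln)
qed

lemma iprod_cong:
  "(\<And>j. j \<notin> K \<Longrightarrow> g j = h j) \<Longrightarrow> iprod K g = iprod K h"
  unfolding iprod_def by (intro INF_cong refl prod.cong) auto

lemma iprod_measurable[measurable (raw)]:
  "(\<And>j. g j \<in> borel_measurable M) \<Longrightarrow> (\<lambda>x. iprod K (\<lambda>j. g j x)) \<in> borel_measurable M"
  unfolding iprod_def
  by (intro borel_measurable_INF borel_measurable_prod_ennreal) auto

text \<open>An intensity without mass on the non-positive half-line: its points are almost surely
  positive, so conditions on the factors are asked at positive arguments only.\<close>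

locale pos_ppp = ppp +
  assumes null_nonpos: "emeasure \<mu> {..0} = 0"
begin

text \<open>The number of non-positive points is Poisson of rate 0.\<close>

lemma AE_points_pos: "AE \<omega> in R. \<forall>n. 0 < X n \<omega>"
proof -
  have "distr R borel (point_count X {..0}) = return borel 0"
    using points sets_\<mu> null_nonpos unfolding poisson_points_def poisson_law_def by auto
  then have "AE x in distr R borel (point_count X {..0}). x = 0"
    by (simp only:) (simp add: AE_return)
  then have "AE \<omega> in R. point_count X {..0} \<omega> = 0"
    by (subst (asm) AE_distr_iff) (auto intro!: point_count_measurable)
  then show ?thesis
    by eventually_elim
       (auto simp: point_count_def emeasure_count_space split: if_splits, metis linorder_not_le mem_Collect_eq empty_iff)
qed

lemma AE_pos: "AE x in \<mu>. 0 < x"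
proof -
  have "{..0} \<in> null_sets \<mu>" using null_nonpos sets_\<mu> by auto
  then show ?thesis by (rule AE_I') auto
qed

lemma laplace_iprod:
  assumes [measurable]: "g \<in> borel_measurable borel" and g: "\<And>x. 0 < x \<Longrightarrow> g x \<le> 1"
  shows "(\<integral>\<^sup>+\<omega>. iprod {} (\<lambda>n. g (X n \<omega>)) \<partial>R) = ee (\<integral>\<^sup>+x. (1 - g x) \<partial>\<mu>)"
proof -
  \<comment> \<open>Replaced by the neutral factor 1 off the positive half-line, where g is not
    known to be at most 1.\<close>
  define g' where "g' x = (if 0 < x then g x else 1)" for x
  have g': "g' x \<le> 1" for x using g by (simp add: g'_def)
  have [measurable]: "g' \<in> borel_measurable borel" unfolding g'_def by measurable
  have "(\<integral>\<^sup>+\<omega>. iprod {} (\<lambda>n. g (X n \<omega>)) \<partial>R) = (\<integral>\<^sup>+\<omega>. ee (\<Sum>n. neg_ln (g' (X n \<omega>))) \<partial>R)"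
    by (rule nn_integral_cong_AE, use AE_points_pos in eventually_elim)
       (simp add: g'_def iprod_eq_ee g)
  also have "\<dots> = ee (\<integral>\<^sup>+x. (1 - g' x) \<partial>\<mu>)"
    by (subst laplace) (auto simp: ee_neg_ln g')
  also have "(\<integral>\<^sup>+x. (1 - g' x) \<partial>\<mu>) = (\<integral>\<^sup>+x. (1 - g x) \<partial>\<mu>)"
    by (rule nn_integral_cong_AE, use AE_pos in eventually_elim) (simp add: g'_def)
  finally show ?thesis .
qed

text \<open>In \<open>sum_functional\<close> the selected point keeps its factor g. Taking \<phi>
  divided by g as summand exchanges that factor for \<phi>, which is possible since g is positive;
  the remaining points form the product without n.\<close>

lemma sum_iprod:
  assumes [measurable]: "g \<in> borel_measurable borel" "\<phi> \<in> borel_measurable borel"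
    and g: "\<And>x. 0 < x \<Longrightarrow> g x \<le> 1" "\<And>x. 0 < x \<Longrightarrow> 0 < g x"
    and I: "(\<integral>\<^sup>+x. (1 - g x) \<partial>\<mu>) < top" and K: "(\<integral>\<^sup>+x. \<phi> x \<partial>\<mu>) < top"
  shows "(\<integral>\<^sup>+\<omega>. (\<Sum>n. \<phi> (X n \<omega>) * iprod {n} (\<lambda>j. g (X j \<omega>))) \<partial>R) =
    ee (\<integral>\<^sup>+x. (1 - g x) \<partial>\<mu>) * (\<integral>\<^sup>+x. \<phi> x \<partial>\<mu>)"
proof -
  define g' where "g' x = (if 0 < x then g x else 1)" for x
  have g': "g' x \<le> 1" "g' x \<noteq> 0" "g' x \<noteq> top" for x
    using g[of x] order_le_less_trans[of "g x" 1 top] by (auto simp: g'_def)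
  have [measurable]: "g' \<in> borel_measurable borel" unfolding g'_def by measurable
  have inv: "g' x * inverse (g' x) = 1" for x
    using g' by (metis ennreal_divide_self divide_ennreal_def less_top)
  define f where "f x = neg_ln (g' x)" for x
  define a where "a x = \<phi> x * inverse (g' x)" for x
  have f: "ee (f x) = g' x" for x by (simp add: f_def ee_neg_ln g')
  have [measurable]: "f \<in> borel_measurable borel" "a \<in> borel_measurable borel"
    unfolding f_def a_def by measurable
  have fa: "ee (f x) * a x = \<phi> x" for x
    using inv[of x] by (simp add: f a_def mult_ac)
  have I': "(\<integral>\<^sup>+x. (1 - g' x) \<partial>\<mu>) = (\<integral>\<^sup>+x. (1 - g x) \<partial>\<mu>)"
    by (rule nn_integral_cong_AE, use AE_pos in eventually_elim) (simp add: g'_def)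
  have "(\<integral>\<^sup>+\<omega>. (\<Sum>n. \<phi> (X n \<omega>) * iprod {n} (\<lambda>j. g (X j \<omega>))) \<partial>R) =
      (\<integral>\<^sup>+\<omega>. ee (\<Sum>n. f (X n \<omega>)) * (\<Sum>n. a (X n \<omega>)) \<partial>R)"
  proof (rule nn_integral_cong_AE, use AE_points_pos in eventually_elim)
    fix \<omega> assume pos: "\<forall>n. 0 < X n \<omega>"
    have "\<phi> (X n \<omega>) * iprod {n} (\<lambda>j. g (X j \<omega>)) = ee (\<Sum>n. f (X n \<omega>)) * a (X n \<omega>)" for n
    proof -
      have "ee (\<Sum>n. f (X n \<omega>)) = iprod {} (\<lambda>j. g' (X j \<omega>))"
        by (simp add: iprod_eq_ee g' f_def)
      also have "\<dots> = g' (X n \<omega>) * iprod {n} (\<lambda>j. g' (X j \<omega>))"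
        by (rule iprod_remove) (auto simp: g')
      also have "\<dots> * a (X n \<omega>) = \<phi> (X n \<omega>) * iprod {n} (\<lambda>j. g' (X j \<omega>)) * (g' (X n \<omega>) * inverse (g' (X n \<omega>)))"
        by (simp add: a_def mult_ac)
      finally show ?thesis using pos by (simp only: inv) (simp add: g'_def)
    qed
    then show "(\<Sum>n. \<phi> (X n \<omega>) * iprod {n} (\<lambda>j. g (X j \<omega>))) = ee (\<Sum>n. f (X n \<omega>)) * (\<Sum>n. a (X n \<omega>))"
      by simp
  qed
  also have "\<dots> = ee (\<integral>\<^sup>+x. (1 - ee (f x)) \<partial>\<mu>) * (\<integral>\<^sup>+x. ee (f x) * a x \<partial>\<mu>)"
    by (rule sum_functional) (use I K in \<open>simp_all add: fa, simp add: f I'\<close>)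
  finally show ?thesis by (simp add: fa) (simp add: f I')
qed

text \<open>The two-point analogue: the factors of both selected points are exchanged for \<phi> and
  \<psi>, and the product runs over the other points.\<close>

lemma sum_iprod_distinct:
  assumes [measurable]: "g \<in> borel_measurable borel" "\<phi> \<in> borel_measurable borel" "\<psi> \<in> borel_measurable borel"
    and g: "\<And>x. 0 < x \<Longrightarrow> g x \<le> 1" "\<And>x. 0 < x \<Longrightarrow> 0 < g x"
    and fin: "\<And>x. 0 < x \<Longrightarrow> \<phi> x < top" "\<And>x. 0 < x \<Longrightarrow> \<psi> x < top"
    and I: "(\<integral>\<^sup>+x. (1 - g x) \<partial>\<mu>) < top"
    and K: "(\<integral>\<^sup>+x. \<phi> x \<partial>\<mu>) < top" "(\<integral>\<^sup>+x. \<psi> x \<partial>\<mu>) < top"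
  shows "(\<integral>\<^sup>+\<omega>. (\<Sum>n. \<Sum>n'. if n' = n then 0 else
      \<phi> (X n \<omega>) * \<psi> (X n' \<omega>) * iprod {n', n} (\<lambda>j. g (X j \<omega>))) \<partial>R) =
    ee (\<integral>\<^sup>+x. (1 - g x) \<partial>\<mu>) * (\<integral>\<^sup>+x. \<phi> x \<partial>\<mu>) * (\<integral>\<^sup>+x. \<psi> x \<partial>\<mu>)"
proof -
  define g' where "g' x = (if 0 < x then g x else 1)" for x
  have g': "g' x \<le> 1" "g' x \<noteq> 0" "g' x \<noteq> top" for x
    using g[of x] order_le_less_trans[of "g x" 1 top] by (auto simp: g'_def)
  have [measurable]: "g' \<in> borel_measurable borel" unfolding g'_def by measurable
  have inv: "g' x * inverse (g' x) = 1" for x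
    using g' by (metis ennreal_divide_self divide_ennreal_def less_top)
  have invfin: "inverse (g' x) < top" for x
    using g'(2)[of x] by (simp add: less_top[symmetric])
  define f where "f x = neg_ln (g' x)" for x
  \<comment> \<open>The value 0 off the positive half-line makes a and b finite everywhere, as the
    two-point formula demands.\<close>
  define a where "a x = (if 0 < x then \<phi> x * inverse (g' x) else 0)" for x
  define b where "b x = (if 0 < x then \<psi> x * inverse (g' x) else 0)" for x
  have f: "ee (f x) = g' x" for x by (simp add: f_def ee_neg_ln g')
  have [measurable]: "f \<in> borel_measurable borel" "a \<in> borel_measurable borel" "b \<in> borel_measurable borel"
    unfolding f_def a_def b_def by measurable
  have fab: "a x < top" "b x < top" for x
    using fin[of x] invfin[of x] by (auto simp: a_def b_def ennreal_mult_less_top)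
  have fa: "(\<integral>\<^sup>+x. ee (f x) * a x \<partial>\<mu>) = (\<integral>\<^sup>+x. \<phi> x \<partial>\<mu>)"
  proof (rule nn_integral_cong_AE, use AE_pos in eventually_elim)
    fix x :: real assume "0 < x"
    then have "ee (f x) * a x = \<phi> x * (g' x * inverse (g' x))" by (simp add: f a_def mult_ac)
    then show "ee (f x) * a x = \<phi> x" using inv by simp
  qed
  have fb: "(\<integral>\<^sup>+x. ee (f x) * b x \<partial>\<mu>) = (\<integral>\<^sup>+x. \<psi> x \<partial>\<mu>)"
  proof (rule nn_integral_cong_AE, use AE_pos in eventually_elim)
    fix x :: real assume "0 < x"
    then have "ee (f x) * b x = \<psi> x * (g' x * inverse (g' x))" by (simp add: f b_def mult_ac)
    then show "ee (f x) * b x = \<psi> x" using inv by simp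
  qed
  have I': "(\<integral>\<^sup>+x. (1 - ee (f x)) \<partial>\<mu>) = (\<integral>\<^sup>+x. (1 - g x) \<partial>\<mu>)"
    unfolding f by (rule nn_integral_cong_AE, use AE_pos in eventually_elim) (simp add: g'_def)
  have "(\<integral>\<^sup>+\<omega>. (\<Sum>n. \<Sum>n'. if n' = n then 0 else
      \<phi> (X n \<omega>) * \<psi> (X n' \<omega>) * iprod {n', n} (\<lambda>j. g (X j \<omega>))) \<partial>R) =
      (\<integral>\<^sup>+\<omega>. (\<Sum>n. a (X n \<omega>) * ee (\<Sum>j. f (X j \<omega>)) * (\<Sum>j. if j = n then 0 else b (X j \<omega>))) \<partial>R)"
  proof (rule nn_integral_cong_AE, use AE_points_pos in eventually_elim)
    fix \<omega> assume pos: "\<forall>n. 0 < X n \<omega>"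
    have *: "\<phi> (X n \<omega>) * \<psi> (X n' \<omega>) * iprod {n', n} (\<lambda>j. g (X j \<omega>)) =
        a (X n \<omega>) * ee (\<Sum>j. f (X j \<omega>)) * b (X n' \<omega>)" if "n' \<noteq> n" for n n'
    proof -
      have "ee (\<Sum>n. f (X n \<omega>)) = iprod {} (\<lambda>j. g' (X j \<omega>))"
        by (simp add: iprod_eq_ee g' f_def)
      also have "\<dots> = g' (X n \<omega>) * iprod {n} (\<lambda>j. g' (X j \<omega>))"
        by (rule iprod_remove) (auto simp: g')
      also have "iprod {n} (\<lambda>j. g' (X j \<omega>)) = g' (X n' \<omega>) * iprod {n', n} (\<lambda>j. g' (X j \<omega>))"
        by (rule iprod_remove) (use that in \<open>auto simp: g'\<close>)
      finally have "a (X n \<omega>) * ee (\<Sum>j. f (X j \<omega>)) * b (X n' \<omega>) =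
        \<phi> (X n \<omega>) * \<psi> (X n' \<omega>) * iprod {n', n} (\<lambda>j. g' (X j \<omega>)) *
        (g' (X n \<omega>) * inverse (g' (X n \<omega>))) * (g' (X n' \<omega>) * inverse (g' (X n' \<omega>)))"
        using pos by (simp add: a_def b_def mult_ac)
      then show ?thesis using pos by (simp only: inv) (simp add: g'_def)
    qed
    have "(\<Sum>n'. if n' = n then 0 else \<phi> (X n \<omega>) * \<psi> (X n' \<omega>) * iprod {n', n} (\<lambda>j. g (X j \<omega>))) =
        a (X n \<omega>) * ee (\<Sum>j. f (X j \<omega>)) * (\<Sum>j. if j = n then 0 else b (X j \<omega>))" for n
      unfolding ennreal_suminf_cmult[symmetric] by (intro suminf_cong) (simp add: *)
    then show "(\<Sum>n. \<Sum>n'. if n' = n then 0 else \<phi> (X n \<omega>) * \<psi> (X n' \<omega>) * iprod {n', n} (\<lambda>j. g (X j \<omega>))) =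
      (\<Sum>n. a (X n \<omega>) * ee (\<Sum>j. f (X j \<omega>)) * (\<Sum>j. if j = n then 0 else b (X j \<omega>)))"
      by simp
  qed
  also have "\<dots> = ee (\<integral>\<^sup>+x. (1 - ee (f x)) \<partial>\<mu>) * (\<integral>\<^sup>+x. ee (f x) * a x \<partial>\<mu>) * (\<integral>\<^sup>+x. ee (f x) * b x \<partial>\<mu>)"
    by (rule sum_functional_distinct) (simp_all add: fa fb I' I K fab)
  finally show ?thesis by (simp add: fa fb I')
qed

end

subsection \<open>Integrals against power intensities\<close>

lemma sets_power_intensity[simp]: "sets (power_intensity a) = sets borel"
  by (simp add: power_intensity_def)

lemma space_power_intensity[simp]: "space (power_intensity a) = UNIV"
  by (simp add: power_intensity_def)

lemma measurable_power_intensity[simp]: "measurable (power_intensity a) N = measurable borel N"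
  by (intro measurable_cong_sets) auto

lemma nn_integral_power_intensity:
  assumes [measurable]: "f \<in> borel_measurable borel"
  shows "(\<integral>\<^sup>+x. f x \<partial>power_intensity a) =
    (\<integral>\<^sup>+x. ennreal (indicator {0<..} x * x powr (-1 - a)) * f x \<partial>lborel)"
  unfolding power_intensity_def by (subst nn_integral_density) auto

lemma power_intensity_nonpos: "emeasure (power_intensity a) {..0} = 0"
proof -
  have "emeasure (power_intensity a) {..0} = (\<integral>\<^sup>+x. indicator {..0} x \<partial>power_intensity a)"
    by simp
  also have "\<dots> = (\<integral>\<^sup>+x. 0 \<partial>(lborel :: real measure))"
    by (subst nn_integral_power_intensity, measurable, intro nn_integral_cong) (auto split: split_indicator)
  finally show ?thesis by simp
qed

lemma AE_power_intensity: "AE x in power_intensity a. 0 < x"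
proof -
  have "{..0} \<in> null_sets (power_intensity a)" using power_intensity_nonpos by (auto simp: null_sets_def)
  then show ?thesis by (rule AE_I') auto
qed

lemma nn_integral_power_intensity_cong:
  "(\<And>x. 0 < x \<Longrightarrow> f x = g x) \<Longrightarrow> (\<integral>\<^sup>+x. f x \<partial>power_intensity a) = (\<integral>\<^sup>+x. g x \<partial>power_intensity a)"
  by (rule nn_integral_cong_AE, use AE_power_intensity in eventually_elim) auto

text \<open>Substituting y = c x costs 1 / c from Lebesgue measure and gains
  \<open>c powr (1 + a)\<close> from the density. At a = 0 the integral is scale invariant.\<close>

lemma power_intensity_scale:
  assumes [measurable]: "f \<in> borel_measurable borel" and c: "0 < c"
  shows "(\<integral>\<^sup>+x. f (c * x) \<partial>power_intensity a) = ennreal (c powr a) * (\<integral>\<^sup>+x. f x \<partial>power_intensity a)"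
proof -
  let ?w = "\<lambda>x::real. ennreal (indicator {0<..} x * x powr (-1 - a))"
  have w: "ennreal c * ?w (c * x) = ennreal (c powr (- a)) * ?w x" for x
  proof (cases "0 < x")
    case True
    have "c powr 1 * c powr (-1 - a) = c powr (- a)"
      by (subst powr_add[symmetric]) simp
    then have "c * (c * x) powr (- 1 - a) = c powr (- a) * x powr (-1 - a)"
      using True c by (simp add: powr_mult mult.assoc[symmetric])
    then show ?thesis
      using True c by (simp add: ennreal_mult[symmetric])
  next
    case False
    then have "\<not> 0 < c * x" using c by (simp add: zero_less_mult_iff)
    then show ?thesis using False by simp
  qed
  have "(\<integral>\<^sup>+x. f x \<partial>power_intensity a) = (\<integral>\<^sup>+x. ?w x * f x \<partial>lborel)"
    by (rule nn_integral_power_intensity) fact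
  also have "\<dots> = ennreal c * (\<integral>\<^sup>+x. ?w (c * x) * f (c * x) \<partial>lborel)"
    using c by (subst nn_integral_real_affine[where c=c and t=0]) auto
  also have "\<dots> = (\<integral>\<^sup>+x. (ennreal c * ?w (c * x)) * f (c * x) \<partial>lborel)"
    by (subst nn_integral_cmult[symmetric]) (auto simp: mult.assoc)
  also have "\<dots> = ennreal (c powr (- a)) * (\<integral>\<^sup>+x. ?w x * f (c * x) \<partial>lborel)"
    unfolding w by (subst nn_integral_cmult[symmetric]) (auto simp: mult.assoc)
  also have "(\<integral>\<^sup>+x. ?w x * f (c * x) \<partial>lborel) = (\<integral>\<^sup>+x. f (c * x) \<partial>power_intensity a)"
    by (rule nn_integral_power_intensity[symmetric]) measurable
  finally have "ennreal (c powr a) * (\<integral>\<^sup>+x. f x \<partial>power_intensity a) =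
      (ennreal (c powr a) * ennreal (c powr (- a))) * (\<integral>\<^sup>+x. f (c * x) \<partial>power_intensity a)"
    by (simp add: mult.assoc)
  also have "ennreal (c powr a) * ennreal (c powr (- a)) = 1"
    using c by (simp add: ennreal_mult[symmetric] powr_add[symmetric])
  finally show ?thesis by simp
qed

text \<open>The substitution \<open>t = C * x powr a\<close> turns Euler's integral for Gamma at b /
  a into this integral; the Jacobian supplies the factor a and the power of C.\<close>

lemma nn_integral_powr_exp:
  fixes a b C :: real
  assumes "0 < a" "0 < b" "0 < C"
  shows "(\<integral>\<^sup>+x. ennreal (x powr (b - 1) * exp (- C * x powr a)) * indicator {0<..} x \<partial>lborel) =
    ennreal (Gamma (b / a) / (a * C powr (b / a)))"
proof -
  define g where "g x = C * x powr a" for x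
  define g' where "g' x = C * a * x powr (a - 1)" for x
  define f where "f t = t powr (b / a - 1) / exp t" for t :: real
  have hi: "(f has_integral Gamma (b / a)) {0..}"
    unfolding f_def using Gamma_integral_real[of "b/a"] assms by simp
  have img: "g ` {0<..} = {0<..}"
  proof safe
    fix x :: real assume "0 < x"
    have "g ((x / C) powr (1 / a)) = x"
      using \<open>0 < x\<close> assms by (simp add: g_def powr_powr)
    moreover have "(x / C) powr (1 / a) \<in> {0<..}" using \<open>0 < x\<close> assms by simp
    ultimately show "x \<in> g ` {0<..}" by (metis image_eqI)
  qed (use assms in \<open>auto simp: g_def\<close>)
  have "(f has_integral Gamma (b / a)) {0<..}"
    using hi by (subst has_integral_spike_set_eq[where T="{0..}"]) (auto intro: negligible_subset[of "{0}"])
  moreover have "0 \<le> f x" if "0 < x" for x using that by (simp add: f_def)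
  ultimately have "f absolutely_integrable_on g ` {0<..} \<and> integral (g ` {0<..}) f = Gamma (b / a)"
    unfolding img by (auto intro!: nonnegative_absolutely_integrable_1)
  moreover have "(g has_real_derivative g' x) (at x within {0<..})" if "x \<in> {0<..}" for x
    using that unfolding g_def g'_def by (auto intro!: derivative_eq_intros)
  moreover have "inj_on g {0<..}"
  proof (rule inj_onI)
    fix x y :: real assume "x \<in> {0<..}" "y \<in> {0<..}" "g x = g y"
    then show "x = y"
      using assms powr_less_mono2[of a x y] powr_less_mono2[of a y x] by (cases x y rule: linorder_cases) (auto simp: g_def)
  qed
  ultimately have "(\<lambda>x. \<bar>g' x\<bar> * f (g x)) absolutely_integrable_on {0<..} \<and>
      integral {0<..} (\<lambda>x. \<bar>g' x\<bar> * f (g x)) = Gamma (b / a)"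
    using has_absolute_integral_change_of_variables_1'[of "{0<..}" g g' f "Gamma (b / a)"] by simp
  then have "((\<lambda>x. \<bar>g' x\<bar> * f (g x)) has_integral Gamma (b / a)) {0<..}"
    by (metis absolutely_integrable_on_def has_integral_integral set_lebesgue_integral_eq_integral(1))
  then have "(\<integral>\<^sup>+x. ennreal (\<bar>g' x\<bar> * f (g x)) * indicator {0<..} x \<partial>lborel) = ennreal (Gamma (b / a))"
    by (intro nn_integral_has_integral_lebesgue') (auto simp: f_def)
  moreover have "ennreal (\<bar>g' x\<bar> * f (g x)) * indicator {0<..} x =
      ennreal (a * C powr (b / a)) * (ennreal (x powr (b - 1) * exp (- C * x powr a)) * indicator {0<..} x)" for x
  proof (cases "0 < x")
    case True
    have "\<bar>g' x\<bar> * f (g x) = a * (C powr 1 * C powr (b / a - 1)) * (x powr (a - 1) * (x powr a) powr (b / a - 1)) * exp (- C * x powr a)"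
      using True assms by (simp add: g'_def f_def g_def powr_mult exp_minus divide_inverse mult_ac)
    also have "C powr 1 * C powr (b / a - 1) = C powr (b / a)"
      by (simp only: powr_add[symmetric]) simp
    also have "x powr (a - 1) * (x powr a) powr (b / a - 1) = x powr (b - 1)"
    proof -
      have "a - 1 + a * (b / a - 1) = b - 1" using assms by (simp add: right_diff_distrib)
      then show ?thesis by (simp only: powr_powr powr_add[symmetric])
    qed
    finally show ?thesis using True assms by (simp add: ennreal_mult[symmetric] mult.assoc)
  qed simp
  ultimately have *: "ennreal (Gamma (b / a)) = ennreal (a * C powr (b / a)) *
      (\<integral>\<^sup>+x. ennreal (x powr (b - 1) * exp (- C * x powr a)) * indicator {0<..} x \<partial>lborel)"
    by (simp add: nn_integral_cmult)
  have "ennreal (Gamma (b / a) / (a * C powr (b / a))) = ennreal (1 / (a * C powr (b / a))) * ennreal (Gamma (b / a))"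
    using assms by (simp add: ennreal_mult[symmetric])
  also have "\<dots> = (ennreal (1 / (a * C powr (b / a))) * ennreal (a * C powr (b / a))) *
      (\<integral>\<^sup>+x. ennreal (x powr (b - 1) * exp (- C * x powr a)) * indicator {0<..} x \<partial>lborel)"
    unfolding * by (simp add: mult.assoc)
  also have "ennreal (1 / (a * C powr (b / a))) * ennreal (a * C powr (b / a)) = 1"
    using assms by (simp add: ennreal_mult[symmetric])
  finally show ?thesis by simp
qed

text \<open>The density of the intensity lowers the exponent, so the Gamma integral is taken with b
  = s - m; the condition m < s is convergence at 0.\<close>

lemma power_intensity_powr_exp:
  assumes "0 < a" "m < s" "0 < C"
  shows "(\<integral>\<^sup>+x. ennreal (x powr s * exp (- C * x powr a)) \<partial>power_intensity m) =
    ennreal (Gamma ((s - m) / a) / (a * C powr ((s - m) / a)))"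
proof -
  have "(\<integral>\<^sup>+x. ennreal (x powr s * exp (- C * x powr a)) \<partial>power_intensity m) =
      (\<integral>\<^sup>+x. ennreal (x powr (s - m - 1) * exp (- C * x powr a)) * indicator {0<..} x \<partial>lborel)"
  proof (subst nn_integral_power_intensity)
    have *: "x powr (-1 - m) * x powr s = x powr (s - m - 1)" for x :: real
      by (subst powr_add[symmetric]) (simp add: algebra_simps)
    show "(\<integral>\<^sup>+x. ennreal (indicator {0<..} x * x powr (-1 - m)) * ennreal (x powr s * exp (- C * x powr a)) \<partial>lborel) =
      (\<integral>\<^sup>+x. ennreal (x powr (s - m - 1) * exp (- C * x powr a)) * indicator {0<..} x \<partial>lborel)"
    proof (intro nn_integral_cong)
      fix x :: real
      show "ennreal (indicator {0<..} x * x powr (-1 - m)) * ennreal (x powr s * exp (- C * x powr a)) =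
        ennreal (x powr (s - m - 1) * exp (- C * x powr a)) * indicator {0<..} x"
      proof (cases "0 < x")
        case True
        have "x powr (-1 - m) * (x powr s * exp (- C * x powr a)) = x powr (s - m - 1) * exp (- C * x powr a)"
          by (simp only: mult.assoc[symmetric] * )
        then show ?thesis using True by (simp add: ennreal_mult[symmetric])
      qed simp
    qed
  qed measurable
  also have "\<dots> = ennreal (Gamma ((s - m) / a) / (a * C powr ((s - m) / a)))"
    by (rule nn_integral_powr_exp) (use assms in auto)
  finally show ?thesis .
qed

lemma power_intensity_tail:
  assumes "0 < m" "0 < c"
  shows "emeasure (power_intensity m) {c..} = ennreal (c powr (- m) / m)"
proof -
  have "emeasure (power_intensity m) {c..} = (\<integral>\<^sup>+x. indicator {c..} x \<partial>power_intensity m)" by simp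
  also have "\<dots> = (\<integral>\<^sup>+x. ennreal (x powr (-1 - m)) * indicator {c..} x \<partial>lborel)"
    using assms by (subst nn_integral_power_intensity) (auto intro!: nn_integral_cong split: split_indicator)
  also have "\<dots> = ennreal (0 - (- (c powr (- m) / m)))"
  proof (rule nn_integral_FTC_atLeast)
    show "DERIV (\<lambda>x. - (x powr (- m) / m)) x :> x powr (-1 - m)" if "c \<le> x" for x
    proof -
      have "DERIV (\<lambda>x. - (x powr (- m) / m)) x :> - ((- m) * x powr (- m - 1) / m)"
        using that assms by (intro DERIV_minus DERIV_cdivide has_real_derivative_powr) auto
      moreover have "- m - 1 = -1 - m" by simp
      ultimately show ?thesis using assms by (simp only:) simp
    qed
    have "((\<lambda>x::real. x powr (- m)) \<longlongrightarrow> 0) at_top"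
      using assms by (intro tendsto_neg_powr filterlim_ident) auto
    then have "((\<lambda>x::real. - (x powr (- m) / m)) \<longlongrightarrow> - (0 / m)) at_top"
      using assms by (intro tendsto_intros) auto
    then show "((\<lambda>x::real. - (x powr (- m) / m)) \<longlongrightarrow> 0) at_top" by simp
  qed auto
  finally show ?thesis by simp
qed

text \<open>Write \<open>1 - exp (- s)\<close> as the integral of \<open>exp (- w)\<close> over \<open>w \<le> s\<close> and exchange the integrals.\<close>

lemma power_intensity_one_minus_exp:
  assumes "0 < m" "m < a" "0 < C"
  shows "(\<integral>\<^sup>+x. ennreal (1 - exp (- C * x powr a)) \<partial>power_intensity m) =
    ennreal (C powr (m / a) * Gamma (1 - m / a) / m)"
proof -
  interpret PI: sigma_finite_measure "power_intensity m"
    unfolding power_intensity_def by (subst sigma_finite_measure.sigma_finite_iff_density_finite[OF sigma_finite_lborel]) auto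
  interpret P: pair_sigma_finite "power_intensity m" lborel ..
  have A: "ennreal (1 - exp (- C * x powr a)) =
      (\<integral>\<^sup>+w. ennreal (exp (- w)) * indicator {0..} w * indicator {w. w \<le> C * x powr a} w \<partial>lborel)" (is "_ = ?R")
    if "0 < x" for x
  proof -
    have "(\<integral>\<^sup>+w. ennreal (exp (- w)) * indicator {0..C * x powr a} w \<partial>lborel) = ennreal (- exp (- (C * x powr a)) - (- exp (- 0)))"
      by (rule nn_integral_FTC_Icc) (use assms in \<open>auto intro!: derivative_eq_intros\<close>)
    moreover have "?R = (\<integral>\<^sup>+w. ennreal (exp (- w)) * indicator {0..C * x powr a} w \<partial>lborel)"
      by (intro nn_integral_cong) (auto split: split_indicator)
    ultimately show ?thesis by simp
  qed
  have "(\<integral>\<^sup>+x. ennreal (1 - exp (- C * x powr a)) \<partial>power_intensity m) =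
     (\<integral>\<^sup>+x. \<integral>\<^sup>+w. ennreal (exp (- w)) * indicator {0..} w * indicator {w. w \<le> C * x powr a} w \<partial>lborel \<partial>power_intensity m)"
    by (rule nn_integral_power_intensity_cong) (rule A)
  also have "\<dots> = (\<integral>\<^sup>+w. \<integral>\<^sup>+x. ennreal (exp (- w)) * indicator {0..} w * indicator {w. w \<le> C * x powr a} w \<partial>power_intensity m \<partial>lborel)"
  proof (rule P.Fubini'[symmetric])
    have "{p \<in> space (borel \<Otimes>\<^sub>M borel). snd p \<le> C * fst p powr a} \<in> sets (borel \<Otimes>\<^sub>M (borel :: real measure))"
      by measurable
    then have [measurable]: "{p. snd p \<le> C * fst p powr a} \<in> sets (borel \<Otimes>\<^sub>M (borel :: real measure))"
      by (simp add: space_pair_measure)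
    have "(\<lambda>(x, w). ennreal (exp (- w)) * indicator {0..} w * indicator {w. w \<le> C * x powr a} w) =
      (\<lambda>p. ennreal (exp (- snd p)) * indicator {0..} (snd p) * indicator {p. snd p \<le> C * fst p powr a} p)"
      by (auto simp: fun_eq_iff split: split_indicator)
    moreover have "\<dots> \<in> borel_measurable (borel \<Otimes>\<^sub>M borel)"
      by measurable
    ultimately show "(\<lambda>(x, w). ennreal (exp (- w)) * indicator {0..} w * indicator {w. w \<le> C * x powr a} w)
        \<in> borel_measurable (power_intensity m \<Otimes>\<^sub>M lborel)"
      by (subst measurable_cong_sets[OF sets_pair_measure_cong[OF sets_power_intensity sets_lborel] refl]) simp
  qed
  also have "\<dots> = (\<integral>\<^sup>+w. ennreal (C powr (m / a) / m) * (ennreal (w powr ((1 - m / a) - 1) * exp (- 1 * w powr 1)) * indicator {0<..} w) \<partial>lborel)"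
  proof (rule nn_integral_cong_AE)
    have "AE w in lborel. w \<noteq> (0::real)" by (rule AE_lborel_singleton)
    then show "AE w in lborel. (\<integral>\<^sup>+x. ennreal (exp (- w)) * indicator {0..} w * indicator {w. w \<le> C * x powr a} w \<partial>power_intensity m) =
      ennreal (C powr (m / a) / m) * (ennreal (w powr ((1 - m / a) - 1) * exp (- 1 * w powr 1)) * indicator {0<..} w)"
    proof eventually_elim
      case (elim w)
      show ?case
      proof (cases "0 < w")
        case True
        \<comment> \<open>The threshold at which \<open>C * x powr a\<close> reaches w. As a
          function of x the indicator is that of the half-line beyond it, whose mass is
          \<open>power_intensity_tail\<close>.\<close>
        define c where "c = (w / C) powr (1 / a)"
        have c: "0 < c" using True assms by (simp add: c_def)
        have iff: "w \<le> C * x powr a \<longleftrightarrow> c \<le> x" if "0 < x" for x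
        proof -
          have "w \<le> C * x powr a \<longleftrightarrow> w / C \<le> x powr a" using assms by (simp add: field_simps)
          also have "w / C = c powr a" using True assms by (simp add: c_def powr_powr)
          also have "c powr a \<le> x powr a \<longleftrightarrow> c \<le> x"
            using assms c that powr_mono2[of a c x] powr_less_mono2[of a x c] by linarith
          finally show ?thesis .
        qed
        have "(\<integral>\<^sup>+x. ennreal (exp (- w)) * indicator {0..} w * indicator {w. w \<le> C * x powr a} w \<partial>power_intensity m) =
            (\<integral>\<^sup>+x. ennreal (exp (- w)) * indicator {c..} x \<partial>power_intensity m)"
          by (rule nn_integral_power_intensity_cong) (use True iff in \<open>auto split: split_indicator\<close>)
        also have "\<dots> = ennreal (exp (- w)) * ennreal (c powr (- m) / m)"
          by (simp add: nn_integral_cmult power_intensity_tail assms c)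
        also have "c powr (- m) = (w / C) powr (- (m / a))"
          using True assms by (simp add: c_def powr_powr)
        also have "\<dots> = w powr (- (m / a)) * C powr (m / a)"
          using True assms by (subst powr_divide) (auto simp: powr_minus_divide)
        finally show ?thesis using True assms
          by (simp add: ennreal_mult[symmetric] mult_ac)
      next
        case False
        then show ?thesis using elim by simp
      qed
    qed
  qed
  also have "\<dots> = ennreal (C powr (m / a) / m) * ennreal (Gamma (1 - m / a))"
  proof -
    have "(\<integral>\<^sup>+w. (ennreal (w powr ((1 - m / a) - 1) * exp (- 1 * w powr 1)) * indicator {0<..} w) \<partial>lborel) =
        ennreal (Gamma ((1 - m / a) / 1) / (1 * 1 powr ((1 - m / a) / 1)))"
      by (rule nn_integral_powr_exp) (use assms in auto)
    then show ?thesis by (subst nn_integral_cmult) auto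
  qed
  also have "\<dots> = ennreal (C powr (m / a) * Gamma (1 - m / a) / m)"
    using assms by (simp add: ennreal_mult[symmetric] Gamma_real_nonneg)
  finally show ?thesis .
qed

subsection \<open>Product spaces and marked Poisson processes\<close>

text \<open>Independence under a product measure is expressed through the set of coordinates that a
  function reads, rather than through generated sigma-algebras.\<close>

definition dep :: "'i set \<Rightarrow> (('i \<Rightarrow> 'v) \<Rightarrow> 'b) \<Rightarrow> bool" where
  "dep J f \<longleftrightarrow> (\<forall>y y'. (\<forall>i\<in>J. y i = y' i) \<longrightarrow> f y = f y')"

lemma depI: "(\<And>y y'. (\<And>i. i \<in> J \<Longrightarrow> y i = y' i) \<Longrightarrow> f y = f y') \<Longrightarrow> dep J f"
  unfolding dep_def by (intro allI impI) (elim meta_allE meta_impE, rule bspec)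

lemma depD: "dep J f \<Longrightarrow> (\<And>i. i \<in> J \<Longrightarrow> y i = y' i) \<Longrightarrow> f y = f y'"
  unfolding dep_def by (drule spec, drule spec, erule mp) (rule ballI)

lemma dep_mono: "dep J f \<Longrightarrow> J \<subseteq> J' \<Longrightarrow> dep J' f"
  by (rule depI, erule depD) (drule subsetD)

text \<open>All spaces are full, so points of the product are plain total functions and
  \<open>override_on\<close> stays inside the product.\<close>

locale coordinates =
  fixes \<nu> :: "'i \<Rightarrow> 'v measure"
  assumes prob_\<nu>: "\<And>i. prob_space (\<nu> i)" and space_\<nu>: "\<And>i. space (\<nu> i) = UNIV"
begin

definition P where "P = PiM UNIV \<nu>"

sublocale product_prob_space \<nu> UNIV
  rewrites "Pi\<^sub>M UNIV \<nu> = P"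
proof -
  interpret prob_space "\<nu> i" for i by (rule prob_\<nu>)
  show "product_prob_space \<nu>" ..
qed (simp add: P_def)

lemma space_P[simp]: "space P = UNIV"
  by (simp add: P_def space_PiM space_\<nu>)

lemma emeasure_P_UNIV[simp]: "emeasure P UNIV = 1"
  using P.emeasure_space_1 by simp

lemma measurable_coordinate[measurable]: "(\<lambda>y. y i) \<in> measurable P (\<nu> i)"
  unfolding P_def by (rule measurable_component_singleton) simp

lemma override_measurable:
  assumes "f \<in> measurable M P" "g \<in> measurable M P"
  shows "(\<lambda>x. override_on (f x) (g x) J) \<in> measurable M P"
  unfolding P_def
proof (rule measurable_PiM_single')
  fix i :: 'i
  have "(\<lambda>x. f x i) \<in> measurable M (\<nu> i)" "(\<lambda>x. g x i) \<in> measurable M (\<nu> i)"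
    using assms by (auto intro: measurable_compose[OF _ measurable_coordinate])
  then show "(\<lambda>x. override_on (f x) (g x) J i) \<in> measurable M (\<nu> i)"
    by (cases "i \<in> J") auto
qed (auto simp: space_\<nu>)

text \<open>Resampling the coordinates in J from an independent copy preserves the product measure:
  a cylinder over K pulls back to the rectangle of its cylinders over \<open>K - J\<close> and
  \<open>K \<inter> J\<close>, whose masses multiply.\<close>

lemma distr_override: "distr (P \<Otimes>\<^sub>M P) P (\<lambda>p. override_on (fst p) (snd p) J) = P"
proof -
  have om: "(\<lambda>p. override_on (fst p) (snd p) J) \<in> measurable (P \<Otimes>\<^sub>M P) P"
    by (rule override_measurable) auto
  have "distr (P \<Otimes>\<^sub>M P) P (\<lambda>p. override_on (fst p) (snd p) J) = P"
  proof (rule PiM_eq)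
    fix K F assume K: "finite K" "K \<subseteq> UNIV" and F: "\<And>j. j \<in> K \<Longrightarrow> F j \<in> sets (\<nu> j)"
    define A where "A K = {y. \<forall>j\<in>K. y j \<in> F j}" for K
    have emb: "prod_emb UNIV \<nu> K' (Pi\<^sub>E K' F) = A K'" for K'
      by (auto simp: prod_emb_def A_def space_\<nu> PiE_def extensional_def Pi_iff restrict_def)
    have A_sets: "A K' \<in> sets P" and A_em: "emeasure P (A K') = (\<Prod>j\<in>K'. emeasure (\<nu> j) (F j))"
      if "K' \<subseteq> K" for K'
    proof -
      have K': "finite K'" "\<And>j. j \<in> K' \<Longrightarrow> F j \<in> sets (\<nu> j)"
        using that K F finite_subset by auto
      show "A K' \<in> sets P"
        unfolding emb[symmetric] P_def by (rule sets_PiM_I) (use K' in auto)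
      show "emeasure P (A K') = (\<Prod>j\<in>K'. emeasure (\<nu> j) (F j))"
        unfolding emb[symmetric] by (rule emeasure_PiM_emb) (use K' in auto)
    qed
    have "emeasure (distr (P \<Otimes>\<^sub>M P) P (\<lambda>p. override_on (fst p) (snd p) J)) (A K) =
        emeasure (P \<Otimes>\<^sub>M P) ((\<lambda>p. override_on (fst p) (snd p) J) -` A K \<inter> space (P \<Otimes>\<^sub>M P))"
      by (rule emeasure_distr[OF om A_sets]) simp
    also have "(\<lambda>p. override_on (fst p) (snd p) J) -` A K \<inter> space (P \<Otimes>\<^sub>M P) = A (K - J) \<times> A (K \<inter> J)"
      by (auto simp: A_def space_pair_measure override_on_def split: if_splits)
    also have "emeasure (P \<Otimes>\<^sub>M P) (A (K - J) \<times> A (K \<inter> J)) = emeasure P (A (K - J)) * emeasure P (A (K \<inter> J))"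
      by (rule P.emeasure_pair_measure_Times) (auto intro!: A_sets)
    also have "\<dots> = (\<Prod>j\<in>K. emeasure (\<nu> j) (F j))"
      by (subst (1 2) A_em) (use K in \<open>auto simp: prod.Int_Diff[of K _ J] mult.commute\<close>)
    finally show "emeasure (distr (P \<Otimes>\<^sub>M P) P (\<lambda>p. override_on (fst p) (snd p) J))
      (prod_emb UNIV \<nu> K (Pi\<^sub>E K F)) = (\<Prod>j\<in>K. emeasure (\<nu> j) (F j))"
      by (simp add: emb)
  qed simp
  then show ?thesis .
qed

lemma decouple:
  assumes [measurable]: "f \<in> borel_measurable P"
  shows "(\<integral>\<^sup>+y. f y \<partial>P) = (\<integral>\<^sup>+y. \<integral>\<^sup>+y'. f (override_on y y' J) \<partial>P \<partial>P)"
proof -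
  have [measurable]: "(\<lambda>p. override_on (fst p) (snd p) J) \<in> measurable (P \<Otimes>\<^sub>M P) P"
    by (rule override_measurable) auto
  have "(\<integral>\<^sup>+y. f y \<partial>P) = (\<integral>\<^sup>+y. f y \<partial>distr (P \<Otimes>\<^sub>M P) P (\<lambda>p. override_on (fst p) (snd p) J))"
    by (simp add: distr_override)
  also have "\<dots> = (\<integral>\<^sup>+p. f (override_on (fst p) (snd p) J) \<partial>(P \<Otimes>\<^sub>M P))"
    by (rule nn_integral_distr) auto
  also have "\<dots> = (\<integral>\<^sup>+y. \<integral>\<^sup>+y'. f (override_on y y' J) \<partial>P \<partial>P)"
    by (subst P.nn_integral_fst[symmetric]) auto
  finally show ?thesis .
qed

lemma nn_integral_coordinate:
  assumes [measurable]: "f \<in> borel_measurable (\<nu> i)"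
  shows "(\<integral>\<^sup>+y. f (y i) \<partial>P) = (\<integral>\<^sup>+x. f x \<partial>\<nu> i)"
proof -
  have "(\<integral>\<^sup>+x. f x \<partial>\<nu> i) = (\<integral>\<^sup>+x. f x \<partial>distr P (\<nu> i) (\<lambda>y. y i))"
    by (simp add: PiM_component)
  also have "\<dots> = (\<integral>\<^sup>+y. f (y i) \<partial>P)"
    by (rule nn_integral_distr) auto
  finally show ?thesis by simp
qed

text \<open>With its first argument fixed, F does not read coordinate i. Resampling that coordinate
  alone makes it independent of the rest, and Fubini separates the two.\<close>

lemma decouple_coordinate:
  assumes m: "(\<lambda>p. F (fst p) (snd p)) \<in> borel_measurable (\<nu> i \<Otimes>\<^sub>M P)"
    and d: "\<And>x. dep (- {i}) (F x)"
  shows "(\<integral>\<^sup>+y. F (y i) y \<partial>P) = (\<integral>\<^sup>+x. \<integral>\<^sup>+y. F x y \<partial>P \<partial>\<nu> i)"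
proof -
  have [measurable]: "(\<lambda>y. F (y i) y) \<in> borel_measurable P"
    by (rule measurable_compose[OF _ m, where f="\<lambda>y. (y i, y)", simplified]) measurable
  have [measurable]: "(\<lambda>p. F (fst p i) (snd p)) \<in> borel_measurable (P \<Otimes>\<^sub>M P)"
    by (rule measurable_compose[OF _ m, where f="\<lambda>p. (fst p i, snd p)", simplified]) measurable
  have [measurable]: "(\<lambda>x. \<integral>\<^sup>+y. F x y \<partial>P) \<in> borel_measurable (\<nu> i)"
    using m by (intro P.borel_measurable_nn_integral) (simp add: case_prod_unfold)
  interpret PP: pair_sigma_finite P P ..
  have "(\<integral>\<^sup>+y. F (y i) y \<partial>P) = (\<integral>\<^sup>+y. \<integral>\<^sup>+y'. F (override_on y y' {i} i) (override_on y y' {i}) \<partial>P \<partial>P)"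
    by (rule decouple) measurable
  also have "\<dots> = (\<integral>\<^sup>+y. \<integral>\<^sup>+y'. F (y' i) y \<partial>P \<partial>P)"
  proof (intro nn_integral_cong)
    fix y y'
    show "F (override_on y y' {i} i) (override_on y y' {i}) = F (y' i) y"
      by (simp, rule depD[OF d]) (auto simp: override_on_def)
  qed
  also have "\<dots> = (\<integral>\<^sup>+y'. \<integral>\<^sup>+y. F (y' i) y \<partial>P \<partial>P)"
    by (rule PP.Fubini') (simp add: case_prod_unfold)
  also have "\<dots> = (\<integral>\<^sup>+x. \<integral>\<^sup>+y. F x y \<partial>P \<partial>\<nu> i)"
    by (rule nn_integral_coordinate) measurable
  finally show ?thesis .
qed

text \<open>Resampling J' replaces the argument of g by an independent copy and leaves f
  unchanged.\<close>

lemma nn_integral_dep_mult: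
  assumes [measurable]: "f \<in> borel_measurable P" "g \<in> borel_measurable P"
    and d: "dep J f" "dep J' g" "J \<inter> J' = {}"
  shows "(\<integral>\<^sup>+y. f y * g y \<partial>P) = (\<integral>\<^sup>+y. f y \<partial>P) * (\<integral>\<^sup>+y. g y \<partial>P)"
proof -
  have "(\<integral>\<^sup>+y. f y * g y \<partial>P) = (\<integral>\<^sup>+y. \<integral>\<^sup>+y'. f (override_on y y' J') * g (override_on y y' J') \<partial>P \<partial>P)"
    by (rule decouple) measurable
  also have "\<dots> = (\<integral>\<^sup>+y. \<integral>\<^sup>+y'. f y * g y' \<partial>P \<partial>P)"
  proof (intro nn_integral_cong)
    fix y y'
    have "f (override_on y y' J') = f y"
      by (rule depD[OF d(1)]) (use d(3) in \<open>auto simp: override_on_def\<close>)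
    moreover have "g (override_on y y' J') = g y'"
      by (rule depD[OF d(2)]) (auto simp: override_on_def)
    ultimately show "f (override_on y y' J') * g (override_on y y' J') = f y * g y'" by simp
  qed
  finally show ?thesis by (simp add: nn_integral_cmult nn_integral_multc)
qed

lemma dep_iprod:
  fixes h :: "nat \<Rightarrow> ('i \<Rightarrow> 'v) \<Rightarrow> ennreal"
  assumes "\<And>j. j \<notin> K \<Longrightarrow> dep (J j) (h j)"
  shows "dep (\<Union>j\<in>-K. J j) (\<lambda>y. iprod K (\<lambda>j. h j y))"
proof (rule depI)
  fix y y' :: "'i \<Rightarrow> 'v" assume "\<And>i. i \<in> (\<Union>j\<in>-K. J j) \<Longrightarrow> y i = y' i"
  then have "h j y = h j y'" if "j \<notin> K" for j
    using depD[OF assms[OF that], of y y'] that by blast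
  then show "iprod K (\<lambda>j. h j y) = iprod K (\<lambda>j. h j y')"
    by (intro iprod_cong)
qed

text \<open>Finite products factorise because the factors read disjoint coordinates; the products
  decrease and are at most 1, so expectation and infimum commute.\<close>

lemma nn_integral_iprod:
  assumes [measurable]: "\<And>j. h j \<in> borel_measurable P" and h: "\<And>j y. h j y \<le> 1"
    and d: "\<And>j. dep (J j) (h j)" "disjoint_family J"
  shows "(\<integral>\<^sup>+y. iprod K (\<lambda>j. h j y) \<partial>P) = iprod K (\<lambda>j. \<integral>\<^sup>+y. h j y \<partial>P)"
proof -
  define h' where "h' j y = (if j \<in> K then 1 else h j y)" for j y
  have [measurable]: "h' j \<in> borel_measurable P" for j
    unfolding h'_def by (cases "j \<in> K") auto
  have h': "h' j y \<le> 1" for j y using h by (auto simp: h'_def)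
  have d': "dep (J j) (h' j)" for j
    using d(1)[of j] by (auto simp: dep_def h'_def)
  have fin: "(\<integral>\<^sup>+y. (\<Prod>j<N. h' j y) \<partial>P) = (\<Prod>j<N. \<integral>\<^sup>+y. h' j y \<partial>P)" for N
  proof (induction N)
    case (Suc N)
    have "(\<integral>\<^sup>+y. (\<Prod>j<N. h' j y) * h' N y \<partial>P) = (\<integral>\<^sup>+y. (\<Prod>j<N. h' j y) \<partial>P) * (\<integral>\<^sup>+y. h' N y \<partial>P)"
    proof (rule nn_integral_dep_mult[where J="\<Union>j<N. J j" and J'="J N"])
      show "dep (\<Union>j<N. J j) (\<lambda>y. \<Prod>j<N. h' j y)"
        by (rule depI, rule prod.cong[OF refl], rule depD[OF d']) auto
      show "(\<Union>j<N. J j) \<inter> J N = {}"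
        using d(2) by (auto simp: disjoint_family_on_def) (metis disjoint_iff less_irrefl)
    qed (use d' in auto)
    then show ?case by (simp add: Suc)
  qed simp
  have "(\<integral>\<^sup>+y. iprod K (\<lambda>j. h j y) \<partial>P) = (\<integral>\<^sup>+y. (INF N. \<Prod>j<N. h' j y) \<partial>P)"
    by (simp add: iprod_def h'_def)
  also have "\<dots> = (INF N. \<integral>\<^sup>+y. (\<Prod>j<N. h' j y) \<partial>P)"
  proof (rule nn_integral_monotone_convergence_INF_decseq)
    show "decseq (\<lambda>N y. \<Prod>j<N. h' j y)"
    proof (intro decseq_SucI le_funI)
      fix N y
      have "(\<Prod>j<N. h' j y) * h' N y \<le> (\<Prod>j<N. h' j y) * 1"
        by (intro mult_left_mono h') auto
      then show "(\<Prod>j<Suc N. h' j y) \<le> (\<Prod>j<N. h' j y)" by simp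
    qed
    show "(\<integral>\<^sup>+y. (\<Prod>j<N. h' j y) \<partial>P) < \<infinity>" for N
    proof -
      have "(\<integral>\<^sup>+y. (\<Prod>j<N. h' j y) \<partial>P) \<le> (\<integral>\<^sup>+y. 1 \<partial>P)"
        by (intro nn_integral_mono prod_le_1) (auto simp: h')
      then show ?thesis by (simp add: order_le_less_trans)
    qed
  qed auto
  also have "\<dots> = iprod K (\<lambda>j. \<integral>\<^sup>+y. h j y \<partial>P)"
    unfolding fin iprod_def
    by (intro INF_cong prod.cong refl) (simp add: h'_def[abs_def])
  finally show ?thesis .
qed

end

abbreviation seq_borel :: "(nat \<Rightarrow> real) measure" where
  "seq_borel \<equiv> PiM UNIV (\<lambda>_. borel)"

text \<open>Coordinate \<open>e\<close> carries the Poisson points; the \<open>n\<close>-th point \<open>x\<close> contributes a factor \<open>h n x\<close> that depends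
only on the coordinates in \<open>J n\<close> and has mean \<open>g x\<close>.\<close>

locale marks = coordinates \<nu> for \<nu> :: "'i \<Rightarrow> (nat \<Rightarrow> real) measure" +
  fixes e :: 'i and \<mu> :: "real measure" and J :: "nat \<Rightarrow> 'i set"
    and h :: "nat \<Rightarrow> real \<Rightarrow> ('i \<Rightarrow> nat \<Rightarrow> real) \<Rightarrow> ennreal" and g :: "real \<Rightarrow> ennreal"
  assumes sets_\<nu>: "\<And>i. sets (\<nu> i) = sets seq_borel"
    and points_e: "pos_ppp (\<nu> e) \<mu> (\<lambda>n x. x n)"
    and J: "disjoint_family J" "\<And>n. e \<notin> J n"
    and h_measurable: "\<And>n. (\<lambda>p. h n (fst p) (snd p)) \<in> borel_measurable (borel \<Otimes>\<^sub>M P)"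
    and h_le_1: "\<And>n x y. 0 < x \<Longrightarrow> h n x y \<le> 1"
    and h_dep: "\<And>n x. dep (J n) (h n x)"
    and g_measurable[measurable]: "g \<in> borel_measurable borel"
    and h_integral: "\<And>n x. 0 < x \<Longrightarrow> (\<integral>\<^sup>+y. h n x y \<partial>P) = g x"
begin

interpretation E: pos_ppp "\<nu> e" \<mu> "\<lambda>n x. x n"
  by (rule points_e)

lemma component_measurable[measurable]: "(\<lambda>x. x n) \<in> borel_measurable (\<nu> i)"
  by (subst measurable_cong_sets[OF sets_\<nu> refl]) simp

lemma mark_measurable:
  assumes f: "(\<lambda>p. f (fst p) (snd p)) \<in> borel_measurable (borel \<Otimes>\<^sub>M P)"
  shows "(\<lambda>p. f (fst p n) (snd p)) \<in> borel_measurable (\<nu> e \<Otimes>\<^sub>M P)"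
    and "f x \<in> borel_measurable P"
proof -
  show "(\<lambda>p. f (fst p n) (snd p)) \<in> borel_measurable (\<nu> e \<Otimes>\<^sub>M P)"
    by (rule measurable_compose[OF _ f, where f="\<lambda>p. (fst p n, snd p)", simplified]) measurable
  show "f x \<in> borel_measurable P"
    by (rule measurable_compose[OF _ f, where f="\<lambda>y. (x, y)", simplified]) measurable
qed

lemma h_dep_e: "dep (- {e}) (h n x)"
  by (rule dep_mono[OF h_dep]) (use J(2)[of n] in auto)

lemma g_le_1: "0 < x \<Longrightarrow> g x \<le> 1"
proof -
  assume x: "0 < x"
  have "(\<integral>\<^sup>+y. h 0 x y \<partial>P) \<le> (\<integral>\<^sup>+y. 1 \<partial>P)"
    by (intro nn_integral_mono h_le_1 x)
  then show "g x \<le> 1" using h_integral[OF x, of 0] by simp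
qed

lemma integral_iprod_h:
  assumes "\<And>n. 0 < x n"
  shows "(\<integral>\<^sup>+y. iprod K (\<lambda>n. h n (x n) y) \<partial>P) = iprod K (\<lambda>n. g (x n))"
  by (subst nn_integral_iprod[where J=J])
     (auto intro: mark_measurable h_measurable h_le_1 assms h_dep J simp: h_integral assms)

text \<open>Conditioning on the points at coordinate e leaves independent marks, whose product has
  as expectation the product of the values of g; the unmarked Laplace functional finishes.\<close>

lemma marked_laplace:
  "(\<integral>\<^sup>+y. iprod {} (\<lambda>n. h n (y e n) y) \<partial>P) = ee (\<integral>\<^sup>+x. (1 - g x) \<partial>\<mu>)"
proof -
  have "(\<integral>\<^sup>+y. iprod {} (\<lambda>n. h n (y e n) y) \<partial>P) = (\<integral>\<^sup>+x. \<integral>\<^sup>+y. iprod {} (\<lambda>n. h n (x n) y) \<partial>P \<partial>\<nu> e)"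
  proof (rule decouple_coordinate[where F="\<lambda>x y. iprod {} (\<lambda>n. h n (x n) y)"])
    show "dep (- {e}) (\<lambda>y. iprod {} (\<lambda>n. h n (x n) y))" for x
      by (rule depI, rule iprod_cong, rule depD[OF h_dep_e]) auto
  qed (intro iprod_measurable mark_measurable(1) h_measurable)
  also have "\<dots> = (\<integral>\<^sup>+x. iprod {} (\<lambda>n. g (x n)) \<partial>\<nu> e)"
    by (rule nn_integral_cong_AE, use E.AE_points_pos in eventually_elim) (simp add: integral_iprod_h)
  also have "\<dots> = ee (\<integral>\<^sup>+x. (1 - g x) \<partial>\<mu>)"
    by (rule E.laplace_iprod) (auto simp: g_le_1)
  finally show ?thesis .
qed

text \<open>Given the points, the mark f of the selected point and the product of the other marks
  read disjoint coordinates, so the expectation factorises and the unmarked one-point formula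
  applies.\<close>

lemma marked_sum:
  assumes f: "\<And>n. (\<lambda>p. f n (fst p) (snd p)) \<in> borel_measurable (borel \<Otimes>\<^sub>M P)"
    and f_dep: "\<And>n x. dep (J n) (f n x)"
    and f_integral: "\<And>n x. 0 < x \<Longrightarrow> (\<integral>\<^sup>+y. f n x y \<partial>P) = \<phi> x"
    and [measurable]: "\<phi> \<in> borel_measurable borel"
    and g: "\<And>x. 0 < x \<Longrightarrow> 0 < g x"
    and I: "(\<integral>\<^sup>+x. (1 - g x) \<partial>\<mu>) < top" and K: "(\<integral>\<^sup>+x. \<phi> x \<partial>\<mu>) < top"
  shows "(\<integral>\<^sup>+y. (\<Sum>n. f n (y e n) y * iprod {n} (\<lambda>j. h j (y e j) y)) \<partial>P) =
    ee (\<integral>\<^sup>+x. (1 - g x) \<partial>\<mu>) * (\<integral>\<^sup>+x. \<phi> x \<partial>\<mu>)"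
proof -
  note [measurable] = mark_measurable(1)[OF f] mark_measurable(1)[OF h_measurable]
    mark_measurable(2)[OF f] mark_measurable(2)[OF h_measurable]
  have f_dep_e: "dep (- {e}) (f n x)" for n x
    by (rule dep_mono[OF f_dep]) (use J(2)[of n] in auto)
  have "(\<integral>\<^sup>+y. (\<Sum>n. f n (y e n) y * iprod {n} (\<lambda>j. h j (y e j) y)) \<partial>P) =
    (\<integral>\<^sup>+x. \<integral>\<^sup>+y. (\<Sum>n. f n (x n) y * iprod {n} (\<lambda>j. h j (x j) y)) \<partial>P \<partial>\<nu> e)"
  proof (rule decouple_coordinate[where F="\<lambda>x y. \<Sum>n. f n (x n) y * iprod {n} (\<lambda>j. h j (x j) y)"])
    show "dep (- {e}) (\<lambda>y. \<Sum>n. f n (x n) y * iprod {n} (\<lambda>j. h j (x j) y))" for x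
      by (rule depI, rule suminf_cong, rule arg_cong2[where f="(*)"])
         (auto intro!: depD[OF f_dep_e] iprod_cong depD[OF h_dep_e])
  qed measurable
  also have "\<dots> = (\<integral>\<^sup>+x. (\<Sum>n. \<phi> (x n) * iprod {n} (\<lambda>j. g (x j))) \<partial>\<nu> e)"
  proof (rule nn_integral_cong_AE, use E.AE_points_pos in eventually_elim)
    fix x :: "nat \<Rightarrow> real" assume x: "\<forall>n. 0 < x n"
    have "(\<integral>\<^sup>+y. f n (x n) y * iprod {n} (\<lambda>j. h j (x j) y) \<partial>P) = \<phi> (x n) * iprod {n} (\<lambda>j. g (x j))" for n
    proof (subst nn_integral_dep_mult[where J="J n" and J'="\<Union>j\<in>-{n}. J j"])
      show "dep (\<Union>j\<in>-{n}. J j) (\<lambda>y. iprod {n} (\<lambda>j. h j (x j) y))"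
        by (rule dep_iprod) (rule h_dep)
      show "J n \<inter> (\<Union>j\<in>-{n}. J j) = {}"
        using J(1) by (auto simp: disjoint_family_on_def)
    qed (use x in \<open>auto simp: f_dep f_integral integral_iprod_h\<close>)
    then show "(\<integral>\<^sup>+y. (\<Sum>n. f n (x n) y * iprod {n} (\<lambda>j. h j (x j) y)) \<partial>P) =
      (\<Sum>n. \<phi> (x n) * iprod {n} (\<lambda>j. g (x j)))"
      by (subst nn_integral_suminf) auto
  qed
  also have "\<dots> = ee (\<integral>\<^sup>+x. (1 - g x) \<partial>\<mu>) * (\<integral>\<^sup>+x. \<phi> x \<partial>\<mu>)"
    by (rule E.sum_iprod) (auto simp: g_le_1 g I K)
  finally show ?thesis .
qed

text \<open>Given the points, the two selected marks and the product over the others are three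
  functions of disjoint coordinates; what remains is the unmarked two-point formula.\<close>

lemma marked_sum_distinct:
  assumes f: "\<And>n. (\<lambda>p. f n (fst p) (snd p)) \<in> borel_measurable (borel \<Otimes>\<^sub>M P)"
      "\<And>n. (\<lambda>p. f' n (fst p) (snd p)) \<in> borel_measurable (borel \<Otimes>\<^sub>M P)"
    and f_dep: "\<And>n x. dep (J n) (f n x)" "\<And>n x. dep (J n) (f' n x)"
    and f_integral: "\<And>n x. 0 < x \<Longrightarrow> (\<integral>\<^sup>+y. f n x y \<partial>P) = \<phi> x"
      "\<And>n x. 0 < x \<Longrightarrow> (\<integral>\<^sup>+y. f' n x y \<partial>P) = \<psi> x"
    and [measurable]: "\<phi> \<in> borel_measurable borel" "\<psi> \<in> borel_measurable borel"
    and g: "\<And>x. 0 < x \<Longrightarrow> 0 < g x"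
    and fin: "\<And>x. 0 < x \<Longrightarrow> \<phi> x < top" "\<And>x. 0 < x \<Longrightarrow> \<psi> x < top"
    and I: "(\<integral>\<^sup>+x. (1 - g x) \<partial>\<mu>) < top"
    and K: "(\<integral>\<^sup>+x. \<phi> x \<partial>\<mu>) < top" "(\<integral>\<^sup>+x. \<psi> x \<partial>\<mu>) < top"
  shows "(\<integral>\<^sup>+y. (\<Sum>n. \<Sum>n'. if n' = n then 0 else
      f n (y e n) y * f' n' (y e n') y * iprod {n', n} (\<lambda>j. h j (y e j) y)) \<partial>P) =
    ee (\<integral>\<^sup>+x. (1 - g x) \<partial>\<mu>) * (\<integral>\<^sup>+x. \<phi> x \<partial>\<mu>) * (\<integral>\<^sup>+x. \<psi> x \<partial>\<mu>)"
proof -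
  note [measurable] = mark_measurable(1)[OF f(1)] mark_measurable(1)[OF f(2)]
    mark_measurable(1)[OF h_measurable]
    mark_measurable(2)[OF f(1)] mark_measurable(2)[OF f(2)] mark_measurable(2)[OF h_measurable]
  have f_dep_e: "dep (- {e}) (f n x)" "dep (- {e}) (f' n x)" for n x
    by (rule dep_mono[OF f_dep(1)] dep_mono[OF f_dep(2)], use J(2)[of n] in auto)+
  define F where "F x y = (\<Sum>n. \<Sum>n'. if n' = n then 0 else
      f n (x n) y * f' n' (x n') y * iprod {n', n} (\<lambda>j. h j (x j) y))" for x y
  have "(\<integral>\<^sup>+y. F (y e) y \<partial>P) = (\<integral>\<^sup>+x. \<integral>\<^sup>+y. F x y \<partial>P \<partial>\<nu> e)"
  proof (rule decouple_coordinate)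
    show "dep (- {e}) (F x)" for x
    proof (rule depI)
      fix y y' :: "'i \<Rightarrow> nat \<Rightarrow> real" assume eq: "\<And>i. i \<in> - {e} \<Longrightarrow> y i = y' i"
      have "f n (x n) y = f n (x n) y'" "f' n (x n) y = f' n (x n) y'" "h n (x n) y = h n (x n) y'" for n
        using eq by (auto intro!: depD[OF f_dep_e(1)] depD[OF f_dep_e(2)] depD[OF h_dep_e])
      then show "F x y = F x y'" by (simp only: F_def)
    qed
    show "(\<lambda>p. F (fst p) (snd p)) \<in> borel_measurable (\<nu> e \<Otimes>\<^sub>M P)"
      unfolding F_def by measurable
  qed
  also have "\<dots> = (\<integral>\<^sup>+x. (\<Sum>n. \<Sum>n'. if n' = n then 0 else
      \<phi> (x n) * \<psi> (x n') * iprod {n', n} (\<lambda>j. g (x j))) \<partial>\<nu> e)"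
  proof (rule nn_integral_cong_AE, use E.AE_points_pos in eventually_elim)
    fix x :: "nat \<Rightarrow> real" assume x: "\<forall>n. 0 < x n"
    have [measurable]: "(\<lambda>y. if n' = n then 0 else
          f n (x n) y * f' n' (x n') y * iprod {n', n} (\<lambda>j. h j (x j) y)) \<in> borel_measurable P" for n n'
      by (cases "n' = n") auto
    have "(\<integral>\<^sup>+y. (if n' = n then 0 else f n (x n) y * f' n' (x n') y * iprod {n', n} (\<lambda>j. h j (x j) y)) \<partial>P) =
        (if n' = n then 0 else \<phi> (x n) * \<psi> (x n') * iprod {n', n} (\<lambda>j. g (x j)))" for n n'
    proof (cases "n' = n")
      case False
      have dj: "J i \<inter> J j = {}" if "i \<noteq> j" for i j
        using J(1) that by (auto simp: disjoint_family_on_def)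
      have "(\<integral>\<^sup>+y. f n (x n) y * (f' n' (x n') y * iprod {n', n} (\<lambda>j. h j (x j) y)) \<partial>P) =
        (\<integral>\<^sup>+y. f n (x n) y \<partial>P) * (\<integral>\<^sup>+y. f' n' (x n') y * iprod {n', n} (\<lambda>j. h j (x j) y) \<partial>P)"
      proof (rule nn_integral_dep_mult[where J="J n" and J'="J n' \<union> (\<Union>j\<in>-{n', n}. J j)"])
        show "dep (J n' \<union> (\<Union>j\<in>- {n', n}. J j)) (\<lambda>y. f' n' (x n') y * iprod {n', n} (\<lambda>j. h j (x j) y))"
          by (rule depI, rule arg_cong2[where f="(*)"])
             (auto intro!: depD[OF f_dep(2)] depD[OF dep_iprod[OF h_dep]])
        show "J n \<inter> (J n' \<union> (\<Union>j\<in>- {n', n}. J j)) = {}"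
          using dj False by blast
      qed (auto intro: f_dep)
      also have "(\<integral>\<^sup>+y. f' n' (x n') y * iprod {n', n} (\<lambda>j. h j (x j) y) \<partial>P) =
        (\<integral>\<^sup>+y. f' n' (x n') y \<partial>P) * (\<integral>\<^sup>+y. iprod {n', n} (\<lambda>j. h j (x j) y) \<partial>P)"
      proof (rule nn_integral_dep_mult[where J="J n'" and J'="\<Union>j\<in>-{n', n}. J j"])
        show "dep (\<Union>j\<in>- {n', n}. J j) (\<lambda>y. iprod {n', n} (\<lambda>j. h j (x j) y))"
          by (rule dep_iprod) (rule h_dep)
        show "J n' \<inter> (\<Union>j\<in>- {n', n}. J j) = {}"
          using dj by blast
      qed (auto intro: f_dep)
      finally show ?thesis
        using False x by (simp add: f_integral integral_iprod_h mult.assoc)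
    qed simp
    then show "(\<integral>\<^sup>+y. F x y \<partial>P) = (\<Sum>n. \<Sum>n'. if n' = n then 0 else
      \<phi> (x n) * \<psi> (x n') * iprod {n', n} (\<lambda>j. g (x j)))"
      unfolding F_def by (simp add: nn_integral_suminf)
  qed
  also have "\<dots> = ee (\<integral>\<^sup>+x. (1 - g x) \<partial>\<mu>) * (\<integral>\<^sup>+x. \<phi> x \<partial>\<mu>) * (\<integral>\<^sup>+x. \<psi> x \<partial>\<mu>)"
    by (rule E.sum_iprod_distinct) (auto simp: g_le_1 g I K fin)
  finally show ?thesis by (simp add: F_def)
qed

end

section \<open>The tree of columns and Poisson sequences\<close>

definition subtree :: "nat list \<Rightarrow> (nat list + nat list) set" where
  "subtree q = {i. \<exists>s. i = Inl (q @ s) \<or> i = Inr (q @ s)}"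

lemma subtree_child: "subtree (p @ [n]) \<subseteq> subtree p - {Inl p, Inr p}"
  by (auto simp: subtree_def)

lemma disjoint_subtree_children: "disjoint_family (\<lambda>n. subtree (p @ [n]))"
  by (auto simp: disjoint_family_on_def subtree_def)

text \<open>A configuration assigns to \<open>Inl p\<close> the Gaussian column of the node \<open>p\<close> and to \<open>Inr p\<close> the sequence of Poisson
points below \<open>p\<close>. An element of \<open>PS\<close> is the state collected along a branch, into which \<open>upd l c\<close> writes
the column \<open>c\<close> of level \<open>l\<close>. Setting \<open>m (Suc k) = 1\<close> lets the leaves obey the same formulas as inner nodes.\<close>

locale cascade =
  fixes k :: nat and m :: "nat \<Rightarrow> real" and \<kappa> :: "nat \<Rightarrow> (nat \<Rightarrow> real) measure"
    and \<rho> :: "nat list \<Rightarrow> (nat \<Rightarrow> real) measure"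
    and PS :: "'a measure" and upd :: "nat \<Rightarrow> (nat \<Rightarrow> real) \<Rightarrow> 'a \<Rightarrow> 'a"
    and F :: "'a \<Rightarrow> real" and Y :: "nat \<Rightarrow> 'a \<Rightarrow> real"
  assumes m_0: "m 0 = 0" and m_less: "\<And>l. l \<le> k \<Longrightarrow> m l < m (Suc l)" and m_top: "m (Suc k) = 1"
    and prob_\<kappa>: "\<And>l. prob_space (\<kappa> l)" and sets_\<kappa>: "\<And>l. sets (\<kappa> l) = sets seq_borel"
    and prob_\<rho>: "\<And>p. prob_space (\<rho> p)" and sets_\<rho>: "\<And>p. sets (\<rho> p) = sets seq_borel"
    and points_\<rho>: "\<And>p. length p < k \<Longrightarrow>
      poisson_points (\<rho> p) (power_intensity (m (Suc (length p)))) (\<lambda>n x. x n)"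
    and upd_measurable: "\<And>l. (\<lambda>x. upd l (fst x) (snd x)) \<in> measurable (seq_borel \<Otimes>\<^sub>M PS) PS"
    and space_PS: "space PS = UNIV"
    and Y_measurable: "\<And>l. l \<le> k \<Longrightarrow> Y l \<in> borel_measurable PS"
    and Y_pos: "\<And>l \<zeta>. l \<le> k \<Longrightarrow> 0 < Y l \<zeta>" and Y_k: "Y k = F"
    and Y_rec: "\<And>l \<zeta>. l < k \<Longrightarrow>
      (\<integral>\<^sup>+c. ennreal (Y (Suc l) (upd (Suc l) c \<zeta>) powr m (Suc l)) \<partial>\<kappa> (Suc l)) = ennreal (Y l \<zeta> powr m (Suc l))"
begin

definition \<nu> :: "nat list + nat list \<Rightarrow> (nat \<Rightarrow> real) measure" where
  "\<nu> i = (case i of Inl p \<Rightarrow> \<kappa> (length p) | Inr p \<Rightarrow> \<rho> p)"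

lemma \<nu>_simps[simp]: "\<nu> (Inl p) = \<kappa> (length p)" "\<nu> (Inr p) = \<rho> p"
  by (simp_all add: \<nu>_def)

lemma sets_\<nu>: "sets (\<nu> i) = sets seq_borel"
  by (cases i) (auto simp: sets_\<kappa> sets_\<rho>)

sublocale coordinates \<nu>
proof (rule coordinates.intro)
  show "prob_space (\<nu> i)" for i by (cases i) (auto simp: prob_\<kappa> prob_\<rho>)
  show "space (\<nu> i) = UNIV" for i
    using sets_eq_imp_space_eq[OF sets_\<nu>[of i]] by (simp add: space_PiM)
qed

lemma seq_measurable[measurable]: "(\<lambda>y. y i) \<in> measurable P seq_borel"
  using measurable_coordinate[of i] by (simp add: measurable_cong_sets[OF refl sets_\<nu>[of i]])

lemma entry_measurable[measurable]: "(\<lambda>y. y i n) \<in> borel_measurable P"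
  by (rule measurable_compose[OF seq_measurable measurable_component_singleton]) simp

lemma \<kappa>_measurable[simp]: "measurable (\<kappa> l) N = measurable seq_borel N"
  by (rule measurable_cong_sets[OF sets_\<kappa> refl])

lemma m_pos: "0 < l \<Longrightarrow> l \<le> Suc k \<Longrightarrow> 0 < m l"
proof (induction l)
  case (Suc l)
  then show ?case using m_less[of l] m_0 by (cases "l = 0") auto
qed simp

lemma upd_compose[measurable (raw)]:
  assumes "f \<in> measurable M seq_borel" "g \<in> measurable M PS"
  shows "(\<lambda>x. upd l (f x) (g x)) \<in> measurable M PS"
  using measurable_compose[OF measurable_Pair[OF assms] upd_measurable[of l]] by simp

lemma const_PS[measurable]: "(\<lambda>x. \<zeta>) \<in> measurable M PS"
  by (simp add: space_PS)

subsection \<open>Constants\<close>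

text \<open>The constant in the exponent of the Laplace transform \<open>lap\<close>: integrating
\<open>1 - exp (- c x powr a)\<close> against the power intensity of parameter \<open>m\<close> gives \<open>c powr (m / a) * Gamma (1 - m / a) / m\<close>.\<close>

primrec Cd :: "nat \<Rightarrow> real" where
  "Cd 0 = 1"
| "Cd (Suc d) = Cd d powr (m (k - d) / m (Suc (k - d))) * Gamma (1 - m (k - d) / m (Suc (k - d))) / m (k - d)"

definition C :: "nat \<Rightarrow> real" where "C l = Cd (k - l)"

text \<open>For \<open>1 \<le> l\<close> and \<open>l \<le> k\<close> this is
  \<open>m l * C (l - 1)\<close>, as \<open>C_rec\<close> states. The form without division by
  \<open>m l\<close> also makes sense at the root, where \<open>m 0 = 0\<close> and the value is
  1.\<close>

definition Ec :: "nat \<Rightarrow> real" where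
  "Ec l = C l powr (m l / m (Suc l)) * Gamma (1 - m l / m (Suc l))"

lemma C_k[simp]: "C k = 1" by (simp add: C_def)

lemma C_rec: "l < k \<Longrightarrow> m (Suc l) * C l = Ec (Suc l)"
  using m_pos[of "Suc l"] by (simp add: C_def Ec_def Suc_diff_Suc[symmetric])

lemma ratio: "l \<le> k \<Longrightarrow> 0 \<le> m l / m (Suc l)" "l \<le> k \<Longrightarrow> m l / m (Suc l) < 1"
  using m_less[of l] m_pos[of "Suc l"] m_pos[of l] m_0 by (cases "l = 0"; simp)+

lemma C_pos: "l \<le> k \<Longrightarrow> 0 < C l"
proof (induction rule: inc_induct)
  case (step l)
  have "0 < Ec (Suc l)"
    unfolding Ec_def using step ratio[of "Suc l"] by (intro mult_pos_pos Gamma_real_pos) auto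
  then show ?case using C_rec[of l] step m_pos[of "Suc l"]
    by (metis Suc_leI less_SucI mult_pos_pos not_less_iff_gr_or_eq zero_less_Suc zero_less_mult_pos)
qed simp

lemma Ec_pos: "l \<le> k \<Longrightarrow> 0 < Ec l"
  unfolding Ec_def using C_pos[of l] ratio[of l] by (intro mult_pos_pos Gamma_real_pos) auto

lemma Ec_0: "Ec 0 = 1"
  using C_pos[of 0] by (simp add: Ec_def m_0)

subsection \<open>Sums over subtrees\<close>

definition child :: "(nat list \<Rightarrow> 'a \<Rightarrow> (nat list + nat list \<Rightarrow> nat \<Rightarrow> real) \<Rightarrow> ennreal) \<Rightarrow>
    nat list \<Rightarrow> 'a \<Rightarrow> nat \<Rightarrow> (nat list + nat list \<Rightarrow> nat \<Rightarrow> real) \<Rightarrow> ennreal" where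
  "child \<Theta> p \<zeta> n y = \<Theta> (p @ [n]) (upd (Suc (length p)) (y (Inl (p @ [n]))) \<zeta>) y"

text \<open>With w = 1 each child contributes the weight of its point. Two leaves below the same
  child share that point, so sums over pairs of leaves use w = 2.\<close>

definition node_sum where
  "node_sum w \<Theta> p \<zeta> y = (\<Sum>n. ennreal (y (Inr p) n) ^ w * child \<Theta> p \<zeta> n y)"

definition node_pair_sum where
  "node_pair_sum \<Theta> \<Theta>' p \<zeta> y = (\<Sum>n. \<Sum>n'. if n' = n then 0 else
     (ennreal (y (Inr p) n) * child \<Theta> p \<zeta> n y) * (ennreal (y (Inr p) n') * child \<Theta>' p \<zeta> n' y))"

primrec Tsum :: "('a \<Rightarrow> ennreal) \<Rightarrow> nat \<Rightarrow> nat list \<Rightarrow> 'a \<Rightarrow> (nat list + nat list \<Rightarrow> nat \<Rightarrow> real) \<Rightarrow> ennreal" where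
  "Tsum G 0 = (\<lambda>p \<zeta> y. G \<zeta>)"
| "Tsum G (Suc d) = node_sum 1 (Tsum G d)"

text \<open>\<open>e\<close> is the distance down to the node where the pair separates, and
  \<open>d\<close> the number of levels below the children of that node; \<open>A\<close> and
  \<open>B\<close> are evaluated at the two leaves.\<close>

primrec Dsum :: "('a \<Rightarrow> ennreal) \<Rightarrow> ('a \<Rightarrow> ennreal) \<Rightarrow> nat \<Rightarrow> nat \<Rightarrow> nat list \<Rightarrow> 'a \<Rightarrow>
    (nat list + nat list \<Rightarrow> nat \<Rightarrow> real) \<Rightarrow> ennreal" where
  "Dsum A B d 0 = node_pair_sum (Tsum A d) (Tsum B d)"
| "Dsum A B d (Suc e) = node_sum 2 (Dsum A B d e)"

text \<open>The column of q itself is excluded: by the time \<Theta> is evaluated at q, that column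
  has been written into the state. This makes the column of a child independent of the coordinates
  read below it.\<close>

definition node_fun :: "(nat list \<Rightarrow> 'a \<Rightarrow> (nat list + nat list \<Rightarrow> nat \<Rightarrow> real) \<Rightarrow> ennreal) \<Rightarrow> bool" where
  "node_fun \<Theta> \<longleftrightarrow> (\<forall>q. (\<lambda>x. \<Theta> q (fst x) (snd x)) \<in> borel_measurable (PS \<Otimes>\<^sub>M P) \<and>
     (\<forall>\<zeta>. dep (subtree q - {Inl q}) (\<Theta> q \<zeta>)))"

lemma node_fun_measurable:
  assumes "node_fun \<Theta>" "f \<in> measurable M PS" "g \<in> measurable M P"
  shows "(\<lambda>x. \<Theta> q (f x) (g x)) \<in> borel_measurable M"
  using measurable_compose[OF measurable_Pair[OF assms(2,3)], of "\<lambda>x. \<Theta> q (fst x) (snd x)" borel] assms(1)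
  by (simp add: node_fun_def)

lemma node_fun_dep: "node_fun \<Theta> \<Longrightarrow> dep (subtree q - {Inl q}) (\<Theta> q \<zeta>)"
  by (simp add: node_fun_def)

lemma child_dep: "node_fun \<Theta> \<Longrightarrow> dep (subtree (p @ [n])) (child \<Theta> p \<zeta> n)"
proof (rule depI)
  fix y y' :: "nat list + nat list \<Rightarrow> nat \<Rightarrow> real"
  assume \<Theta>: "node_fun \<Theta>" and eq: "\<And>i. i \<in> subtree (p @ [n]) \<Longrightarrow> y i = y' i"
  have "y (Inl (p @ [n])) = y' (Inl (p @ [n]))" by (rule eq) (simp add: subtree_def)
  then show "child \<Theta> p \<zeta> n y = child \<Theta> p \<zeta> n y'"
    unfolding child_def by (simp, intro depD[OF node_fun_dep[OF \<Theta>]] eq) auto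
qed

lemma child_measurable:
  assumes "node_fun \<Theta>" "f \<in> measurable M PS" and [measurable]: "g \<in> measurable M P"
  shows "(\<lambda>x. child \<Theta> p (f x) n (g x)) \<in> borel_measurable M"
  unfolding child_def
  by (rule node_fun_measurable[OF assms(1) _ assms(3)])
     (intro upd_compose assms measurable_compose[OF assms(3) seq_measurable])

lemma node_fun_const: "G \<in> borel_measurable PS \<Longrightarrow> node_fun (\<lambda>p \<zeta> y. G \<zeta>)"
  by (auto simp: node_fun_def dep_def)

text \<open>A sum at p reads the points at p and the subtrees of its children, but not the column of
  p.\<close>

lemma dep_node:
  assumes "\<And>n. dep (subtree (p @ [n])) (f n)"
    and "\<And>y y'. y (Inr p) = y' (Inr p) \<Longrightarrow> (\<And>n. f n y = f n y') \<Longrightarrow> g y = g y'"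
  shows "dep (subtree p - {Inl p}) g"
proof (rule depI, rule assms(2))
  fix y y' :: "nat list + nat list \<Rightarrow> 'b" assume eq: "\<And>i. i \<in> subtree p - {Inl p} \<Longrightarrow> y i = y' i"
  show "y (Inr p) = y' (Inr p)" by (rule eq) (simp add: subtree_def)
  show "f n y = f n y'" for n
    by (rule depD[OF assms(1)], rule eq) (use subtree_child[of p n] in auto)
qed

lemma node_fun_node_sum:
  assumes "node_fun \<Theta>"
  shows "node_fun (node_sum w \<Theta>)"
  unfolding node_fun_def
proof (intro allI conjI)
  fix q
  have [measurable]: "(\<lambda>x. child \<Theta> q (fst x) n (snd x)) \<in> borel_measurable (PS \<Otimes>\<^sub>M P)" for n
    by (rule child_measurable[OF assms]) measurable
  show "(\<lambda>x. node_sum w \<Theta> q (fst x) (snd x)) \<in> borel_measurable (PS \<Otimes>\<^sub>M P)"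
    unfolding node_sum_def by measurable
  show "dep (subtree q - {Inl q}) (node_sum w \<Theta> q \<zeta>)" for \<zeta>
    by (rule dep_node[OF child_dep[OF assms, where \<zeta>=\<zeta>]]) (simp only: node_sum_def)
qed

lemma node_fun_node_pair_sum:
  assumes "node_fun \<Theta>" "node_fun \<Theta>'"
  shows "node_fun (node_pair_sum \<Theta> \<Theta>')"
  unfolding node_fun_def
proof (intro allI conjI)
  fix q
  have [measurable]: "(\<lambda>x. child \<Theta> q (fst x) n (snd x)) \<in> borel_measurable (PS \<Otimes>\<^sub>M P)"
      "(\<lambda>x. child \<Theta>' q (fst x) n (snd x)) \<in> borel_measurable (PS \<Otimes>\<^sub>M P)" for n
    by (rule child_measurable[OF assms(1)] child_measurable[OF assms(2)], measurable)+
  show "(\<lambda>x. node_pair_sum \<Theta> \<Theta>' q (fst x) (snd x)) \<in> borel_measurable (PS \<Otimes>\<^sub>M P)"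
    unfolding node_pair_sum_def by measurable
  show "dep (subtree q - {Inl q}) (node_pair_sum \<Theta> \<Theta>' q \<zeta>)" for \<zeta>
  proof (rule dep_node[where f="\<lambda>n y. (child \<Theta> q \<zeta> n y, child \<Theta>' q \<zeta> n y)"])
    show "dep (subtree (q @ [n])) (\<lambda>y. (child \<Theta> q \<zeta> n y, child \<Theta>' q \<zeta> n y))" for n
    proof (rule depI)
      fix y y' :: "nat list + nat list \<Rightarrow> nat \<Rightarrow> real"
      assume "\<And>i. i \<in> subtree (q @ [n]) \<Longrightarrow> y i = y' i"
      then show "(child \<Theta> q \<zeta> n y, child \<Theta>' q \<zeta> n y) = (child \<Theta> q \<zeta> n y', child \<Theta>' q \<zeta> n y')"
        using depD[OF child_dep[OF assms(1)]] depD[OF child_dep[OF assms(2)]] by blast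
    qed
  qed (simp only: node_pair_sum_def prod.inject)
qed

lemma node_fun_Tsum: "G \<in> borel_measurable PS \<Longrightarrow> node_fun (Tsum G d)"
  by (induction d) (auto intro: node_fun_const node_fun_node_sum)

lemma node_fun_Dsum: "A \<in> borel_measurable PS \<Longrightarrow> B \<in> borel_measurable PS \<Longrightarrow> node_fun (Dsum A B d e)"
  by (induction e) (auto intro: node_fun_node_pair_sum node_fun_node_sum node_fun_Tsum)

text \<open>The column of the child is read only through the state, so it is independent of the
  coordinates read below the child and may be integrated last.\<close>

lemma child_integral:
  assumes "node_fun \<Theta>"
  shows "(\<integral>\<^sup>+y. child \<Theta> p \<zeta> n y \<partial>P) =
    (\<integral>\<^sup>+c. \<integral>\<^sup>+y. \<Theta> (p @ [n]) (upd (Suc (length p)) c \<zeta>) y \<partial>P \<partial>\<kappa> (Suc (length p)))"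
proof -
  have s: "sets (\<kappa> (Suc (length p)) \<Otimes>\<^sub>M P) = sets (seq_borel \<Otimes>\<^sub>M P)"
    by (rule sets_pair_measure_cong[OF sets_\<kappa> refl])
  have "(\<integral>\<^sup>+y. child \<Theta> p \<zeta> n y \<partial>P) =
    (\<integral>\<^sup>+c. \<integral>\<^sup>+y. \<Theta> (p @ [n]) (upd (Suc (length p)) c \<zeta>) y \<partial>P \<partial>\<nu> (Inl (p @ [n])))"
    unfolding child_def
  proof (rule decouple_coordinate[where F="\<lambda>c y. \<Theta> (p @ [n]) (upd (Suc (length p)) c \<zeta>) y"])
    show "dep (- {Inl (p @ [n])}) (\<Theta> (p @ [n]) (upd (Suc (length p)) x \<zeta>))" for x
      by (rule dep_mono[OF node_fun_dep[OF assms]]) auto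
    show "(\<lambda>x. \<Theta> (p @ [n]) (upd (Suc (length p)) (fst x) \<zeta>) (snd x))
        \<in> borel_measurable (\<nu> (Inl (p @ [n])) \<Otimes>\<^sub>M P)"
      using s by (simp add: measurable_cong_sets[OF s refl])
        (rule node_fun_measurable[OF assms], measurable)
  qed
  then show ?thesis by simp
qed

end

section \<open>Integrals for one level of the recursion\<close>

context cascade
begin

lemma snd_\<kappa>[measurable]: "snd \<in> measurable (A \<Otimes>\<^sub>M \<kappa> l) seq_borel"
  using measurable_snd[of A "\<kappa> l"] by (simp add: measurable_cong_sets[OF refl sets_\<kappa>])

lemma ident_\<kappa>[measurable]: "(\<lambda>c. c) \<in> measurable (\<kappa> l) seq_borel"
  by simp

lemma upd_\<kappa>[measurable]: "(\<lambda>c. upd j c \<zeta>) \<in> measurable (\<kappa> l) PS"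
  by (rule upd_compose) measurable

text \<open>The average over column \<open>Suc l\<close> with density \<open>W_(l+1)\<close>.\<close>

definition avg :: "nat \<Rightarrow> ('a \<Rightarrow> ennreal) \<Rightarrow> 'a \<Rightarrow> ennreal" where
  "avg l Q \<zeta> = (\<integral>\<^sup>+c. Q (upd (Suc l) c \<zeta>) *
     ennreal ((Y (Suc l) (upd (Suc l) c \<zeta>) / Y l \<zeta>) powr m (Suc l)) \<partial>\<kappa> (Suc l))"

lemma avg_measurable:
  assumes [measurable]: "Q \<in> borel_measurable PS" and l: "l < k"
  shows "avg l Q \<in> borel_measurable PS"
proof -
  interpret \<kappa>: prob_space "\<kappa> (Suc l)" by (rule prob_\<kappa>)
  have [measurable]: "Y l \<in> borel_measurable PS" "Y (Suc l) \<in> borel_measurable PS"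
    using l by (auto intro: Y_measurable)
  have [measurable]: "(\<lambda>x. upd (Suc l) (snd x) (fst x)) \<in> measurable (PS \<Otimes>\<^sub>M \<kappa> (Suc l)) PS"
    by (rule upd_compose) measurable
  show ?thesis
    unfolding avg_def[abs_def]
    by (rule \<kappa>.borel_measurable_nn_integral) (simp add: case_prod_unfold)
qed

lemma nn_integral_avg:
  assumes [measurable]: "Q \<in> borel_measurable PS" and l: "l < k"
  shows "(\<integral>\<^sup>+c. Q (upd (Suc l) c \<zeta>) * ennreal (Y (Suc l) (upd (Suc l) c \<zeta>) powr m (Suc l)) \<partial>\<kappa> (Suc l)) =
    ennreal (Y l \<zeta> powr m (Suc l)) * avg l Q \<zeta>"
proof -
  have [measurable]: "Y (Suc l) \<in> borel_measurable PS"
    using l by (auto intro: Y_measurable)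
  have Y: "0 < Y l \<zeta>" "0 < Y (Suc l) \<xi>" for \<xi> using l by (auto intro: Y_pos)
  have *: "ennreal (Y (Suc l) \<xi> powr m (Suc l)) =
      ennreal (Y l \<zeta> powr m (Suc l)) * ennreal ((Y (Suc l) \<xi> / Y l \<zeta>) powr m (Suc l))" for \<xi>
    using Y(1) Y(2)[of \<xi>] by (simp add: ennreal_mult[symmetric] powr_divide)
  show ?thesis
    unfolding avg_def * by (subst nn_integral_cmult[symmetric]) (auto simp: mult_ac)
qed

text \<open>The recursion \<open>Y_rec\<close> says precisely that the density of \<open>avg\<close>
  has total mass 1.\<close>

lemma avg_1: "l < k \<Longrightarrow> avg l (\<lambda>_. 1) \<zeta> = 1"
proof -
  assume l: "l < k"
  have "ennreal (Y l \<zeta> powr m (Suc l)) * avg l (\<lambda>_. 1) \<zeta> = ennreal (Y l \<zeta> powr m (Suc l)) * 1"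
    using nn_integral_avg[of "\<lambda>_. 1" l \<zeta>] Y_rec[OF l, of \<zeta>] l by simp
  moreover have "Y l \<zeta> powr m (Suc l) \<noteq> 0" using Y_pos[of l \<zeta>] l by simp
  ultimately show ?thesis
    by (subst (asm) ennreal_mult_cancel_left) (auto simp: ennreal_eq_0_iff not_le)
qed

lemma avg_le_1:
  assumes "\<And>\<zeta>. Q \<zeta> \<le> 1" and l: "l < k"
  shows "avg l Q \<zeta> \<le> 1"
proof -
  have "avg l Q \<zeta> \<le> avg l (\<lambda>_. 1) \<zeta>"
    unfolding avg_def by (intro nn_integral_mono mult_right_mono assms) auto
  then show ?thesis using avg_1[OF l] by simp
qed

text \<open>The value that the induction establishes for the Laplace transform of the sum below a
  node of depth l: a one-sided stable law of index \<open>m (Suc l)\<close>, degenerate at the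
  leaves, where the index is 1.\<close>

definition lap :: "nat \<Rightarrow> real \<Rightarrow> 'a \<Rightarrow> real" where
  "lap l \<tau> \<zeta> = exp (- C l * (\<tau> * Y l \<zeta>) powr m (Suc l))"

lemma lap_measurable[measurable]:
  assumes "l \<le> k" and [measurable]: "f \<in> borel_measurable M" "g \<in> measurable M PS"
  shows "(\<lambda>x. lap l (f x) (g x)) \<in> borel_measurable M"
proof -
  have [measurable]: "(\<lambda>x. Y l (g x)) \<in> borel_measurable M"
    by (rule measurable_compose[OF assms(3) Y_measurable[OF assms(1)]])
  show ?thesis unfolding lap_def by measurable
qed

text \<open>The mean of the factor contributed by a point x together with its subtree, that is, the
  g of the locale \<open>marks\<close>.\<close>

definition gfun :: "nat \<Rightarrow> real \<Rightarrow> 'a \<Rightarrow> real \<Rightarrow> ennreal" where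
  "gfun l \<tau> \<zeta> x = (\<integral>\<^sup>+c. ennreal (lap (Suc l) (\<tau> * x) (upd (Suc l) c \<zeta>)) \<partial>\<kappa> (Suc l))"

text \<open>For a fixed column, rescaling by \<open>\<tau> * Y (Suc l)\<close> leaves a constant
  integral, equal to \<open>C l\<close> by the recursion of the constants. The remaining power of
  \<open>Y (Suc l)\<close> is integrated over the column by \<open>Y_rec\<close>.\<close>

lemma integral_one_minus_gfun:
  assumes l: "l < k" and \<tau>: "0 < \<tau>"
  shows "(\<integral>\<^sup>+x. (1 - gfun l \<tau> \<zeta> x) \<partial>power_intensity (m (Suc l))) =
    ennreal (C l * (\<tau> * Y l \<zeta>) powr m (Suc l))"
proof -
  let ?M = "m (Suc l)" and ?M' = "m (Suc (Suc l))" and ?Y = "\<lambda>c. Y (Suc l) (upd (Suc l) c \<zeta>)"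
  interpret \<kappa>: prob_space "\<kappa> (Suc l)" by (rule prob_\<kappa>)
  interpret PI: sigma_finite_measure "power_intensity ?M"
    unfolding power_intensity_def
    by (subst sigma_finite_measure.sigma_finite_iff_density_finite[OF sigma_finite_lborel]) auto
  interpret Q: pair_sigma_finite "power_intensity ?M" "\<kappa> (Suc l)" ..
  have [measurable]: "Y (Suc l) \<in> borel_measurable PS"
    using l by (auto intro: Y_measurable)
  have Y: "0 < Y l \<zeta>" "0 < Y (Suc l) \<xi>" for \<xi> using l by (auto intro: Y_pos)
  have M: "0 < ?M" "?M < ?M'" "0 < C (Suc l)"
    using l m_less[of "Suc l"] m_pos[of "Suc l"] C_pos[of "Suc l"] by auto
  have le1: "lap (Suc l) a \<xi> \<le> 1" for a \<xi> using M by (simp add: lap_def)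
  define G where "G x c = ennreal (1 - lap (Suc l) (\<tau> * x) (upd (Suc l) c \<zeta>))" for x c
  have Gm: "case_prod G \<in> borel_measurable (power_intensity ?M \<Otimes>\<^sub>M \<kappa> (Suc l))"
  proof -
    have "(\<lambda>p. lap (Suc l) (\<tau> * fst p) (upd (Suc l) (snd p) \<zeta>)) \<in> borel_measurable (borel \<Otimes>\<^sub>M \<kappa> (Suc l))"
    proof (rule lap_measurable)
      show "(\<lambda>p. upd (Suc l) (snd p) \<zeta>) \<in> measurable (borel \<Otimes>\<^sub>M \<kappa> (Suc l)) PS"
        by (rule upd_compose) measurable
    qed (use l in auto)
    then have "case_prod G \<in> borel_measurable (borel \<Otimes>\<^sub>M \<kappa> (Suc l))"
      unfolding G_def case_prod_unfold by measurable
    then show ?thesis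
      by (subst measurable_cong_sets[OF sets_pair_measure_cong[OF sets_power_intensity refl] refl])
  qed
  have lm: "(\<lambda>c. lap (Suc l) a (upd (Suc l) c \<zeta>)) \<in> borel_measurable (\<kappa> (Suc l))" for a
    by (rule lap_measurable[OF _ measurable_const upd_\<kappa>]) (use l in auto)
  have "1 - gfun l \<tau> \<zeta> x = (\<integral>\<^sup>+c. G x c \<partial>\<kappa> (Suc l))" for x
  proof -
    have *: "gfun l \<tau> \<zeta> x \<le> (\<integral>\<^sup>+c. 1 \<partial>\<kappa> (Suc l))"
      unfolding gfun_def by (intro nn_integral_mono) (simp add: le1)
    have "(\<integral>\<^sup>+c. G x c \<partial>\<kappa> (Suc l)) = (\<integral>\<^sup>+c. 1 - ennreal (lap (Suc l) (\<tau> * x) (upd (Suc l) c \<zeta>)) \<partial>\<kappa> (Suc l))"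
      unfolding G_def by (intro nn_integral_cong) (simp add: ennreal_minus lap_def flip: ennreal_1)
    also have "\<dots> = (\<integral>\<^sup>+c. 1 \<partial>\<kappa> (Suc l)) - gfun l \<tau> \<zeta> x"
      unfolding gfun_def
      by (rule nn_integral_diff) (use lm * le1 in \<open>auto simp: gfun_def \<kappa>.emeasure_space_1 top_unique\<close>)
    finally show ?thesis by (simp add: \<kappa>.emeasure_space_1)
  qed
  then have "(\<integral>\<^sup>+x. (1 - gfun l \<tau> \<zeta> x) \<partial>power_intensity ?M) =
      (\<integral>\<^sup>+c. \<integral>\<^sup>+x. G x c \<partial>power_intensity ?M \<partial>\<kappa> (Suc l))"
    by (simp add: Q.Fubini'[OF Gm])
  also have "\<dots> = (\<integral>\<^sup>+c. ennreal (C l * \<tau> powr ?M) * ennreal (?Y c powr ?M) \<partial>\<kappa> (Suc l))"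
  proof (intro nn_integral_cong)
    fix c
    have "(\<integral>\<^sup>+x. G x c \<partial>power_intensity ?M) =
      (\<integral>\<^sup>+x. ennreal (1 - exp (- C (Suc l) * ((\<tau> * ?Y c) * x) powr ?M')) \<partial>power_intensity ?M)"
      by (simp add: G_def lap_def mult_ac)
    also have "\<dots> = ennreal ((\<tau> * ?Y c) powr ?M) * (\<integral>\<^sup>+x. ennreal (1 - exp (- C (Suc l) * x powr ?M')) \<partial>power_intensity ?M)"
      by (rule power_intensity_scale[where f="\<lambda>x. ennreal (1 - exp (- C (Suc l) * x powr ?M'))"])
        (use \<tau> Y in auto)
    also have "\<dots> = ennreal ((\<tau> * ?Y c) powr ?M) * ennreal (C l)"
    proof -
      have "C (Suc l) powr (?M / ?M') * Gamma (1 - ?M / ?M') / ?M = C l"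
        using C_rec[OF l] M by (simp add: Ec_def field_simps)
      then show ?thesis by (subst power_intensity_one_minus_exp) (use M in auto)
    qed
    also have "\<dots> = ennreal (C l * \<tau> powr ?M) * ennreal (?Y c powr ?M)"
      using \<tau> Y(2)[of "upd (Suc l) c \<zeta>"] C_pos[of l] l by (simp add: ennreal_mult[symmetric] powr_mult mult_ac)
    finally show "(\<integral>\<^sup>+x. G x c \<partial>power_intensity ?M) = ennreal (C l * \<tau> powr ?M) * ennreal (?Y c powr ?M)" .
  qed
  also have "\<dots> = ennreal (C l * \<tau> powr ?M) * ennreal (Y l \<zeta> powr ?M)"
    by (subst nn_integral_cmult) (auto simp: Y_rec[OF l])
  also have "\<dots> = ennreal (C l * (\<tau> * Y l \<zeta>) powr ?M)"
    using \<tau> Y(1) C_pos[of l] l by (simp add: ennreal_mult[symmetric] powr_mult mult_ac)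
  finally show ?thesis .
qed

text \<open>The shape preserved by one step of the recursion towards the root; \<open>w\<close> is the degree of homogeneity
(\<open>1\<close> for sums over leaves, \<open>2\<close> for sums over pairs of leaves).\<close>

definition mono_fun :: "nat \<Rightarrow> nat \<Rightarrow> real \<Rightarrow> real \<Rightarrow> real \<Rightarrow> 'a \<Rightarrow> real" where
  "mono_fun l w b s \<tau> \<zeta> = 1 / \<tau> ^ w * b * (\<tau> * Y l \<zeta>) powr s * lap l \<tau> \<zeta>"

text \<open>The mean over the mark of the summand attached to a selected point x; it plays the role
  of \<phi> in the marked Mecke formulas.\<close>

definition phi :: "nat \<Rightarrow> nat \<Rightarrow> real \<Rightarrow> real \<Rightarrow> ('a \<Rightarrow> ennreal) \<Rightarrow> real \<Rightarrow> 'a \<Rightarrow> real \<Rightarrow> ennreal" where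
  "phi l w b s Q \<tau> \<zeta> x = (\<integral>\<^sup>+c. ennreal x ^ w *
     (ennreal (mono_fun (Suc l) w b s (\<tau> * x) (upd (Suc l) c \<zeta>)) * Q (upd (Suc l) c \<zeta>)) \<partial>\<kappa> (Suc l))"

text \<open>The Gamma integral of \<open>u powr s * exp (- C l * u powr m (Suc l))\<close> against
  the intensity of parameter \<open>m l\<close>, multiplied by b.\<close>

definition step_const :: "nat \<Rightarrow> real \<Rightarrow> real \<Rightarrow> real" where
  "step_const l b s = b * (Gamma ((s - m l) / m (Suc l)) /
     (m (Suc l) * C l powr ((s - m l) / m (Suc l))))"

lemma phi_integrand_measurable:
  assumes [measurable]: "Q \<in> borel_measurable PS" and l: "l < k"
  shows "(\<lambda>(x, c). ennreal x ^ w * (ennreal (mono_fun (Suc l) w b s (\<tau> * x) (upd (Suc l) c \<zeta>)) *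
      Q (upd (Suc l) c \<zeta>))) \<in> borel_measurable (borel \<Otimes>\<^sub>M \<kappa> (Suc l))"
proof -
  have [measurable]: "Y (Suc l) \<in> borel_measurable PS"
    using l by (auto intro: Y_measurable)
  have u[measurable]: "(\<lambda>p. upd (Suc l) (snd p) \<zeta>) \<in> measurable (borel \<Otimes>\<^sub>M \<kappa> (Suc l)) PS"
    by (rule upd_compose) measurable
  have [measurable]: "(\<lambda>p. lap (Suc l) (\<tau> * fst p) (upd (Suc l) (snd p) \<zeta>)) \<in> borel_measurable (borel \<Otimes>\<^sub>M \<kappa> (Suc l))"
    by (rule lap_measurable[OF _ _ u]) (use l in auto)
  show ?thesis
    unfolding mono_fun_def case_prod_unfold by measurable
qed

lemma phi_measurable:
  assumes "Q \<in> borel_measurable PS" and l: "l < k"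
  shows "phi l w b s Q \<tau> \<zeta> \<in> borel_measurable borel"
proof -
  interpret \<kappa>: prob_space "\<kappa> (Suc l)" by (rule prob_\<kappa>)
  show ?thesis
    unfolding phi_def[abs_def]
    by (rule \<kappa>.borel_measurable_nn_integral) (rule phi_integrand_measurable[OF assms])
qed

text \<open>The powers \<open>x ^ w\<close> and \<open>1 / (\<tau> * x) ^ w\<close> cancel up to
  \<open>1 / \<tau> ^ w\<close>, so x occurs only in the product of \<tau>, Y and x. Rescaling
  yields the Gamma integral times a power of Y, and averaging that power together with Q over the
  column is \<open>avg\<close>.\<close>

lemma integral_phi:
  assumes [measurable]: "Q \<in> borel_measurable PS" and l: "l < k" and \<tau>: "0 < \<tau>"
    and b: "0 \<le> b" and s: "m (Suc l) < s"
  shows "(\<integral>\<^sup>+x. phi l w b s Q \<tau> \<zeta> x \<partial>power_intensity (m (Suc l))) =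
    ennreal (1 / \<tau> ^ w * step_const (Suc l) b s * (\<tau> * Y l \<zeta>) powr m (Suc l)) * avg l Q \<zeta>"
proof -
  let ?M = "m (Suc l)" and ?M' = "m (Suc (Suc l))" and ?Y = "\<lambda>c. Y (Suc l) (upd (Suc l) c \<zeta>)"
    and ?Q = "\<lambda>c. Q (upd (Suc l) c \<zeta>)"
  interpret \<kappa>: prob_space "\<kappa> (Suc l)" by (rule prob_\<kappa>)
  interpret PI: sigma_finite_measure "power_intensity ?M"
    unfolding power_intensity_def
    by (subst sigma_finite_measure.sigma_finite_iff_density_finite[OF sigma_finite_lborel]) auto
  interpret PQ: pair_sigma_finite "power_intensity ?M" "\<kappa> (Suc l)" ..
  have [measurable]: "Y (Suc l) \<in> borel_measurable PS"
    using l by (auto intro: Y_measurable)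
  have Y: "0 < Y l \<zeta>" "0 < Y (Suc l) \<xi>" for \<xi> using l by (auto intro: Y_pos)
  have M: "0 < ?M" "?M < ?M'" "0 < C (Suc l)"
    using l m_less[of "Suc l"] m_pos[of "Suc l"] C_pos[of "Suc l"] by auto
  define K where "K = Gamma ((s - ?M) / ?M') / (?M' * C (Suc l) powr ((s - ?M) / ?M'))"
  have K: "0 \<le> K" unfolding K_def
    using M s by (intro divide_nonneg_pos mult_pos_pos) (auto intro!: Gamma_real_nonneg)
  have "(\<integral>\<^sup>+x. phi l w b s Q \<tau> \<zeta> x \<partial>power_intensity ?M) =
      (\<integral>\<^sup>+c. \<integral>\<^sup>+x. ennreal x ^ w * (ennreal (mono_fun (Suc l) w b s (\<tau> * x) (upd (Suc l) c \<zeta>)) * ?Q c) \<partial>power_intensity ?M \<partial>\<kappa> (Suc l))"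
    unfolding phi_def
    by (rule PQ.Fubini'[symmetric], subst measurable_cong_sets[OF sets_pair_measure_cong[OF sets_power_intensity refl] refl])
       (rule phi_integrand_measurable, use l in auto)
  also have "\<dots> = (\<integral>\<^sup>+c. ennreal (1 / \<tau> ^ w * (b * K) * \<tau> powr ?M) * (?Q c * ennreal (?Y c powr ?M)) \<partial>\<kappa> (Suc l))"
  proof (intro nn_integral_cong)
    fix c
    let ?a = "\<tau> * ?Y c"
    have a: "0 < ?a" using \<tau> Y(2) by simp
    have "(\<integral>\<^sup>+x. ennreal x ^ w * (ennreal (mono_fun (Suc l) w b s (\<tau> * x) (upd (Suc l) c \<zeta>)) * ?Q c) \<partial>power_intensity ?M) =
      (\<integral>\<^sup>+x. (?Q c * ennreal (1 / \<tau> ^ w * b)) * ennreal ((?a * x) powr s * exp (- C (Suc l) * (?a * x) powr ?M')) \<partial>power_intensity ?M)"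
    proof (rule nn_integral_power_intensity_cong)
      fix x :: real assume x: "0 < x"
      have "x ^ w * mono_fun (Suc l) w b s (\<tau> * x) (upd (Suc l) c \<zeta>) =
          (1 / \<tau> ^ w * b) * ((?a * x) powr s * exp (- C (Suc l) * (?a * x) powr ?M'))"
        using x \<tau> by (simp add: mono_fun_def lap_def power_mult_distrib mult_ac)
      moreover have "0 \<le> mono_fun (Suc l) w b s (\<tau> * x) (upd (Suc l) c \<zeta>)"
        using x \<tau> b by (simp add: mono_fun_def lap_def)
      ultimately have "ennreal x ^ w * ennreal (mono_fun (Suc l) w b s (\<tau> * x) (upd (Suc l) c \<zeta>)) =
        ennreal (1 / \<tau> ^ w * b) * ennreal ((?a * x) powr s * exp (- C (Suc l) * (?a * x) powr ?M'))"
        using x \<tau> b by (simp add: ennreal_power ennreal_mult[symmetric])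
      then show "ennreal x ^ w * (ennreal (mono_fun (Suc l) w b s (\<tau> * x) (upd (Suc l) c \<zeta>)) * ?Q c) =
        (?Q c * ennreal (1 / \<tau> ^ w * b)) * ennreal ((?a * x) powr s * exp (- C (Suc l) * (?a * x) powr ?M'))"
        by (simp only: mult.assoc[symmetric]) (simp only: mult_ac)
    qed
    also have "\<dots> = (?Q c * ennreal (1 / \<tau> ^ w * b)) *
        (\<integral>\<^sup>+x. ennreal ((?a * x) powr s * exp (- C (Suc l) * (?a * x) powr ?M')) \<partial>power_intensity ?M)"
      by (rule nn_integral_cmult) simp
    also have "(\<integral>\<^sup>+x. ennreal ((?a * x) powr s * exp (- C (Suc l) * (?a * x) powr ?M')) \<partial>power_intensity ?M) =
        ennreal (?a powr ?M) * (\<integral>\<^sup>+x. ennreal (x powr s * exp (- C (Suc l) * x powr ?M')) \<partial>power_intensity ?M)"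
      by (rule power_intensity_scale[where f="\<lambda>x. ennreal (x powr s * exp (- C (Suc l) * x powr ?M'))"])
         (use a in auto)
    also have "(\<integral>\<^sup>+x. ennreal (x powr s * exp (- C (Suc l) * x powr ?M')) \<partial>power_intensity ?M) = ennreal K"
      unfolding K_def by (rule power_intensity_powr_exp) (use M s in auto)
    also have "(?Q c * ennreal (1 / \<tau> ^ w * b)) * (ennreal (?a powr ?M) * ennreal K) =
        (ennreal (1 / \<tau> ^ w * b) * ennreal (?a powr ?M) * ennreal K) * ?Q c"
      by (simp only: mult_ac)
    also have "ennreal (1 / \<tau> ^ w * b) * ennreal (?a powr ?M) * ennreal K =
        ennreal (1 / \<tau> ^ w * (b * K) * \<tau> powr ?M) * ennreal (?Y c powr ?M)"
      using \<tau> Y(2)[of "upd (Suc l) c \<zeta>"] K b by (simp add: ennreal_mult[symmetric] powr_mult mult_ac)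
    finally show "(\<integral>\<^sup>+x. ennreal x ^ w * (ennreal (mono_fun (Suc l) w b s (\<tau> * x) (upd (Suc l) c \<zeta>)) * ?Q c) \<partial>power_intensity ?M) =
      ennreal (1 / \<tau> ^ w * (b * K) * \<tau> powr ?M) * (?Q c * ennreal (?Y c powr ?M))"
      by (simp only: mult_ac)
  qed
  also have "\<dots> = ennreal (1 / \<tau> ^ w * (b * K) * \<tau> powr ?M) * (ennreal (Y l \<zeta> powr ?M) * avg l Q \<zeta>)"
    using l by (subst nn_integral_cmult) (auto simp: nn_integral_avg)
  also have "\<dots> = (ennreal (1 / \<tau> ^ w * (b * K) * \<tau> powr ?M) * ennreal (Y l \<zeta> powr ?M)) * avg l Q \<zeta>"
    by (simp only: mult.assoc)
  also have "ennreal (1 / \<tau> ^ w * (b * K) * \<tau> powr ?M) * ennreal (Y l \<zeta> powr ?M) =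
      ennreal (1 / \<tau> ^ w * (b * K) * (\<tau> * Y l \<zeta>) powr ?M)"
    using \<tau> Y(1) K b by (simp add: ennreal_mult[symmetric] powr_mult mult_ac)
  finally show ?thesis by (simp add: step_const_def K_def)
qed

end

section \<open>Induction from the leaves to the root\<close>

context cascade
begin

abbreviation TF :: "nat \<Rightarrow> nat list \<Rightarrow> 'a \<Rightarrow> (nat list + nat list \<Rightarrow> nat \<Rightarrow> real) \<Rightarrow> ennreal" where
  "TF l \<equiv> Tsum (\<lambda>\<zeta>. ennreal (F \<zeta>)) (k - l)"

lemma F_measurable[measurable]: "F \<in> borel_measurable PS"
  using Y_measurable[of k] by (simp add: Y_k)

lemma F_pos: "0 < F \<zeta>"
  using Y_pos[of k \<zeta>] by (simp add: Y_k)

lemma node_fun_TF: "node_fun (TF l)"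
  by (rule node_fun_Tsum) measurable

lemma TF_rec: "l < k \<Longrightarrow> TF l = node_sum 1 (TF (Suc l))"
  by (simp add: Suc_diff_Suc[symmetric])

lemma gfun_measurable: "l < k \<Longrightarrow> gfun l \<tau> \<zeta> \<in> borel_measurable borel"
proof -
  assume l: "l < k"
  interpret \<kappa>: prob_space "\<kappa> (Suc l)" by (rule prob_\<kappa>)
  have u: "(\<lambda>p. upd (Suc l) (snd p) \<zeta>) \<in> measurable (borel \<Otimes>\<^sub>M \<kappa> (Suc l)) PS"
    by (rule upd_compose) measurable
  have "(\<lambda>p. lap (Suc l) (\<tau> * fst p) (upd (Suc l) (snd p) \<zeta>)) \<in> borel_measurable (borel \<Otimes>\<^sub>M \<kappa> (Suc l))"
    by (rule lap_measurable[OF _ _ u]) (use l in auto)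
  then show ?thesis
    unfolding gfun_def[abs_def]
    by (intro \<kappa>.borel_measurable_nn_integral) (simp add: case_prod_unfold)
qed

text \<open>A mean of positive exponentials is positive; this allows the division by g behind the
  Mecke formulas.\<close>

lemma gfun_pos: "l < k \<Longrightarrow> 0 < gfun l \<tau> \<zeta> x"
proof -
  assume l: "l < k"
  interpret \<kappa>: prob_space "\<kappa> (Suc l)" by (rule prob_\<kappa>)
  have lm[measurable]: "(\<lambda>c. lap (Suc l) (\<tau> * x) (upd (Suc l) c \<zeta>)) \<in> borel_measurable (\<kappa> (Suc l))"
    by (rule lap_measurable[OF _ measurable_const upd_\<kappa>]) (use l in auto)
  have "gfun l \<tau> \<zeta> x \<noteq> 0"
  proof
    assume "gfun l \<tau> \<zeta> x = 0"
    then have "AE c in \<kappa> (Suc l). ennreal (lap (Suc l) (\<tau> * x) (upd (Suc l) c \<zeta>)) = 0"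
      unfolding gfun_def by (subst (asm) nn_integral_0_iff_AE) (use lm in auto)
    then have "AE c in \<kappa> (Suc l). False"
      by eventually_elim (simp add: lap_def ennreal_eq_0_iff not_le)
    then show False by simp
  qed
  then show ?thesis by (simp add: zero_less_iff_neq_zero)
qed

definition laplace_at :: "nat \<Rightarrow> bool" where
  "laplace_at l \<longleftrightarrow> (\<forall>p \<zeta> \<tau>. length p = l \<longrightarrow> 0 < \<tau> \<longrightarrow>
     (\<integral>\<^sup>+y. ee (ennreal \<tau> * TF l p \<zeta> y) \<partial>P) = ennreal (lap l \<tau> \<zeta>))"

text \<open>\<Theta> is the sum whose moment is taken, w its degree, and Q the average over columns
  collected so far.\<close>

definition moment_at where
  "moment_at l w b s \<Theta> Q \<longleftrightarrow> (\<forall>p \<zeta> \<tau>. length p = l \<longrightarrow> 0 < \<tau> \<longrightarrow>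
     (\<integral>\<^sup>+y. \<Theta> p \<zeta> y * ee (ennreal \<tau> * TF l p \<zeta> y) \<partial>P) = ennreal (mono_fun l w b s \<tau> \<zeta>) * Q \<zeta>)"

lemma ee_node_sum:
  assumes "0 < \<tau>"
  shows "ee (ennreal \<tau> * node_sum 1 \<Theta> p \<zeta> y) =
    iprod {} (\<lambda>n. ee (ennreal (\<tau> * y (Inr p) n) * child \<Theta> p \<zeta> n y))"
proof -
  have "ennreal \<tau> * ennreal x = ennreal (\<tau> * x)" for x
    using assms by (cases "0 \<le> x") (auto simp: ennreal_mult ennreal_neg mult_nonneg_nonpos not_le mult_le_0_iff)
  then have "ennreal \<tau> * node_sum 1 \<Theta> p \<zeta> y = (\<Sum>n. ennreal (\<tau> * y (Inr p) n) * child \<Theta> p \<zeta> n y)"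
    unfolding node_sum_def by (simp only: ennreal_suminf_cmult[symmetric] mult.assoc[symmetric] power_one_right)
  then show ?thesis by (simp add: ee_suminf iprod_def)
qed

lemma node_fun_ee: "node_fun (\<lambda>q \<zeta> y. ee (ennreal a * TF l q \<zeta> y))"
  unfolding node_fun_def
proof (intro allI conjI)
  fix q
  have [measurable]: "(\<lambda>x. TF l q (fst x) (snd x)) \<in> borel_measurable (PS \<Otimes>\<^sub>M P)"
    by (rule node_fun_measurable[OF node_fun_TF]) measurable
  show "(\<lambda>x. ee (ennreal a * TF l q (fst x) (snd x))) \<in> borel_measurable (PS \<Otimes>\<^sub>M P)"
    by measurable
  show "dep (subtree q - {Inl q}) (\<lambda>y. ee (ennreal a * TF l q \<zeta> y))" for \<zeta>
    by (rule depI, rule arg_cong[where f="\<lambda>x. ee (ennreal a * x)"], erule depD[OF node_fun_dep[OF node_fun_TF]])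
qed

lemma node_fun_mult:
  assumes "node_fun \<Theta>" "node_fun \<Theta>'"
  shows "node_fun (\<lambda>q \<zeta> y. \<Theta> q \<zeta> y * \<Theta>' q \<zeta> y)"
  unfolding node_fun_def
proof (intro allI conjI)
  fix q
  show "(\<lambda>x. \<Theta> q (fst x) (snd x) * \<Theta>' q (fst x) (snd x)) \<in> borel_measurable (PS \<Otimes>\<^sub>M P)"
    by (intro borel_measurable_times_ennreal node_fun_measurable[OF assms(1)] node_fun_measurable[OF assms(2)]) measurable
  show "dep (subtree q - {Inl q}) (\<lambda>y. \<Theta> q \<zeta> y * \<Theta>' q \<zeta> y)" for \<zeta>
    by (rule depI, rule arg_cong2[where f="(*)"])
       (erule depD[OF node_fun_dep[OF assms(1)]], erule depD[OF node_fun_dep[OF assms(2)]])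
qed

text \<open>The subtrees of the children are the marks of the Poisson sequence at p: they use
  disjoint coordinates, none of them \<open>Inr p\<close>, and the induction hypothesis supplies the
  mean of each factor.\<close>

lemma marks_node:
  assumes l: "l < k" and p: "length p = l" and \<tau>: "0 < \<tau>" and IH: "laplace_at (Suc l)"
  shows "marks \<nu> (Inr p) (power_intensity (m (Suc l))) (\<lambda>n. subtree (p @ [n]))
    (\<lambda>n x y. ee (ennreal (\<tau> * x) * child (TF (Suc l)) p \<zeta> n y)) (gfun l \<tau> \<zeta>)"
proof (rule marks.intro)
  show "coordinates \<nu>" by (rule coordinates_axioms)
  show "marks_axioms \<nu> (Inr p) (power_intensity (m (Suc l))) (\<lambda>n. subtree (p @ [n]))
    (\<lambda>n x y. ee (ennreal (\<tau> * x) * child (TF (Suc l)) p \<zeta> n y)) (gfun l \<tau> \<zeta>)"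
  proof (rule marks_axioms.intro)
    show "pos_ppp (\<nu> (Inr p)) (power_intensity (m (Suc l))) (\<lambda>n x. x n)"
      using points_\<rho>[of p] l p power_intensity_nonpos
      by (intro pos_ppp.intro ppp.intro ppp_axioms.intro pos_ppp_axioms.intro) (auto simp: prob_\<rho>)
    show "disjoint_family (\<lambda>n. subtree (p @ [n]))" by (rule disjoint_subtree_children)
    show "Inr p \<notin> subtree (p @ [n])" for n by (auto simp: subtree_def)
    fix n
    have cm[measurable]: "child (TF (Suc l)) p \<zeta> n \<in> borel_measurable P"
      by (rule child_measurable[OF node_fun_TF]) measurable
    show "(\<lambda>q. ee (ennreal (\<tau> * fst q) * child (TF (Suc l)) p \<zeta> n (snd q))) \<in> borel_measurable (borel \<Otimes>\<^sub>M P)"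
      by measurable
    fix x :: real
    show "dep (subtree (p @ [n])) (\<lambda>y. ee (ennreal (\<tau> * x) * child (TF (Suc l)) p \<zeta> n y))"
      by (rule depI, rule arg_cong[where f="\<lambda>z. ee (ennreal (\<tau> * x) * z)"], erule depD[OF child_dep[OF node_fun_TF]])
    assume x: "0 < x"
    have p': "length (p @ [n]) = Suc l" using p by simp
    have "(\<integral>\<^sup>+y. ee (ennreal (\<tau> * x) * child (TF (Suc l)) p \<zeta> n y) \<partial>P) =
        (\<integral>\<^sup>+y. child (\<lambda>q \<zeta> y. ee (ennreal (\<tau> * x) * TF (Suc l) q \<zeta> y)) p \<zeta> n y \<partial>P)"
      by (simp add: child_def)
    also have "\<dots> = gfun l \<tau> \<zeta> x"
      using IH p' x \<tau> unfolding child_integral[OF node_fun_ee] gfun_def laplace_at_def p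
      by (intro nn_integral_cong) auto
    finally show "(\<integral>\<^sup>+y. ee (ennreal (\<tau> * x) * child (TF (Suc l)) p \<zeta> n y) \<partial>P) = gfun l \<tau> \<zeta> x" .
  qed (use sets_\<nu> gfun_measurable l in auto)
qed

lemma laplace_step:
  assumes l: "l < k" and IH: "laplace_at (Suc l)"
  shows "laplace_at l"
  unfolding laplace_at_def
proof (intro allI impI)
  fix p :: "nat list" and \<zeta> :: 'a and \<tau> :: real assume p: "length p = l" and \<tau>: "0 < \<tau>"
  interpret N: marks \<nu> "Inr p" "power_intensity (m (Suc l))" "\<lambda>n. subtree (p @ [n])"
    "\<lambda>n x y. ee (ennreal (\<tau> * x) * child (TF (Suc l)) p \<zeta> n y)" "gfun l \<tau> \<zeta>"
    by (rule marks_node[OF l p \<tau> IH])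
  have "(\<integral>\<^sup>+y. ee (ennreal \<tau> * TF l p \<zeta> y) \<partial>P) = ee (\<integral>\<^sup>+x. (1 - gfun l \<tau> \<zeta> x) \<partial>power_intensity (m (Suc l)))"
    unfolding TF_rec[OF l] ee_node_sum[OF \<tau>] by (rule N.marked_laplace)
  also have "\<dots> = ennreal (lap l \<tau> \<zeta>)"
    using C_pos[of l] l by (simp add: integral_one_minus_gfun[OF l \<tau>] ee_ennreal lap_def)
  finally show "(\<integral>\<^sup>+y. ee (ennreal \<tau> * TF l p \<zeta> y) \<partial>P) = ennreal (lap l \<tau> \<zeta>)" .
qed

lemma laplace_at_all: "l \<le> k \<Longrightarrow> laplace_at l"
proof (induction rule: inc_induct)
  \<comment> \<open>At a leaf the sum is the deterministic F, which fits \<open>lap\<close> because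
    \<open>m (Suc k) = 1\<close>, \<open>C k = 1\<close> and \<open>Y k = F\<close>.\<close>
  case base
  show ?case
    unfolding laplace_at_def
  proof (intro allI impI)
    fix p :: "nat list" and \<zeta> :: 'a and \<tau> :: real assume \<tau>: "0 < \<tau>"
    have "ennreal \<tau> * ennreal (F \<zeta>) = ennreal (\<tau> * F \<zeta>)" "0 < \<tau> * F \<zeta>"
      using \<tau> F_pos[of \<zeta>] by (auto simp: ennreal_mult)
    then show "(\<integral>\<^sup>+y. ee (ennreal \<tau> * TF k p \<zeta> y) \<partial>P) = ennreal (lap k \<tau> \<zeta>)"
      by (simp add: lap_def Y_k m_top ee_ennreal)
  qed
next
  case (step l)
  show ?case by (rule laplace_step) (use step in auto)
qed

text \<open>The point x enters twice: as the weight of the summand, and by changing the Laplace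
  parameter of the child to \<open>\<tau> * x\<close>, at which the moment formula one level below
  is used.\<close>

lemma child_moment_integral:
  assumes l: "l < k" and p: "length p = l" and \<Theta>: "node_fun \<Theta>" and [measurable]: "Q \<in> borel_measurable PS"
    and mom: "moment_at (Suc l) w b s \<Theta> Q" and \<tau>: "0 < \<tau>" and x: "0 < x"
  shows "(\<integral>\<^sup>+y. ennreal x ^ w * (child \<Theta> p \<zeta> n y * ee (ennreal (\<tau> * x) * child (TF (Suc l)) p \<zeta> n y)) \<partial>P) =
    phi l w b s Q \<tau> \<zeta> x"
proof -
  have p': "length (p @ [n]) = Suc l" using p by simp
  have [measurable]: "child \<Theta> p \<zeta> n \<in> borel_measurable P" "child (TF (Suc l)) p \<zeta> n \<in> borel_measurable P"
    by (rule child_measurable[OF \<Theta>] child_measurable[OF node_fun_TF], measurable)+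
  have "(\<integral>\<^sup>+y. ennreal x ^ w * (child \<Theta> p \<zeta> n y * ee (ennreal (\<tau> * x) * child (TF (Suc l)) p \<zeta> n y)) \<partial>P) =
      ennreal x ^ w * (\<integral>\<^sup>+y. child (\<lambda>q \<zeta> y. \<Theta> q \<zeta> y * ee (ennreal (\<tau> * x) * TF (Suc l) q \<zeta> y)) p \<zeta> n y \<partial>P)"
  proof -
    have eq: "child (\<lambda>q \<zeta> y. \<Theta> q \<zeta> y * ee (ennreal (\<tau> * x) * TF (Suc l) q \<zeta> y)) p \<zeta> n y =
        child \<Theta> p \<zeta> n y * ee (ennreal (\<tau> * x) * child (TF (Suc l)) p \<zeta> n y)" for y
      by (simp add: child_def)
    show ?thesis unfolding eq by (rule nn_integral_cmult) measurable
  qed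
  also have "(\<integral>\<^sup>+y. child (\<lambda>q \<zeta> y. \<Theta> q \<zeta> y * ee (ennreal (\<tau> * x) * TF (Suc l) q \<zeta> y)) p \<zeta> n y \<partial>P) =
      (\<integral>\<^sup>+c. ennreal (mono_fun (Suc l) w b s (\<tau> * x) (upd (Suc l) c \<zeta>)) * Q (upd (Suc l) c \<zeta>) \<partial>\<kappa> (Suc l))"
    using mom p' x \<tau> unfolding child_integral[OF node_fun_mult[OF \<Theta> node_fun_ee]] moment_at_def p
    by (intro nn_integral_cong) auto
  also have "ennreal x ^ w * \<dots> = phi l w b s Q \<tau> \<zeta> x"
    unfolding phi_def
  proof (rule nn_integral_cmult[symmetric])
    have [measurable]: "Y (Suc l) \<in> borel_measurable PS"
      using l by (auto intro: Y_measurable)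
    have [measurable]: "(\<lambda>c. lap (Suc l) (\<tau> * x) (upd (Suc l) c \<zeta>)) \<in> borel_measurable (\<kappa> (Suc l))"
      by (rule lap_measurable[OF _ measurable_const upd_\<kappa>]) (use l in auto)
    show "(\<lambda>c. ennreal (mono_fun (Suc l) w b s (\<tau> * x) (upd (Suc l) c \<zeta>)) * Q (upd (Suc l) c \<zeta>))
        \<in> borel_measurable (\<kappa> (Suc l))"
      unfolding mono_fun_def by measurable
  qed
  finally show ?thesis .
qed

lemma mult_ee_node_sum:
  assumes "0 < \<tau>"
  shows "a n * ee (ennreal \<tau> * node_sum 1 \<Theta> p \<zeta> y) =
    (a n * ee (ennreal (\<tau> * y (Inr p) n) * child \<Theta> p \<zeta> n y)) *
    iprod {n} (\<lambda>n. ee (ennreal (\<tau> * y (Inr p) n) * child \<Theta> p \<zeta> n y))"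
  unfolding ee_node_sum[OF assms] by (subst iprod_remove[of _ n]) (auto simp: mult.assoc)

lemma integral_phi_less_top:
  assumes "Q \<in> borel_measurable PS" "\<And>\<zeta>. Q \<zeta> \<le> 1" "l < k" "0 < \<tau>" "0 \<le> b" "m (Suc l) < s"
  shows "(\<integral>\<^sup>+x. phi l w b s Q \<tau> \<zeta> x \<partial>power_intensity (m (Suc l))) < top"
  using assms avg_le_1[of Q l \<zeta>] order_le_less_trans[of "avg l Q \<zeta>" 1 top]
  by (subst integral_phi) (auto simp: ennreal_mult_less_top)

lemma step_const_nonneg: "l \<le> k \<Longrightarrow> 0 \<le> b \<Longrightarrow> m l < s \<Longrightarrow> 0 \<le> step_const l b s"
  unfolding step_const_def using C_pos[of l] m_pos[of "Suc l"]
  by (intro mult_nonneg_nonneg divide_nonneg_pos mult_pos_pos Gamma_real_nonneg) auto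

text \<open>The marked one-point formula at p: its exponential part is \<open>lap\<close>, and the
  integral over the selected point is \<open>integral_phi\<close>. Whatever exponent s enters, the
  exponent that leaves is \<open>m (Suc l)\<close>, produced by the scaling of the
  intensity.\<close>

lemma moment_step:
  assumes l: "l < k" and \<Theta>: "node_fun \<Theta>" and Q: "Q \<in> borel_measurable PS" "\<And>\<zeta>. Q \<zeta> \<le> 1"
    and mom: "moment_at (Suc l) w b s \<Theta> Q" and b: "0 \<le> b" and s: "m (Suc l) < s"
  shows "moment_at l w (step_const (Suc l) b s) (m (Suc l)) (node_sum w \<Theta>) (avg l Q)"
  unfolding moment_at_def
proof (intro allI impI)
  fix p :: "nat list" and \<zeta> :: 'a and \<tau> :: real assume p: "length p = l" and \<tau>: "0 < \<tau>"
  let ?h = "\<lambda>n x y. ee (ennreal (\<tau> * x) * child (TF (Suc l)) p \<zeta> n y)"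
  interpret N: marks \<nu> "Inr p" "power_intensity (m (Suc l))" "\<lambda>n. subtree (p @ [n])" ?h "gfun l \<tau> \<zeta>"
    by (rule marks_node[OF l p \<tau> laplace_at_all]) (use l in auto)
  have [measurable]: "child \<Theta> p \<zeta> n \<in> borel_measurable P" "child (TF (Suc l)) p \<zeta> n \<in> borel_measurable P" for n
    by (rule child_measurable[OF \<Theta>] child_measurable[OF node_fun_TF], measurable)+
  define f where "f n x y = ennreal x ^ w * (child \<Theta> p \<zeta> n y * ?h n x y)" for n x y
  have "node_sum w \<Theta> p \<zeta> y * ee (ennreal \<tau> * TF l p \<zeta> y) =
      (\<Sum>n. f n (y (Inr p) n) y * iprod {n} (\<lambda>j. ?h j (y (Inr p) j) y))" for y
    unfolding TF_rec[OF l] f_def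
    by (subst node_sum_def, subst ennreal_suminf_multc[symmetric], intro suminf_cong)
       (subst mult_ee_node_sum[OF \<tau>, where a="\<lambda>n. ennreal (y (Inr p) n) ^ w * child \<Theta> p \<zeta> n y"], simp only: mult.assoc)
  then have "(\<integral>\<^sup>+y. node_sum w \<Theta> p \<zeta> y * ee (ennreal \<tau> * TF l p \<zeta> y) \<partial>P) =
      (\<integral>\<^sup>+y. (\<Sum>n. f n (y (Inr p) n) y * iprod {n} (\<lambda>j. ?h j (y (Inr p) j) y)) \<partial>P)" by simp
  also have "\<dots> = ee (\<integral>\<^sup>+x. (1 - gfun l \<tau> \<zeta> x) \<partial>power_intensity (m (Suc l))) *
      (\<integral>\<^sup>+x. phi l w b s Q \<tau> \<zeta> x \<partial>power_intensity (m (Suc l)))"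
  proof (rule N.marked_sum[where f=f])
    show "(\<lambda>q. f n (fst q) (snd q)) \<in> borel_measurable (borel \<Otimes>\<^sub>M P)" for n
      unfolding f_def by measurable
    show "dep (subtree (p @ [n])) (f n x)" for n x
      unfolding f_def
      by (rule depI, rule arg_cong2[where f="\<lambda>a c. ennreal x ^ w * (a * ee (ennreal (\<tau> * x) * c))"])
         (erule depD[OF child_dep[OF \<Theta>]], erule depD[OF child_dep[OF node_fun_TF]])
    show "(\<integral>\<^sup>+y. f n x y \<partial>P) = phi l w b s Q \<tau> \<zeta> x" if "0 < x" for n x
      unfolding f_def by (rule child_moment_integral[OF l p \<Theta> Q(1) mom \<tau> that])
    show "(\<integral>\<^sup>+x. (1 - gfun l \<tau> \<zeta> x) \<partial>power_intensity (m (Suc l))) < top"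
      by (simp add: integral_one_minus_gfun[OF l \<tau>])
    show "(\<integral>\<^sup>+x. phi l w b s Q \<tau> \<zeta> x \<partial>power_intensity (m (Suc l))) < top"
      by (rule integral_phi_less_top[OF Q l \<tau> b s])
  qed (use l Q in \<open>auto intro: phi_measurable gfun_pos\<close>)
  also have "\<dots> = ennreal (lap l \<tau> \<zeta>) *
      (ennreal (1 / \<tau> ^ w * step_const (Suc l) b s * (\<tau> * Y l \<zeta>) powr m (Suc l)) * avg l Q \<zeta>)"
    using C_pos[of l] l
    by (simp add: integral_one_minus_gfun[OF l \<tau>] ee_ennreal lap_def integral_phi[OF Q(1) l \<tau> b s])
  also have "\<dots> = ennreal (mono_fun l w (step_const (Suc l) b s) (m (Suc l)) \<tau> \<zeta>) * avg l Q \<zeta>"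
    using \<tau> step_const_nonneg[of "Suc l" b s] l b s
    by (simp add: mono_fun_def mult.assoc[symmetric] lap_def ennreal_mult[symmetric]) (simp add: mult_ac)
  finally show "(\<integral>\<^sup>+y. node_sum w \<Theta> p \<zeta> y * ee (ennreal \<tau> * TF l p \<zeta> y) \<partial>P) =
    ennreal (mono_fun l w (step_const (Suc l) b s) (m (Suc l)) \<tau> \<zeta>) * avg l Q \<zeta>" .
qed

lemma mult_exp_neg_le: "0 < c \<Longrightarrow> 0 \<le> u \<Longrightarrow> u * exp (- c * u) \<le> 1 / (c::real)"
proof -
  assume c: "0 < c" "0 \<le> u"
  have "c * u \<le> exp (c * u)" using exp_ge_add_one_self[of "c * u"] by linarith
  then have "c * u * exp (- (c * u)) \<le> exp (c * u) * exp (- (c * u))"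
    by (intro mult_right_mono) auto
  also have "exp (c * u) * exp (- (c * u)) = 1" by (simp flip: exp_add)
  finally show ?thesis using c(1) by (simp add: pos_le_divide_eq mult_ac)
qed

text \<open>The two-point formula asks for summands that are finite at each point, not only
  integrable. With the exponent \<open>m (Suc (Suc l))\<close> the integrand has the form u exp(-C
  u) up to a constant and a factor at most 1, hence is bounded.\<close>

lemma phi_less_top:
  assumes Q: "\<And>\<zeta>. Q \<zeta> \<le> 1" and l: "l < k" and \<tau>: "0 < \<tau>" and b: "0 \<le> b" and x: "0 < x"
  shows "phi l w b (m (Suc (Suc l))) Q \<tau> \<zeta> x < top"
proof -
  interpret \<kappa>: prob_space "\<kappa> (Suc l)" by (rule prob_\<kappa>)
  let ?B = "ennreal x ^ w * ennreal (1 / (\<tau> * x) ^ w * b * (1 / C (Suc l)))"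
  have "phi l w b (m (Suc (Suc l))) Q \<tau> \<zeta> x \<le> (\<integral>\<^sup>+c. ?B \<partial>\<kappa> (Suc l))"
    unfolding phi_def
  proof (intro nn_integral_mono mult_left_mono)
    fix c
    let ?u = "(\<tau> * x * Y (Suc l) (upd (Suc l) c \<zeta>)) powr m (Suc (Suc l))"
    have "mono_fun (Suc l) w b (m (Suc (Suc l))) (\<tau> * x) (upd (Suc l) c \<zeta>) =
      (1 / (\<tau> * x) ^ w * b) * (?u * exp (- C (Suc l) * ?u))"
      by (simp add: mono_fun_def lap_def)
    also have "\<dots> \<le> (1 / (\<tau> * x) ^ w * b) * (1 / C (Suc l))"
      using \<tau> x b l C_pos[of "Suc l"] by (intro mult_left_mono mult_exp_neg_le) auto
    finally have "ennreal (mono_fun (Suc l) w b (m (Suc (Suc l))) (\<tau> * x) (upd (Suc l) c \<zeta>)) *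
        Q (upd (Suc l) c \<zeta>) \<le> ennreal (1 / (\<tau> * x) ^ w * b * (1 / C (Suc l))) * 1"
      by (intro mult_mono ennreal_leI Q) auto
    then show "ennreal (mono_fun (Suc l) w b (m (Suc (Suc l))) (\<tau> * x) (upd (Suc l) c \<zeta>)) *
        Q (upd (Suc l) c \<zeta>) \<le> ennreal (1 / (\<tau> * x) ^ w * b * (1 / C (Suc l)))" by simp
  qed auto
  also have "\<dots> < top"
    using x by (simp add: \<kappa>.emeasure_space_1 ennreal_mult_less_top ennreal_power less_imp_le)
  finally show ?thesis .
qed

text \<open>The two-point formula yields a product of two one-point integrals. Hence the constant is
  squared, the exponent doubles and, as both leaves share the state at p, the two averages are
  multiplied.\<close>

lemma moment_pair_step:
  assumes l: "l < k" and \<Theta>: "node_fun \<Theta>" "node_fun \<Theta>'"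
    and Q: "Q \<in> borel_measurable PS" "\<And>\<zeta>. Q \<zeta> \<le> 1" and Q': "Q' \<in> borel_measurable PS" "\<And>\<zeta>. Q' \<zeta> \<le> 1"
    and s: "s = m (Suc (Suc l))" and b: "0 \<le> b"
    and mom: "moment_at (Suc l) 1 b s \<Theta> Q" "moment_at (Suc l) 1 b s \<Theta>' Q'"
  shows "moment_at l 2 ((step_const (Suc l) b s)\<^sup>2) (2 * m (Suc l)) (node_pair_sum \<Theta> \<Theta>') (\<lambda>\<zeta>. avg l Q \<zeta> * avg l Q' \<zeta>)"
  unfolding moment_at_def
proof (intro allI impI)
  fix p :: "nat list" and \<zeta> :: 'a and \<tau> :: real assume p: "length p = l" and \<tau>: "0 < \<tau>"
  let ?h = "\<lambda>n x y. ee (ennreal (\<tau> * x) * child (TF (Suc l)) p \<zeta> n y)"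
  let ?Y = "(\<tau> * Y l \<zeta>) powr m (Suc l)" and ?b = "step_const (Suc l) b s"
  have sm: "m (Suc l) < s" using m_less[of "Suc l"] l s by simp
  have b': "0 \<le> ?b" using step_const_nonneg[of "Suc l" b s] l b sm by simp
  interpret N: marks \<nu> "Inr p" "power_intensity (m (Suc l))" "\<lambda>n. subtree (p @ [n])" ?h "gfun l \<tau> \<zeta>"
    by (rule marks_node[OF l p \<tau> laplace_at_all]) (use l in auto)
  have [measurable]: "child \<Theta> p \<zeta> n \<in> borel_measurable P" "child \<Theta>' p \<zeta> n \<in> borel_measurable P"
     "child (TF (Suc l)) p \<zeta> n \<in> borel_measurable P" for n
    by (rule child_measurable[OF \<Theta>(1)] child_measurable[OF \<Theta>(2)] child_measurable[OF node_fun_TF], measurable)+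
  define f where "f n x y = ennreal x ^ 1 * (child \<Theta> p \<zeta> n y * ?h n x y)" for n x y
  define f' where "f' n x y = ennreal x ^ 1 * (child \<Theta>' p \<zeta> n y * ?h n x y)" for n x y
  have "node_pair_sum \<Theta> \<Theta>' p \<zeta> y * ee (ennreal \<tau> * TF l p \<zeta> y) =
      (\<Sum>n. \<Sum>n'. if n' = n then 0 else f n (y (Inr p) n) y * f' n' (y (Inr p) n') y *
         iprod {n', n} (\<lambda>j. ?h j (y (Inr p) j) y))" for y
  proof -
    have eq: "(ennreal (y (Inr p) n) * child \<Theta> p \<zeta> n y) * (ennreal (y (Inr p) n') * child \<Theta>' p \<zeta> n' y) *
        ee (ennreal \<tau> * TF l p \<zeta> y) = f n (y (Inr p) n) y * f' n' (y (Inr p) n') y *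
         iprod {n', n} (\<lambda>j. ?h j (y (Inr p) j) y)" if "n' \<noteq> n" for n n'
    proof -
      have "ee (ennreal \<tau> * TF l p \<zeta> y) = ?h n (y (Inr p) n) y * iprod {n} (\<lambda>j. ?h j (y (Inr p) j) y)"
        unfolding TF_rec[OF l] ee_node_sum[OF \<tau>] by (rule iprod_remove) auto
      also have "iprod {n} (\<lambda>j. ?h j (y (Inr p) j) y) = ?h n' (y (Inr p) n') y * iprod {n', n} (\<lambda>j. ?h j (y (Inr p) j) y)"
        by (rule iprod_remove) (use that in auto)
      finally show ?thesis
        by (simp only: f_def f'_def power_one_right mult_ac)
    qed
    show ?thesis
      unfolding node_pair_sum_def ennreal_suminf_multc[symmetric]
      by (intro suminf_cong) (auto simp: eq)
  qed
  then have "(\<integral>\<^sup>+y. node_pair_sum \<Theta> \<Theta>' p \<zeta> y * ee (ennreal \<tau> * TF l p \<zeta> y) \<partial>P) =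
      (\<integral>\<^sup>+y. (\<Sum>n. \<Sum>n'. if n' = n then 0 else f n (y (Inr p) n) y * f' n' (y (Inr p) n') y *
         iprod {n', n} (\<lambda>j. ?h j (y (Inr p) j) y)) \<partial>P)" by simp
  also have "\<dots> = ee (\<integral>\<^sup>+x. (1 - gfun l \<tau> \<zeta> x) \<partial>power_intensity (m (Suc l))) *
      (\<integral>\<^sup>+x. phi l 1 b s Q \<tau> \<zeta> x \<partial>power_intensity (m (Suc l))) *
      (\<integral>\<^sup>+x. phi l 1 b s Q' \<tau> \<zeta> x \<partial>power_intensity (m (Suc l)))"
  proof (rule N.marked_sum_distinct[where f=f and f'=f'])
    show "(\<lambda>q. f n (fst q) (snd q)) \<in> borel_measurable (borel \<Otimes>\<^sub>M P)"
        "(\<lambda>q. f' n (fst q) (snd q)) \<in> borel_measurable (borel \<Otimes>\<^sub>M P)" for n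
      unfolding f_def f'_def by measurable
    show "dep (subtree (p @ [n])) (f n x)" for n x
      unfolding f_def
      by (rule depI, rule arg_cong2[where f="\<lambda>a c. ennreal x ^ 1 * (a * ee (ennreal (\<tau> * x) * c))"])
         (erule depD[OF child_dep[OF \<Theta>(1)]], erule depD[OF child_dep[OF node_fun_TF]])
    show "dep (subtree (p @ [n])) (f' n x)" for n x
      unfolding f'_def
      by (rule depI, rule arg_cong2[where f="\<lambda>a c. ennreal x ^ 1 * (a * ee (ennreal (\<tau> * x) * c))"])
         (erule depD[OF child_dep[OF \<Theta>(2)]], erule depD[OF child_dep[OF node_fun_TF]])
    show "(\<integral>\<^sup>+y. f n x y \<partial>P) = phi l 1 b s Q \<tau> \<zeta> x" if "0 < x" for n x
      unfolding f_def by (rule child_moment_integral[OF l p \<Theta>(1) Q(1) mom(1) \<tau> that])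
    show "(\<integral>\<^sup>+y. f' n x y \<partial>P) = phi l 1 b s Q' \<tau> \<zeta> x" if "0 < x" for n x
      unfolding f'_def by (rule child_moment_integral[OF l p \<Theta>(2) Q'(1) mom(2) \<tau> that])
    show "(\<integral>\<^sup>+x. (1 - gfun l \<tau> \<zeta> x) \<partial>power_intensity (m (Suc l))) < top"
      by (simp add: integral_one_minus_gfun[OF l \<tau>])
    show "(\<integral>\<^sup>+x. phi l 1 b s Q \<tau> \<zeta> x \<partial>power_intensity (m (Suc l))) < top"
      by (rule integral_phi_less_top[OF Q l \<tau> b sm])
    show "(\<integral>\<^sup>+x. phi l 1 b s Q' \<tau> \<zeta> x \<partial>power_intensity (m (Suc l))) < top"
      by (rule integral_phi_less_top[OF Q' l \<tau> b sm])
    show "phi l 1 b s Q \<tau> \<zeta> x < top" "phi l 1 b s Q' \<tau> \<zeta> x < top" if "0 < x" for x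
      unfolding s using that by (auto intro!: phi_less_top Q Q' l \<tau> b)
  qed (use l Q Q' in \<open>auto intro: phi_measurable gfun_pos\<close>)
  also have "\<dots> = ennreal (lap l \<tau> \<zeta>) * (ennreal (1 / \<tau> ^ 1 * ?b * ?Y) * avg l Q \<zeta>) *
      (ennreal (1 / \<tau> ^ 1 * ?b * ?Y) * avg l Q' \<zeta>)"
    using C_pos[of l] l
    by (simp add: integral_one_minus_gfun[OF l \<tau>] ee_ennreal lap_def integral_phi[OF Q(1) l \<tau> b sm]
        integral_phi[OF Q'(1) l \<tau> b sm])
  also have "\<dots> = (ennreal (lap l \<tau> \<zeta>) * ennreal (1 / \<tau> ^ 1 * ?b * ?Y) * ennreal (1 / \<tau> ^ 1 * ?b * ?Y)) *
      (avg l Q \<zeta> * avg l Q' \<zeta>)"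
    by (simp only: mult_ac)
  also have "ennreal (lap l \<tau> \<zeta>) * ennreal (1 / \<tau> ^ 1 * ?b * ?Y) * ennreal (1 / \<tau> ^ 1 * ?b * ?Y) =
      ennreal (mono_fun l 2 (?b\<^sup>2) (2 * m (Suc l)) \<tau> \<zeta>)"
  proof -
    have YY: "(\<tau> * Y l \<zeta>) powr (2 * m (Suc l)) = ?Y * ?Y"
      by (subst mult_2) (rule powr_add)
    have "mono_fun l 2 (?b\<^sup>2) (2 * m (Suc l)) \<tau> \<zeta> = lap l \<tau> \<zeta> * (1 / \<tau> ^ 1 * ?b * ?Y) * (1 / \<tau> ^ 1 * ?b * ?Y)"
      unfolding mono_fun_def YY by (simp add: power2_eq_square)
    moreover have "0 \<le> lap l \<tau> \<zeta>" "0 \<le> 1 / \<tau> ^ 1 * ?b * ?Y"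
      using \<tau> b' by (auto simp: lap_def)
    ultimately show ?thesis
      by (simp only: ennreal_mult mult_nonneg_nonneg)
  qed
  finally show "(\<integral>\<^sup>+y. node_pair_sum \<Theta> \<Theta>' p \<zeta> y * ee (ennreal \<tau> * TF l p \<zeta> y) \<partial>P) =
    ennreal (mono_fun l 2 (?b\<^sup>2) (2 * m (Suc l)) \<tau> \<zeta>) * (avg l Q \<zeta> * avg l Q' \<zeta>)" .
qed

end

text \<open>Written against the intensity dx / x of parameter 0, hence with a square of x, so that
  the root can be treated with the same integrals as a level of the tree.\<close>

lemma integral_mult_ee:
  assumes "0 < T" "T < top"
  shows "(\<integral>\<^sup>+x. ennreal x ^ 2 * ee (ennreal x * T) \<partial>power_intensity 0) = inverse (T ^ 2)"
proof -
  obtain t where t: "T = ennreal t" "0 < t" using assms by (cases T) auto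
  have "(\<integral>\<^sup>+x. ennreal x ^ 2 * ee (ennreal x * T) \<partial>power_intensity 0) =
      (\<integral>\<^sup>+x. ennreal (x powr 2 * exp (- t * x powr 1)) \<partial>power_intensity 0)"
    by (rule nn_integral_power_intensity_cong)
       (use t in \<open>simp add: ennreal_mult[symmetric] ee_ennreal ennreal_power mult_ac\<close>)
  also have "\<dots> = ennreal (Gamma ((2 - 0) / 1) / (1 * t powr ((2 - 0) / 1)))"
    by (rule power_intensity_powr_exp) (use t in auto)
  also have "\<dots> = inverse (T ^ 2)"
    using t by (simp add: ennreal_power inverse_ennreal Gamma_numeral divide_inverse)
  finally show ?thesis .
qed

section \<open>Constants, iterated averages and the expectation at the root\<close>

context cascade
begin

text \<open>When A is the Boltzmann weight of one configuration, its quotient by F is the Gibbs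
  weight at a leaf; then d columns are averaged out, starting from the last. \<open>GG\<close>
  indexes the same functions by depth.\<close>

primrec Gd :: "('a \<Rightarrow> ennreal) \<Rightarrow> nat \<Rightarrow> 'a \<Rightarrow> ennreal" where
  "Gd A 0 = (\<lambda>\<zeta>. A \<zeta> / ennreal (F \<zeta>))"
| "Gd A (Suc d) = avg (k - Suc d) (Gd A d)"

definition GG :: "('a \<Rightarrow> ennreal) \<Rightarrow> nat \<Rightarrow> 'a \<Rightarrow> ennreal" where
  "GG A l = Gd A (k - l)"

lemma GG_k: "GG A k = (\<lambda>\<zeta>. A \<zeta> / ennreal (F \<zeta>))"
  by (simp add: GG_def)

lemma GG_rec: "l < k \<Longrightarrow> GG A l = avg l (GG A (Suc l))"
  by (simp add: GG_def Suc_diff_Suc[symmetric])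

lemma GG_measurable_le_1:
  assumes [measurable]: "A \<in> borel_measurable PS" and A: "\<And>\<zeta>. A \<zeta> \<le> ennreal (F \<zeta>)"
  shows "l \<le> k \<Longrightarrow> GG A l \<in> borel_measurable PS \<and> (\<forall>\<zeta>. GG A l \<zeta> \<le> 1)"
proof (induction rule: inc_induct)
  case base
  have "A \<zeta> / ennreal (F \<zeta>) \<le> 1" for \<zeta>
    using F_pos[of \<zeta>] A[of \<zeta>] by (intro divide_le_posI_ennreal) auto
  then show ?case by (simp add: GG_k)
next
  case (step l)
  then show ?case by (auto simp: GG_rec intro!: avg_measurable avg_le_1)
qed

text \<open>The Gamma argument is \<open>1 - \<rho>\<close> with
  \<open>\<rho> = m (Suc l) / m (Suc (Suc l))\<close>, so the result is \<open>Ec (Suc l)\<close>: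
  the form \<open>m (Suc l) * C l\<close> of the constant reproduces itself from level to
  level.\<close>

lemma step_const_leaf:
  assumes "l < k"
  shows "step_const (Suc l) (m (Suc (Suc l)) * C (Suc l)) (m (Suc (Suc l))) = m (Suc l) * C l"
proof -
  let ?M = "m (Suc l)" and ?M' = "m (Suc (Suc l))"
  have M: "0 < ?M'" "0 < C (Suc l)"
    using assms m_pos[of "Suc (Suc l)"] C_pos[of "Suc l"] by auto
  have e: "(?M' - ?M) / ?M' = 1 - ?M / ?M'" using M by (simp add: diff_divide_distrib)
  have "C (Suc l) / C (Suc l) powr (1 - ?M / ?M') = C (Suc l) powr (?M / ?M')"
    using M by (simp add: powr_diff)
  moreover have "step_const (Suc l) (?M' * C (Suc l)) ?M' = (C (Suc l) / C (Suc l) powr (1 - ?M / ?M')) * Gamma (1 - ?M / ?M')"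
    using M by (simp add: step_const_def e)
  ultimately show ?thesis
    using C_rec[OF assms] by (simp add: Ec_def)
qed

text \<open>For A = F all averages are 1 and the formula is minus the derivative of
  \<open>lap\<close> in \<tau>, which explains the constant \<open>m (Suc l) * C l\<close> and the
  exponent. A general A only adds the average \<open>GG A l\<close>.\<close>

lemma moment_Tsum:
  assumes A: "A \<in> borel_measurable PS" "\<And>\<zeta>. A \<zeta> \<le> ennreal (F \<zeta>)"
  shows "l \<le> k \<Longrightarrow> moment_at l 1 (m (Suc l) * C l) (m (Suc l)) (Tsum A (k - l)) (GG A l)"
proof (induction rule: inc_induct)
  case base
  show ?case
    unfolding moment_at_def
  proof (intro allI impI)
    fix p :: "nat list" and \<zeta> :: 'a and \<tau> :: real assume \<tau>: "0 < \<tau>"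
    have F: "0 < F \<zeta>" "0 < \<tau> * F \<zeta>" "ennreal \<tau> * ennreal (F \<zeta>) = ennreal (\<tau> * F \<zeta>)"
      using \<tau> F_pos[of \<zeta>] by (auto simp: ennreal_mult)
    have 1: "mono_fun k 1 (m (Suc k) * C k) (m (Suc k)) \<tau> \<zeta> = F \<zeta> * exp (- (\<tau> * F \<zeta>))"
      using \<tau> F by (simp add: mono_fun_def lap_def Y_k m_top)
    have 2: "ennreal (F \<zeta>) * (A \<zeta> / ennreal (F \<zeta>)) = A \<zeta>"
      using F(1) by (simp add: ennreal_times_divide mult.commute[of "ennreal (F \<zeta>)"] ennreal_mult_divide_eq)
    have "ennreal (mono_fun k 1 (m (Suc k) * C k) (m (Suc k)) \<tau> \<zeta>) * GG A k \<zeta> =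
        (ennreal (F \<zeta>) * (A \<zeta> / ennreal (F \<zeta>))) * ennreal (exp (- (\<tau> * F \<zeta>)))"
      unfolding 1 GG_k using F(1) by (simp add: ennreal_mult mult_ac)
    also have "\<dots> = (\<integral>\<^sup>+y. Tsum A (k - k) p \<zeta> y * ee (ennreal \<tau> * TF k p \<zeta> y) \<partial>P)"
      unfolding 2 using F by (simp add: ee_ennreal)
    finally show "(\<integral>\<^sup>+y. Tsum A (k - k) p \<zeta> y * ee (ennreal \<tau> * TF k p \<zeta> y) \<partial>P) =
      ennreal (mono_fun k 1 (m (Suc k) * C k) (m (Suc k)) \<tau> \<zeta>) * GG A k \<zeta>" by simp
  qed
next
  case (step l)
  have l: "l < k" by (rule step(2))
  have "moment_at l 1 (step_const (Suc l) (m (Suc (Suc l)) * C (Suc l)) (m (Suc (Suc l)))) (m (Suc l))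
      (node_sum 1 (Tsum A (k - Suc l))) (avg l (GG A (Suc l)))"
  proof (rule moment_step[OF l node_fun_Tsum[OF A(1)] _ _ step(3)])
    show "0 \<le> m (Suc (Suc l)) * C (Suc l)"
      using l m_pos[of "Suc (Suc l)"] C_pos[of "Suc l"] by simp
    show "m (Suc l) < m (Suc (Suc l))" using l by (intro m_less) simp
  qed (use GG_measurable_le_1[OF A, of "Suc l"] l in auto)
  then show ?case
    using l by (simp add: step_const_leaf GG_rec Suc_diff_Suc[symmetric])
qed

text \<open>The constants of the iteration telescope to \<open>(m r - m (r - 1)) * Ec l\<close>.\<close>

lemma step_const_branch:
  assumes "r < k"
  shows "step_const r ((m (Suc r) * C r)\<^sup>2) (2 * m (Suc r)) = (m (Suc r) - m r) * Ec r"
proof -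
  let ?M = "m (Suc r)" and ?\<rho> = "m r / m (Suc r)"
  have M: "0 < ?M" "0 < C r" using assms m_pos[of "Suc r"] C_pos[of r] by auto
  have \<rho>: "?\<rho> < 1" using ratio[of r] assms by simp
  have e: "(2 * ?M - m r) / ?M = (1 - ?\<rho>) + 1" using M by (simp add: diff_divide_distrib)
  \<comment> \<open>The factor \<open>1 - ?\<rho>\<close> split off here is what turns
    \<open>m (Suc r)\<close> into the difference of the two parameters.\<close>
  have G: "Gamma ((1 - ?\<rho>) + 1) = (1 - ?\<rho>) * Gamma (1 - ?\<rho>)"
    using \<rho> by (intro Gamma_plus1) (auto elim!: nonpos_Ints_cases)
  have P: "C r powr ((1 - ?\<rho>) + 1) = (C r)\<^sup>2 / C r powr ?\<rho>"
    using M by (simp add: powr_diff powr_add power2_eq_square)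
  have "step_const r ((?M * C r)\<^sup>2) (2 * ?M) = (?M * (1 - ?\<rho>)) * (C r powr ?\<rho> * Gamma (1 - ?\<rho>))"
    unfolding step_const_def e G P using M by (simp add: power2_eq_square)
  also have "?M * (1 - ?\<rho>) = ?M - m r" using M by (simp add: right_diff_distrib)
  finally show ?thesis by (simp add: Ec_def)
qed

text \<open>Above the branching node the exponent is back to \<open>m (Suc l)\<close> and the Gamma
  argument to \<open>1 - \<rho>\<close>. Since \<open>Ec (Suc l) = m (Suc l) * C l\<close>, the step
  replaces \<open>Ec (Suc l)\<close> by \<open>Ec l\<close> and leaves c untouched.\<close>

lemma step_const_above:
  assumes "l < k"
  shows "step_const l (c * Ec (Suc l)) (m (Suc l)) = c * Ec l"
proof -
  let ?M = "m (Suc l)" and ?\<rho> = "m l / m (Suc l)"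
  have M: "0 < ?M" "0 < C l" using assms m_pos[of "Suc l"] C_pos[of l] by auto
  have e: "(?M - m l) / ?M = 1 - ?\<rho>" using M by (simp add: diff_divide_distrib)
  have P: "C l powr (1 - ?\<rho>) = C l / C l powr ?\<rho>" using M by (simp add: powr_diff)
  show ?thesis
    unfolding step_const_def e P C_rec[OF assms, symmetric] using M by (simp add: Ec_def)
qed

text \<open>\<open>r\<close> is the depth of the node where the two leaves separate. Given the state
  there, the replicas are independent, hence a product of averages; the columns above are common and
  averaged once.\<close>

primrec Qd :: "('a \<Rightarrow> ennreal) \<Rightarrow> ('a \<Rightarrow> ennreal) \<Rightarrow> nat \<Rightarrow> nat \<Rightarrow> 'a \<Rightarrow> ennreal" where
  "Qd A B r 0 = (\<lambda>\<zeta>. GG A r \<zeta> * GG B r \<zeta>)"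
| "Qd A B r (Suc e) = avg (r - Suc e) (Qd A B r e)"

lemma Qd_measurable_le_1:
  assumes A: "A \<in> borel_measurable PS" "\<And>\<zeta>. A \<zeta> \<le> ennreal (F \<zeta>)"
    and B: "B \<in> borel_measurable PS" "\<And>\<zeta>. B \<zeta> \<le> ennreal (F \<zeta>)" and r: "r < k"
  shows "e \<le> r \<Longrightarrow> Qd A B r e \<in> borel_measurable PS \<and> (\<forall>\<zeta>. Qd A B r e \<zeta> \<le> 1)"
proof (induction e)
  case 0
  have "GG A r \<zeta> * GG B r \<zeta> \<le> 1 * 1" for \<zeta>
    using GG_measurable_le_1[OF A, of r] GG_measurable_le_1[OF B, of r] r by (intro mult_mono) auto
  then show ?case
    using GG_measurable_le_1[OF A, of r] GG_measurable_le_1[OF B, of r] r by (auto intro!: borel_measurable_times_ennreal)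
next
  case (Suc e)
  then show ?case using r by (auto intro!: avg_measurable avg_le_1)
qed

text \<open>The pair (b, s) is left existential because it changes shape after one step: squared
  constant and doubled exponent at the branching node, exponent \<open>m (Suc (r - e))\<close> above
  it. Only the constant of the next step has a form uniform in e.\<close>

lemma moment_Dsum:
  assumes A: "A \<in> borel_measurable PS" "\<And>\<zeta>. A \<zeta> \<le> ennreal (F \<zeta>)"
    and B: "B \<in> borel_measurable PS" "\<And>\<zeta>. B \<zeta> \<le> ennreal (F \<zeta>)" and r: "r < k"
  shows "e \<le> r \<Longrightarrow> \<exists>b s. moment_at (r - e) 2 b s (Dsum A B (k - Suc r) e) (Qd A B r e) \<and>
    0 \<le> b \<and> m (r - e) < s \<and> step_const (r - e) b s = (m (Suc r) - m r) * Ec (r - e)"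
proof (induction e)
  case 0
  let ?b = "m (Suc (Suc r)) * C (Suc r)" and ?s = "m (Suc (Suc r))"
  have b: "0 \<le> ?b" using r m_pos[of "Suc (Suc r)"] C_pos[of "Suc r"] by simp
  have "moment_at r 2 ((step_const (Suc r) ?b ?s)\<^sup>2) (2 * m (Suc r))
     (node_pair_sum (Tsum A (k - Suc r)) (Tsum B (k - Suc r))) (\<lambda>\<zeta>. avg r (GG A (Suc r)) \<zeta> * avg r (GG B (Suc r)) \<zeta>)"
    by (rule moment_pair_step[OF r])
       (use A B r b GG_measurable_le_1[OF A, of "Suc r"] GG_measurable_le_1[OF B, of "Suc r"]
         moment_Tsum[OF A, of "Suc r"] moment_Tsum[OF B, of "Suc r"] in \<open>auto intro: node_fun_Tsum\<close>)
  moreover have "m r < 2 * m (Suc r)"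
    using m_less[of r] m_pos[of "Suc r"] r by simp
  ultimately show ?case
    using r by - (rule exI[of _ "(m (Suc r) * C r)\<^sup>2"], rule exI[of _ "2 * m (Suc r)"],
      simp add: step_const_leaf GG_rec step_const_branch)
next
  case (Suc e)
  define l where "l = r - Suc e"
  have l: "Suc l = r - e" "l < k" using Suc.prems r by (auto simp: l_def)
  obtain b s where IH: "moment_at (Suc l) 2 b s (Dsum A B (k - Suc r) e) (Qd A B r e)"
    "0 \<le> b" "m (Suc l) < s" "step_const (Suc l) b s = (m (Suc r) - m r) * Ec (Suc l)"
    using Suc by (auto simp: l)
  have "moment_at l 2 (step_const (Suc l) b s) (m (Suc l)) (node_sum 2 (Dsum A B (k - Suc r) e)) (avg l (Qd A B r e))"
    by (rule moment_step[OF l(2) node_fun_Dsum[OF A(1) B(1)] _ _ IH(1-3)])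
       (use Qd_measurable_le_1[OF A B r, of e] Suc.prems in auto)
  note mom = this[unfolded IH(4)]
  have "0 \<le> (m (Suc r) - m r) * Ec (Suc l)"
    using m_less[of r] Ec_pos[of "Suc l"] l r by (intro mult_nonneg_nonneg) auto
  moreover have "m l < m (Suc l)" using l by (intro m_less) simp
  ultimately show ?case
    using mom step_const_above[OF l(2), of "m (Suc r) - m r"]
    unfolding Dsum.simps Qd.simps l_def[symmetric] by blast
qed

text \<open>The Laplace transform is at most the probability that the sum is finite, and it tends to
  1 as \<tau> decreases to 0.\<close>

lemma AE_TF_finite: "AE y in P. TF 0 [] \<zeta> y < top"
proof -
  have [measurable]: "TF 0 [] \<zeta> \<in> borel_measurable P"
    by (rule node_fun_measurable[OF node_fun_TF]) measurable
  have "{y \<in> space P. TF 0 [] \<zeta> y < top} \<in> sets P" by measurable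
  then have fin_set: "{y. TF 0 [] \<zeta> y < top} \<in> sets P" by simp
  have le: "ennreal (lap 0 \<tau> \<zeta>) \<le> emeasure P {y. TF 0 [] \<zeta> y < top}" if "0 < \<tau>" for \<tau>
  proof -
    have "ennreal (lap 0 \<tau> \<zeta>) = (\<integral>\<^sup>+y. ee (ennreal \<tau> * TF 0 [] \<zeta> y) \<partial>P)"
      using laplace_at_all[of 0] that by (simp add: laplace_at_def)
    also have "\<dots> \<le> (\<integral>\<^sup>+y. indicator {y. TF 0 [] \<zeta> y < top} y \<partial>P)"
      using that by (intro nn_integral_mono)
        (auto split: split_indicator simp: less_top[symmetric] ennreal_mult_top)
    also have "\<dots> = emeasure P {y. TF 0 [] \<zeta> y < top}"
      by (rule nn_integral_indicator) (rule fin_set)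
    finally show ?thesis .
  qed
  have "((\<lambda>\<tau>. ennreal (lap 0 \<tau> \<zeta>)) \<longlongrightarrow> ennreal (exp (- C 0 * (0 * Y 0 \<zeta>) powr m (Suc 0)))) (at_right 0)"
    unfolding lap_def using m_pos[of "Suc 0"]
    by (intro tendsto_ennrealI tendsto_exp tendsto_mult tendsto_const tendsto_powr' tendsto_ident_at)
       (use Y_pos[of 0 \<zeta>] in \<open>auto simp: eventually_at_filter mult_nonneg_nonneg\<close>)
  then have "ennreal (exp (- C 0 * (0 * Y 0 \<zeta>) powr m (Suc 0))) \<le> emeasure P {y. TF 0 [] \<zeta> y < top}"
  proof (rule tendsto_upperbound)
    show "\<forall>\<^sub>F \<tau> in at_right 0. ennreal (lap 0 \<tau> \<zeta>) \<le> emeasure P {y. TF 0 [] \<zeta> y < top}"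
      using eventually_at_right_less by (rule eventually_mono) (rule le)
  qed simp
  then have "1 \<le> emeasure P {y. TF 0 [] \<zeta> y < top}" by simp
  then have "emeasure P {y. TF 0 [] \<zeta> y < top} = 1"
    using P.emeasure_le_1 by (intro antisym) auto
  then have "P.prob {y. TF 0 [] \<zeta> y < top} = 1"
    by (simp only: P.emeasure_eq_measure ennreal_eq_1)
  then have "AE y in P. y \<in> {y. TF 0 [] \<zeta> y < top}"
    by (simp only: P.AE_in_set_eq_1[OF fin_set])
  then show ?thesis by simp
qed

text \<open>The probability that the sum vanishes is at most the Laplace transform at every \<tau>,
  which tends to 0 as \<tau> grows.\<close>

lemma AE_TF_pos: "AE y in P. 0 < TF 0 [] \<zeta> y"
proof -
  have [measurable]: "TF 0 [] \<zeta> \<in> borel_measurable P"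
    by (rule node_fun_measurable[OF node_fun_TF]) measurable
  have "{y \<in> space P. TF 0 [] \<zeta> y = 0} \<in> sets P" by measurable
  then have zero_set: "{y. TF 0 [] \<zeta> y = 0} \<in> sets P" by simp
  have le: "emeasure P {y. TF 0 [] \<zeta> y = 0} \<le> ennreal (lap 0 \<tau> \<zeta>)" if "0 < \<tau>" for \<tau>
  proof -
    have "emeasure P {y. TF 0 [] \<zeta> y = 0} = (\<integral>\<^sup>+y. indicator {y. TF 0 [] \<zeta> y = 0} y \<partial>P)"
      by (rule nn_integral_indicator[symmetric]) (rule zero_set)
    also have "\<dots> \<le> (\<integral>\<^sup>+y. ee (ennreal \<tau> * TF 0 [] \<zeta> y) \<partial>P)"
      by (intro nn_integral_mono) (auto split: split_indicator)
    also have "\<dots> = ennreal (lap 0 \<tau> \<zeta>)"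
      using laplace_at_all[of 0] that by (simp add: laplace_at_def)
    finally show ?thesis .
  qed
  have M: "0 < m (Suc 0)" "0 < C 0" "0 < Y 0 \<zeta>" using m_pos[of "Suc 0"] C_pos[of 0] Y_pos[of 0] by auto
  \<comment> \<open>Uses the \<tau> that solves
    \<open>(\<tau> * Y 0 \<zeta>) powr m (Suc 0) = K\<close>.\<close>
  have le': "emeasure P {y. TF 0 [] \<zeta> y = 0} \<le> ennreal (exp (- (C 0 * K)))" if "0 < K" for K
    using le[of "K powr (1 / m (Suc 0)) / Y 0 \<zeta>"] M that by (simp add: lap_def powr_powr)
  have "filterlim (\<lambda>K. C 0 * K) at_top at_top"
    by (rule filterlim_tendsto_pos_mult_at_top[OF tendsto_const M(2) filterlim_ident])
  then have "((\<lambda>K. exp (- (C 0 * K))) \<longlongrightarrow> 0) at_top"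
    by (intro filterlim_compose[OF exp_at_bot] filterlim_compose[OF filterlim_uminus_at_bot_at_top])
  then have "((\<lambda>K. ennreal (exp (- (C 0 * K)))) \<longlongrightarrow> ennreal 0) at_top"
    by (rule tendsto_ennrealI)
  then have "emeasure P {y. TF 0 [] \<zeta> y = 0} \<le> ennreal 0"
  proof (rule tendsto_lowerbound)
    show "\<forall>\<^sub>F K in at_top. emeasure P {y. TF 0 [] \<zeta> y = 0} \<le> ennreal (exp (- (C 0 * K)))"
      using eventually_gt_at_top[of 0] by (rule eventually_mono) (rule le')
  qed simp
  then have "{y. TF 0 [] \<zeta> y = 0} \<in> null_sets P"
    using zero_set by (simp only: null_sets_def mem_Collect_eq) simp
  then have "AE y in P. y \<notin> {y. TF 0 [] \<zeta> y = 0}" by (rule AE_not_in)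
  then show ?thesis by (simp add: zero_less_iff_neq_zero)
qed

text \<open>After exchanging the integrals, the moment formula at the root is integrated over \<tau>
  against dx / x. This is one more step, of parameter \<open>m 0 = 0\<close>; its constant
  \<open>step_const 0 b s\<close> equals the difference of the m's since
  \<open>Ec 0 = 1\<close>.\<close>

theorem integral_Dsum:
  assumes A: "A \<in> borel_measurable PS" "\<And>\<zeta>. A \<zeta> \<le> ennreal (F \<zeta>)"
    and B: "B \<in> borel_measurable PS" "\<And>\<zeta>. B \<zeta> \<le> ennreal (F \<zeta>)" and r: "r < k"
  shows "(\<integral>\<^sup>+y. Dsum A B (k - Suc r) r [] \<zeta> y * inverse ((TF 0 [] \<zeta> y)\<^sup>2) \<partial>P) =
    ennreal (m (Suc r) - m r) * Qd A B r r \<zeta>"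
proof -
  let ?D = "Dsum A B (k - Suc r) r [] \<zeta>" and ?T = "TF 0 [] \<zeta>"
  have [measurable]: "?T \<in> borel_measurable P" "?D \<in> borel_measurable P"
    by (rule node_fun_measurable[OF node_fun_TF] node_fun_measurable[OF node_fun_Dsum[OF A(1) B(1)]],
        measurable)+
  interpret PI: sigma_finite_measure "power_intensity 0"
    unfolding power_intensity_def
    by (subst sigma_finite_measure.sigma_finite_iff_density_finite[OF sigma_finite_lborel]) auto
  interpret PP: pair_sigma_finite "power_intensity 0" P ..
  obtain b s where D: "moment_at 0 2 b s (Dsum A B (k - Suc r) r) (Qd A B r r)" "0 \<le> b" "m 0 < s"
    "step_const 0 b s = (m (Suc r) - m r) * Ec 0"
    using moment_Dsum[OF A B r, of r] by auto
  have "(\<integral>\<^sup>+y. ?D y * inverse ((?T y)\<^sup>2) \<partial>P) =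
      (\<integral>\<^sup>+y. \<integral>\<^sup>+x. ?D y * (ennreal x ^ 2 * ee (ennreal x * ?T y)) \<partial>power_intensity 0 \<partial>P)"
  proof (rule nn_integral_cong_AE, use AE_TF_finite[of \<zeta>] AE_TF_pos[of \<zeta>] in eventually_elim)
    case (elim y)
    then show ?case
      by (subst nn_integral_cmult) (auto simp: integral_mult_ee)
  qed
  also have "\<dots> = (\<integral>\<^sup>+x. \<integral>\<^sup>+y. ?D y * (ennreal x ^ 2 * ee (ennreal x * ?T y)) \<partial>P \<partial>power_intensity 0)"
  proof (rule PP.Fubini')
    have "(\<lambda>(x, y). ?D y * (ennreal x ^ 2 * ee (ennreal x * ?T y))) \<in> borel_measurable (borel \<Otimes>\<^sub>M P)"
      by measurable
    then show "(\<lambda>(x, y). ?D y * (ennreal x ^ 2 * ee (ennreal x * ?T y))) \<in> borel_measurable (power_intensity 0 \<Otimes>\<^sub>M P)"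
      by (subst measurable_cong_sets[OF sets_pair_measure_cong[OF sets_power_intensity refl] refl])
  qed
  also have "\<dots> = (\<integral>\<^sup>+x. (ennreal b * Qd A B r r \<zeta>) * ennreal ((Y 0 \<zeta> * x) powr s * exp (- C 0 * (Y 0 \<zeta> * x) powr m 1)) \<partial>power_intensity 0)"
  proof (rule nn_integral_power_intensity_cong)
    fix x :: real assume x: "0 < x"
    have "(\<integral>\<^sup>+y. ?D y * (ennreal x ^ 2 * ee (ennreal x * ?T y)) \<partial>P) =
        ennreal x ^ 2 * (\<integral>\<^sup>+y. ?D y * ee (ennreal x * ?T y) \<partial>P)"
      by (subst nn_integral_cmult[symmetric], measurable) (simp only: mult_ac)
    also have "\<dots> = ennreal x ^ 2 * (ennreal (mono_fun 0 2 b s x \<zeta>) * Qd A B r r \<zeta>)"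
      using D(1) x by (simp add: moment_at_def)
    also have "\<dots> = (ennreal x ^ 2 * ennreal (mono_fun 0 2 b s x \<zeta>)) * Qd A B r r \<zeta>"
      by (simp only: mult_ac)
    also have "ennreal x ^ 2 * ennreal (mono_fun 0 2 b s x \<zeta>) = ennreal (x ^ 2 * mono_fun 0 2 b s x \<zeta>)"
    proof -
      have "0 \<le> mono_fun 0 2 b s x \<zeta>" using x D(2) by (simp add: mono_fun_def lap_def)
      then show ?thesis using x by (simp add: ennreal_power ennreal_mult)
    qed
    also have "x ^ 2 * mono_fun 0 2 b s x \<zeta> = b * ((Y 0 \<zeta> * x) powr s * exp (- C 0 * (Y 0 \<zeta> * x) powr m 1))"
      using x by (simp add: mono_fun_def lap_def mult_ac)
    also have "ennreal \<dots> = ennreal b * ennreal ((Y 0 \<zeta> * x) powr s * exp (- C 0 * (Y 0 \<zeta> * x) powr m 1))"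
      using D(2) by (intro ennreal_mult) auto
    finally show "(\<integral>\<^sup>+y. ?D y * (ennreal x ^ 2 * ee (ennreal x * ?T y)) \<partial>P) =
      (ennreal b * Qd A B r r \<zeta>) * ennreal ((Y 0 \<zeta> * x) powr s * exp (- C 0 * (Y 0 \<zeta> * x) powr m 1))"
      by (simp only: mult_ac)
  qed
  also have "\<dots> = (ennreal b * Qd A B r r \<zeta>) *
      (\<integral>\<^sup>+x. ennreal ((Y 0 \<zeta> * x) powr s * exp (- C 0 * (Y 0 \<zeta> * x) powr m 1)) \<partial>power_intensity 0)"
    by (rule nn_integral_cmult) simp
  \<comment> \<open>Scale invariance of dx / x removes \<open>Y 0 \<zeta>\<close>.\<close>
  also have "(\<integral>\<^sup>+x. ennreal ((Y 0 \<zeta> * x) powr s * exp (- C 0 * (Y 0 \<zeta> * x) powr m 1)) \<partial>power_intensity 0) =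
      (\<integral>\<^sup>+x. ennreal (x powr s * exp (- C 0 * x powr m 1)) \<partial>power_intensity 0)"
    using power_intensity_scale[where f="\<lambda>x. ennreal (x powr s * exp (- C 0 * x powr m 1))" and c="Y 0 \<zeta>" and a=0]
      Y_pos[of 0 \<zeta>] by simp
  also have "\<dots> = ennreal (Gamma ((s - 0) / m 1) / (m 1 * C 0 powr ((s - 0) / m 1)))"
    by (rule power_intensity_powr_exp) (use m_pos[of 1] C_pos[of 0] D(3) m_0 in auto)
  also have "(ennreal b * Qd A B r r \<zeta>) * \<dots> = ennreal (step_const 0 b s) * Qd A B r r \<zeta>"
  proof -
    have "ennreal (step_const 0 b s) = ennreal b * ennreal (Gamma ((s - 0) / m 1) / (m 1 * C 0 powr ((s - 0) / m 1)))"
      unfolding step_const_def m_0 using D(2) by (subst ennreal_mult'[symmetric]) auto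
    then show ?thesis by (simp only: mult_ac)
  qed
  finally show ?thesis by (simp add: D(4) Ec_0)
qed

end

section \<open>Sums over leaves as iterated sums over labels\<close>

lemma countable_leaves: "countable (leaves d)"
  by (rule countable_subset[OF subset_UNIV]) simp

lemma nn_integral_leaves_0: "(\<integral>\<^sup>+\<gamma>. g \<gamma> \<partial>count_space (leaves 0)) = g []"
proof -
  have "leaves 0 = {[]}" by (auto simp: leaves_def)
  then show ?thesis by (simp add: nn_integral_count_space_finite)
qed

lemma nn_integral_leaves_Suc:
  "(\<integral>\<^sup>+\<gamma>. g \<gamma> \<partial>count_space (leaves (Suc d))) = (\<Sum>n. \<integral>\<^sup>+\<gamma>. g (n # \<gamma>) \<partial>count_space (leaves d))"
proof -
  interpret L: sigma_finite_measure "count_space (leaves d)"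
    by (rule sigma_finite_measure_count_space_countable) (rule countable_leaves)
  have bij: "bij_betw (\<lambda>(n, \<gamma>). n # \<gamma>) (UNIV \<times> leaves d) (leaves (Suc d))"
    by (auto simp: bij_betw_def inj_on_def leaves_def image_iff length_Suc_conv)
  have "(\<Sum>n. \<integral>\<^sup>+\<gamma>. g (n # \<gamma>) \<partial>count_space (leaves d)) =
      (\<integral>\<^sup>+n. \<integral>\<^sup>+\<gamma>. g (n # \<gamma>) \<partial>count_space (leaves d) \<partial>count_space UNIV)"
    by (simp add: nn_integral_count_space_nat)
  also have "\<dots> = (\<integral>\<^sup>+n. \<integral>\<^sup>+\<gamma>. (\<lambda>(n, \<gamma>). g (n # \<gamma>)) (n, \<gamma>) \<partial>count_space (leaves d) \<partial>count_space UNIV)"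
    by simp
  also have "\<dots> = (\<integral>\<^sup>+x. (\<lambda>(n, \<gamma>). g (n # \<gamma>)) x \<partial>(count_space UNIV \<Otimes>\<^sub>M count_space (leaves d)))"
    by (rule L.nn_integral_fst) (simp add: pair_measure_countable countable_leaves)
  also have "\<dots> = (\<integral>\<^sup>+x. g ((\<lambda>(n, \<gamma>). n # \<gamma>) x) \<partial>count_space (UNIV \<times> leaves d))"
    by (simp add: pair_measure_countable countable_leaves case_prod_unfold)
  also have "\<dots> = (\<integral>\<^sup>+\<gamma>. g \<gamma> \<partial>count_space (leaves (Suc d)))"
    by (rule nn_integral_bij_count_space[OF bij])
  finally show ?thesis by simp
qed

text \<open>Positions count from 0: e is the length of the common prefix. In this form separation is
  compatible with prepending a label.\<close>

definition branch_at :: "nat \<Rightarrow> nat list \<Rightarrow> nat list \<Rightarrow> bool" where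
  "branch_at e \<gamma> \<gamma>' \<longleftrightarrow> take e \<gamma> = take e \<gamma>' \<and> \<gamma> ! e \<noteq> \<gamma>' ! e"

lemma branch_at_Cons[simp]:
  "branch_at 0 (n # \<gamma>) (n' # \<gamma>') \<longleftrightarrow> n' \<noteq> n"
  "branch_at (Suc e) (n # \<gamma>) (n' # \<gamma>') \<longleftrightarrow> n' = n \<and> branch_at e \<gamma> \<gamma>'"
  by (auto simp: branch_at_def)

text \<open>\<open>wedge\<close> counts labels from 1, so the value \<open>Suc r\<close> means a
  common prefix of length r. Equal leaves cannot interfere: for them \<open>wedge\<close> is
  \<open>k + 1\<close>, beyond \<open>Suc r\<close>.\<close>

lemma wedge_eq_iff:
  assumes "\<alpha> \<in> leaves k" "\<beta> \<in> leaves k" "r < k"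
  shows "wedge k \<alpha> \<beta> = Suc r \<longleftrightarrow> branch_at r \<alpha> \<beta>"
proof
  assume b: "branch_at r \<alpha> \<beta>"
  then have "\<alpha> \<noteq> \<beta>" by (auto simp: branch_at_def)
  have eq: "\<alpha> ! j = \<beta> ! j" if "j < r" for j
    using b that unfolding branch_at_def by (metis nth_take)
  have "(LEAST l. 1 \<le> l \<and> \<alpha> ! (l - 1) \<noteq> \<beta> ! (l - 1)) = Suc r"
  proof (rule Least_equality)
    show "1 \<le> Suc r \<and> \<alpha> ! (Suc r - 1) \<noteq> \<beta> ! (Suc r - 1)"
      using b by (simp add: branch_at_def)
    show "Suc r \<le> l" if "1 \<le> l \<and> \<alpha> ! (l - 1) \<noteq> \<beta> ! (l - 1)" for l
      using that eq[of "l - 1"] by (cases "l - 1 < r") auto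
  qed
  then show "wedge k \<alpha> \<beta> = Suc r" using \<open>\<alpha> \<noteq> \<beta>\<close> by (simp add: wedge_def)
next
  assume w: "wedge k \<alpha> \<beta> = Suc r"
  have ne: "\<alpha> \<noteq> \<beta>" using w assms(3) by (auto simp: wedge_def split: if_splits)
  let ?P = "\<lambda>l. 1 \<le> l \<and> \<alpha> ! (l - 1) \<noteq> \<beta> ! (l - 1)"
  have L: "(LEAST l. ?P l) = Suc r" using w ne by (simp add: wedge_def)
  obtain j where "j < k" "\<alpha> ! j \<noteq> \<beta> ! j"
    using ne assms(1,2) by (auto simp: leaves_def list_eq_iff_nth_eq)
  then have "?P (Suc j)" by simp
  then have 1: "?P (Suc r)" using LeastI[of ?P "Suc j"] L by simp
  have "\<alpha> ! i = \<beta> ! i" if "i < r" for i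
    using not_less_Least[of "Suc i" ?P] that L by simp
  then have "take r \<alpha> = take r \<beta>"
    using assms by (intro nth_equalityI) (auto simp: leaves_def)
  then show "branch_at r \<alpha> \<beta>" using 1 by (simp add: branch_at_def)
qed

context cascade
begin

primrec leaf_weight :: "nat list \<Rightarrow> nat list \<Rightarrow> (nat list + nat list \<Rightarrow> nat \<Rightarrow> real) \<Rightarrow> ennreal" where
  "leaf_weight p [] y = 1"
| "leaf_weight p (n # \<gamma>) y = ennreal (y (Inr p) n) * leaf_weight (p @ [n]) \<gamma> y"

primrec leaf_path :: "nat list \<Rightarrow> nat list \<Rightarrow> 'a \<Rightarrow> (nat list + nat list \<Rightarrow> nat \<Rightarrow> real) \<Rightarrow> 'a" where
  "leaf_path p [] \<zeta> y = \<zeta>"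
| "leaf_path p (n # \<gamma>) \<zeta> y = leaf_path (p @ [n]) \<gamma> (upd (Suc (length p)) (y (Inl (p @ [n]))) \<zeta>) y"

definition leaf_term where
  "leaf_term G p \<gamma> \<zeta> y = leaf_weight p \<gamma> y * G (leaf_path p \<gamma> \<zeta> y)"

lemma leaf_term_Cons: "leaf_term G p (n # \<gamma>) \<zeta> y = ennreal (y (Inr p) n) *
    leaf_term G (p @ [n]) \<gamma> (upd (Suc (length p)) (y (Inl (p @ [n]))) \<zeta>) y"
  by (simp add: leaf_term_def mult.assoc)

lemma Tsum_leaves: "Tsum G d p \<zeta> y = (\<integral>\<^sup>+\<gamma>. leaf_term G p \<gamma> \<zeta> y \<partial>count_space (leaves d))"
proof (induction d arbitrary: p \<zeta>)
  case 0
  then show ?case by (simp add: nn_integral_leaves_0 leaf_term_def)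
next
  case (Suc d)
  then show ?case
    by (simp add: nn_integral_leaves_Suc leaf_term_Cons node_sum_def child_def nn_integral_cmult)
qed

text \<open>As long as both leaves lie below the same child, the point of that child occurs in both
  weights and gives the square in \<open>node_sum 2\<close>; at distance e the labels must
  differ.\<close>

lemma Dsum_leaves: "Dsum A B d e p \<zeta> y =
  (\<integral>\<^sup>+\<gamma>. \<integral>\<^sup>+\<gamma>'. of_bool (branch_at e \<gamma> \<gamma>') * (leaf_term A p \<gamma> \<zeta> y * leaf_term B p \<gamma>' \<zeta> y)
     \<partial>count_space (leaves (Suc (d + e))) \<partial>count_space (leaves (Suc (d + e))))"
proof (induction e arbitrary: p \<zeta>)
  case 0
  let ?a = "\<lambda>n \<gamma>. leaf_term A p (n # \<gamma>) \<zeta> y" and ?b = "\<lambda>n \<gamma>. leaf_term B p (n # \<gamma>) \<zeta> y"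
  have eq: "ennreal (y (Inr p) n) * child (Tsum G d) p \<zeta> n y = (\<integral>\<^sup>+\<gamma>. leaf_term G p (n # \<gamma>) \<zeta> y \<partial>count_space (leaves d))" for n G
    by (simp add: child_def Tsum_leaves leaf_term_Cons nn_integral_cmult)
  have "Dsum A B d 0 p \<zeta> y = (\<Sum>n. \<Sum>n'. if n' = n then 0 else
      (\<integral>\<^sup>+\<gamma>. ?a n \<gamma> \<partial>count_space (leaves d)) * (\<integral>\<^sup>+\<gamma>'. ?b n' \<gamma>' \<partial>count_space (leaves d)))"
    unfolding Dsum.simps node_pair_sum_def eq ..
  also have "\<dots> = (\<Sum>n. \<Sum>n'. (\<integral>\<^sup>+\<gamma>. \<integral>\<^sup>+\<gamma>'. of_bool (n' \<noteq> n) * (?a n \<gamma> * ?b n' \<gamma>') \<partial>count_space (leaves d) \<partial>count_space (leaves d)))"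
    by (intro suminf_cong) (auto simp: nn_integral_cmult nn_integral_multc)
  also have "\<dots> = (\<Sum>n. (\<integral>\<^sup>+\<gamma>. (\<Sum>n'. \<integral>\<^sup>+\<gamma>'. of_bool (n' \<noteq> n) * (?a n \<gamma> * ?b n' \<gamma>') \<partial>count_space (leaves d)) \<partial>count_space (leaves d)))"
    by (intro suminf_cong nn_integral_suminf[symmetric]) auto
  finally show ?case by (simp add: nn_integral_leaves_Suc)
next
  case (Suc e)
  let ?l = "leaves (Suc (d + e))"
  have c: "ennreal x ^ 2 * (\<integral>\<^sup>+\<gamma>. \<integral>\<^sup>+\<gamma>'. of_bool (branch_at e \<gamma> \<gamma>') * (f \<gamma> * g \<gamma>') \<partial>count_space ?l \<partial>count_space ?l) =
      (\<integral>\<^sup>+\<gamma>. \<integral>\<^sup>+\<gamma>'. of_bool (branch_at e \<gamma> \<gamma>') * ((ennreal x * f \<gamma>) * (ennreal x * g \<gamma>')) \<partial>count_space ?l \<partial>count_space ?l)"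
    for x f g
    by (simp add: nn_integral_cmult[symmetric] power2_eq_square mult_ac)
  have "Dsum A B d (Suc e) p \<zeta> y = (\<Sum>n. \<integral>\<^sup>+\<gamma>. \<integral>\<^sup>+\<gamma>'. of_bool (branch_at e \<gamma> \<gamma>') *
     (leaf_term A p (n # \<gamma>) \<zeta> y * leaf_term B p (n # \<gamma>') \<zeta> y) \<partial>count_space ?l \<partial>count_space ?l)"
    by (simp add: node_sum_def child_def Suc c leaf_term_Cons)
  also have "\<dots> = (\<Sum>n. \<integral>\<^sup>+\<gamma>. (\<Sum>n'. \<integral>\<^sup>+\<gamma>'. of_bool (branch_at (Suc e) (n # \<gamma>) (n' # \<gamma>')) *
     (leaf_term A p (n # \<gamma>) \<zeta> y * leaf_term B p (n' # \<gamma>') \<zeta> y) \<partial>count_space ?l) \<partial>count_space ?l)"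
  proof (intro suminf_cong nn_integral_cong)
    fix n \<gamma>
    have "(\<Sum>n'. \<integral>\<^sup>+\<gamma>'. of_bool (branch_at (Suc e) (n # \<gamma>) (n' # \<gamma>')) *
     (leaf_term A p (n # \<gamma>) \<zeta> y * leaf_term B p (n' # \<gamma>') \<zeta> y) \<partial>count_space ?l) =
      (\<Sum>n'\<in>{n}. \<integral>\<^sup>+\<gamma>'. of_bool (branch_at (Suc e) (n # \<gamma>) (n' # \<gamma>')) *
     (leaf_term A p (n # \<gamma>) \<zeta> y * leaf_term B p (n' # \<gamma>') \<zeta> y) \<partial>count_space ?l)"
      by (rule suminf_finite) auto
    then show "(\<integral>\<^sup>+\<gamma>'. of_bool (branch_at e \<gamma> \<gamma>') * (leaf_term A p (n # \<gamma>) \<zeta> y * leaf_term B p (n # \<gamma>') \<zeta> y) \<partial>count_space ?l) =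
      (\<Sum>n'. \<integral>\<^sup>+\<gamma>'. of_bool (branch_at (Suc e) (n # \<gamma>) (n' # \<gamma>')) *
     (leaf_term A p (n # \<gamma>) \<zeta> y * leaf_term B p (n' # \<gamma>') \<zeta> y) \<partial>count_space ?l)"
      by simp
  qed
  finally show ?case by (simp add: nn_integral_leaves_Suc)
qed

lemma leaf_weight_prod: "leaf_weight p \<gamma> y = (\<Prod>j<length \<gamma>. ennreal (y (Inr (p @ take j \<gamma>)) (\<gamma> ! j)))"
proof (induction \<gamma> arbitrary: p)
  case (Cons n \<gamma>)
  then show ?case by (simp add: prod.lessThan_Suc_shift del: prod.lessThan_Suc)
qed simp

end

section \<open>Independent families padded by constants\<close>

text \<open>An event about a constant is empty or the whole space, so constants may be added to an
  independent family. The product spaces are indexed by whole types, whereas the given variables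
  exist only on part of the indices.\<close>

lemma (in prob_space) indep_vars_extend_const:
  assumes ind: "indep_vars (\<lambda>_. S) X J" and c: "\<And>i. c i \<in> space S"
  shows "indep_vars (\<lambda>_. S) (\<lambda>i \<omega>. if i \<in> J then X i \<omega> else c i) UNIV"
  unfolding indep_vars_def2
proof (intro conjI ballI)
  let ?X = "\<lambda>i \<omega>. if i \<in> J then X i \<omega> else c i"
  have Xm: "i \<in> J \<Longrightarrow> X i \<in> measurable M S" for i
    using ind by (auto simp: indep_vars_def2)
  show rv: "?X i \<in> measurable M S" for i
    using Xm[of i] c by (cases "i \<in> J") auto
  have indJ: "indep_sets (\<lambda>i. {X i -` A \<inter> space M |A. A \<in> sets S}) J"
    using ind by (simp add: indep_vars_def2)
  show "indep_sets (\<lambda>i. {?X i -` A \<inter> space M |A. A \<in> sets S}) UNIV"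
  proof (rule indep_setsI)
    show "{?X i -` A \<inter> space M |A. A \<in> sets S} \<subseteq> events" for i
      using rv[of i] by (auto intro: measurable_sets)
    fix B K assume K: "K \<noteq> {}" "K \<subseteq> UNIV" "finite K" and B: "\<forall>j\<in>K. B j \<in> {?X j -` A \<inter> space M |A. A \<in> sets S}"
    have out: "B j = {} \<or> B j = space M" if "j \<in> K" "j \<notin> J" for j
    proof -
      obtain A where "B j = ?X j -` A \<inter> space M" using B \<open>j \<in> K\<close> by auto
      then show ?thesis using \<open>j \<notin> J\<close> by (cases "c j \<in> A") auto
    qed
    show "prob (\<Inter>j\<in>K. B j) = (\<Prod>j\<in>K. prob (B j))"
    proof (cases "\<exists>j\<in>K. j \<notin> J \<and> B j = {}")
      case True
      then obtain j where j: "j \<in> K" "B j = {}" by auto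
      then have "(\<Inter>j\<in>K. B j) = {}" by auto
      moreover have "(\<Prod>j\<in>K. prob (B j)) = 0"
        using j K by (intro prod_zero) (auto intro: bexI[of _ j])
      ultimately show ?thesis by simp
    next
      case False
      then have out: "B j = space M" if "j \<in> K" "j \<notin> J" for j using out that by auto
      have "(\<Prod>j\<in>K. prob (B j)) = (\<Prod>j\<in>K \<inter> J. prob (B j))"
        by (rule prod.mono_neutral_right) (use K out in \<open>auto simp: prob_space\<close>)
      moreover have "prob (\<Inter>j\<in>K. B j) = (\<Prod>j\<in>K \<inter> J. prob (B j))"
      proof (cases "K \<inter> J = {}")
        case True
        then have "(\<Inter>j\<in>K. B j) = space M" using out K(1) by auto
        then show ?thesis using True by (simp add: prob_space)
      next
        case False
        have BJ: "\<forall>j\<in>K \<inter> J. B j \<in> {X j -` A \<inter> space M |A. A \<in> sets S}"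
        proof
          fix j assume j: "j \<in> K \<inter> J"
          then obtain A where "A \<in> sets S" "B j = (\<lambda>\<omega>. if j \<in> J then X j \<omega> else c j) -` A \<inter> space M"
            using B by auto
          then show "B j \<in> {X j -` A \<inter> space M |A. A \<in> sets S}"
            using j by auto
        qed
        have "(\<Inter>j\<in>K. B j) = (\<Inter>j\<in>K \<inter> J. B j)"
        proof
          show "(\<Inter>j\<in>K \<inter> J. B j) \<subseteq> (\<Inter>j\<in>K. B j)"
          proof
            fix \<omega> assume \<omega>: "\<omega> \<in> (\<Inter>j\<in>K \<inter> J. B j)"
            obtain i where "i \<in> K \<inter> J" using False by auto
            then have "\<omega> \<in> space M" using \<omega> BJ by auto
            then show "\<omega> \<in> (\<Inter>j\<in>K. B j)" using \<omega> out by (metis INT_I INT_E IntI)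
          qed
        qed auto
        then show ?thesis
          using indep_setsD[OF indJ, of "K \<inter> J" B] False K BJ by auto
      qed
      ultimately show ?thesis by simp
    qed
  qed
qed

lemma (in prob_space) distr_extend_const:
  assumes ind: "indep_vars (\<lambda>_. S) X J" and c: "\<And>i. c i \<in> space S"
  shows "distr M (PiM UNIV (\<lambda>_. S)) (\<lambda>\<omega> i. if i \<in> J then X i \<omega> else c i) =
    PiM UNIV (\<lambda>i. if i \<in> J then distr M S (X i) else return S (c i))"
proof -
  let ?X = "\<lambda>i \<omega>. if i \<in> J then X i \<omega> else c i"
  have iv: "indep_vars (\<lambda>_. S) ?X UNIV" by (rule indep_vars_extend_const[OF assms])
  then have rv: "?X i \<in> measurable M S" for i by (simp add: indep_vars_def2)
  have "distr M (PiM UNIV (\<lambda>_. S)) (\<lambda>\<omega>. \<lambda>i\<in>UNIV. ?X i \<omega>) = PiM UNIV (\<lambda>i. distr M S (?X i))"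
    using indep_vars_iff_distr_eq_PiM[of UNIV ?X "\<lambda>_. S"] rv iv by auto
  also have "PiM UNIV (\<lambda>i. distr M S (?X i)) = PiM UNIV (\<lambda>i. if i \<in> J then distr M S (X i) else return S (c i))"
    by (intro PiM_cong refl) (auto simp: distr_const c)
  finally show ?thesis by (simp only: restrict_UNIV)
qed

subsection \<open>Gaussian columns\<close>

lemma prob_space_centered_gaussian: "prob_space (centered_gaussian v)"
proof -
  interpret prob_space std_normal_distribution by (rule prob_space_normal_density) simp
  show ?thesis unfolding centered_gaussian_def by (rule prob_space_distr) simp
qed

lemma sets_centered_gaussian[simp]: "sets (centered_gaussian v) = sets borel"
  by (simp add: centered_gaussian_def)

lemma space_centered_gaussian[simp]: "space (centered_gaussian v) = UNIV"
  by (simp add: centered_gaussian_def)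

lemma measurable_centered_gaussian[simp]: "measurable (centered_gaussian v) N = measurable borel N"
  by (rule measurable_cong_sets) auto

text \<open>Completing the square: the integrand is a normal density of mean a, times
  \<open>exp (a ^ 2 / 2)\<close>.\<close>

lemma nn_integral_exp_std_normal: "(\<integral>\<^sup>+x. ennreal (exp (a * x)) \<partial>std_normal_distribution) = ennreal (exp (a\<^sup>2 / 2))"
proof -
  interpret N: prob_space "density lborel (normal_density a 1)" by (rule prob_space_normal_density) simp
  have eq: "std_normal_density x * exp (a * x) = exp (a\<^sup>2 / 2) * normal_density a 1 x" for x
  proof -
    have "- x\<^sup>2 / 2 + a * x = a\<^sup>2 / 2 + - (x - a)\<^sup>2 / 2"
      by (simp add: power2_diff field_simps)
    then have "exp (- x\<^sup>2 / 2) * exp (a * x) = exp (a\<^sup>2 / 2) * exp (- (x - a)\<^sup>2 / 2)"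
      by (simp only: exp_add[symmetric])
    then show ?thesis by (simp add: normal_density_def)
  qed
  have "(\<integral>\<^sup>+x. ennreal (exp (a * x)) \<partial>std_normal_distribution) =
      (\<integral>\<^sup>+x. ennreal (exp (a\<^sup>2 / 2)) * ennreal (normal_density a 1 x) \<partial>lborel)"
    by (subst nn_integral_density) (auto simp: ennreal_mult[symmetric] eq)
  also have "\<dots> = ennreal (exp (a\<^sup>2 / 2)) * emeasure (density lborel (normal_density a 1)) UNIV"
    by (simp add: nn_integral_cmult emeasure_density)
  finally show ?thesis using N.emeasure_space_1 by simp
qed

text \<open>An exponential of an absolute value is at most the sum of the exponentials with both
  signs, which reduces the bound to two Gaussian transforms.\<close>

lemma nn_integral_exp_abs_gaussian: "(\<integral>\<^sup>+x. ennreal (exp (a * \<bar>x\<bar>)) \<partial>centered_gaussian v) < top"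
proof -
  let ?s = "a * sqrt v"
  have "(\<integral>\<^sup>+x. ennreal (exp (a * \<bar>x\<bar>)) \<partial>centered_gaussian v) =
      (\<integral>\<^sup>+x. ennreal (exp (a * \<bar>sqrt v * x\<bar>)) \<partial>std_normal_distribution)"
    unfolding centered_gaussian_def by (rule nn_integral_distr) auto
  also have "\<dots> \<le> (\<integral>\<^sup>+x. ennreal (exp (?s * x)) + ennreal (exp (- ?s * x)) \<partial>std_normal_distribution)"
    by (intro nn_integral_mono) (auto simp: abs_if mult_ac simp flip: ennreal_plus intro!: ennreal_leI)
  also have "\<dots> = ennreal (exp (?s\<^sup>2 / 2)) + ennreal (exp ((- ?s)\<^sup>2 / 2))"
    by (subst nn_integral_add) (simp_all only: nn_integral_exp_std_normal, measurable)
  also have "\<dots> < top" by simp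
  finally show ?thesis .
qed

text \<open>Columns are extended by zeros beyond N. This makes them total sequences like the Poisson
  sequences, so that both kinds of coordinates live in one product.\<close>

definition column_law :: "nat \<Rightarrow> real \<Rightarrow> (nat \<Rightarrow> real) measure" where
  "column_law N v = PiM UNIV (\<lambda>i. if i < N then centered_gaussian v else return borel 0)"

lemma column_law_coordinates: "coordinates (\<lambda>i. if i < N then centered_gaussian v else return borel (0::real))"
  by (rule coordinates.intro) (auto simp: prob_space_centered_gaussian prob_space_return)

lemma prob_space_column_law: "prob_space (column_law N v)"
  unfolding column_law_def by (rule prob_space_PiM) (auto simp: prob_space_centered_gaussian prob_space_return)

lemma sets_column_law: "sets (column_law N v) = sets seq_borel"
  unfolding column_law_def by (rule sets_PiM_cong) auto

lemma measurable_column_law: "measurable (column_law N v) K = measurable seq_borel K"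
  by (rule measurable_cong_sets[OF sets_column_law refl])

lemma (in prob_space) distr_column:
  assumes "indep_vars (\<lambda>_. borel) X {..<N}" "\<And>i. i < N \<Longrightarrow> distr M borel (X i) = centered_gaussian v"
  shows "distr M seq_borel (\<lambda>\<omega> i. if i < N then X i \<omega> else 0) = column_law N v"
  using distr_extend_const[OF assms(1), of "\<lambda>_. 0"] assms(2)
  by (simp add: column_law_def cong: if_cong)

text \<open>The entries are independent, so the exponential moment is a product of one-dimensional
  ones. This integrability is what makes the functionals X_l finite.\<close>

lemma nn_integral_exp_column: "(\<integral>\<^sup>+c. ennreal (exp (a * (\<Sum>i<N. \<bar>c i\<bar>))) \<partial>column_law N v) < top"
proof -
  let ?\<nu> = "\<lambda>i. if i < N then centered_gaussian v else return borel (0::real)"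
  interpret L: coordinates ?\<nu> by (rule column_law_coordinates)
  have PL: "L.P = column_law N v" by (simp add: L.P_def column_law_def)
  have [measurable]: "(\<lambda>c. c i) \<in> borel_measurable L.P" for i
    using measurable_component_singleton[of i UNIV "\<lambda>_. borel"] by (simp add: PL measurable_column_law)
  have 1: "(\<integral>\<^sup>+c. ennreal (exp (a * (\<Sum>i<n. \<bar>c i\<bar>))) \<partial>L.P) < top" if "n \<le> N" for n
    using that
  proof (induction n)
    case (Suc n)
    have "(\<integral>\<^sup>+c. ennreal (exp (a * (\<Sum>i<Suc n. \<bar>c i\<bar>))) \<partial>L.P) =
        (\<integral>\<^sup>+c. ennreal (exp (a * (\<Sum>i<n. \<bar>c i\<bar>))) * ennreal (exp (a * \<bar>c n\<bar>)) \<partial>L.P)"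
      by (simp add: ennreal_mult[symmetric] exp_add[symmetric] distrib_left)
    also have "\<dots> = (\<integral>\<^sup>+c. ennreal (exp (a * (\<Sum>i<n. \<bar>c i\<bar>))) \<partial>L.P) * (\<integral>\<^sup>+c. ennreal (exp (a * \<bar>c n\<bar>)) \<partial>L.P)"
      by (rule L.nn_integral_dep_mult[where J="{..<n}" and J'="{n}"])
         (auto intro!: depI sum.cong arg_cong[where f="(*) a"] arg_cong[where f=exp] simp: exp_inj_iff)
    also have "(\<integral>\<^sup>+c. ennreal (exp (a * \<bar>c n\<bar>)) \<partial>L.P) = (\<integral>\<^sup>+x. ennreal (exp (a * \<bar>x\<bar>)) \<partial>?\<nu> n)"
      by (rule L.nn_integral_coordinate[where f="\<lambda>x. ennreal (exp (a * \<bar>x\<bar>))"]) (use Suc.prems in auto)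
    finally show ?case
      using Suc nn_integral_exp_abs_gaussian[where a=a and v=v] by (simp add: ennreal_mult_less_top)
  qed simp
  show ?thesis using 1[of N] by (simp add: PL)
qed

lemma (in prob_space) indep_vars_group:
  assumes "indep_vars (\<lambda>_. S) X I" "\<And>j. j \<in> L \<Longrightarrow> K j \<subseteq> I" "disjoint_family_on K L"
    and "\<And>j. j \<in> L \<Longrightarrow> g j \<in> measurable (PiM (K j) (\<lambda>_. S)) T"
  shows "indep_vars (\<lambda>_. T) (\<lambda>j \<omega>. g j (\<lambda>i\<in>K j. X i \<omega>)) L"
  using indep_vars_compose2[OF indep_vars_restrict[OF assms(1-3)], of g "\<lambda>_. T"] assms(4) by simp

lemma (in prob_space) indep_vars_reindex_inj:
  assumes "indep_vars (\<lambda>_. S) X I" "inj_on f L" "f ` L \<subseteq> I"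
  shows "indep_vars (\<lambda>_. S) (\<lambda>j. X (f j)) L"
proof -
  have "indep_vars (\<lambda>_. S) (\<lambda>j \<omega>. (\<lambda>x. x (f j)) (\<lambda>i\<in>{f j}. X i \<omega>)) L"
    using assms by (intro indep_vars_group[where K="\<lambda>j. {f j}"])
      (auto simp: disjoint_family_on_def inj_on_def intro: measurable_component_singleton)
  then show ?thesis by simp
qed

lemma indep_vars_PiM_coordinate:
  assumes "\<And>i. i \<in> I \<Longrightarrow> prob_space (Q i)" "\<And>i. i \<in> I \<Longrightarrow> sets (Q i) = sets S"
  shows "prob_space.indep_vars (PiM I Q) (\<lambda>_. S) (\<lambda>i y. y i) I"
proof -
  interpret prob_space "PiM I Q" by (rule prob_space_PiM) fact
  have rv: "(\<lambda>y. y i) \<in> measurable (PiM I Q) S" if "i \<in> I" for i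
    using measurable_component_singleton[OF that, of Q] by (simp add: measurable_cong_sets[OF refl assms(2)[OF that]])
  show ?thesis
  proof (cases "I = {}")
    case True
    then show ?thesis unfolding indep_vars_def2 indep_sets_def by auto
  next
    case False
    have s: "sets (PiM I (\<lambda>_. S)) = sets (PiM I Q)"
      using assms(2) by (intro sets_PiM_cong) auto
    have "distr (PiM I Q) (PiM I (\<lambda>_. S)) (\<lambda>x. \<lambda>i\<in>I. x i) = distr (PiM I Q) (PiM I Q) (\<lambda>x. x)"
      by (rule distr_cong) (auto simp: s space_PiM PiE_def extensional_restrict)
    also have "\<dots> = PiM I (\<lambda>i. distr (PiM I Q) S (\<lambda>y. y i))"
    proof -
      have "distr (PiM I Q) S (\<lambda>y. y i) = Q i" if "i \<in> I" for i
        using distr_PiM_component[of I Q i] assms that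
          distr_cong[of "PiM I Q" "PiM I Q" S "Q i" "\<lambda>y. y i" "\<lambda>y. y i"]
        by simp
      then show ?thesis by (simp cong: PiM_cong)
    qed
    finally show ?thesis
      by (subst indep_vars_iff_distr_eq_PiM'[OF False rv])
  qed
qed

lemma measurable_to_centered_gaussian[simp]: "measurable M (centered_gaussian v) = borel_measurable M"
  by (rule measurable_cong_sets) auto

section \<open>Matrices and the functionals X_l\<close>

definition setcol :: "nat \<Rightarrow> (nat \<Rightarrow> real) \<Rightarrow> (nat \<times> nat \<Rightarrow> real) \<Rightarrow> nat \<times> nat \<Rightarrow> real" where
  "setcol l c z = (\<lambda>(i, j). if j = l then c i else z (i, j))"

abbreviation energy_borel :: "((nat \<Rightarrow> real) \<Rightarrow> real) measure" where
  "energy_borel \<equiv> PiM UNIV (\<lambda>_. borel)"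

abbreviation matrix_borel :: "(nat \<times> nat \<Rightarrow> real) measure" where
  "matrix_borel \<equiv> PiM UNIV (\<lambda>_. borel)"

definition agree :: "nat \<Rightarrow> nat \<Rightarrow> (nat \<times> nat \<Rightarrow> real) \<Rightarrow> (nat \<times> nat \<Rightarrow> real) \<Rightarrow> bool" where
  "agree N l z z' \<longleftrightarrow> (\<forall>i<N. \<forall>j\<le>l. z (i, j) = z' (i, j))"

lemma agree_setcol: "l < j \<Longrightarrow> agree N l (setcol j c z) z"
  by (auto simp: agree_def setcol_def)

lemma setcol_measurable[measurable (raw)]:
  assumes c: "f \<in> measurable M seq_borel" and z: "g \<in> measurable M matrix_borel"
  shows "(\<lambda>x. setcol l (f x) (g x)) \<in> measurable M matrix_borel"
proof (rule measurable_PiM_single')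
  fix i :: "nat \<times> nat"
  show "(\<lambda>x. setcol l (f x) (g x) i) \<in> borel_measurable M"
    using measurable_compose[OF c measurable_component_singleton[of "fst i"]]
      measurable_compose[OF z measurable_component_singleton[of i]]
    by (cases i; cases "snd i = l") (auto simp: setcol_def)
qed (auto simp: space_PiM)

lemma hamiltonian_cong:
  "(\<And>i. i < N \<Longrightarrow> s i = s' i) \<Longrightarrow> hamiltonian N t h s \<sigma> = hamiltonian N t h s' \<sigma>"
  unfolding hamiltonian_def
  by (intro arg_cong2[where f="(+)"] arg_cong2[where f="(*)"] refl sum.cong) auto

lemma matrix_field_agree: "agree N k z z' \<Longrightarrow> i < N \<Longrightarrow> matrix_field k z i = matrix_field k z' i"
  unfolding matrix_field_def agree_def by (intro sum.cong) auto

lemma finite_spins[simp]: "finite (spins N)"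
  by (simp add: spins_def finite_PiE)

lemma spins_nonempty[simp]: "spins N \<noteq> {}"
  by (simp add: spins_def PiE_eq_empty_iff)

lemma spin_abs: "\<sigma> \<in> spins N \<Longrightarrow> i < N \<Longrightarrow> \<bar>\<sigma> i\<bar> = 1"
  by (force simp: spins_def PiE_def Pi_def)

text \<open>\<open>expect_from\<close> integrates the columns l, ..., k, but G reads columns up to l
  only; the integration over the later ones has no effect and a single column remains.\<close>

lemma expect_from_column:
  assumes l: "l \<le> k" and G: "\<And>z z'. agree N l z z' \<Longrightarrow> G z = G z'"
    and m: "(\<lambda>c. G (setcol l c z)) \<in> borel_measurable seq_borel"
  shows "expect_from N k \<xi> q l G z = (\<integral>c. G (setcol l c z) \<partial>column_law N (column_var \<xi> q l))"
proof -
  let ?S = "{..<N} \<times> {l..k}" and ?Q = "\<lambda>(i::nat, p). centered_gaussian (column_var \<xi> q p)"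
  interpret Q: prob_space "PiM ?S ?Q"
    by (rule prob_space_PiM) (auto simp: prob_space_centered_gaussian)
  \<comment> \<open>Extracts column l from the integrated block and pads it by zeros, so that its
    law is \<open>column_law\<close>.\<close>
  define f where "f y i = (if i < N then y (i, l) else 0)" for y :: "nat \<times> nat \<Rightarrow> real" and i
  have ind: "Q.indep_vars (\<lambda>_. borel) (\<lambda>i y. y i) ?S"
    by (rule indep_vars_PiM_coordinate) (auto simp: prob_space_centered_gaussian)
  have "Q.indep_vars (\<lambda>_. borel) (\<lambda>i y. y (i, l)) {..<N}"
    by (rule Q.indep_vars_reindex_inj[OF ind]) (use l in \<open>auto simp: inj_on_def\<close>)
  moreover have "distr (PiM ?S ?Q) borel (\<lambda>y. y (i, l)) = centered_gaussian (column_var \<xi> q l)" if "i < N" for i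
  proof -
    have "distr (PiM ?S ?Q) (?Q (i, l)) (\<lambda>y. y (i, l)) = ?Q (i, l)"
      by (rule distr_PiM_component) (use that l in \<open>auto simp: prob_space_centered_gaussian\<close>)
    then show ?thesis
      using distr_cong[of "PiM ?S ?Q" "PiM ?S ?Q" "?Q (i, l)" borel "\<lambda>y. y (i, l)" "\<lambda>y. y (i, l)"] by simp
  qed
  ultimately have law: "distr (PiM ?S ?Q) seq_borel f = column_law N (column_var \<xi> q l)"
    unfolding f_def[abs_def] by (rule Q.distr_column)
  have fm: "f \<in> measurable (PiM ?S ?Q) seq_borel"
  proof -
    have "(\<lambda>y. y (i, l)) \<in> borel_measurable (PiM ?S ?Q)" if "i < N" for i
      using measurable_component_singleton[of "(i, l)" ?S ?Q] that l by simp
    then have "(\<lambda>y. f y i) \<in> borel_measurable (PiM ?S ?Q)" for i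
      unfolding f_def by (cases "i < N") auto
    then show ?thesis by (intro measurable_PiM_single') (auto simp: space_PiM)
  qed
  have "expect_from N k \<xi> q l G z = (\<integral>y. G (setcol l (f y) z) \<partial>PiM ?S ?Q)"
    unfolding expect_from_def
    by (intro Bochner_Integration.integral_cong refl G)
       (use l in \<open>auto simp: agree_def override_on_def setcol_def f_def\<close>)
  also have "\<dots> = (\<integral>c. G (setcol l c z) \<partial>distr (PiM ?S ?Q) seq_borel f)"
    by (rule integral_distr[OF fm m, symmetric])
  finally show ?thesis by (simp add: law)
qed

text \<open>The columns after l are overridden by the integration variables before the functional of
  level \<open>Suc l\<close> is evaluated, so they cannot influence level l.\<close>

lemma X_fun_agree:
  assumes "l \<le> k" "agree N l z z'"
  shows "X_fun N k \<xi> q m t h l z = X_fun N k \<xi> q m t h l z'"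
  using assms
proof (induction arbitrary: z z' rule: inc_induct)
  case base
  then have "hamiltonian N t h (matrix_field k z) \<sigma> = hamiltonian N t h (matrix_field k z') \<sigma>" for \<sigma>
    by (intro hamiltonian_cong matrix_field_agree)
  then show ?case by (simp add: X_fun.simps)
next
  case (step l)
  have "X_fun N k \<xi> q m t h (Suc l) (override_on z y ({..<N} \<times> {Suc l..k})) =
      X_fun N k \<xi> q m t h (Suc l) (override_on z' y ({..<N} \<times> {Suc l..k}))" for y
    by (rule step.IH) (use step in \<open>auto simp: agree_def override_on_def\<close>)
  then show ?case
    using step by (subst (1 2) X_fun.simps) (simp add: expect_from_def)
qed

lemma X_fun_measurable:
  assumes "l \<le> k"
  shows "(\<lambda>x. X_fun N k \<xi> q m t (fst x) l (snd x)) \<in> borel_measurable (energy_borel \<Otimes>\<^sub>M matrix_borel)"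
  using assms
proof (induction rule: inc_induct)
  case base
  show ?case
    by (simp add: X_fun.simps hamiltonian_def matrix_field_def) measurable
next
  case (step l)
  let ?S = "{..<N} \<times> {Suc l..k}" and ?Q = "\<lambda>(i::nat, p). centered_gaussian (column_var \<xi> q p)"
  let ?PS = "energy_borel \<Otimes>\<^sub>M matrix_borel"
  interpret Q: prob_space "PiM ?S ?Q"
    by (rule prob_space_PiM) (auto simp: prob_space_centered_gaussian)
  have o: "(\<lambda>p. override_on (snd (fst p)) (snd p) ?S) \<in> measurable (?PS \<Otimes>\<^sub>M PiM ?S ?Q) matrix_borel"
  proof (rule measurable_PiM_single')
    fix i :: "nat \<times> nat"
    show "(\<lambda>p. override_on (snd (fst p)) (snd p) ?S i) \<in> borel_measurable (?PS \<Otimes>\<^sub>M PiM ?S ?Q)"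
    proof (cases "i \<in> ?S")
      case True
      have "(\<lambda>y. y i) \<in> borel_measurable (PiM ?S ?Q)"
        using measurable_component_singleton[OF True, of ?Q] True by (cases i) simp
      then have "(\<lambda>p. snd p i) \<in> borel_measurable (?PS \<Otimes>\<^sub>M PiM ?S ?Q)"
        by (rule measurable_compose[OF measurable_snd])
      then show ?thesis using True by simp
    next
      case False
      then show ?thesis by simp
    qed
  qed (auto simp: space_PiM)
  have "(\<lambda>p. X_fun N k \<xi> q m t (fst (fst p)) (Suc l) (override_on (snd (fst p)) (snd p) ?S))
      \<in> borel_measurable (?PS \<Otimes>\<^sub>M PiM ?S ?Q)"
    using measurable_compose[OF measurable_Pair[OF _ o] step.IH, of "\<lambda>p. fst (fst p)"] by simp
  then have "(\<lambda>(x, y). exp (m (Suc l) * X_fun N k \<xi> q m t (fst x) (Suc l) (override_on (snd x) y ?S)))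
      \<in> borel_measurable (?PS \<Otimes>\<^sub>M PiM ?S ?Q)"
    unfolding case_prod_unfold by measurable
  then have "(\<lambda>x. expect_from N k \<xi> q (Suc l) (\<lambda>z'. exp (m (Suc l) * X_fun N k \<xi> q m t (fst x) (Suc l) z')) (snd x))
      \<in> borel_measurable ?PS"
    unfolding expect_from_def by (rule Q.borel_measurable_lebesgue_integral)
  then show ?case
    using step by (subst X_fun.simps) simp
qed

section \<open>Finiteness and the exponential recursion of X_l\<close>

locale spin_params =
  fixes N k :: nat and \<xi> :: "real \<Rightarrow> real" and q m :: "nat \<Rightarrow> real" and t :: real
  assumes m_zero: "m 0 = 0" and m_mono: "\<And>l. l < k \<Longrightarrow> m l < m (Suc l)" and m_last: "m k < 1"
begin

abbreviation "state \<equiv> energy_borel \<Otimes>\<^sub>M matrix_borel"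

definition Xc :: "nat \<Rightarrow> ((nat \<Rightarrow> real) \<Rightarrow> real) \<times> (nat \<times> nat \<Rightarrow> real) \<Rightarrow> real" where
  "Xc l x = X_fun N k \<xi> q m t (fst x) l (snd x)"

definition partition_fun :: "nat \<Rightarrow> ((nat \<Rightarrow> real) \<Rightarrow> real) \<times> (nat \<times> nat \<Rightarrow> real) \<Rightarrow> real" where
  "partition_fun l x = (\<Sum>\<sigma>\<in>spins N. exp (hamiltonian N t (fst x) (matrix_field l (snd x)) \<sigma>))"

definition col :: "nat \<Rightarrow> (nat \<Rightarrow> real) measure" where
  "col l = column_law N (column_var \<xi> q l)"

definition updc :: "nat \<Rightarrow> (nat \<Rightarrow> real) \<Rightarrow> ((nat \<Rightarrow> real) \<Rightarrow> real) \<times> (nat \<times> nat \<Rightarrow> real) \<Rightarrow>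
    ((nat \<Rightarrow> real) \<Rightarrow> real) \<times> (nat \<times> nat \<Rightarrow> real)" where
  "updc l c x = (fst x, setcol l c (snd x))"

lemma updc_simps[simp]: "fst (updc l c x) = fst x" "snd (updc l c x) = setcol l c (snd x)"
  by (simp_all add: updc_def)

lemma m_Suc_pos: "l < k \<Longrightarrow> 0 < m (Suc l)"
proof (induction l)
  case 0
  then show ?case using m_mono[of 0] m_zero by simp
next
  case (Suc l)
  then show ?case using m_mono[of "Suc l"] by simp
qed

lemma partition_fun_pos: "0 < partition_fun l x"
  unfolding partition_fun_def by (intro sum_pos) auto

text \<open>Spins have absolute value 1, so adding a column raises each exponent by at most a
  multiple of the sum of the absolute entries of that column.\<close>

lemma partition_fun_le:
  "partition_fun (Suc l) (updc (Suc l) c x) \<le> partition_fun l x * exp (\<bar>sqrt (1 - t)\<bar> * (\<Sum>i<N. \<bar>c i\<bar>))"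
  unfolding partition_fun_def sum_distrib_right
proof (rule sum_mono)
  fix \<sigma> assume \<sigma>: "\<sigma> \<in> spins N"
  have "matrix_field (Suc l) (snd (updc (Suc l) c x)) i = matrix_field l (snd x) i + c i" for i
    by (simp add: matrix_field_def setcol_def)
  then have h: "hamiltonian N t (fst (updc (Suc l) c x)) (matrix_field (Suc l) (snd (updc (Suc l) c x))) \<sigma> =
      hamiltonian N t (fst x) (matrix_field l (snd x)) \<sigma> + sqrt (1 - t) * (\<Sum>i<N. c i * \<sigma> i)"
    by (simp add: hamiltonian_def distrib_right sum.distrib distrib_left)
  have "\<bar>\<Sum>i<N. c i * \<sigma> i\<bar> \<le> (\<Sum>i<N. \<bar>c i * \<sigma> i\<bar>)" by (rule sum_abs)
  also have "\<dots> = (\<Sum>i<N. \<bar>c i\<bar>)" using spin_abs[OF \<sigma>] by (simp add: abs_mult)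
  finally have "\<bar>sqrt (1 - t) * (\<Sum>i<N. c i * \<sigma> i)\<bar> \<le> \<bar>sqrt (1 - t)\<bar> * (\<Sum>i<N. \<bar>c i\<bar>)"
    unfolding abs_mult by (intro mult_left_mono) auto
  then have "sqrt (1 - t) * (\<Sum>i<N. c i * \<sigma> i) \<le> \<bar>sqrt (1 - t)\<bar> * (\<Sum>i<N. \<bar>c i\<bar>)"
    by (rule abs_le_D1)
  then show "exp (hamiltonian N t (fst (updc (Suc l) c x)) (matrix_field (Suc l) (snd (updc (Suc l) c x))) \<sigma>)
      \<le> exp (hamiltonian N t (fst x) (matrix_field l (snd x)) \<sigma>) * exp (\<bar>sqrt (1 - t)\<bar> * (\<Sum>i<N. \<bar>c i\<bar>))"
    unfolding h by (simp add: exp_add[symmetric])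
qed

lemma Xc_measurable: "l \<le> k \<Longrightarrow> Xc l \<in> borel_measurable state"
  unfolding Xc_def[abs_def] by (rule X_fun_measurable)

lemma exp_Xc_top: "exp (Xc k x) = partition_fun k x"
proof -
  have "0 < (\<Sum>\<sigma>\<in>spins N. exp (hamiltonian N t (fst x) (matrix_field k (snd x)) \<sigma>))"
    using partition_fun_pos[of k x] by (simp add: partition_fun_def)
  then show ?thesis
    by (simp add: Xc_def partition_fun_def X_fun.simps)
qed

lemma updc_measurable_column: "(\<lambda>c. updc l c x) \<in> measurable seq_borel state"
  unfolding updc_def by (intro measurable_Pair setcol_measurable) (auto simp: space_PiM)

text \<open>\<open>X_fun\<close> is defined by a Bochner integral and \<open>ln\<close>, which carry
  information only if the integral exists and is positive. The bound by \<open>partition_fun\<close>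
  gives integrability through the exponential moments of a column, and raising to the power
  \<open>1 / m (Suc l)\<close> passes the bound on to level l.\<close>

lemma Xc_step:
  assumes l: "l < k" and K: "0 < K" "\<And>x. exp (Xc (Suc l) x) \<le> K * partition_fun (Suc l) x"
  shows "(\<integral>\<^sup>+c. ennreal (exp (m (Suc l) * Xc (Suc l) (updc (Suc l) c x))) \<partial>col (Suc l)) = ennreal (exp (m (Suc l) * Xc l x))"
    and "\<exists>K'>0. \<forall>x. exp (Xc l x) \<le> K' * partition_fun l x"
proof -
  let ?m = "m (Suc l)" and ?b = "\<bar>sqrt (1 - t)\<bar>"
  interpret C: prob_space "col (Suc l)" unfolding col_def by (rule prob_space_column_law)
  have m: "0 < ?m" by (rule m_Suc_pos[OF l])
  define Mr where "Mr = enn2real (\<integral>\<^sup>+c. ennreal (exp ((?m * ?b) * (\<Sum>i<N. \<bar>c i\<bar>))) \<partial>col (Suc l))"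
  have Mr: "(\<integral>\<^sup>+c. ennreal (exp ((?m * ?b) * (\<Sum>i<N. \<bar>c i\<bar>))) \<partial>col (Suc l)) = ennreal Mr"
    unfolding Mr_def using nn_integral_exp_column[where a="?m * ?b" and N=N and v="column_var \<xi> q (Suc l)"] by (simp add: col_def)
  have sc: "(\<lambda>c. \<Sum>i<N. \<bar>c i\<bar>) \<in> borel_measurable (col (Suc l))"
    unfolding col_def measurable_column_law by measurable
  define E where "E x c = exp (?m * Xc (Suc l) (updc (Suc l) c x))" for x c
  have Em: "E x \<in> borel_measurable (col (Suc l))" for x
  proof -
    have "(\<lambda>c. Xc (Suc l) (updc (Suc l) c x)) \<in> borel_measurable seq_borel"
      using l by (intro measurable_compose[OF updc_measurable_column Xc_measurable]) auto
    then show ?thesis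
      unfolding E_def col_def measurable_column_law by measurable
  qed
  have Ebound: "E x c \<le> (K * partition_fun l x) powr ?m * exp ((?m * ?b) * (\<Sum>i<N. \<bar>c i\<bar>))" for x c
  proof -
    have "E x c = exp (Xc (Suc l) (updc (Suc l) c x)) powr ?m"
      by (simp add: E_def powr_def)
    also have "\<dots> \<le> (K * (partition_fun l x * exp (?b * (\<Sum>i<N. \<bar>c i\<bar>)))) powr ?m"
      using m K(1) order_trans[OF K(2) mult_left_mono[OF partition_fun_le]] by (intro powr_mono2) auto
    also have "\<dots> = (K * partition_fun l x) powr ?m * exp (?b * (\<Sum>i<N. \<bar>c i\<bar>)) powr ?m"
      using K(1) partition_fun_pos[of l x] by (simp only: mult.assoc[symmetric]) (simp add: powr_mult)
    also have "exp (?b * (\<Sum>i<N. \<bar>c i\<bar>)) powr ?m = exp ((?m * ?b) * (\<Sum>i<N. \<bar>c i\<bar>))"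
      by (simp add: powr_def mult_ac)
    finally show ?thesis .
  qed
  have nnE: "(\<integral>\<^sup>+c. ennreal (E x c) \<partial>col (Suc l)) \<le> ennreal ((K * partition_fun l x) powr ?m) * ennreal Mr" for x
  proof -
    have "(\<integral>\<^sup>+c. ennreal (E x c) \<partial>col (Suc l)) \<le>
        (\<integral>\<^sup>+c. ennreal ((K * partition_fun l x) powr ?m) * ennreal (exp ((?m * ?b) * (\<Sum>i<N. \<bar>c i\<bar>))) \<partial>col (Suc l))"
      by (intro nn_integral_mono) (simp add: ennreal_mult[symmetric] ennreal_leI[OF Ebound])
    also have "\<dots> = ennreal ((K * partition_fun l x) powr ?m) * ennreal Mr"
      using sc by (subst nn_integral_cmult) (auto simp: Mr)
    finally show ?thesis .
  qed
  have int: "integrable (col (Suc l)) (E x)" for x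
  proof (rule integrableI_nonneg)
    show "(\<integral>\<^sup>+c. ennreal (E x c) \<partial>col (Suc l)) < \<infinity>"
      using nnE[of x] by (auto simp: ennreal_mult_less_top intro: le_less_trans)
  qed (auto simp: Em E_def)
  have I: "exp (?m * Xc l x) = (\<integral>c. E x c \<partial>col (Suc l))" for x
  proof -
    have "expect_from N k \<xi> q (Suc l) (\<lambda>z'. exp (?m * X_fun N k \<xi> q m t (fst x) (Suc l) z')) (snd x) =
        (\<integral>c. E x c \<partial>col (Suc l))"
      unfolding E_def Xc_def col_def updc_simps
    proof (rule expect_from_column)
      show "Suc l \<le> k" using l by simp
      show "exp (?m * X_fun N k \<xi> q m t (fst x) (Suc l) z) = exp (?m * X_fun N k \<xi> q m t (fst x) (Suc l) z')"
        if "agree N (Suc l) z z'" for z z'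
        using X_fun_agree[OF _ that, of k \<xi> q m t "fst x"] l by simp
      show "(\<lambda>c. exp (?m * X_fun N k \<xi> q m t (fst x) (Suc l) (setcol (Suc l) c (snd x)))) \<in> borel_measurable seq_borel"
        using Em[of x] unfolding E_def Xc_def col_def measurable_column_law updc_simps .
    qed
    then have "?m * Xc l x = ln (\<integral>c. E x c \<partial>col (Suc l))"
      using l m unfolding Xc_def by (subst X_fun.simps) simp
    moreover have "0 < (\<integral>c. E x c \<partial>col (Suc l))"
    proof -
      have "(\<integral>c. E x c \<partial>col (Suc l)) \<noteq> 0"
      proof
        assume "(\<integral>c. E x c \<partial>col (Suc l)) = 0"
        then have "AE c in col (Suc l). E x c = 0"
          using int by (subst (asm) integral_nonneg_eq_0_iff_AE) (auto simp: E_def)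
        then have "AE c in col (Suc l). False" by (simp add: E_def)
        then show False by simp
      qed
      moreover have "0 \<le> (\<integral>c. E x c \<partial>col (Suc l))"
        by (rule Bochner_Integration.integral_nonneg) (simp add: E_def)
      ultimately show ?thesis by simp
    qed
    ultimately show ?thesis by simp
  qed
  have nnI: "(\<integral>\<^sup>+c. ennreal (E x c) \<partial>col (Suc l)) = ennreal (exp (?m * Xc l x))" for x
    unfolding I by (rule nn_integral_eq_integral[OF int]) (simp add: E_def)
  show "(\<integral>\<^sup>+c. ennreal (exp (m (Suc l) * Xc (Suc l) (updc (Suc l) c x))) \<partial>col (Suc l)) = ennreal (exp (m (Suc l) * Xc l x))"
    using nnI[of x] by (simp add: E_def)
  \<comment> \<open>The maximum with 1 keeps the new constant positive.\<close>
  define Mm where "Mm = max 1 Mr"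
  have Mm: "0 < Mm" "Mr \<le> Mm" by (auto simp: Mm_def)
  have "exp (Xc l x) \<le> (K * Mm powr (1 / ?m)) * partition_fun l x" for x
  proof -
    have "ennreal (exp (?m * Xc l x)) \<le> ennreal ((K * partition_fun l x) powr ?m * Mm)"
      using nnE[of x] Mm unfolding nnI by (simp add: ennreal_mult' mult_left_mono ennreal_leI order_trans)
    then have "exp (?m * Xc l x) \<le> (K * partition_fun l x) powr ?m * Mm"
      by (subst (asm) ennreal_le_iff) (use Mm in auto)
    then have "exp (?m * Xc l x) powr (1 / ?m) \<le> ((K * partition_fun l x) powr ?m * Mm) powr (1 / ?m)"
      using m by (intro powr_mono2) auto
    also have "exp (?m * Xc l x) powr (1 / ?m) = exp (Xc l x)"
      using m by (simp add: powr_def)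
    also have "((K * partition_fun l x) powr ?m * Mm) powr (1 / ?m) = (K * partition_fun l x) * Mm powr (1 / ?m)"
      using m K(1) partition_fun_pos[of l x] Mm by (simp add: powr_mult powr_powr)
    finally show ?thesis by (simp add: mult_ac)
  qed
  moreover have "0 < K * Mm powr (1 / ?m)" using K Mm by simp
  ultimately show "\<exists>K'>0. \<forall>x. exp (Xc l x) \<le> K' * partition_fun l x" by blast
qed

lemma exp_Xc_bound: "l \<le> k \<Longrightarrow> \<exists>K>0. \<forall>x. exp (Xc l x) \<le> K * partition_fun l x"
proof (induction rule: inc_induct)
  case base
  then show ?case by (intro exI[of _ 1]) (simp add: exp_Xc_top)
next
  case (step l)
  then obtain K where "0 < K" "\<And>x. exp (Xc (Suc l) x) \<le> K * partition_fun (Suc l) x" by auto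
  then show ?case using Xc_step(2) step(2) by blast
qed

lemma nn_integral_exp_Xc:
  assumes "l < k"
  shows "(\<integral>\<^sup>+c. ennreal (exp (m (Suc l) * Xc (Suc l) (updc (Suc l) c x))) \<partial>col (Suc l)) = ennreal (exp (m (Suc l) * Xc l x))"
proof -
  obtain K where "0 < K" "\<And>x. exp (Xc (Suc l) x) \<le> K * partition_fun (Suc l) x"
    using exp_Xc_bound[of "Suc l"] assms by auto
  from Xc_step(1)[OF assms this] show ?thesis .
qed

text \<open>The given parameters are specified only up to k; the value 1 at \<open>Suc k\<close> is
  the index of the degenerate law at the leaves.\<close>

definition mh :: "nat \<Rightarrow> real" where
  "mh = m(Suc k := 1)"

lemma cascade_intro:
  assumes "\<And>p. prob_space (\<rho> p)" "\<And>p. sets (\<rho> p) = sets seq_borel"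
    "\<And>p. length p < k \<Longrightarrow> poisson_points (\<rho> p) (power_intensity (m (Suc (length p)))) (\<lambda>n x. x n)"
  shows "cascade k mh col \<rho> state updc (partition_fun k) (\<lambda>l x. exp (Xc l x))"
proof (rule cascade.intro)
  show "mh l < mh (Suc l)" if "l \<le> k" for l
    using that m_mono[of l] m_last by (cases "l = k") (auto simp: mh_def)
  show "prob_space (col l)" for l by (simp add: col_def prob_space_column_law)
  show "sets (col l) = sets seq_borel" for l by (simp add: col_def sets_column_law)
  show "(\<lambda>x. updc l (fst x) (snd x)) \<in> measurable (seq_borel \<Otimes>\<^sub>M state) state" for l
    unfolding updc_def by measurable
  show "(\<lambda>x. exp (Xc l x)) \<in> borel_measurable state" if "l \<le> k" for l
    using Xc_measurable[OF that] by measurable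
  show "(\<lambda>x. exp (Xc k x)) = partition_fun k" by (simp add: exp_Xc_top fun_eq_iff)
  show "(\<integral>\<^sup>+c. ennreal (exp (Xc (Suc l) (updc (Suc l) c \<zeta>)) powr mh (Suc l)) \<partial>col (Suc l)) =
     ennreal (exp (Xc l \<zeta>) powr mh (Suc l))" if "l < k" for l \<zeta>
    using nn_integral_exp_Xc[OF that, of \<zeta>] that by (simp add: powr_def mh_def)
  show "poisson_points (\<rho> p) (power_intensity (mh (Suc (length p)))) (\<lambda>n x. x n)"
    if "length p < k" for p
    using assms(3)[OF that] that by (simp add: mh_def)
qed (use m_zero assms in \<open>auto simp: mh_def space_PiM space_pair_measure\<close>)

end

section \<open>Iterated averages in terms of the factors W_l\<close>

locale spin_cascade = spin_params +
  fixes \<rho> :: "nat list \<Rightarrow> (nat \<Rightarrow> real) measure"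
  assumes seq_prob: "\<And>p. prob_space (\<rho> p)" and seq_sets: "\<And>p. sets (\<rho> p) = sets seq_borel"
    and seq_points: "\<And>p. length p < k \<Longrightarrow>
      poisson_points (\<rho> p) (power_intensity (m (Suc (length p)))) (\<lambda>n x. x n)"
begin

sublocale cascade k mh col \<rho> state updc "partition_fun k" "\<lambda>l x. exp (Xc l x)"
  by (rule cascade_intro[OF seq_prob seq_sets seq_points])

definition Wc :: "nat \<Rightarrow> ((nat \<Rightarrow> real) \<Rightarrow> real) \<times> (nat \<times> nat \<Rightarrow> real) \<Rightarrow> ennreal" where
  "Wc l x = ennreal (exp (m l * (Xc l x - Xc (l - 1) x)))"

text \<open>Adaptedness: the value is a function of the energies and of the columns 0, ...,
  l.\<close>

definition up_to :: "nat \<Rightarrow> (((nat \<Rightarrow> real) \<Rightarrow> real) \<times> (nat \<times> nat \<Rightarrow> real) \<Rightarrow> 'b) \<Rightarrow> bool" where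
  "up_to l Q \<longleftrightarrow> (\<forall>h z z'. agree N l z z' \<longrightarrow> Q (h, z) = Q (h, z'))"

lemma up_toD: "up_to l Q \<Longrightarrow> fst x = fst x' \<Longrightarrow> agree N l (snd x) (snd x') \<Longrightarrow> Q x = Q x'"
  unfolding up_to_def by (cases x; cases x') auto

lemma agree_mono: "agree N l z z' \<Longrightarrow> l' \<le> l \<Longrightarrow> agree N l' z z'"
  by (auto simp: agree_def)

lemma Xc_up_to: "l \<le> k \<Longrightarrow> up_to l (Xc l)"
  by (simp add: up_to_def Xc_def X_fun_agree)

lemma Wc_up_to: "l \<le> k \<Longrightarrow> up_to l (Wc l)"
  unfolding up_to_def
proof (intro allI impI)
  fix h z z' assume l: "l \<le> k" and a: "agree N l z z'"
  have "Xc l (h, z) = Xc l (h, z')"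
    by (rule up_toD[OF Xc_up_to[OF l]]) (simp_all add: a)
  moreover have "Xc (l - 1) (h, z) = Xc (l - 1) (h, z')"
    by (rule up_toD[OF Xc_up_to]) (use l agree_mono[OF a, of "l - 1"] in auto)
  ultimately show "Wc l (h, z) = Wc l (h, z')" by (simp only: Wc_def)
qed

lemma Wc_measurable[measurable]: "l \<le> k \<Longrightarrow> Wc l \<in> borel_measurable state"
proof -
  assume "l \<le> k"
  then have [measurable]: "Xc l \<in> borel_measurable state" "Xc (l - 1) \<in> borel_measurable state"
    by (auto intro: Xc_measurable)
  show ?thesis unfolding Wc_def by measurable
qed

text \<open>Column \<open>Suc l\<close> does not affect \<open>Xc l\<close>, so the density in
  \<open>avg\<close>, a power of a ratio of exponentials, is the factor \<open>Wc (Suc l)\<close> at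
  the updated state.\<close>

lemma avg_eq: "l < k \<Longrightarrow> avg l Q x = (\<integral>\<^sup>+c. Q (updc (Suc l) c x) * Wc (Suc l) (updc (Suc l) c x) \<partial>col (Suc l))"
proof -
  assume l: "l < k"
  have "Xc l (updc (Suc l) c x) = Xc l x" for c
    by (rule up_toD[OF Xc_up_to]) (use l in \<open>auto intro: agree_setcol\<close>)
  then have "ennreal ((exp (Xc (Suc l) (updc (Suc l) c x)) / exp (Xc l x)) powr m (Suc l)) = Wc (Suc l) (updc (Suc l) c x)" for c
    by (simp add: Wc_def exp_diff[symmetric] powr_def)
  moreover have "mh (Suc l) = m (Suc l)" using l by (simp add: mh_def)
  ultimately show ?thesis unfolding avg_def by (simp only:)
qed

lemma avg_up_to: "l < k \<Longrightarrow> up_to (Suc l) Q \<Longrightarrow> up_to l (avg l Q)"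
proof -
  assume l: "l < k" and Q: "up_to (Suc l) Q"
  show ?thesis unfolding up_to_def avg_eq[OF l]
  proof (intro allI impI nn_integral_cong arg_cong2[where f="(*)"])
    fix h z z' c assume a: "agree N l z z'"
    have a': "agree N (Suc l) (setcol (Suc l) c z) (setcol (Suc l) c z')"
      using a by (auto simp: agree_def setcol_def le_Suc_eq)
    show "Q (updc (Suc l) c (h, z)) = Q (updc (Suc l) c (h, z'))"
      by (rule up_toD[OF Q]) (use a' in auto)
    show "Wc (Suc l) (updc (Suc l) c (h, z)) = Wc (Suc l) (updc (Suc l) c (h, z'))"
      by (rule up_toD[OF Wc_up_to]) (use a' l in auto)
  qed
qed

lemma GG_up_to:
  assumes A: "up_to k A" and "l \<le> k"
  shows "up_to l (GG A l)"
  using assms(2)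
proof (induction rule: inc_induct)
  case base
  have "up_to k (\<lambda>x. exp (Xc k x))"
    unfolding up_to_def by (auto intro!: up_toD[OF Xc_up_to])
  then show ?case using A unfolding GG_k up_to_def by (simp add: exp_Xc_top)
next
  case (step l)
  then show ?case by (simp add: GG_rec avg_up_to)
qed

lemma Qd_up_to: "up_to k A \<Longrightarrow> up_to k B \<Longrightarrow> r < k \<Longrightarrow> e \<le> r \<Longrightarrow> up_to (r - e) (Qd A B r e)"
proof (induction e)
  case 0
  then show ?case using GG_up_to[of A r] GG_up_to[of B r] by (simp add: up_to_def)
next
  case (Suc e)
  then have "up_to (Suc (r - Suc e)) (Qd A B r e)" by (simp add: Suc_diff_Suc)
  then show ?case using Suc.prems by (auto intro: avg_up_to)
qed

subsection \<open>Coupled copies\<close>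

definition col_of :: "nat \<times> nat \<Rightarrow> (nat \<Rightarrow> real) measure" where
  "col_of i = col (snd i)"

sublocale Z: coordinates col_of
proof (rule coordinates.intro)
  show "prob_space (col_of i)" for i by (simp add: col_of_def col_def prob_space_column_law)
  show "space (col_of i) = UNIV" for i
    using sets_eq_imp_space_eq[OF sets_column_law] by (simp add: col_of_def col_def space_PiM)
qed

lemma measurable_col_of: "measurable (col_of i) K = measurable seq_borel K"
  by (simp add: col_of_def col_def measurable_column_law)

lemma Z_column[measurable]: "(\<lambda>y. y i) \<in> measurable Z.P seq_borel"
  using Z.measurable_coordinate[of i]
  unfolding col_of_def col_def measurable_cong_sets[OF refl sets_column_law] .

text \<open>The first copy uses the columns \<open>(1, l)\<close>; the second one replaces those with \<open>r \<le> l\<close> by \<open>(2, l)\<close>.\<close>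

definition copy1 :: "((nat \<Rightarrow> real) \<Rightarrow> real) \<Rightarrow> (nat \<times> nat \<Rightarrow> nat \<Rightarrow> real) \<Rightarrow>
    ((nat \<Rightarrow> real) \<Rightarrow> real) \<times> (nat \<times> nat \<Rightarrow> real)" where
  "copy1 h y = (h, \<lambda>(i, l). y (1, l) i)"

definition copy2 :: "nat \<Rightarrow> ((nat \<Rightarrow> real) \<Rightarrow> real) \<Rightarrow> (nat \<times> nat \<Rightarrow> nat \<Rightarrow> real) \<Rightarrow>
    ((nat \<Rightarrow> real) \<Rightarrow> real) \<times> (nat \<times> nat \<Rightarrow> real)" where
  "copy2 r h y = (h, \<lambda>(i, l). y (if l < r then 1 else 2, l) i)"

lemma copy_measurable:
  "(\<lambda>y. (h, \<lambda>(i, l). y (f l, l) i)) \<in> measurable Z.P state"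
proof (intro measurable_Pair measurable_PiM_single')
  fix i :: "nat \<times> nat"
  show "(\<lambda>y. (case i of (i, l) \<Rightarrow> y (f l, l) i)) \<in> borel_measurable Z.P"
    using measurable_compose[OF Z_column measurable_component_singleton] by (cases i) simp
qed (auto simp: space_PiM)

lemma copy1_measurable[measurable]: "copy1 h \<in> measurable Z.P state"
  unfolding copy1_def[abs_def] by (rule copy_measurable[of h "\<lambda>_. 1"])

lemma copy2_measurable[measurable]: "copy2 r h \<in> measurable Z.P state"
  unfolding copy2_def[abs_def] by (rule copy_measurable[of h "\<lambda>l. if l < r then 1 else 2"])

text \<open>Resampling the column \<open>(j, Suc l)\<close> changes \<pi> by \<open>updc\<close> and
  leaves R fixed, so integrating that column against its factor W is \<open>avg\<close>, by
  \<open>avg_eq\<close>.\<close>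

lemma peel:
  assumes l: "l < k" and [measurable]: "\<pi> \<in> measurable Z.P state" "Q \<in> borel_measurable state" "R \<in> borel_measurable Z.P"
    and \<pi>: "\<And>y y'. \<pi> (override_on y y' {(j, Suc l)}) = updc (Suc l) (y' (j, Suc l)) (\<pi> y)"
    and R: "\<And>y y'. R (override_on y y' {(j, Suc l)}) = R y"
  shows "(\<integral>\<^sup>+y. R y * (Wc (Suc l) (\<pi> y) * Q (\<pi> y)) \<partial>Z.P) = (\<integral>\<^sup>+y. R y * avg l Q (\<pi> y) \<partial>Z.P)"
proof -
  have [measurable]: "Wc (Suc l) \<in> borel_measurable state" using l by auto
  have "(\<integral>\<^sup>+y. R y * (Wc (Suc l) (\<pi> y) * Q (\<pi> y)) \<partial>Z.P) =
    (\<integral>\<^sup>+y. \<integral>\<^sup>+y'. R y * (Wc (Suc l) (updc (Suc l) (y' (j, Suc l)) (\<pi> y)) * Q (updc (Suc l) (y' (j, Suc l)) (\<pi> y))) \<partial>Z.P \<partial>Z.P)"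
    by (subst Z.decouple[where J="{(j, Suc l)}"]) (auto simp: \<pi> R)
  also have "\<dots> = (\<integral>\<^sup>+y. R y * avg l Q (\<pi> y) \<partial>Z.P)"
  proof (rule nn_integral_cong)
    fix y
    have u: "(\<lambda>c. updc (Suc l) c (\<pi> y)) \<in> measurable seq_borel state" by (rule updc_measurable_column)
    have um: "(\<lambda>c. Wc (Suc l) (updc (Suc l) c (\<pi> y)) * Q (updc (Suc l) c (\<pi> y))) \<in> borel_measurable (col_of (j, Suc l))"
      unfolding col_of_def col_def measurable_column_law by (rule measurable_compose[OF u]) measurable
    have "(\<lambda>y'. Wc (Suc l) (updc (Suc l) (y' (j, Suc l)) (\<pi> y)) * Q (updc (Suc l) (y' (j, Suc l)) (\<pi> y))) \<in> borel_measurable Z.P"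
      by (rule measurable_compose[OF measurable_compose[OF Z_column u]]) measurable
    then have "(\<integral>\<^sup>+y'. R y * (Wc (Suc l) (updc (Suc l) (y' (j, Suc l)) (\<pi> y)) * Q (updc (Suc l) (y' (j, Suc l)) (\<pi> y))) \<partial>Z.P) =
        R y * (\<integral>\<^sup>+y'. (Wc (Suc l) (updc (Suc l) (y' (j, Suc l)) (\<pi> y)) * Q (updc (Suc l) (y' (j, Suc l)) (\<pi> y))) \<partial>Z.P)"
      by (rule nn_integral_cmult)
    also have "(\<integral>\<^sup>+y'. (Wc (Suc l) (updc (Suc l) (y' (j, Suc l)) (\<pi> y)) * Q (updc (Suc l) (y' (j, Suc l)) (\<pi> y))) \<partial>Z.P) = avg l Q (\<pi> y)"
      unfolding avg_eq[OF l] Z.nn_integral_coordinate[OF um] by (simp add: col_of_def mult.commute)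
    finally show "(\<integral>\<^sup>+y'. R y * (Wc (Suc l) (updc (Suc l) (y' (j, Suc l)) (\<pi> y)) * Q (updc (Suc l) (y' (j, Suc l)) (\<pi> y))) \<partial>Z.P) =
      R y * avg l Q (\<pi> y)" .
  qed
  finally show ?thesis .
qed

text \<open>Columns are removed from the last one down: the factors \<open>Wc i\<close> with smaller
  i do not read the column being removed, so they join S in the fixed factor R of
  \<open>peel\<close>.\<close>

lemma peel_columns:
  assumes [measurable]: "\<pi> \<in> measurable Z.P state" "S \<in> borel_measurable Z.P"
    and G: "\<And>l. l0 \<le> l \<Longrightarrow> l \<le> k0 \<Longrightarrow> G l \<in> borel_measurable state"
      "\<And>l. l0 \<le> l \<Longrightarrow> l < k0 \<Longrightarrow> G l = avg l (G (Suc l))"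
    and \<pi>: "\<And>l y y'. l0 \<le> l \<Longrightarrow> \<pi> (override_on y y' {(j, Suc l)}) = updc (Suc l) (y' (j, Suc l)) (\<pi> y)"
    and S: "\<And>l y y'. l0 \<le> l \<Longrightarrow> S (override_on y y' {(j, Suc l)}) = S y"
    and k0: "k0 \<le> k" and l: "l0 \<le> l" "l \<le> k0"
  shows "(\<integral>\<^sup>+y. S y * ((\<Prod>i\<in>{Suc l0..l}. Wc i (\<pi> y)) * G l (\<pi> y)) \<partial>Z.P) = (\<integral>\<^sup>+y. S y * G l0 (\<pi> y) \<partial>Z.P)"
  using l
proof (induction rule: dec_induct)
  case base
  then show ?case by simp
next
  case (step l)
  let ?R = "\<lambda>y. S y * (\<Prod>i\<in>{Suc l0..l}. Wc i (\<pi> y))"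
  have lk: "l < k" using step k0 by simp
  have [measurable]: "Wc i \<in> borel_measurable state" if "i \<in> {Suc l0..l}" for i
    using that lk by auto
  have Rm: "?R \<in> borel_measurable Z.P"
    by (intro borel_measurable_times_ennreal borel_measurable_prod_ennreal measurable_compose[OF assms(1)]) measurable
  have "(\<integral>\<^sup>+y. S y * ((\<Prod>i\<in>{Suc l0..Suc l}. Wc i (\<pi> y)) * G (Suc l) (\<pi> y)) \<partial>Z.P) =
      (\<integral>\<^sup>+y. ?R y * (Wc (Suc l) (\<pi> y) * G (Suc l) (\<pi> y)) \<partial>Z.P)"
    using step by (simp add: mult_ac)
  also have "\<dots> = (\<integral>\<^sup>+y. ?R y * avg l (G (Suc l)) (\<pi> y) \<partial>Z.P)"
  proof (rule peel[OF lk assms(1) _ Rm \<pi>])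
    show "G (Suc l) \<in> borel_measurable state" using step by (intro G) auto
    show "?R (override_on y y' {(j, Suc l)}) = ?R y" for y y'
    proof -
      have "Wc i (\<pi> (override_on y y' {(j, Suc l)})) = Wc i (\<pi> y)" if "i \<in> {Suc l0..l}" for i
        unfolding \<pi>[OF step(1)]
        by (rule up_toD[OF Wc_up_to]) (use that lk in \<open>auto intro: agree_setcol\<close>)
      then show ?thesis using S[OF step(1)] by simp
    qed
  qed (use step in auto)
  also have "avg l (G (Suc l)) = G l" using G(2)[of l] step by simp
  also have "(\<integral>\<^sup>+y. ?R y * G l (\<pi> y) \<partial>Z.P) = (\<integral>\<^sup>+y. S y * G l0 (\<pi> y) \<partial>Z.P)"
    using step by (simp add: mult.assoc)
  finally show ?case .
qed

lemma copy1_override: "copy1 h (override_on y y' {(1, l)}) = updc l (y' (1, l)) (copy1 h y)"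
  by (auto simp: copy1_def updc_def setcol_def override_on_def fun_eq_iff)

lemma copy1_override_2: "copy1 h (override_on y y' {(2, l)}) = copy1 h y"
  by (auto simp: copy1_def override_on_def fun_eq_iff)

lemma copy2_override:
  assumes "r \<le> l"
  shows "copy2 r h (override_on y y' {(2, l)}) = updc l (y' (2, l)) (copy2 r h y)"
proof (rule prod_eqI)
  show "snd (copy2 r h (override_on y y' {(2, l)})) = snd (updc l (y' (2, l)) (copy2 r h y))"
  proof
    fix i :: "nat \<times> nat"
    show "snd (copy2 r h (override_on y y' {(2, l)})) i = snd (updc l (y' (2, l)) (copy2 r h y)) i"
      using assms by (cases i; cases "snd i < r") (auto simp: copy2_def setcol_def override_on_def)
  qed
qed (simp add: copy2_def)

lemma copy2_override_1:
  assumes "r \<le> l"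
  shows "copy2 r h (override_on y y' {(1, l)}) = copy2 r h y"
proof (rule prod_eqI)
  show "snd (copy2 r h (override_on y y' {(1, l)})) = snd (copy2 r h y)"
  proof
    fix i :: "nat \<times> nat"
    show "snd (copy2 r h (override_on y y' {(1, l)})) i = snd (copy2 r h y) i"
      using assms by (cases i; cases "snd i < r") (auto simp: copy2_def override_on_def)
  qed
qed (simp add: copy2_def)

text \<open>The private columns of the first copy are integrated with everything about the second
  copy as a fixed factor, then those of the second copy. At depth r the copies agree, so both
  averages are taken at the same state; the common columns are then removed down to column 0, which
  carries no factor W.\<close>

theorem coupled_integral:
  assumes A: "A \<in> borel_measurable state" "\<And>x. A x \<le> ennreal (partition_fun k x)" "up_to k A"
    and B: "B \<in> borel_measurable state" "\<And>x. B x \<le> ennreal (partition_fun k x)" "up_to k B"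
    and r: "r < k"
  shows "(\<integral>\<^sup>+y. (\<Prod>l\<in>{1..<Suc r}. Wc l (copy1 h y)) *
      (\<Prod>l\<in>{Suc r..k}. Wc l (copy1 h y) * Wc l (copy2 (Suc r) h y)) *
      (GG A k (copy1 h y) * GG B k (copy2 (Suc r) h y)) \<partial>Z.P) =
    (\<integral>\<^sup>+c. Qd A B r r (updc 0 c (h, \<lambda>_. 0)) \<partial>col 0)"
proof -
  let ?z1 = "copy1 h" and ?z2 = "copy2 (Suc r) h"
  have GA: "GG A l \<in> borel_measurable state" if "l \<le> k" for l using GG_measurable_le_1[OF A(1,2) that] by simp
  have GB: "GG B l \<in> borel_measurable state" if "l \<le> k" for l using GG_measurable_le_1[OF B(1,2) that] by simp
  have QD: "Qd A B r e \<in> borel_measurable state" if "e \<le> r" for e using Qd_measurable_le_1[OF A(1,2) B(1,2) r that] by simp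
  define P1 where "P1 y = (\<Prod>l\<in>{1..<Suc r}. Wc l (?z1 y))" for y
  define T2 where "T2 y = (\<Prod>l\<in>{Suc r..k}. Wc l (?z2 y)) * GG B k (?z2 y)" for y
  have P1m[measurable]: "P1 \<in> borel_measurable Z.P"
    unfolding P1_def using r
    by (intro borel_measurable_prod_ennreal measurable_compose[OF copy1_measurable] Wc_measurable) auto
  have T2m[measurable]: "T2 \<in> borel_measurable Z.P"
    unfolding T2_def using r
    by (intro borel_measurable_times_ennreal borel_measurable_prod_ennreal
        measurable_compose[OF copy2_measurable] Wc_measurable GB) auto
  have P1_1: "P1 (override_on y y' {(1, Suc l)}) = P1 y" if "r \<le> l" for l y y'
    unfolding P1_def copy1_override
    by (intro prod.cong refl up_toD[OF Wc_up_to]) (use that r in \<open>auto intro!: agree_setcol\<close>)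
  have P1_2: "P1 (override_on y y' {(2, l)}) = P1 y" for l y y'
    by (simp add: P1_def copy1_override_2)
  have "(\<integral>\<^sup>+y. (\<Prod>l\<in>{1..<Suc r}. Wc l (?z1 y)) * (\<Prod>l\<in>{Suc r..k}. Wc l (?z1 y) * Wc l (?z2 y)) *
      (GG A k (?z1 y) * GG B k (?z2 y)) \<partial>Z.P) =
    (\<integral>\<^sup>+y. (P1 y * T2 y) * ((\<Prod>l\<in>{Suc r..k}. Wc l (?z1 y)) * GG A k (?z1 y)) \<partial>Z.P)"
    by (simp only: P1_def T2_def prod.distrib mult_ac)
  also have "\<dots> = (\<integral>\<^sup>+y. (P1 y * T2 y) * GG A r (?z1 y) \<partial>Z.P)"
  proof (rule peel_columns[where j=1 and ?k0.0=k])
    show "copy1 h (override_on y y' {(1, Suc l)}) = updc (Suc l) (y' (1, Suc l)) (copy1 h y)" for l y y'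
      by (rule copy1_override)
    show "P1 (override_on y y' {(1, Suc l)}) * T2 (override_on y y' {(1, Suc l)}) = P1 y * T2 y" if "r \<le> l" for l y y'
      by (simp only: P1_1[OF that] T2_def copy2_override_1[OF Suc_le_mono[THEN iffD2, OF that]])
  qed (use r in \<open>auto intro: GA GG_rec\<close>)
  also have "\<dots> = (\<integral>\<^sup>+y. (P1 y * GG A r (?z1 y)) * ((\<Prod>l\<in>{Suc r..k}. Wc l (?z2 y)) * GG B k (?z2 y)) \<partial>Z.P)"
    by (simp only: T2_def mult_ac)
  also have "\<dots> = (\<integral>\<^sup>+y. (P1 y * GG A r (?z1 y)) * GG B r (?z2 y) \<partial>Z.P)"
  proof (rule peel_columns[where j=2 and ?k0.0=k])
    have [measurable]: "GG A r \<in> borel_measurable state" using r by (intro GA) simp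
    show "(\<lambda>y. P1 y * GG A r (?z1 y)) \<in> borel_measurable Z.P" by measurable
    show "?z2 (override_on y y' {(2, Suc l)}) = updc (Suc l) (y' (2, Suc l)) (?z2 y)" if "r \<le> l" for l y y'
      using that by (intro copy2_override) simp
    show "P1 (override_on y y' {(2, Suc l)}) * GG A r (?z1 (override_on y y' {(2, Suc l)})) = P1 y * GG A r (?z1 y)" for l y y'
      by (simp only: P1_2 copy1_override_2)
  qed (use r in \<open>auto intro: GB GG_rec\<close>)
  also have "\<dots> = (\<integral>\<^sup>+y. 1 * ((\<Prod>l\<in>{Suc 0..r}. Wc l (?z1 y)) * Qd A B r 0 (?z1 y)) \<partial>Z.P)"
  proof (rule nn_integral_cong)
    fix y
    \<comment> \<open>Only columns up to r are read, and for these the second copy uses the columns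
      of the first.\<close>
    have "GG B r (?z2 y) = GG B r (?z1 y)"
      by (rule up_toD[OF GG_up_to[OF B(3)]]) (use r in \<open>auto simp: agree_def copy1_def copy2_def\<close>)
    moreover have "{1..<Suc r} = {Suc 0..r}" by auto
    ultimately show "(P1 y * GG A r (?z1 y)) * GG B r (?z2 y) = 1 * ((\<Prod>l\<in>{Suc 0..r}. Wc l (?z1 y)) * Qd A B r 0 (?z1 y))"
      by (simp only: P1_def Qd.simps(1) mult_ac mult_1_left)
  qed
  also have "\<dots> = (\<integral>\<^sup>+y. 1 * Qd A B r r (?z1 y) \<partial>Z.P)"
  proof -
    \<comment> \<open>Counting levels from the root instead of from the branching node puts
      \<open>Qd\<close> into the form required by \<open>peel_columns\<close>.\<close>
    define G where "G l = Qd A B r (r - l)" for l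
    have "(\<integral>\<^sup>+y. 1 * ((\<Prod>l\<in>{Suc 0..r}. Wc l (?z1 y)) * G r (?z1 y)) \<partial>Z.P) = (\<integral>\<^sup>+y. 1 * G 0 (?z1 y) \<partial>Z.P)"
    proof (rule peel_columns[where j=1 and ?k0.0=r])
      show "G l = avg l (G (Suc l))" if "l < r" for l
      proof -
        have 1: "r - l = Suc (r - Suc l)" and 2: "r - Suc (r - Suc l) = l" using that by auto
        show ?thesis unfolding G_def 1 Qd.simps(2) 2 ..
      qed
      show "copy1 h (override_on y y' {(1, Suc l)}) = updc (Suc l) (y' (1, Suc l)) (copy1 h y)" for l y y'
        by (rule copy1_override)
    qed (use r in \<open>auto simp: G_def intro: QD\<close>)
    then show ?thesis by (simp add: G_def)
  qed
  also have "\<dots> = (\<integral>\<^sup>+y. Qd A B r r (updc 0 (y (1, 0)) (h, \<lambda>_. 0)) \<partial>Z.P)"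
  proof (rule nn_integral_cong)
    fix y
    have "up_to (r - r) (Qd A B r r)" by (rule Qd_up_to[OF A(3) B(3) r]) simp
    then have "Qd A B r r (?z1 y) = Qd A B r r (updc 0 (y (1, 0)) (h, \<lambda>_. 0))"
      by (rule up_toD) (auto simp: agree_def copy1_def setcol_def)
    then show "1 * Qd A B r r (?z1 y) = Qd A B r r (updc 0 (y (1, 0)) (h, \<lambda>_. 0))"
      by simp
  qed
  also have "\<dots> = (\<integral>\<^sup>+c. Qd A B r r (updc 0 c (h, \<lambda>_. 0)) \<partial>col_of (1, 0))"
  proof (rule Z.nn_integral_coordinate[where f="\<lambda>c. Qd A B r r (updc 0 c (h, \<lambda>_. 0))"])
    show "(\<lambda>c. Qd A B r r (updc 0 c (h, \<lambda>_. 0))) \<in> borel_measurable (col_of (1, 0))"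
      unfolding measurable_col_of
      by (rule measurable_compose[OF updc_measurable_column QD]) simp
  qed
  finally show ?thesis by (simp add: col_of_def)
qed

end

subsection \<open>The Gibbs measure\<close>

lemma summable_on_iff_integrable:
  fixes f :: "'a \<Rightarrow> real"
  shows "f summable_on A \<longleftrightarrow> integrable (count_space A) f"
  using abs_summable_equivalent[of f A] summable_on_iff_abs_summable_on_real[of f A]
  by (simp add: Infinite_Set_Sum.abs_summable_on_def)

text \<open>The two notions agree unconditionally: both return 0 when the family is not
  summable.\<close>

lemma infsum_eq_integral:
  fixes f :: "'a \<Rightarrow> real"
  shows "infsum f A = integral\<^sup>L (count_space A) f"
proof (cases "integrable (count_space A) f")
  case True
  then have "Infinite_Set_Sum.abs_summable_on f A" by (simp add: Infinite_Set_Sum.abs_summable_on_def)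
  then show ?thesis using infsetsum_infsum[of f A] by (simp add: infsetsum_def)
next
  case False
  then show ?thesis
    using summable_on_iff_integrable[of f A]
    by (simp add: infsum_not_exists not_integrable_integral_eq)
qed

lemma infsum_eq_enn2real:
  fixes f :: "'a \<Rightarrow> real"
  assumes "\<And>x. x \<in> A \<Longrightarrow> 0 \<le> f x"
  shows "infsum f A = enn2real (\<integral>\<^sup>+x. ennreal (f x) \<partial>count_space A)"
  unfolding infsum_eq_integral
  by (rule integral_eq_nn_integral) (use assms in \<open>auto simp: AE_count_space\<close>)

lemma infsum_measurable:
  fixes f :: "'i \<Rightarrow> 'w \<Rightarrow> real"
  assumes "countable A" "\<And>i. i \<in> A \<Longrightarrow> f i \<in> borel_measurable M"
  shows "(\<lambda>\<omega>. \<Sum>\<^sub>\<infinity>i\<in>A. f i \<omega>) \<in> borel_measurable M"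
proof -
  interpret sigma_finite_measure "count_space A"
    by (rule sigma_finite_measure_count_space_countable) fact
  have "(\<lambda>(\<omega>, i). f i \<omega>) \<in> borel_measurable (M \<Otimes>\<^sub>M count_space A)"
    by (subst measurable_pair_swap_iff, rule measurable_pair_measure_countable1) (use assms in auto)
  then show ?thesis
    unfolding infsum_eq_integral by (rule borel_measurable_lebesgue_integral)
qed

lemma nn_integral_count_space_measurable:
  assumes "countable A" "\<And>i. i \<in> A \<Longrightarrow> f i \<in> borel_measurable M"
  shows "(\<lambda>\<omega>. \<integral>\<^sup>+i. f i \<omega> \<partial>count_space A) \<in> borel_measurable M"
proof -
  interpret sigma_finite_measure "count_space A"
    by (rule sigma_finite_measure_count_space_countable) fact
  have "(\<lambda>(\<omega>, i). f i \<omega>) \<in> borel_measurable (M \<Otimes>\<^sub>M count_space A)"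
    by (subst measurable_pair_swap_iff, rule measurable_pair_measure_countable1) (use assms in auto)
  then show ?thesis by (rule borel_measurable_nn_integral)
qed

lemma nn_integral_count_space_Times:
  assumes "countable A" "countable B"
  shows "(\<integral>\<^sup>+x. g x \<partial>count_space (A \<times> B)) = (\<integral>\<^sup>+a. \<integral>\<^sup>+b. g (a, b) \<partial>count_space B \<partial>count_space A)"
proof -
  interpret sigma_finite_measure "count_space B"
    by (rule sigma_finite_measure_count_space_countable) fact
  have "(\<integral>\<^sup>+a. \<integral>\<^sup>+b. g (a, b) \<partial>count_space B \<partial>count_space A) = (\<integral>\<^sup>+x. g x \<partial>(count_space A \<Otimes>\<^sub>M count_space B))"
    by (rule nn_integral_fst) (simp add: pair_measure_countable assms)
  then show ?thesis by (simp add: pair_measure_countable assms)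
qed

text \<open>For weights that are not summable the normalising sum is 0 by convention, and so are all
  quotients. The measure is therefore finite for every realisation, not only almost surely.\<close>

lemma finite_point_measure_normalized:
  fixes g :: "'a \<Rightarrow> real"
  shows "finite_measure (point_measure A (\<lambda>x. ennreal (g x / (\<Sum>\<^sub>\<infinity>y\<in>A. g y))))"
proof (rule finite_measureI)
  let ?c = "\<Sum>\<^sub>\<infinity>y\<in>A. g y"
  have "emeasure (point_measure A (\<lambda>x. ennreal (g x / ?c))) A = (\<integral>\<^sup>+x. ennreal (g x / ?c) \<partial>count_space A)"
    by (simp add: point_measure_def emeasure_density)
       (intro nn_integral_cong, simp)
  also have "\<dots> < top"
  proof (cases "integrable (count_space A) g")
    case True
    then have "integrable (count_space A) (\<lambda>x. g x / ?c)" by simp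
    then have "(\<integral>\<^sup>+x. ennreal (norm (g x / ?c)) \<partial>count_space A) < top"
      by (simp add: integrable_iff_bounded)
    moreover have "(\<integral>\<^sup>+x. ennreal (g x / ?c) \<partial>count_space A) \<le> (\<integral>\<^sup>+x. ennreal (norm (g x / ?c)) \<partial>count_space A)"
      by (intro nn_integral_mono ennreal_leI) (simp only: real_norm_def abs_ge_self)
    ultimately show ?thesis by (rule le_less_trans[rotated])
  next
    case False
    then have "?c = 0" by (simp add: infsum_eq_integral not_integrable_integral_eq)
    then show ?thesis by simp
  qed
  finally show "emeasure (point_measure A (\<lambda>x. ennreal (g x / ?c))) (space (point_measure A (\<lambda>x. ennreal (g x / ?c)))) \<noteq> \<infinity>"
    by (simp add: space_point_measure less_top[symmetric])
qed

definition pair_mass :: "nat \<Rightarrow> nat \<Rightarrow> ((nat \<Rightarrow> real) \<times> nat list \<Rightarrow> ennreal) \<Rightarrow> (nat \<Rightarrow> real) \<Rightarrow> (nat \<Rightarrow> real) \<Rightarrow> ennreal" where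
  "pair_mass k r \<rho> a b = (\<integral>\<^sup>+\<alpha>. \<integral>\<^sup>+\<beta>. of_bool (wedge k \<alpha> \<beta> = r) * (\<rho> (a, \<alpha>) * \<rho> (b, \<beta>))
     \<partial>count_space (leaves k) \<partial>count_space (leaves k))"

text \<open>Apart from the separation level, the integrand depends on the spins only, of which there
  are finitely many; the integral is a finite combination of the masses of the sets
  \<open>E a b\<close>.\<close>

lemma integral_point_measure_pair:
  fixes \<rho> :: "(nat \<Rightarrow> real) \<times> nat list \<Rightarrow> ennreal" and D :: "(nat \<Rightarrow> real) \<Rightarrow> (nat \<Rightarrow> real) \<Rightarrow> real"
  assumes fin: "finite_measure (point_measure (spins N \<times> leaves k) \<rho>)"
  shows "integral\<^sup>L (point_measure (spins N \<times> leaves k) \<rho> \<Otimes>\<^sub>M point_measure (spins N \<times> leaves k) \<rho>)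
      (\<lambda>((\<sigma>1, \<alpha>), (\<sigma>2, \<beta>)). D \<sigma>1 \<sigma>2 * of_bool (wedge k \<alpha> \<beta> = r)) =
    (\<Sum>a\<in>spins N. \<Sum>b\<in>spins N. D a b * enn2real (pair_mass k r \<rho> a b))"
    and "\<And>a b. a \<in> spins N \<Longrightarrow> b \<in> spins N \<Longrightarrow> pair_mass k r \<rho> a b < top"
proof -
  let ?S = "spins N \<times> leaves k"
  let ?G = "point_measure ?S \<rho>"
  interpret G: finite_measure ?G by fact
  interpret GG: finite_measure "?G \<Otimes>\<^sub>M ?G"
    by (rule finite_measure_pair_measure) fact+
  have cS: "countable ?S" by (intro countable_SIGMA countable_finite finite_spins countable_leaves)
  \<comment> \<open>Both factors live on a countable set with all subsets measurable, so every
    subset of the product is measurable.\<close>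
  have "sets (?G \<Otimes>\<^sub>M ?G) = sets (count_space ?S \<Otimes>\<^sub>M count_space ?S)"
    by (intro sets_pair_measure_cong) (auto simp: sets_point_measure)
  then have sets: "sets (?G \<Otimes>\<^sub>M ?G) = Pow (?S \<times> ?S)"
    by (simp only: pair_measure_countable[OF cS cS] sets_count_space)
  define E where "E a b = {((\<sigma>1, \<alpha>), (\<sigma>2, \<beta>)) | \<sigma>1 \<alpha> \<sigma>2 \<beta>. \<sigma>1 = a \<and> \<sigma>2 = b \<and> \<alpha> \<in> leaves k \<and> \<beta> \<in> leaves k \<and> wedge k \<alpha> \<beta> = r}" for a b :: "nat \<Rightarrow> real"
  have E: "E a b \<in> sets (?G \<Otimes>\<^sub>M ?G)" if "a \<in> spins N" "b \<in> spins N" for a b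
    unfolding sets using that by (auto simp: E_def)
  have mass: "emeasure (?G \<Otimes>\<^sub>M ?G) (E a b) = pair_mass k r \<rho> a b" if ab: "a \<in> spins N" "b \<in> spins N" for a b
  proof -
    have one: "(\<integral>\<^sup>+x. of_bool (fst x = c) * g x \<partial>count_space ?S) = (\<integral>\<^sup>+\<alpha>. g (c, \<alpha>) \<partial>count_space (leaves k))"
      if c: "c \<in> spins N" for c and g :: "(nat \<Rightarrow> real) \<times> nat list \<Rightarrow> ennreal"
    proof -
      have "(\<integral>\<^sup>+x. of_bool (fst x = c) * g x \<partial>count_space ?S) =
          (\<integral>\<^sup>+\<sigma>. \<integral>\<^sup>+\<alpha>. of_bool (\<sigma> = c) * g (\<sigma>, \<alpha>) \<partial>count_space (leaves k) \<partial>count_space (spins N))"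
        by (subst nn_integral_count_space_Times) (auto intro: countable_finite countable_leaves)
      also have "\<dots> = (\<Sum>\<sigma>\<in>spins N. \<integral>\<^sup>+\<alpha>. of_bool (\<sigma> = c) * g (\<sigma>, \<alpha>) \<partial>count_space (leaves k))"
        by (simp add: nn_integral_count_space_finite)
      also have "\<dots> = (\<Sum>\<sigma>\<in>spins N. if \<sigma> = c then \<integral>\<^sup>+\<alpha>. g (\<sigma>, \<alpha>) \<partial>count_space (leaves k) else 0)"
        by (intro sum.cong) auto
      also have "\<dots> = (\<integral>\<^sup>+\<alpha>. g (c, \<alpha>) \<partial>count_space (leaves k))"
        using c by simp
      finally show ?thesis .
    qed
    have "emeasure (?G \<Otimes>\<^sub>M ?G) (E a b) = (\<integral>\<^sup>+x. \<integral>\<^sup>+y. indicator (E a b) (x, y) \<partial>?G \<partial>?G)"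
      using E[OF ab] by (rule G.emeasure_pair_measure)
    also have "\<dots> = (\<integral>\<^sup>+x. \<rho> x * (\<integral>\<^sup>+y. \<rho> y * indicator (E a b) (x, y) \<partial>count_space ?S) \<partial>count_space ?S)"
      by (simp add: point_measure_def nn_integral_density)
    also have "\<dots> = (\<integral>\<^sup>+x. of_bool (fst x = a) * (\<rho> x * (\<integral>\<^sup>+y. of_bool (fst y = b) *
        (\<rho> y * of_bool (wedge k (snd x) (snd y) = r)) \<partial>count_space ?S)) \<partial>count_space ?S)"
    proof (intro nn_integral_cong)
      fix x assume "x \<in> space (count_space ?S)"
      then have "\<rho> y * indicator (E a b) (x, y) =
          of_bool (fst x = a) * (of_bool (fst y = b) * (\<rho> y * of_bool (wedge k (snd x) (snd y) = r)))"
        if "y \<in> ?S" for y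
        using that by (cases x; cases y) (auto simp: E_def split: split_indicator)
      then have "(\<integral>\<^sup>+y. \<rho> y * indicator (E a b) (x, y) \<partial>count_space ?S) =
        (\<integral>\<^sup>+y. of_bool (fst x = a) * (of_bool (fst y = b) * (\<rho> y * of_bool (wedge k (snd x) (snd y) = r))) \<partial>count_space ?S)"
        by (intro nn_integral_cong) simp
      then show "\<rho> x * (\<integral>\<^sup>+y. \<rho> y * indicator (E a b) (x, y) \<partial>count_space ?S) =
        of_bool (fst x = a) * (\<rho> x * (\<integral>\<^sup>+y. of_bool (fst y = b) *
        (\<rho> y * of_bool (wedge k (snd x) (snd y) = r)) \<partial>count_space ?S))"
        by (simp add: nn_integral_cmult mult.left_commute)
    qed
    also have "\<dots> = pair_mass k r \<rho> a b"
      unfolding one[OF ab(1)] one[OF ab(2)] pair_mass_def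
      by (simp add: nn_integral_cmult[symmetric] mult_ac)
    finally show ?thesis .
  qed
  show "pair_mass k r \<rho> a b < top" if "a \<in> spins N" "b \<in> spins N" for a b
    unfolding mass[OF that, symmetric] by (simp add: less_top[symmetric] GG.emeasure_finite)
  have "integral\<^sup>L (?G \<Otimes>\<^sub>M ?G) (\<lambda>((\<sigma>1, \<alpha>), (\<sigma>2, \<beta>)). D \<sigma>1 \<sigma>2 * of_bool (wedge k \<alpha> \<beta> = r)) =
      integral\<^sup>L (?G \<Otimes>\<^sub>M ?G) (\<lambda>p. \<Sum>a\<in>spins N. \<Sum>b\<in>spins N. D a b * indicator (E a b) p)"
  proof (rule Bochner_Integration.integral_cong[OF refl])
    fix p assume "p \<in> space (?G \<Otimes>\<^sub>M ?G)"
    then obtain \<sigma>1 \<alpha> \<sigma>2 \<beta> where p: "p = ((\<sigma>1, \<alpha>), (\<sigma>2, \<beta>))" "\<sigma>1 \<in> spins N" "\<sigma>2 \<in> spins N" "\<alpha> \<in> leaves k" "\<beta> \<in> leaves k"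
      by (auto simp: space_pair_measure space_point_measure)
    have "(\<Sum>a\<in>spins N. \<Sum>b\<in>spins N. D a b * indicator (E a b) p) =
        (\<Sum>a\<in>spins N. \<Sum>b\<in>spins N. if b = \<sigma>2 then (if a = \<sigma>1 then D a b * of_bool (wedge k \<alpha> \<beta> = r) else 0) else 0)"
      using p by (intro sum.cong refl) (auto simp: E_def split: split_indicator)
    also have "\<dots> = D \<sigma>1 \<sigma>2 * of_bool (wedge k \<alpha> \<beta> = r)"
      using p by simp
    finally show "(\<lambda>((\<sigma>1, \<alpha>), (\<sigma>2, \<beta>)). D \<sigma>1 \<sigma>2 * of_bool (wedge k \<alpha> \<beta> = r)) p =
      (\<Sum>a\<in>spins N. \<Sum>b\<in>spins N. D a b * indicator (E a b) p)"
      using p by simp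
  qed
  also have "\<dots> = (\<Sum>a\<in>spins N. \<Sum>b\<in>spins N. D a b * measure (?G \<Otimes>\<^sub>M ?G) (E a b))"
  proof -
    have int: "integrable (?G \<Otimes>\<^sub>M ?G) (\<lambda>p. D a b * indicator (E a b) p)" if "a \<in> spins N" "b \<in> spins N" for a b
      using E[OF that] by (intro integrable_mult_right integrable_real_indicator) (auto simp: less_top[symmetric])
    have i1: "integral\<^sup>L (?G \<Otimes>\<^sub>M ?G) (\<lambda>p. D a b * indicator (E a b) p) = D a b * measure (?G \<Otimes>\<^sub>M ?G) (E a b)"
      if "a \<in> spins N" "b \<in> spins N" for a b
      using E[OF that] sets.sets_into_space[OF E[OF that]] by (simp add: Int_absorb2)
    have i2: "integral\<^sup>L (?G \<Otimes>\<^sub>M ?G) (\<lambda>p. \<Sum>a\<in>spins N. \<Sum>b\<in>spins N. D a b * indicator (E a b) p) =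
        (\<Sum>a\<in>spins N. \<Sum>b\<in>spins N. integral\<^sup>L (?G \<Otimes>\<^sub>M ?G) (\<lambda>p. D a b * indicator (E a b) p))"
    proof (subst Bochner_Integration.integral_sum)
      show "integrable (?G \<Otimes>\<^sub>M ?G) (\<lambda>p. \<Sum>b\<in>spins N. D a b * indicator (E a b) p)" if "a \<in> spins N" for a
        by (intro Bochner_Integration.integrable_sum int that)
    qed (intro sum.cong refl Bochner_Integration.integral_sum int)
    show ?thesis unfolding i2 by (intro sum.cong refl i1)
  qed
  also have "\<dots> = (\<Sum>a\<in>spins N. \<Sum>b\<in>spins N. D a b * enn2real (pair_mass k r \<rho> a b))"
    by (intro sum.cong refl) (simp add: measure_def mass)
  finally show "integral\<^sup>L (?G \<Otimes>\<^sub>M ?G) (\<lambda>((\<sigma>1, \<alpha>), (\<sigma>2, \<beta>)). D \<sigma>1 \<sigma>2 * of_bool (wedge k \<alpha> \<beta> = r)) =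
    (\<Sum>a\<in>spins N. \<Sum>b\<in>spins N. D a b * enn2real (pair_mass k r \<rho> a b))" .
qed

definition pos_points :: "nat \<Rightarrow> (nat list \<Rightarrow> real) \<Rightarrow> bool" where
  "pos_points k uu \<longleftrightarrow> (\<forall>p n. length p < k \<longrightarrow> 0 < uu (p @ [n]))"

lemma cascade_v_pos:
  assumes "\<alpha> \<in> leaves k" "pos_points k uu"
  shows "0 < cascade_v k uu \<alpha>"
  unfolding cascade_v_def
proof (rule prod_pos)
  fix l assume l: "l \<in> {1..k}"
  then have "l - 1 < length \<alpha>" "Suc (l - 1) = l" using assms(1) by (auto simp: leaves_def)
  then have "take l \<alpha> = take (l - 1) \<alpha> @ [\<alpha> ! (l - 1)]"
    using take_Suc_conv_app_nth[of "l - 1" \<alpha>] by simp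
  moreover have "length (take (l - 1) \<alpha>) < k" using l assms(1) by (auto simp: leaves_def)
  ultimately show "0 < uu (take l \<alpha>)" using assms(2) unfolding pos_points_def by metis
qed

section \<open>Gibbs weights as terms of the sums over leaves\<close>

context spin_cascade
begin

definition Ae :: "(nat \<Rightarrow> real) \<Rightarrow> ((nat \<Rightarrow> real) \<Rightarrow> real) \<times> (nat \<times> nat \<Rightarrow> real) \<Rightarrow> ennreal" where
  "Ae a x = ennreal (exp (hamiltonian N t (fst x) (matrix_field k (snd x)) a))"

lemma Ae_measurable[measurable]: "Ae a \<in> borel_measurable state"
  unfolding Ae_def[abs_def] hamiltonian_def matrix_field_def by measurable

lemma Ae_le: "a \<in> spins N \<Longrightarrow> Ae a x \<le> ennreal (partition_fun k x)"
  unfolding Ae_def partition_fun_def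
  by (intro ennreal_leI member_le_sum[where f="\<lambda>a. exp (hamiltonian N t (fst x) (matrix_field k (snd x)) a)"]) auto

lemma Ae_up_to: "up_to k (Ae a)"
  unfolding up_to_def
proof (intro allI impI)
  fix h z z' assume "agree N k z z'"
  then have "hamiltonian N t h (matrix_field k z) a = hamiltonian N t h (matrix_field k z') a"
    by (intro hamiltonian_cong matrix_field_agree)
  then show "Ae a (h, z) = Ae a (h, z')" by (simp add: Ae_def)
qed

lemma fst_leaf_path[simp]: "fst (leaf_path p \<gamma> \<zeta> y) = fst \<zeta>"
  by (induction \<gamma> arbitrary: p \<zeta>) auto

lemma snd_leaf_path: "snd (leaf_path p \<gamma> \<zeta> y) (i, l) =
    (if length p < l \<and> l \<le> length p + length \<gamma> then y (Inl (p @ take (l - length p) \<gamma>)) i else snd \<zeta> (i, l))"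
proof (induction \<gamma> arbitrary: p \<zeta>)
  case (Cons n \<gamma>)
  show ?case
  proof (cases "l = Suc (length p)")
    case True
    then show ?thesis unfolding leaf_path.simps Cons.IH by (simp add: setcol_def)
  next
    case False
    show ?thesis
    proof (cases "Suc (length p) < l")
      case True
      then have "l - length p = Suc (l - Suc (length p))" by simp
      then show ?thesis using True False unfolding leaf_path.simps Cons.IH by (simp add: setcol_def)
    next
      case f: False
      then have "\<not> length p < l" using False by simp
      then show ?thesis using f False unfolding leaf_path.simps Cons.IH by (simp add: setcol_def)
    qed
  qed
qed auto

text \<open>The zeros at nodes outside the tree are placeholders; those at entries beyond N match
  \<open>column_law\<close>.\<close>

definition conf :: "(nat list \<times> nat \<Rightarrow> real) \<Rightarrow> (nat list \<Rightarrow> real) \<Rightarrow> nat list + nat list \<Rightarrow> nat \<Rightarrow> real" where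
  "conf zz uu i = (case i of
     Inl p \<Rightarrow> if length p \<le> k then (\<lambda>i. if i < N then zz (p, i) else 0) else (\<lambda>_. 0)
   | Inr p \<Rightarrow> if length p < k then (\<lambda>n. uu (p @ [n])) else (\<lambda>_. 0))"

text \<open>The root column belongs to no Poisson point, so it is written into the state before the
  sums start.\<close>

definition start_path :: "((nat \<Rightarrow> real) \<Rightarrow> real) \<Rightarrow> (nat list + nat list \<Rightarrow> nat \<Rightarrow> real) \<Rightarrow>
    ((nat \<Rightarrow> real) \<Rightarrow> real) \<times> (nat \<times> nat \<Rightarrow> real)" where
  "start_path h y = updc 0 (y (Inl [])) (h, \<lambda>_. 0)"

lemma leaf_weight_conf:
  assumes \<alpha>: "\<alpha> \<in> leaves k" and pos: "pos_points k uu"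
  shows "leaf_weight [] \<alpha> (conf zz uu) = ennreal (cascade_v k uu \<alpha>)"
proof -
  have len: "length \<alpha> = k" using \<alpha> by (simp add: leaves_def)
  have "leaf_weight [] \<alpha> (conf zz uu) = (\<Prod>j<k. ennreal (uu (take (Suc j) \<alpha>)))"
    unfolding leaf_weight_prod len
    by (intro prod.cong refl) (auto simp: conf_def len take_Suc_conv_app_nth)
  also have "\<dots> = ennreal (\<Prod>j<k. uu (take (Suc j) \<alpha>))"
    by (rule prod_ennreal) (use pos len in \<open>auto simp: pos_points_def take_Suc_conv_app_nth intro!: less_imp_le\<close>)
  also have "(\<Prod>j<k. uu (take (Suc j) \<alpha>)) = cascade_v k uu \<alpha>"
    unfolding cascade_v_def
    by (rule prod.reindex_bij_witness[where i="\<lambda>l. l - 1" and j=Suc]) auto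
  finally show ?thesis .
qed

lemma Ae_leaf_path:
  assumes \<alpha>: "\<alpha> \<in> leaves k"
  shows "Ae a (leaf_path [] \<alpha> (start_path h (conf zz uu)) (conf zz uu)) =
    ennreal (exp (hamiltonian N t h (leaf_field k zz \<alpha>) a))"
proof -
  have len: "length \<alpha> = k" using \<alpha> by (simp add: leaves_def)
  let ?x = "leaf_path [] \<alpha> (start_path h (conf zz uu)) (conf zz uu)"
  have "matrix_field k (snd ?x) i = leaf_field k zz \<alpha> i" if i: "i < N" for i
    unfolding matrix_field_def leaf_field_def
  proof (rule sum.cong[OF refl])
    fix l assume l: "l \<in> {..k}"
    show "snd ?x (i, l) = zz (take l \<alpha>, i)"
      using l i by (cases "l = 0") (auto simp: snd_leaf_path len start_path_def setcol_def conf_def)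
  qed
  then have "hamiltonian N t (fst ?x) (matrix_field k (snd ?x)) a = hamiltonian N t (fst ?x) (leaf_field k zz \<alpha>) a"
    by (rule hamiltonian_cong)
  then show ?thesis by (simp add: Ae_def start_path_def)
qed

lemma leaf_term_conf:
  assumes \<alpha>: "\<alpha> \<in> leaves k" and pos: "pos_points k uu"
  shows "leaf_term (Ae a) [] \<alpha> (start_path h (conf zz uu)) (conf zz uu) =
    ennreal (cascade_v k uu \<alpha> * exp (hamiltonian N t h (leaf_field k zz \<alpha>) a))"
  using cascade_v_pos[of \<alpha> k uu] assms
  by (simp add: leaf_term_def leaf_weight_conf[OF assms] Ae_leaf_path ennreal_mult)

lemma partition_fun_eq_sum: "ennreal (partition_fun k x) = (\<Sum>a\<in>spins N. Ae a x)"
  unfolding partition_fun_def Ae_def by (rule sum_ennreal[symmetric]) simp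

abbreviation "gibbs_density h zz uu \<equiv>
  (\<lambda>x. ennreal (gibbs_weight N k t h zz uu x / (\<Sum>\<^sub>\<infinity>y\<in>spins N \<times> leaves k. gibbs_weight N k t h zz uu y)))"

text \<open>The normalisation V of the cascade weights occurs in every Gibbs weight and cancels
  against the partition sum, so unnormalised leaf terms divided by T give the same density.
  Finiteness of V and T keeps the infinite sums from taking their default value.\<close>

lemma gibbs_density_eq:
  fixes h zz uu
  defines "y \<equiv> conf zz uu"
  assumes pos: "pos_points k uu"
    and T1: "(\<integral>\<^sup>+\<alpha>. leaf_weight [] \<alpha> y \<partial>count_space (leaves k)) < top"
    and T: "0 < TF 0 [] (start_path h y) y" "TF 0 [] (start_path h y) y < top"
    and a: "a \<in> spins N" and \<alpha>: "\<alpha> \<in> leaves k"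
  shows "gibbs_density h zz uu (a, \<alpha>) = leaf_term (Ae a) [] \<alpha> (start_path h y) y * inverse (TF 0 [] (start_path h y) y)"
proof -
  let ?S = "spins N \<times> leaves k"
  let ?E = "\<lambda>\<sigma> \<alpha>. exp (hamiltonian N t h (leaf_field k zz \<alpha>) \<sigma>)"
  have v: "0 < cascade_v k uu \<alpha>" if "\<alpha> \<in> leaves k" for \<alpha>
    by (rule cascade_v_pos[OF that pos])
  have lt: "leaf_term (Ae a) [] \<alpha> (start_path h y) y = ennreal (cascade_v k uu \<alpha> * ?E a \<alpha>)" if "\<alpha> \<in> leaves k" for a \<alpha>
    unfolding y_def by (rule leaf_term_conf[OF that pos])
  define V where "V = (\<Sum>\<^sub>\<infinity>\<gamma>\<in>leaves k. cascade_v k uu \<gamma>)"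
  have V': "(\<integral>\<^sup>+\<alpha>. leaf_weight [] \<alpha> y \<partial>count_space (leaves k)) = (\<integral>\<^sup>+\<alpha>. ennreal (cascade_v k uu \<alpha>) \<partial>count_space (leaves k))"
    by (intro nn_integral_cong) (simp add: y_def leaf_weight_conf pos)
  have "V = enn2real (\<integral>\<^sup>+\<alpha>. ennreal (cascade_v k uu \<alpha>) \<partial>count_space (leaves k))"
    unfolding V_def using v by (intro infsum_eq_enn2real) (auto intro: less_imp_le)
  moreover have "ennreal (cascade_v k uu \<alpha>) \<le> (\<integral>\<^sup>+\<alpha>. ennreal (cascade_v k uu \<alpha>) \<partial>count_space (leaves k))"
    by (rule nn_integral_ge_point[OF \<alpha>])
  ultimately have V: "0 < V"
    using v[OF \<alpha>] T1 unfolding V'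
    by (cases "\<integral>\<^sup>+\<alpha>. ennreal (cascade_v k uu \<alpha>) \<partial>count_space (leaves k)") auto
  obtain Tr where Tr: "TF 0 [] (start_path h y) y = ennreal Tr" "0 < Tr"
    using T by (cases "TF 0 [] (start_path h y) y") auto
  have TF: "TF 0 [] (start_path h y) y = (\<integral>\<^sup>+\<alpha>. (\<Sum>a\<in>spins N. ennreal (cascade_v k uu \<alpha> * ?E a \<alpha>)) \<partial>count_space (leaves k))"
    unfolding Tsum_leaves diff_zero
  proof (intro nn_integral_cong)
    fix \<alpha> assume "\<alpha> \<in> space (count_space (leaves k))"
    then have "leaf_term (Ae a) [] \<alpha> (start_path h y) y = ennreal (cascade_v k uu \<alpha> * ?E a \<alpha>)" for a
      by (intro lt) simp
    moreover have "leaf_term (\<lambda>\<zeta>. ennreal (partition_fun k \<zeta>)) [] \<alpha> (start_path h y) y = (\<Sum>a\<in>spins N. leaf_term (Ae a) [] \<alpha> (start_path h y) y)"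
      by (simp add: leaf_term_def partition_fun_eq_sum sum_distrib_left)
    ultimately show "leaf_term (\<lambda>\<zeta>. ennreal (partition_fun k \<zeta>)) [] \<alpha> (start_path h y) y = (\<Sum>a\<in>spins N. ennreal (cascade_v k uu \<alpha> * ?E a \<alpha>))"
      by simp
  qed
  have gw: "gibbs_weight N k t h zz uu (\<sigma>, \<alpha>) = 1 / V * (cascade_v k uu \<alpha> * ?E \<sigma> \<alpha>)" for \<sigma> \<alpha>
    by (simp add: gibbs_weight_def cascade_w_def V_def)
  have "(\<integral>\<^sup>+x. ennreal (gibbs_weight N k t h zz uu x) \<partial>count_space ?S) =
      (\<Sum>\<sigma>\<in>spins N. \<integral>\<^sup>+\<alpha>. ennreal (1 / V) * ennreal (cascade_v k uu \<alpha> * ?E \<sigma> \<alpha>) \<partial>count_space (leaves k))"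
  proof -
    have "(\<integral>\<^sup>+x. ennreal (gibbs_weight N k t h zz uu x) \<partial>count_space ?S) =
      (\<Sum>\<sigma>\<in>spins N. \<integral>\<^sup>+\<alpha>. ennreal (gibbs_weight N k t h zz uu (\<sigma>, \<alpha>)) \<partial>count_space (leaves k))"
      by (subst nn_integral_count_space_Times)
         (auto simp: nn_integral_count_space_finite countable_leaves intro: countable_finite)
    also have "\<dots> = (\<Sum>\<sigma>\<in>spins N. \<integral>\<^sup>+\<alpha>. ennreal (1 / V) * ennreal (cascade_v k uu \<alpha> * ?E \<sigma> \<alpha>) \<partial>count_space (leaves k))"
      unfolding gw using V v
      by (intro sum.cong refl nn_integral_cong ennreal_mult) (auto intro: less_imp_le)
    finally show ?thesis .
  qed
  also have "\<dots> = ennreal (1 / V) * TF 0 [] (start_path h y) y"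
    unfolding TF by (simp add: nn_integral_cmult nn_integral_sum sum_distrib_left[symmetric])
  also have "\<dots> = ennreal (Tr / V)"
    using V Tr by (simp add: ennreal_mult[symmetric])
  finally have "(\<Sum>\<^sub>\<infinity>x\<in>?S. gibbs_weight N k t h zz uu x) = enn2real (ennreal (Tr / V))"
    using V v by (subst infsum_eq_enn2real) (auto simp: gw intro!: divide_nonneg_pos mult_nonneg_nonneg less_imp_le[OF v])
  then have Z: "(\<Sum>\<^sub>\<infinity>x\<in>?S. gibbs_weight N k t h zz uu x) = Tr / V" using V Tr by simp
  have "gibbs_weight N k t h zz uu (a, \<alpha>) / (Tr / V) = cascade_v k uu \<alpha> * ?E a \<alpha> * inverse Tr"
    unfolding gw using V Tr by (simp add: field_simps)
  then show ?thesis
    unfolding Z lt[OF \<alpha>] Tr(1) using Tr(2) v[OF \<alpha>]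
    by (simp add: inverse_ennreal ennreal_mult less_imp_le)
qed

lemma pair_mass_gibbs:
  fixes h zz uu
  defines "y \<equiv> conf zz uu"
  assumes pos: "pos_points k uu"
    and T1: "(\<integral>\<^sup>+\<alpha>. leaf_weight [] \<alpha> y \<partial>count_space (leaves k)) < top"
    and T: "0 < TF 0 [] (start_path h y) y" "TF 0 [] (start_path h y) y < top"
    and ab: "a \<in> spins N" "b \<in> spins N" and r: "r < k"
  shows "pair_mass k (Suc r) (gibbs_density h zz uu) a b =
    Dsum (Ae a) (Ae b) (k - Suc r) r [] (start_path h y) y * inverse ((TF 0 [] (start_path h y) y)\<^sup>2)"
proof -
  let ?T = "TF 0 [] (start_path h y) y"
  have k: "Suc (k - Suc r + r) = k" using r by simp
  have inv: "inverse ?T * inverse ?T = inverse (?T\<^sup>2)"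
    using T by (cases ?T) (auto simp: inverse_ennreal ennreal_mult[symmetric] ennreal_power power2_eq_square)
  have "pair_mass k (Suc r) (gibbs_density h zz uu) a b =
    (\<integral>\<^sup>+\<alpha>. \<integral>\<^sup>+\<beta>. inverse (?T\<^sup>2) * (of_bool (branch_at r \<alpha> \<beta>) * (leaf_term (Ae a) [] \<alpha> (start_path h y) y * leaf_term (Ae b) [] \<beta> (start_path h y) y))
       \<partial>count_space (leaves k) \<partial>count_space (leaves k))"
    unfolding pair_mass_def
  proof (intro nn_integral_cong)
    fix \<alpha> \<beta> assume "\<alpha> \<in> space (count_space (leaves k))" "\<beta> \<in> space (count_space (leaves k))"
    then have l: "\<alpha> \<in> leaves k" "\<beta> \<in> leaves k" by auto
    have d: "gibbs_density h zz uu (a, \<alpha>) = leaf_term (Ae a) [] \<alpha> (start_path h y) y * inverse ?T"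
      "gibbs_density h zz uu (b, \<beta>) = leaf_term (Ae b) [] \<beta> (start_path h y) y * inverse ?T"
      unfolding y_def
      by (rule gibbs_density_eq[OF pos T1[unfolded y_def] T[unfolded y_def] ab(1) l(1)]
          gibbs_density_eq[OF pos T1[unfolded y_def] T[unfolded y_def] ab(2) l(2)])+
    show "of_bool (wedge k \<alpha> \<beta> = Suc r) * (gibbs_density h zz uu (a, \<alpha>) * gibbs_density h zz uu (b, \<beta>)) =
      inverse (?T\<^sup>2) * (of_bool (branch_at r \<alpha> \<beta>) * (leaf_term (Ae a) [] \<alpha> (start_path h y) y * leaf_term (Ae b) [] \<beta> (start_path h y) y))"
      unfolding d wedge_eq_iff[OF l r] inv[symmetric] by (simp only: mult_ac)
  qed
  also have "\<dots> = inverse (?T\<^sup>2) * Dsum (Ae a) (Ae b) (k - Suc r) r [] (start_path h y) y"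
    unfolding Dsum_leaves k by (simp add: nn_integral_cmult)
  finally show ?thesis by (simp add: mult.commute)
qed

end

section \<open>Laws and independence on product spaces\<close>

context prob_space
begin

text \<open>f reads coordinates in J only, so both integrals may be computed after replacing the
  other coordinates by the constants c; then both laws are the same product measure.\<close>

lemma nn_integral_config:
  fixes \<nu> :: "'i \<Rightarrow> 'v measure"
  assumes ind: "indep_vars (\<lambda>_. S) X J" and S: "space S = UNIV"
    and \<nu>: "\<And>i. prob_space (\<nu> i)" "\<And>i. sets (\<nu> i) = sets S" "\<And>i. i \<in> J \<Longrightarrow> distr M S (X i) = \<nu> i"
    and f: "f \<in> borel_measurable (PiM UNIV (\<lambda>_. S))" and d: "dep J f"
  shows "(\<integral>\<^sup>+\<omega>. f (\<lambda>i. if i \<in> J then X i \<omega> else c i) \<partial>M) = (\<integral>\<^sup>+y. f y \<partial>PiM UNIV \<nu>)"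
proof -
  interpret Q: prob_space "PiM UNIV \<nu>" by (rule prob_space_PiM) (rule \<nu>)
  let ?D = "PiM UNIV (\<lambda>i. if i \<in> J then \<nu> i else return S (c i))"
  have mX: "(\<lambda>\<omega> i. if i \<in> J then X i \<omega> else c i) \<in> measurable M (PiM UNIV (\<lambda>_. S))"
  proof (rule measurable_PiM_single')
    fix i
    show "(\<lambda>\<omega>. if i \<in> J then X i \<omega> else c i) \<in> measurable M S"
      using ind by (cases "i \<in> J") (auto simp: indep_vars_def2 S)
  qed (auto simp: S)
  have mQ: "(\<lambda>y i. if i \<in> J then y i else c i) \<in> measurable (PiM UNIV \<nu>) (PiM UNIV (\<lambda>_. S))"
  proof (rule measurable_PiM_single')
    fix i
    have "(\<lambda>y. y i) \<in> measurable (PiM UNIV \<nu>) S"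
      using measurable_component_singleton[of i UNIV \<nu>] by (subst measurable_cong_sets[OF refl \<nu>(2)[of i, symmetric]]) simp
    then show "(\<lambda>y. if i \<in> J then y i else c i) \<in> measurable (PiM UNIV \<nu>) S"
      by (cases "i \<in> J") (auto simp: S)
  qed (auto simp: S)
  have lX: "distr M (PiM UNIV (\<lambda>_. S)) (\<lambda>\<omega> i. if i \<in> J then X i \<omega> else c i) = ?D"
    using distr_extend_const[OF ind, of c] \<nu>(3) by (simp add: S cong: if_cong)
  have "Q.indep_vars (\<lambda>_. S) (\<lambda>i y. y i) UNIV"
    by (rule indep_vars_PiM_coordinate) (auto simp: \<nu>)
  then have indQ: "Q.indep_vars (\<lambda>_. S) (\<lambda>i y. y i) J" by (rule Q.indep_vars_subset) simp
  have "distr (PiM UNIV \<nu>) S (\<lambda>y. y i) = \<nu> i" for i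
    using distr_PiM_component[of UNIV \<nu> i] \<nu>(1)
      distr_cong[of "PiM UNIV \<nu>" "PiM UNIV \<nu>" S "\<nu> i" "\<lambda>y. y i" "\<lambda>y. y i"] by (simp add: \<nu>(2))
  then have lQ: "distr (PiM UNIV \<nu>) (PiM UNIV (\<lambda>_. S)) (\<lambda>y i. if i \<in> J then y i else c i) = ?D"
    using Q.distr_extend_const[OF indQ, of c] by (simp add: S cong: if_cong)
  have "(\<integral>\<^sup>+\<omega>. f (\<lambda>i. if i \<in> J then X i \<omega> else c i) \<partial>M) = (\<integral>\<^sup>+y. f y \<partial>?D)"
    unfolding lX[symmetric] by (rule nn_integral_distr[OF mX, symmetric]) (use f in simp)
  also have "\<dots> = (\<integral>\<^sup>+y. f (\<lambda>i. if i \<in> J then y i else c i) \<partial>PiM UNIV \<nu>)"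
    unfolding lQ[symmetric] by (rule nn_integral_distr[OF mQ]) (use f in simp)
  also have "\<dots> = (\<integral>\<^sup>+y. f y \<partial>PiM UNIV \<nu>)"
    by (intro nn_integral_cong depD[OF d]) simp
  finally show ?thesis .
qed

lemma distr_pair_indep_set:
  assumes ind: "indep_set \<A> \<B>" and X[measurable]: "X \<in> measurable M S" and Y[measurable]: "Y \<in> measurable M T"
    and XA: "\<And>A. A \<in> sets S \<Longrightarrow> X -` A \<inter> space M \<in> \<A>" and YB: "\<And>B. B \<in> sets T \<Longrightarrow> Y -` B \<inter> space M \<in> \<B>"
  shows "distr M S X \<Otimes>\<^sub>M distr M T Y = distr M (S \<Otimes>\<^sub>M T) (\<lambda>\<omega>. (X \<omega>, Y \<omega>))"
proof -
  interpret X: prob_space "distr M S X" by (rule prob_space_distr) fact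
  interpret Y: prob_space "distr M T Y" by (rule prob_space_distr) fact
  show ?thesis
  proof (rule pair_measure_eqI)
    fix A B assume "A \<in> sets (distr M S X)" "B \<in> sets (distr M T Y)"
    then have [measurable]: "A \<in> sets S" "B \<in> sets T" by auto
    have "emeasure M ((X -` A \<inter> space M) \<inter> (Y -` B \<inter> space M)) = emeasure M (X -` A \<inter> space M) * emeasure M (Y -` B \<inter> space M)"
      using ind XA[of A] YB[of B] unfolding indep_sets2_eq
      by (simp add: emeasure_eq_measure ennreal_mult)
    also have "(X -` A \<inter> space M) \<inter> (Y -` B \<inter> space M) = (\<lambda>\<omega>. (X \<omega>, Y \<omega>)) -` (A \<times> B) \<inter> space M"
      by auto
    finally show "emeasure (distr M S X) A * emeasure (distr M T Y) B =
        emeasure (distr M (S \<Otimes>\<^sub>M T) (\<lambda>\<omega>. (X \<omega>, Y \<omega>))) (A \<times> B)"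
      by (simp add: emeasure_distr)
  qed (auto intro: X.sigma_finite_measure_axioms Y.sigma_finite_measure_axioms)
qed

lemma nn_integral_pair_distr:
  assumes rv[measurable]: "X \<in> measurable M S" "Y \<in> measurable M T"
    and eq: "distr M S X \<Otimes>\<^sub>M distr M T Y = distr M (S \<Otimes>\<^sub>M T) (\<lambda>\<omega>. (X \<omega>, Y \<omega>))"
    and f[measurable]: "(\<lambda>p. f (fst p) (snd p)) \<in> borel_measurable (S \<Otimes>\<^sub>M T)"
  shows "(\<integral>\<^sup>+\<omega>. f (X \<omega>) (Y \<omega>) \<partial>M) = (\<integral>\<^sup>+\<omega>. \<integral>\<^sup>+\<omega>'. f (X \<omega>) (Y \<omega>') \<partial>M \<partial>M)"
proof -
  interpret X: prob_space "distr M S X" by (rule prob_space_distr) fact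
  interpret Y: prob_space "distr M T Y" by (rule prob_space_distr) fact
  have fm: "(\<lambda>p. f (fst p) (snd p)) \<in> borel_measurable (distr M S X \<Otimes>\<^sub>M distr M T Y)"
    by (subst measurable_cong_sets[OF sets_pair_measure_cong[OF sets_distr sets_distr] refl]) fact
  have "(\<integral>\<^sup>+\<omega>. f (X \<omega>) (Y \<omega>) \<partial>M) = (\<integral>\<^sup>+p. f (fst p) (snd p) \<partial>(distr M S X \<Otimes>\<^sub>M distr M T Y))"
    unfolding eq by (subst nn_integral_distr) auto
  also have "\<dots> = (\<integral>\<^sup>+x. \<integral>\<^sup>+y. f x y \<partial>distr M T Y \<partial>distr M S X)"
    by (subst Y.nn_integral_fst[symmetric, OF fm]) simp
  also have "\<dots> = (\<integral>\<^sup>+\<omega>. \<integral>\<^sup>+y. f (X \<omega>) y \<partial>distr M T Y \<partial>M)"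
    by (rule nn_integral_distr[OF rv(1)])
       (use Y.borel_measurable_nn_integral[of "\<lambda>x y. f x y" "distr M S X"] fm in \<open>simp add: case_prod_unfold\<close>)
  also have "\<dots> = (\<integral>\<^sup>+\<omega>. \<integral>\<^sup>+\<omega>'. f (X \<omega>) (Y \<omega>') \<partial>M \<partial>M)"
  proof (rule nn_integral_cong)
    fix \<omega> assume "\<omega> \<in> space M"
    then have "X \<omega> \<in> space S" using rv(1) by (rule measurable_space[rotated])
    then have "(\<lambda>y. f (X \<omega>) y) \<in> borel_measurable T"
      using measurable_compose[OF measurable_Pair1' f, of "X \<omega>"] by simp
    then show "(\<integral>\<^sup>+y. f (X \<omega>) y \<partial>distr M T Y) = (\<integral>\<^sup>+\<omega>'. f (X \<omega>) (Y \<omega>') \<partial>M)"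
      by (intro nn_integral_distr[OF rv(2)]) simp
  qed
  finally show ?thesis .
qed

text \<open>Finite intersections within each family stay in the respective sigma-algebra, so
  independence of the two algebras splits an intersection into two parts, each handled by its own
  family.\<close>

lemma indep_vars_Plus:
  assumes X: "indep_vars (\<lambda>_. S) X I" and Y: "indep_vars (\<lambda>_. S) Y J"
    and ind: "indep_set \<A> \<B>" and sa: "sigma_algebra (space M) \<A>" "sigma_algebra (space M) \<B>"
    and XA: "\<And>i A. i \<in> I \<Longrightarrow> A \<in> sets S \<Longrightarrow> X i -` A \<inter> space M \<in> \<A>"
    and YB: "\<And>j A. j \<in> J \<Longrightarrow> A \<in> sets S \<Longrightarrow> Y j -` A \<inter> space M \<in> \<B>"
  shows "indep_vars (\<lambda>_. S) (case_sum X Y) (Inl ` I \<union> Inr ` J)"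
  unfolding indep_vars_def2
proof (intro conjI ballI)
  show rv: "case_sum X Y i \<in> measurable M S" if "i \<in> Inl ` I \<union> Inr ` J" for i
    using that X Y by (auto simp: indep_vars_def2)
  have iX: "indep_sets (\<lambda>i. {X i -` A \<inter> space M |A. A \<in> sets S}) I"
    and iY: "indep_sets (\<lambda>i. {Y i -` A \<inter> space M |A. A \<in> sets S}) J"
    using X Y by (auto simp: indep_vars_def2)
  interpret A: sigma_algebra "space M" \<A> by fact
  interpret B: sigma_algebra "space M" \<B> by fact
  show "indep_sets (\<lambda>i. {case_sum X Y i -` A \<inter> space M |A. A \<in> sets S}) (Inl ` I \<union> Inr ` J)"
  proof (rule indep_setsI)
    show "{case_sum X Y i -` A \<inter> space M |A. A \<in> sets S} \<subseteq> events" if "i \<in> Inl ` I \<union> Inr ` J" for i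
      using rv[OF that] by (auto intro: measurable_sets)
    fix C K assume K: "K \<noteq> {}" "K \<subseteq> Inl ` I \<union> Inr ` J" "finite K"
      and C: "\<forall>j\<in>K. C j \<in> {case_sum X Y j -` A \<inter> space M |A. A \<in> sets S}"
    define K1 where "K1 = Inl -` K" define K2 where "K2 = Inr -` K"
    have Keq: "K = Inl ` K1 \<union> Inr ` K2"
      using K(2) by (auto simp: K1_def K2_def)
    have fin: "finite K1" "finite K2" unfolding K1_def K2_def
      using K(3) by (auto intro: finite_vimageI)
    have sub: "K1 \<subseteq> I" "K2 \<subseteq> J" using K(2) by (auto simp: K1_def K2_def)
    have C1: "C (Inl i) \<in> {X i -` A \<inter> space M |A. A \<in> sets S}" if "i \<in> K1" for i
      using bspec[OF C, of "Inl i"] that by (simp add: K1_def)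
    have C2: "C (Inr i) \<in> {Y i -` A \<inter> space M |A. A \<in> sets S}" if "i \<in> K2" for i
      using bspec[OF C, of "Inr i"] that by (simp add: K2_def)
    have p1: "prob (\<Inter>i\<in>K1. C (Inl i)) = (\<Prod>i\<in>K1. prob (C (Inl i)))" if "K1 \<noteq> {}"
      by (rule indep_setsD[OF iX sub(1) that fin(1)]) (use C1 in blast)
    have p2: "prob (\<Inter>i\<in>K2. C (Inr i)) = (\<Prod>i\<in>K2. prob (C (Inr i)))" if "K2 \<noteq> {}"
      by (rule indep_setsD[OF iY sub(2) that fin(2)]) (use C2 in blast)
    have prodK: "(\<Prod>j\<in>K. prob (C j)) = (\<Prod>i\<in>K1. prob (C (Inl i))) * (\<Prod>i\<in>K2. prob (C (Inr i)))"
      unfolding Keq using fin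
      by (subst prod.union_disjoint) (auto simp: prod.reindex)
    consider "K1 = {}" "K2 \<noteq> {}" | "K2 = {}" "K1 \<noteq> {}" | "K1 \<noteq> {}" "K2 \<noteq> {}"
      using K(1) Keq by auto
    then show "prob (\<Inter>j\<in>K. C j) = (\<Prod>j\<in>K. prob (C j))"
    proof cases
      case 1
      show ?thesis using p2[OF 1(2)] unfolding prodK unfolding Keq 1 by simp
    next
      case 2
      show ?thesis using p1[OF 2(2)] unfolding prodK unfolding Keq 2 by simp
    next
      case 3
      have "(\<Inter>i\<in>K1. C (Inl i)) \<in> \<A>"
        proof (rule A.finite_INT[OF fin(1) 3(1)])
          fix i assume i: "i \<in> K1"
          obtain A where "C (Inl i) = X i -` A \<inter> space M" "A \<in> sets S" using C1[OF i] by auto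
          then show "C (Inl i) \<in> \<A>" using XA[of i A] i sub by auto
        qed
      moreover have "(\<Inter>i\<in>K2. C (Inr i)) \<in> \<B>"
      proof (rule B.finite_INT[OF fin(2) 3(2)])
          fix i assume i: "i \<in> K2"
          obtain A where "C (Inr i) = Y i -` A \<inter> space M" "A \<in> sets S" using C2[OF i] by auto
          then show "C (Inr i) \<in> \<B>" using YB[of i A] i sub by auto
        qed
      ultimately have "prob ((\<Inter>i\<in>K1. C (Inl i)) \<inter> (\<Inter>i\<in>K2. C (Inr i))) =
          prob (\<Inter>i\<in>K1. C (Inl i)) * prob (\<Inter>i\<in>K2. C (Inr i))"
        using ind unfolding indep_sets2_eq by blast
      moreover have "(\<Inter>j\<in>K. C j) = (\<Inter>i\<in>K1. C (Inl i)) \<inter> (\<Inter>i\<in>K2. C (Inr i))"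
        unfolding Keq by blast
      ultimately show ?thesis using p1[OF 3(1)] p2[OF 3(2)] prodK by simp
    qed
  qed
qed

lemma indep_vars_distr:
  assumes f: "f \<in> measurable M S" and G: "\<And>i. i \<in> I \<Longrightarrow> G i \<in> measurable S (T i)"
    and ind: "indep_vars T (\<lambda>i \<omega>. G i (f \<omega>)) I"
  shows "prob_space.indep_vars (distr M S f) T G I"
proof -
  interpret D: prob_space "distr M S f" by (rule prob_space_distr) fact
  show ?thesis
  proof (cases "I = {}")
    case True
    then show ?thesis unfolding D.indep_vars_def2 D.indep_sets_def by auto
  next
    case False
    have G': "G i \<in> measurable (distr M S f) (T i)" if "i \<in> I" for i using G[OF that] by simp
    have "distr (distr M S f) (PiM I T) (\<lambda>x. \<lambda>i\<in>I. G i x) = distr M (PiM I T) (\<lambda>\<omega>. \<lambda>i\<in>I. G i (f \<omega>))"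
      by (subst distr_distr) (auto intro!: measurable_restrict G f simp: comp_def)
    also have "\<dots> = PiM I (\<lambda>i. distr M (T i) (\<lambda>\<omega>. G i (f \<omega>)))"
      using ind by (subst (asm) indep_vars_iff_distr_eq_PiM'[OF False]) (auto intro: measurable_compose[OF f] G)
    also have "\<dots> = PiM I (\<lambda>i. distr (distr M S f) (T i) (G i))"
      by (intro PiM_cong refl) (simp add: distr_distr G f comp_def)
    finally show ?thesis by (subst D.indep_vars_iff_distr_eq_PiM'[OF False G'])
  qed
qed

text \<open>Counts are functions of the sequence, so being a Poisson process is a property of the
  law of the sequence alone.\<close>

lemma poisson_points_distr:
  assumes pts: "poisson_points M \<mu> X" and s: "sets \<mu> = sets borel"
  shows "poisson_points (distr M seq_borel (\<lambda>\<omega> n. X n \<omega>)) \<mu> (\<lambda>n x. x n)"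
proof -
  have X: "X n \<in> borel_measurable M" for n using pts by (simp add: poisson_points_def)
  have f: "(\<lambda>\<omega> n. X n \<omega>) \<in> measurable M seq_borel"
    by (rule measurable_PiM_single') (auto simp: X)
  have pc: "point_count (\<lambda>n x. x n) A (\<lambda>n. X n \<omega>) = point_count X A \<omega>" for A \<omega>
    by (simp add: point_count_def)
  have pcm: "point_count (\<lambda>n x. x n) A \<in> borel_measurable seq_borel" if "A \<in> sets borel" for A
    unfolding point_count_eq_suminf[abs_def]
    by (intro borel_measurable_suminf_order measurable_compose[OF measurable_component_singleton]
        borel_measurable_indicator that) simp
  show ?thesis
    unfolding poisson_points_def
  proof (intro conjI allI ballI impI)
    show "(\<lambda>x. x n) \<in> borel_measurable (distr M seq_borel (\<lambda>\<omega> n. X n \<omega>))" for n by simp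
    show "distr (distr M seq_borel (\<lambda>\<omega> n. X n \<omega>)) borel (point_count (\<lambda>n x. x n) A) = poisson_law (emeasure \<mu> A)"
      if "A \<in> sets \<mu>" for A
      using pts that pcm[of A] f s
      by (subst distr_distr) (auto simp: comp_def pc poisson_points_def)
    show "prob_space.indep_vars (distr M seq_borel (\<lambda>\<omega> n. X n \<omega>)) (\<lambda>_. borel) (point_count (\<lambda>n x. x n)) F"
      if F: "finite F \<and> F \<subseteq> sets \<mu> \<and> disjoint F" for F
    proof (rule indep_vars_distr[OF f])
      show "point_count (\<lambda>n x. x n) A \<in> borel_measurable seq_borel" if "A \<in> F" for A
        using that F s by (intro pcm) auto
      show "indep_vars (\<lambda>_. borel) (\<lambda>A \<omega>. point_count (\<lambda>n x. x n) A (\<lambda>n. X n \<omega>)) F"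
        using pts F unfolding pc poisson_points_def by simp
    qed
  qed
qed

end

lemma generated_events_preimage:
  assumes "g \<in> measurable (PiM I (\<lambda>_. borel)) S" "\<And>\<omega>. \<omega> \<in> space M \<Longrightarrow> f \<omega> = g (\<lambda>i\<in>I. X i \<omega>)" "A \<in> sets S"
  shows "f -` A \<inter> space M \<in> generated_events M I X"
proof -
  have "f -` A \<inter> space M = (\<lambda>\<omega>. \<lambda>i\<in>I. X i \<omega>) -` (g -` A \<inter> space (PiM I (\<lambda>_. borel))) \<inter> space M"
    using assms(2) by (auto simp: space_PiM)
  also have "\<dots> \<in> generated_events M I X"
    unfolding generated_events_def using measurable_sets[OF assms(1,3)] by (rule in_vimage_algebra)
  finally show ?thesis .
qed

lemma sigma_algebra_generated_events: "sigma_algebra (space M) (generated_events M I X)"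
  unfolding generated_events_def
  using sets.sigma_algebra_axioms[of "vimage_algebra (space M) (\<lambda>\<omega>. \<lambda>i\<in>I. X i \<omega>) (PiM I (\<lambda>_. borel))"] by simp

lemma Int_stable_generated_events: "Int_stable (generated_events M I X)"
  unfolding generated_events_def by (rule sets.Int_stable)

section \<open>Relevant coordinates and almost sure regularity\<close>

context cascade
begin

lemma Tsum_cong:
  assumes "\<And>q. length q \<le> length p + d \<Longrightarrow> y (Inl q) = y' (Inl q)"
    "\<And>q. length q < length p + d \<Longrightarrow> y (Inr q) = y' (Inr q)"
  shows "Tsum G d p \<zeta> y = Tsum G d p \<zeta> y'"
  using assms
proof (induction d arbitrary: p \<zeta>)
  case (Suc d)
  have "Tsum G d (p @ [n]) \<eta> y = Tsum G d (p @ [n]) \<eta> y'" for n \<eta>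
    by (rule Suc.IH) (auto intro: Suc.prems)
  then show ?case
    by (simp add: node_sum_def child_def Suc.prems)
qed simp

lemma Dsum_cong:
  assumes "\<And>q. length q \<le> length p + Suc (d + e) \<Longrightarrow> y (Inl q) = y' (Inl q)"
    "\<And>q. length q < length p + Suc (d + e) \<Longrightarrow> y (Inr q) = y' (Inr q)"
  shows "Dsum A B d e p \<zeta> y = Dsum A B d e p \<zeta> y'"
  using assms
proof (induction e arbitrary: p \<zeta>)
  case 0
  have "Tsum G d (p @ [n]) \<eta> y = Tsum G d (p @ [n]) \<eta> y'" for n \<eta> G
    by (rule Tsum_cong) (auto intro: 0)
  then show ?case
    by (simp add: node_pair_sum_def child_def 0 cong: if_cong)
next
  case (Suc e)
  have "Dsum A B d e (p @ [n]) \<eta> y = Dsum A B d e (p @ [n]) \<eta> y'" for n \<eta>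
    by (rule Suc.IH) (auto intro: Suc.prems)
  then show ?case
    by (simp add: node_sum_def child_def Suc.prems)
qed

lemma dep_root: "node_fun \<Theta> \<Longrightarrow> dep (- {Inl []}) (\<Theta> [] \<zeta>)"
  by (rule dep_mono[OF node_fun_dep]) auto

end

text \<open>A leaf has a column but no points below it, hence the strict inequality for
  \<open>Inr\<close>.\<close>

definition active :: "nat \<Rightarrow> (nat list + nat list) set" where
  "active k = {i. case i of Inl p \<Rightarrow> length p \<le> k | Inr p \<Rightarrow> length p < k}"

context spin_cascade
begin

definition branch_ratio where
  "branch_ratio a b r h y =
     Dsum (Ae a) (Ae b) (k - Suc r) r [] (start_path h y) y * inverse ((TF 0 [] (start_path h y) y)\<^sup>2)"

text \<open>The realisations for which the normalisations do not fall back on default values; the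
  last condition concerns the sum of the unnormalised cascade weights.\<close>

definition regular where
  "regular h y \<longleftrightarrow> 0 < TF 0 [] (start_path h y) y \<and> TF 0 [] (start_path h y) y < top \<and>
     Tsum (\<lambda>_. 1) k [] (start_path h y) y < top"

lemma start_path_measurable[measurable (raw)]:
  assumes "f \<in> measurable L energy_borel" "g \<in> measurable L P"
  shows "(\<lambda>x. start_path (f x) (g x)) \<in> measurable L state"
proof -
  have [measurable]: "f \<in> measurable L energy_borel" "(\<lambda>x. g x (Inl [])) \<in> measurable L seq_borel"
    using assms by (auto intro: measurable_compose[OF _ seq_measurable])
  have "(\<lambda>x. \<lambda>_. 0) \<in> measurable L matrix_borel"
    by (rule measurable_const) (simp add: space_PiM)
  then show ?thesis
    unfolding start_path_def updc_def by measurable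
qed

lemma branch_ratio_measurable:
  assumes "f \<in> measurable L energy_borel" "g \<in> measurable L P"
  shows "(\<lambda>x. branch_ratio a b r (f x) (g x)) \<in> borel_measurable L"
proof -
  have sp: "(\<lambda>x. start_path (f x) (g x)) \<in> measurable L state"
    using assms by measurable
  have [measurable]: "(\<lambda>x. TF 0 [] (start_path (f x) (g x)) (g x)) \<in> borel_measurable L"
    "(\<lambda>x. Dsum (Ae a) (Ae b) (k - Suc r) r [] (start_path (f x) (g x)) (g x)) \<in> borel_measurable L"
    by (rule node_fun_measurable[OF node_fun_TF sp assms(2)]
        node_fun_measurable[OF node_fun_Dsum[OF Ae_measurable Ae_measurable] sp assms(2)])+
  show ?thesis unfolding branch_ratio_def by measurable
qed

lemma regular_measurable:
  assumes "f \<in> measurable L energy_borel" "g \<in> measurable L P"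
  shows "Measurable.pred L (\<lambda>x. regular (f x) (g x))"
proof -
  have sp: "(\<lambda>x. start_path (f x) (g x)) \<in> measurable L state"
    using assms by measurable
  have n1: "node_fun (Tsum (\<lambda>_. 1) k)" by (rule node_fun_Tsum) simp
  have [measurable]: "(\<lambda>x. TF 0 [] (start_path (f x) (g x)) (g x)) \<in> borel_measurable L"
    "(\<lambda>x. Tsum (\<lambda>_. 1) k [] (start_path (f x) (g x)) (g x)) \<in> borel_measurable L"
    by (rule node_fun_measurable[OF node_fun_TF sp assms(2)] node_fun_measurable[OF n1 sp assms(2)])+
  show ?thesis unfolding regular_def by measurable
qed

lemma dep_active:
  assumes "r < k"
  shows "dep (active k) (branch_ratio a b r h)" "dep (active k) (regular h)"
proof -
  have eq: "start_path h y = start_path h y'" "Tsum G k [] \<zeta> y = Tsum G k [] \<zeta> y'"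
    "Dsum (Ae a) (Ae b) (k - Suc r) r [] \<zeta> y = Dsum (Ae a) (Ae b) (k - Suc r) r [] \<zeta> y'"
    if y: "\<And>i. i \<in> active k \<Longrightarrow> y i = y' i" for y y' \<zeta> G
  proof -
    have 1: "length q \<le> k \<Longrightarrow> y (Inl q) = y' (Inl q)" "length q < k \<Longrightarrow> y (Inr q) = y' (Inr q)" for q
      by (auto intro!: y simp: active_def)
    show "start_path h y = start_path h y'" by (simp add: start_path_def 1)
    show "Tsum G k [] \<zeta> y = Tsum G k [] \<zeta> y'" by (rule Tsum_cong) (auto intro: 1)
    show "Dsum (Ae a) (Ae b) (k - Suc r) r [] \<zeta> y = Dsum (Ae a) (Ae b) (k - Suc r) r [] \<zeta> y'"
      by (rule Dsum_cong) (use assms in \<open>auto intro: 1\<close>)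
  qed
  show "dep (active k) (branch_ratio a b r h)"
  proof (rule depI)
    fix y y' :: "nat list + nat list \<Rightarrow> nat \<Rightarrow> real" assume y: "\<And>i. i \<in> active k \<Longrightarrow> y i = y' i"
    have "start_path h y = start_path h y'" "TF 0 [] \<zeta> y = TF 0 [] \<zeta> y'"
      "Dsum (Ae a) (Ae b) (k - Suc r) r [] \<zeta> y = Dsum (Ae a) (Ae b) (k - Suc r) r [] \<zeta> y'" for \<zeta>
      unfolding diff_zero by (rule eq, erule y)+
    then show "branch_ratio a b r h y = branch_ratio a b r h y'"
      unfolding branch_ratio_def by (simp only:)
  qed
  show "dep (active k) (regular h)"
  proof (rule depI)
    fix y y' :: "nat list + nat list \<Rightarrow> nat \<Rightarrow> real" assume y: "\<And>i. i \<in> active k \<Longrightarrow> y i = y' i"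
    have "start_path h y = start_path h y'" "TF 0 [] \<zeta> y = TF 0 [] \<zeta> y'"
      "Tsum (\<lambda>_. 1) k [] \<zeta> y = Tsum (\<lambda>_. 1) k [] \<zeta> y'" for \<zeta>
      unfolding diff_zero by (rule eq, erule y)+
    then show "regular h y = regular h y'"
      unfolding regular_def by (simp only:)
  qed
qed

lemma start_column_measurable:
  "(\<lambda>p. updc 0 (fst p) (h, \<lambda>_. 0)) \<in> measurable (col 0 \<Otimes>\<^sub>M P) state"
proof (rule measurable_compose[OF _ updc_measurable_column])
  show "fst \<in> measurable (col 0 \<Otimes>\<^sub>M P) seq_borel"
    using measurable_fst[of "col 0" P] by (simp add: measurable_cong_sets[OF refl sets_\<kappa>])
qed

text \<open>Integrating the root column separately fixes the starting state, to which
  \<open>integral_Dsum\<close> applies. The modified sequence \<open>mh\<close> agrees with m at r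
  and \<open>Suc r\<close> because r < k.\<close>

lemma integral_branch_ratio:
  assumes ab: "a \<in> spins N" "b \<in> spins N" and r: "r < k"
  shows "(\<integral>\<^sup>+y. branch_ratio a b r h y \<partial>P) =
    ennreal (m (Suc r) - m r) * (\<integral>\<^sup>+c. Qd (Ae a) (Ae b) r r (updc 0 c (h, \<lambda>_. 0)) \<partial>col 0)"
proof -
  let ?G = "\<lambda>x y. Dsum (Ae a) (Ae b) (k - Suc r) r [] (updc 0 x (h, \<lambda>_. 0)) y *
    inverse ((TF 0 [] (updc 0 x (h, \<lambda>_. 0)) y)\<^sup>2)"
  have [measurable]: "(\<lambda>p. TF 0 [] (updc 0 (fst p) (h, \<lambda>_. 0)) (snd p)) \<in> borel_measurable (col 0 \<Otimes>\<^sub>M P)"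
    "(\<lambda>p. Dsum (Ae a) (Ae b) (k - Suc r) r [] (updc 0 (fst p) (h, \<lambda>_. 0)) (snd p)) \<in> borel_measurable (col 0 \<Otimes>\<^sub>M P)"
    by (rule node_fun_measurable[OF node_fun_TF start_column_measurable measurable_snd]
        node_fun_measurable[OF node_fun_Dsum[OF Ae_measurable Ae_measurable] start_column_measurable measurable_snd])+
  have "(\<integral>\<^sup>+y. ?G (y (Inl [])) y \<partial>P) = (\<integral>\<^sup>+x. \<integral>\<^sup>+y. ?G x y \<partial>P \<partial>\<nu> (Inl []))"
  proof (rule decouple_coordinate)
    show "(\<lambda>p. ?G (fst p) (snd p)) \<in> borel_measurable (\<nu> (Inl []) \<Otimes>\<^sub>M P)"
      unfolding \<nu>_simps list.size(3) by measurable
    show "dep (- {Inl []}) (?G x)" for x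
    proof (rule depI)
      fix y y' :: "nat list + nat list \<Rightarrow> nat \<Rightarrow> real" assume y: "\<And>i. i \<in> - {Inl []} \<Longrightarrow> y i = y' i"
      have "TF 0 [] \<zeta> y = TF 0 [] \<zeta> y'"
        "Dsum (Ae a) (Ae b) (k - Suc r) r [] \<zeta> y = Dsum (Ae a) (Ae b) (k - Suc r) r [] \<zeta> y'" for \<zeta>
        by (rule depD[OF dep_root[OF node_fun_TF] y] depD[OF dep_root[OF node_fun_Dsum[OF Ae_measurable Ae_measurable]] y], assumption)+
      then show "?G x y = ?G x y'" by simp
    qed
  qed
  also have "\<dots> = (\<integral>\<^sup>+x. ennreal (m (Suc r) - m r) * Qd (Ae a) (Ae b) r r (updc 0 x (h, \<lambda>_. 0)) \<partial>col 0)"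
  proof -
    have "mh (Suc r) - mh r = m (Suc r) - m r" using r by (simp add: mh_def)
    then show ?thesis
      using integral_Dsum[OF Ae_measurable Ae_le[OF ab(1)] Ae_measurable Ae_le[OF ab(2)] r] by simp
  qed
  also have "\<dots> = ennreal (m (Suc r) - m r) * (\<integral>\<^sup>+x. Qd (Ae a) (Ae b) r r (updc 0 x (h, \<lambda>_. 0)) \<partial>col 0)"
  proof (rule nn_integral_cmult)
    show "(\<lambda>x. Qd (Ae a) (Ae b) r r (updc 0 x (h, \<lambda>_. 0))) \<in> borel_measurable (col 0)"
      unfolding \<kappa>_measurable
      by (rule measurable_compose[OF updc_measurable_column])
        (use Qd_measurable_le_1[OF Ae_measurable Ae_le[OF ab(1)] Ae_measurable Ae_le[OF ab(2)] r, of r] in simp)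
  qed
  finally show ?thesis unfolding branch_ratio_def start_path_def .
qed

text \<open>At parameter t = 1 with zero energies the partition function is the number of spin
  configurations, hence at least 1, while the cascade and its columns are the same. The finiteness
  already proved for that model dominates the sum of the weights.\<close>

lemma AE_Tsum_1_finite: "AE y in P. Tsum (\<lambda>_. 1) k [] \<zeta> y < top"
proof -
  interpret S1: spin_cascade N k \<xi> q m 1 \<rho>
    by (rule spin_cascade_axioms)
  have "AE y in P. S1.TF 0 [] (\<lambda>_. 0, \<lambda>_. 0) y < top"
    by (rule S1.AE_TF_finite)
  moreover have "Tsum (\<lambda>_. 1) k [] \<zeta> y \<le> S1.TF 0 [] (\<lambda>_. 0, \<lambda>_. 0) y" for y
    unfolding Tsum_leaves diff_zero
  proof (rule nn_integral_mono)
    fix \<gamma>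
    have "S1.partition_fun k (leaf_path [] \<gamma> (\<lambda>_. 0, \<lambda>_. 0) y) = real (card (spins N))"
      by (simp add: S1.partition_fun_def hamiltonian_def)
    moreover have "1 \<le> real (card (spins N))"
      using card_gt_0_iff[of "spins N"] by (simp add: Suc_le_eq)
    ultimately have "1 \<le> ennreal (S1.partition_fun k (leaf_path [] \<gamma> (\<lambda>_. 0, \<lambda>_. 0) y))"
      by simp
    then show "leaf_term (\<lambda>_. 1) [] \<gamma> \<zeta> y \<le> leaf_term (\<lambda>\<zeta>. ennreal (S1.partition_fun k \<zeta>)) [] \<gamma> (\<lambda>_. 0, \<lambda>_. 0) y"
      unfolding leaf_term_def by (intro mult_left_mono) auto
  qed
  ultimately show ?thesis by (auto elim!: eventually_mono intro: le_less_trans)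
qed

lemma integral_not_regular: "(\<integral>\<^sup>+y. of_bool (\<not> regular h y) \<partial>P) = 0"
proof -
  let ?R = "\<lambda>\<zeta> y. 0 < TF 0 [] \<zeta> y \<and> TF 0 [] \<zeta> y < top \<and> Tsum (\<lambda>_. 1) k [] \<zeta> y < top"
  have n1: "node_fun (Tsum (\<lambda>_. 1) k)" by (rule node_fun_Tsum) simp
  have [measurable]: "(\<lambda>p. TF 0 [] (updc 0 (fst p) (h, \<lambda>_. 0)) (snd p)) \<in> borel_measurable (col 0 \<Otimes>\<^sub>M P)"
    "(\<lambda>p. Tsum (\<lambda>_. 1) k [] (updc 0 (fst p) (h, \<lambda>_. 0)) (snd p)) \<in> borel_measurable (col 0 \<Otimes>\<^sub>M P)"
    by (rule node_fun_measurable[OF node_fun_TF start_column_measurable measurable_snd]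
        node_fun_measurable[OF n1 start_column_measurable measurable_snd])+
  have "(\<integral>\<^sup>+y. of_bool (\<not> ?R (updc 0 (y (Inl [])) (h, \<lambda>_. 0)) y) \<partial>P) =
      (\<integral>\<^sup>+x. \<integral>\<^sup>+y. of_bool (\<not> ?R (updc 0 x (h, \<lambda>_. 0)) y) \<partial>P \<partial>\<nu> (Inl []))"
  proof (rule decouple_coordinate)
    show "(\<lambda>p. of_bool (\<not> ?R (updc 0 (fst p) (h, \<lambda>_. 0)) (snd p)) :: ennreal) \<in> borel_measurable (\<nu> (Inl []) \<Otimes>\<^sub>M P)"
      unfolding \<nu>_simps list.size(3) by measurable
    show "dep (- {Inl []}) (\<lambda>y. of_bool (\<not> ?R (updc 0 x (h, \<lambda>_. 0)) y) :: ennreal)" for x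
    proof (rule depI)
      fix y y' :: "nat list + nat list \<Rightarrow> nat \<Rightarrow> real" assume y: "\<And>i. i \<in> - {Inl []} \<Longrightarrow> y i = y' i"
      have "TF 0 [] \<zeta> y = TF 0 [] \<zeta> y'" "Tsum (\<lambda>_. 1) k [] \<zeta> y = Tsum (\<lambda>_. 1) k [] \<zeta> y'" for \<zeta>
        by (rule depD[OF dep_root[OF node_fun_TF] y] depD[OF dep_root[OF n1] y], assumption)+
      then show "of_bool (\<not> ?R (updc 0 x (h, \<lambda>_. 0)) y) = (of_bool (\<not> ?R (updc 0 x (h, \<lambda>_. 0)) y') :: ennreal)" by simp
    qed
  qed
  also have "\<dots> = (\<integral>\<^sup>+x. 0 \<partial>\<nu> (Inl []))"
  proof (rule nn_integral_cong)
    fix x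
    have "AE y in P. ?R (updc 0 x (h, \<lambda>_. 0)) y"
      using AE_TF_pos AE_TF_finite AE_Tsum_1_finite by eventually_elim blast
    then have "(\<integral>\<^sup>+y. of_bool (\<not> ?R (updc 0 x (h, \<lambda>_. 0)) y) \<partial>P) = (\<integral>\<^sup>+y. 0 \<partial>P)"
      by (intro nn_integral_cong_AE) (auto elim!: eventually_mono)
    then show "(\<integral>\<^sup>+y. of_bool (\<not> ?R (updc 0 x (h, \<lambda>_. 0)) y) \<partial>P) = 0" by simp
  qed
  finally show ?thesis unfolding regular_def start_path_def by simp
qed

lemma Tsum_1_leaf_weight: "Tsum (\<lambda>_. 1) k [] \<zeta> y = (\<integral>\<^sup>+\<alpha>. leaf_weight [] \<alpha> y \<partial>count_space (leaves k))"
  by (simp add: Tsum_leaves leaf_term_def)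

lemma pair_mass_branch_ratio:
  assumes "pos_points k uu" "regular h (conf zz uu)" "a \<in> spins N" "b \<in> spins N" "r < k"
  shows "pair_mass k (Suc r) (gibbs_density h zz uu) a b = branch_ratio a b r h (conf zz uu)"
  unfolding branch_ratio_def
  by (rule pair_mass_gibbs) (use assms in \<open>auto simp: regular_def Tsum_1_leaf_weight\<close>)

end

subsection \<open>Transfer to the given probability space\<close>

lemma gibbs_weight_cong:
  assumes "\<And>\<sigma>. \<sigma> \<in> spins N \<Longrightarrow> h \<sigma> = h' \<sigma>" "x \<in> spins N \<times> leaves k"
  shows "gibbs_weight N k t h zz uu x = gibbs_weight N k t h' zz uu x"
  using assms by (auto simp: gibbs_weight_def hamiltonian_def)

text \<open>H matters on spin configurations only; the extension by 0 makes the energy a random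
  element of a product over the whole function type.\<close>

definition spin_energy :: "nat \<Rightarrow> ((nat \<Rightarrow> real) \<Rightarrow> 'w \<Rightarrow> real) \<Rightarrow> 'w \<Rightarrow> (nat \<Rightarrow> real) \<Rightarrow> real" where
  "spin_energy N H \<omega> \<sigma> = (if \<sigma> \<in> spins N then H \<sigma> \<omega> else 0)"

lemma spin_energy_measurable:
  assumes "\<And>\<sigma>. \<sigma> \<in> spins N \<Longrightarrow> H \<sigma> \<in> borel_measurable M"
  shows "spin_energy N H \<in> measurable M energy_borel"
proof (rule measurable_PiM_single')
  fix \<sigma> show "(\<lambda>\<omega>. spin_energy N H \<omega> \<sigma>) \<in> borel_measurable M"
    by (cases "\<sigma> \<in> spins N") (simp_all add: spin_energy_def assms)
qed auto

lemma spin_energy_generated: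
  assumes A: "A \<in> sets energy_borel"
  shows "spin_energy N H -` A \<inter> space M \<in> generated_events M (spins N) H"
proof (rule generated_events_preimage[OF _ _ A])
  show "(\<lambda>f \<sigma>. if \<sigma> \<in> spins N then f \<sigma> else 0) \<in> measurable (PiM (spins N) (\<lambda>_. borel)) energy_borel"
  proof (rule measurable_PiM_single')
    fix \<sigma> show "(\<lambda>f. if \<sigma> \<in> spins N then f \<sigma> else 0) \<in> borel_measurable (PiM (spins N) (\<lambda>_. borel))"
      by (cases "\<sigma> \<in> spins N") (auto intro: measurable_component_singleton)
  qed auto
qed (auto simp: spin_energy_def fun_eq_iff)

lemma AE_poisson_points_pos:
  assumes "prob_space M" "poisson_points M (power_intensity a) X"
  shows "AE \<omega> in M. \<forall>n. 0 < X n \<omega>"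
  by (rule pos_ppp.AE_points_pos, intro pos_ppp.intro ppp.intro ppp_axioms.intro pos_ppp_axioms.intro)
    (rule assms sets_power_intensity power_intensity_nonpos)+

text \<open>The random data of the left-hand side on the given probability space.\<close>

locale disorder = prob_space M + spin_params N k \<xi> q m t
  for M :: "'w measure" and N k \<xi> q m t +
  fixes H :: "(nat \<Rightarrow> real) \<Rightarrow> 'w \<Rightarrow> real" and z :: "nat list \<times> nat \<Rightarrow> 'w \<Rightarrow> real" and u :: "nat list \<Rightarrow> 'w \<Rightarrow> real"
  assumes H_measurable: "\<And>\<sigma>. \<sigma> \<in> spins N \<Longrightarrow> H \<sigma> \<in> borel_measurable M"
    and u_cascade: "derrida_ruelle_cascade M k m u"
    and z_gaussian: "independent_gaussians M (tree_entries N k) (\<lambda>(p, i). column_var \<xi> q (length p)) z"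
    and Hzu_indep: "indep_sets (\<lambda>b. [generated_events M (spins N) H,
                 generated_events M (tree_entries N k) z,
                 generated_events M (nodes k) u] ! b) {..<3}"
begin

text \<open>Nodes of depth k or more carry no points; a dummy law there lets the product run over
  all lists.\<close>

definition seq_law :: "nat list \<Rightarrow> (nat \<Rightarrow> real) measure" where
  "seq_law p = (if length p < k then distr M seq_borel (\<lambda>\<omega> n. u (p @ [n]) \<omega>) else return seq_borel (\<lambda>_. 0))"

lemma u_measurable: "length p < k \<Longrightarrow> u (p @ [n]) \<in> borel_measurable M"
  using u_cascade by (auto simp: derrida_ruelle_cascade_def poisson_points_def)

lemma u_seq_measurable: "length p < k \<Longrightarrow> (\<lambda>\<omega> n. u (p @ [n]) \<omega>) \<in> measurable M seq_borel"
  by (rule measurable_PiM_single') (auto intro: u_measurable)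

abbreviation "energy \<equiv> spin_energy N H"

definition entry :: "nat list + nat list \<Rightarrow> 'w \<Rightarrow> nat \<Rightarrow> real" where
  "entry = case_sum (\<lambda>p \<omega> i. if i < N then z (p, i) \<omega> else 0) (\<lambda>p \<omega> n. u (p @ [n]) \<omega>)"

definition config :: "'w \<Rightarrow> nat list + nat list \<Rightarrow> nat \<Rightarrow> real" where
  "config \<omega> = (\<lambda>i. if i \<in> active k then entry i \<omega> else (\<lambda>_. 0))"

abbreviation "config_borel \<equiv> PiM (UNIV :: (nat list + nat list) set) (\<lambda>_. seq_borel)"

lemma z_measurable: "length p \<le> k \<Longrightarrow> i < N \<Longrightarrow> z (p, i) \<in> borel_measurable M"
  using z_gaussian by (auto simp: independent_gaussians_def tree_entries_def)

lemma zu_indep: "indep_set (generated_events M (tree_entries N k) z) (generated_events M (nodes k) u)"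
proof -
  have sub: "generated_events M (tree_entries N k) z \<subseteq> sets M" "generated_events M (nodes k) u \<subseteq> sets M"
    using conjunct1[OF Hzu_indep[unfolded indep_sets_def], rule_format, of 1]
      conjunct1[OF Hzu_indep[unfolded indep_sets_def], rule_format, of 2] by simp_all
  show ?thesis
    unfolding indep_sets2_eq
  proof (intro conjI ballI sub)
    fix A B assume AB: "A \<in> generated_events M (tree_entries N k) z" "B \<in> generated_events M (nodes k) u"
    have "measure M (\<Inter>j\<in>{1, 2::nat}. if j = 1 then A else B) = (\<Prod>j\<in>{1, 2::nat}. measure M (if j = 1 then A else B))"
      by (rule indep_setsD[OF Hzu_indep]) (use AB in auto)
    then show "measure M (A \<inter> B) = measure M A * measure M B" by (simp add: Int_commute)
  qed
qed

text \<open>Columns are disjoint groups of the independent Gaussian entries, the Poisson sequences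
  are independent by assumption, and the two families are independent of each other.\<close>

lemma entries_indep: "indep_vars (\<lambda>_. seq_borel) entry (active k)"
proof -
  let ?I = "{p :: nat list. length p \<le> k}" and ?J = "{p :: nat list. length p < k}"
  have act: "active k = Inl ` ?I \<union> Inr ` ?J"
    (is "?A = ?B")
  proof (rule set_eqI)
    fix i show "i \<in> ?A \<longleftrightarrow> i \<in> ?B" by (cases i) (auto simp: active_def)
  qed
  let ?g = "\<lambda>p (f :: nat list \<times> nat \<Rightarrow> real) i. if i < N then f (p, i) else 0"
  have gm: "?g p \<in> measurable (PiM ({p} \<times> {..<N}) (\<lambda>_. borel)) seq_borel" for p
  proof (rule measurable_PiM_single')
    fix i show "(\<lambda>f. ?g p f i) \<in> borel_measurable (PiM ({p} \<times> {..<N}) (\<lambda>_. borel))"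
      by (cases "i < N") (auto intro: measurable_component_singleton)
  qed auto
  have zi: "indep_vars (\<lambda>_. borel) z (tree_entries N k)"
    using z_gaussian by (simp add: independent_gaussians_def)
  have "indep_vars (\<lambda>_. seq_borel) (\<lambda>p \<omega>. ?g p (\<lambda>i\<in>{p} \<times> {..<N}. z i \<omega>)) ?I"
    by (rule indep_vars_group[OF zi _ _ gm]) (auto simp: tree_entries_def disjoint_family_on_def)
  also have "(\<lambda>p \<omega>. ?g p (\<lambda>i\<in>{p} \<times> {..<N}. z i \<omega>)) = (\<lambda>p \<omega> i. if i < N then z (p, i) \<omega> else 0)"
    by (auto simp: fun_eq_iff)
  finally have X: "indep_vars (\<lambda>_. seq_borel) (\<lambda>p \<omega> i. if i < N then z (p, i) \<omega> else 0) ?I" .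
  have Y: "indep_vars (\<lambda>_. seq_borel) (\<lambda>p \<omega> n. u (p @ [n]) \<omega>) ?J"
    using u_cascade by (simp add: derrida_ruelle_cascade_def)
  have XA: "(\<lambda>\<omega> i. if i < N then z (p, i) \<omega> else 0) -` A \<inter> space M \<in> generated_events M (tree_entries N k) z"
    if p: "p \<in> ?I" and A: "A \<in> sets seq_borel" for p A
  proof (rule generated_events_preimage[OF _ _ A])
    show "?g p \<in> measurable (PiM (tree_entries N k) (\<lambda>_. borel)) seq_borel"
    proof (rule measurable_PiM_single')
      fix i show "(\<lambda>f. ?g p f i) \<in> borel_measurable (PiM (tree_entries N k) (\<lambda>_. borel))"
        using p by (cases "i < N") (auto intro!: measurable_component_singleton simp: tree_entries_def)
    qed auto
  qed (use p in \<open>auto simp: tree_entries_def fun_eq_iff\<close>)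
  have YB: "(\<lambda>\<omega> n. u (p @ [n]) \<omega>) -` A \<inter> space M \<in> generated_events M (nodes k) u"
    if p: "p \<in> ?J" and A: "A \<in> sets seq_borel" for p A
  proof (rule generated_events_preimage[OF _ _ A])
    show "(\<lambda>f n. f (p @ [n])) \<in> measurable (PiM (nodes k) (\<lambda>_. borel)) seq_borel"
      by (rule measurable_PiM_single') (use p in \<open>auto intro!: measurable_component_singleton simp: nodes_def\<close>)
  qed (use p in \<open>auto simp: nodes_def fun_eq_iff\<close>)
  show ?thesis
    unfolding act entry_def
    by (rule indep_vars_Plus[OF X Y zu_indep sigma_algebra_generated_events sigma_algebra_generated_events XA YB])
qed

text \<open>The three-fold independence is regrouped so that the energies are independent of columns
  and points jointly; the configuration is measurable with respect to the sigma-algebra S generated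
  by the latter two.\<close>

lemma energy_config:
  shows energy_measurable: "energy \<in> measurable M energy_borel"
    and config_measurable: "config \<in> measurable M config_borel"
    and energy_config_indep: "distr M energy_borel energy \<Otimes>\<^sub>M distr M config_borel config =
      distr M (energy_borel \<Otimes>\<^sub>M config_borel) (\<lambda>\<omega>. (energy \<omega>, config \<omega>))"
proof -
  let ?E = "\<lambda>b. [generated_events M (spins N) H, generated_events M (tree_entries N k) z, generated_events M (nodes k) u] ! b"
  let ?I = "\<lambda>b. if b then {0} else {1, 2::nat}"
  define S where "S = sigma_sets (space M) (generated_events M (tree_entries N k) z \<union> generated_events M (nodes k) u)"
  have U: "(\<Union>j\<in>UNIV. ?I j) = {..<3}" by (auto simp: UNIV_bool)
  have "indep_sets (\<lambda>j. sigma_sets (space M) (\<Union>i\<in>?I j. ?E i)) UNIV"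
  proof (rule indep_sets_collect_sigma)
    show "indep_sets ?E (\<Union>j\<in>UNIV. ?I j)" unfolding U by (rule Hzu_indep)
    show "Int_stable (?E i)" if "i \<in> ?I j" for i j
      using that by (auto split: if_splits intro: Int_stable_generated_events)
  qed (auto simp: disjoint_family_on_def)
  then have ind: "indep_set (generated_events M (spins N) H) S"
    unfolding indep_set_def
    by (rule indep_sets_mono_sets) (auto split: bool.split simp: S_def)
  have sub: "generated_events M (tree_entries N k) z \<union> generated_events M (nodes k) u \<subseteq> Pow (space M)"
    using zu_indep sets.sets_into_space unfolding indep_sets2_eq by blast
  \<comment> \<open>This measurable space carries S, so measurability of the configuration on it
    yields preimages that lie in S.\<close>
  let ?MS = "sigma (space M) (generated_events M (tree_entries N k) z \<union> generated_events M (nodes k) u)"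
  have sMS: "sets ?MS = S" "space ?MS = space M"
    using sub by (simp_all add: S_def)
  have zm: "z (p, i) \<in> borel_measurable ?MS" if "length p \<le> k" "i < N" for p i
  proof (rule measurableI)
    fix A :: "real set" assume "A \<in> sets borel"
    then have "z (p, i) -` A \<inter> space M \<in> generated_events M (tree_entries N k) z"
      by (intro generated_events_preimage[where g="\<lambda>f. f (p, i)" and S=borel])
         (use that in \<open>auto intro!: measurable_component_singleton simp: tree_entries_def\<close>)
    then show "z (p, i) -` A \<inter> space ?MS \<in> sets ?MS"
      unfolding sMS by (simp add: S_def)
  qed simp
  have um: "u (p @ [n]) \<in> borel_measurable ?MS" if "length p < k" for p n
  proof (rule measurableI)
    fix A :: "real set" assume "A \<in> sets borel"
    then have "u (p @ [n]) -` A \<inter> space M \<in> generated_events M (nodes k) u"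
      by (intro generated_events_preimage[where g="\<lambda>f. f (p @ [n])" and S=borel])
         (use that in \<open>auto intro!: measurable_component_singleton simp: nodes_def\<close>)
    then show "u (p @ [n]) -` A \<inter> space ?MS \<in> sets ?MS"
      unfolding sMS by (simp add: S_def)
  qed simp
  have cm: "config \<in> measurable L config_borel"
    if "\<And>p i. length p \<le> k \<Longrightarrow> i < N \<Longrightarrow> z (p, i) \<in> borel_measurable L"
      "\<And>p n. length p < k \<Longrightarrow> u (p @ [n]) \<in> borel_measurable L" for L
  proof (rule measurable_PiM_single')
    fix i
    show "(\<lambda>\<omega>. config \<omega> i) \<in> measurable L seq_borel"
    proof (rule measurable_PiM_single')
      fix n
      show "(\<lambda>\<omega>. config \<omega> i n) \<in> borel_measurable L"
      proof (cases i)
        case (Inl p)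
        then show ?thesis
          using that(1)[of p n] by (cases "length p \<le> k"; cases "n < N") (simp_all add: config_def entry_def active_def)
      next
        case (Inr p)
        then show ?thesis
          using that(2)[of p n] by (cases "length p < k") (simp_all add: config_def entry_def active_def)
      qed
    qed auto
  qed (auto simp: space_PiM)
  show em: "energy \<in> measurable M energy_borel"
    by (rule spin_energy_measurable) (rule H_measurable)
  show com: "config \<in> measurable M config_borel"
    by (rule cm) (auto intro: z_measurable u_measurable)
  show "distr M energy_borel energy \<Otimes>\<^sub>M distr M config_borel config =
      distr M (energy_borel \<Otimes>\<^sub>M config_borel) (\<lambda>\<omega>. (energy \<omega>, config \<omega>))"
  proof (rule distr_pair_indep_set[OF ind em com])
    show "energy -` A \<inter> space M \<in> generated_events M (spins N) H" if A: "A \<in> sets energy_borel" for A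
      using A by (rule spin_energy_generated)
    have "config \<in> measurable ?MS config_borel" by (rule cm) (auto intro: zm um)
    then show "config -` A \<inter> space M \<in> S" if "A \<in> sets config_borel" for A
      using measurable_sets[of config ?MS config_borel A] that unfolding sMS by simp
  qed
qed

lemma integral_energy_entries:
  assumes \<nu>: "\<And>i. prob_space (\<nu> i)" "\<And>i. sets (\<nu> i) = sets seq_borel"
      "\<And>i. i \<in> active k \<Longrightarrow> distr M seq_borel (entry i) = \<nu> i"
    and f: "(\<lambda>p. f (fst p) (snd p)) \<in> borel_measurable (energy_borel \<Otimes>\<^sub>M config_borel)"
    and d: "\<And>h. dep (active k) (f h)"
  shows "(\<integral>\<^sup>+\<omega>. f (energy \<omega>) (config \<omega>) \<partial>M) = (\<integral>\<^sup>+\<omega>. \<integral>\<^sup>+y. f (energy \<omega>) y \<partial>PiM UNIV \<nu> \<partial>M)"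
proof -
  have "(\<integral>\<^sup>+\<omega>. f (energy \<omega>) (config \<omega>) \<partial>M) = (\<integral>\<^sup>+\<omega>. \<integral>\<^sup>+\<omega>'. f (energy \<omega>) (config \<omega>') \<partial>M \<partial>M)"
    by (rule nn_integral_pair_distr[OF energy_config f])
  also have "\<dots> = (\<integral>\<^sup>+\<omega>. \<integral>\<^sup>+y. f (energy \<omega>) y \<partial>PiM UNIV \<nu> \<partial>M)"
  proof (rule nn_integral_cong)
    fix \<omega>
    have "f (energy \<omega>) \<in> borel_measurable config_borel"
      using measurable_compose[OF measurable_Pair1' f, of "energy \<omega>"] by (simp add: space_PiM)
    then show "(\<integral>\<^sup>+\<omega>'. f (energy \<omega>) (config \<omega>') \<partial>M) = (\<integral>\<^sup>+y. f (energy \<omega>) y \<partial>PiM UNIV \<nu>)"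
      unfolding config_def
      by (intro nn_integral_config[OF entries_indep])
        (auto simp: space_PiM \<nu> d)
  qed
  finally show ?thesis .
qed

lemma AE_pos_points: "AE \<omega> in M. pos_points k (\<lambda>p. u p \<omega>)"
proof -
  have "AE \<omega> in M. \<forall>n. 0 < u (p @ [n]) \<omega>" if p: "length p < k" for p
  proof (rule AE_poisson_points_pos[OF prob_space_axioms])
    show "poisson_points M (power_intensity (m (Suc (length p)))) (\<lambda>n. u (p @ [n]))"
      using u_cascade p by (simp add: derrida_ruelle_cascade_def)
  qed
  then have "AE \<omega> in M. \<forall>p. length p < k \<longrightarrow> (\<forall>n. 0 < u (p @ [n]) \<omega>)"
    by (subst AE_all_countable) (intro allI AE_impI)
  then show ?thesis by eventually_elim (auto simp: pos_points_def)
qed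

lemma column_entry_law:
  assumes p: "length p \<le> k"
  shows "distr M seq_borel (entry (Inl p)) = col (length p)"
proof -
  have zi: "indep_vars (\<lambda>_. borel) z (tree_entries N k)"
    and zl: "\<And>i. i < N \<Longrightarrow> distr M borel (z (p, i)) = centered_gaussian (column_var \<xi> q (length p))"
    using z_gaussian p by (auto simp: independent_gaussians_def tree_entries_def)
  have "indep_vars (\<lambda>_. borel) (\<lambda>i. z (p, i)) {..<N}"
    by (rule indep_vars_reindex_inj[OF zi]) (use p in \<open>auto simp: inj_on_def tree_entries_def\<close>)
  from distr_column[OF this zl] show ?thesis
    by (simp add: entry_def col_def)
qed

sublocale spin_cascade N k \<xi> q m t seq_law
proof (rule spin_cascade.intro[OF spin_params_axioms], rule spin_cascade_axioms.intro)
  show "prob_space (seq_law p)" for p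
    by (auto simp: seq_law_def space_PiM intro!: prob_space_distr prob_space_return u_seq_measurable)
  show "sets (seq_law p) = sets seq_borel" for p by (simp add: seq_law_def)
  show "poisson_points (seq_law p) (power_intensity (m (Suc (length p)))) (\<lambda>n x. x n)" if "length p < k" for p
    using poisson_points_distr[of "power_intensity (m (Suc (length p)))" "\<lambda>n. u (p @ [n])"] u_cascade that
    by (simp add: seq_law_def derrida_ruelle_cascade_def)
qed

lemma sets_P: "sets P = sets config_borel"
  unfolding P_def by (rule sets_PiM_cong) (auto simp: sets_\<nu>)

lemma config_eq: "config \<omega> = conf (\<lambda>x. z x \<omega>) (\<lambda>p. u p \<omega>)"
proof
  fix i show "config \<omega> i = conf (\<lambda>x. z x \<omega>) (\<lambda>p. u p \<omega>) i"
    by (cases i) (auto simp: config_def conf_def active_def entry_def)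
qed

lemma entry_law: "i \<in> active k \<Longrightarrow> distr M seq_borel (entry i) = \<nu> i"
  using column_entry_law by (cases i) (auto simp: active_def entry_def seq_law_def)

lemma integral_energy_config:
  assumes f: "(\<lambda>p. f (fst p) (snd p)) \<in> borel_measurable (energy_borel \<Otimes>\<^sub>M config_borel)"
    and d: "\<And>h. dep (active k) (f h)"
  shows "(\<integral>\<^sup>+\<omega>. f (energy \<omega>) (config \<omega>) \<partial>M) = (\<integral>\<^sup>+\<omega>. \<integral>\<^sup>+y. f (energy \<omega>) y \<partial>P \<partial>M)"
  unfolding P_def
  by (rule integral_energy_entries[OF prob_\<nu> sets_\<nu> entry_law f d])

text \<open>Almost every realisation is regular with positive points, so the mass is
  \<open>branch_ratio\<close> evaluated at the configuration. That ratio reads only active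
  coordinates, and its expectation can be computed under the product measure P with the energies
  fixed.\<close>

theorem integral_pair_mass:
  assumes ab: "a \<in> spins N" "b \<in> spins N" and r: "r < k"
  shows "(\<integral>\<^sup>+\<omega>. pair_mass k (Suc r) (gibbs_density (\<lambda>\<sigma>. H \<sigma> \<omega>) (\<lambda>x. z x \<omega>) (\<lambda>p. u p \<omega>)) a b \<partial>M) =
    ennreal (m (Suc r) - m r) *
      (\<integral>\<^sup>+\<omega>. \<integral>\<^sup>+c. Qd (Ae a) (Ae b) r r (updc 0 c (energy \<omega>, \<lambda>_. 0)) \<partial>col 0 \<partial>M)"
proof -
  have sets: "sets (energy_borel \<Otimes>\<^sub>M config_borel) = sets (energy_borel \<Otimes>\<^sub>M P)"
    by (intro sets_pair_measure_cong) (simp_all add: sets_P)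
  note meas_eq = measurable_cong_sets[OF sets refl]
  have rm: "Measurable.pred (energy_borel \<Otimes>\<^sub>M P) (\<lambda>p. regular (fst p) (snd p))"
    by (rule regular_measurable) auto
  have mm: "(\<lambda>p. of_bool (\<not> regular (fst p) (snd p)) :: ennreal) \<in> borel_measurable (energy_borel \<Otimes>\<^sub>M P)"
    using rm by measurable
  \<comment> \<open>Regularity is itself transferred from P: the expected indicator of its failure
    vanishes.\<close>
  have "(\<integral>\<^sup>+\<omega>. of_bool (\<not> regular (energy \<omega>) (config \<omega>)) \<partial>M) = (\<integral>\<^sup>+\<omega>. \<integral>\<^sup>+y. of_bool (\<not> regular (energy \<omega>) y) \<partial>P \<partial>M)"
  proof (rule integral_energy_config)
    show "dep (active k) (\<lambda>y. of_bool (\<not> regular h y) :: ennreal)" for h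
      by (rule depI, rule arg_cong[where f="\<lambda>b. of_bool (\<not> b)"], erule depD[OF dep_active(2)[OF r]])
  qed (unfold meas_eq, rule mm)
  then have i0: "(\<integral>\<^sup>+\<omega>. of_bool (\<not> regular (energy \<omega>) (config \<omega>)) \<partial>M) = 0"
    by (simp add: integral_not_regular)
  have em: "energy \<in> measurable M energy_borel" "config \<in> measurable M P"
    using energy_measurable config_measurable by (auto simp: measurable_cong_sets[OF refl sets_P])
  have "(\<lambda>\<omega>. of_bool (\<not> regular (energy \<omega>) (config \<omega>)) :: ennreal) \<in> borel_measurable M"
    using measurable_compose[OF measurable_Pair[OF em] mm] by simp
  then have reg: "AE \<omega> in M. regular (energy \<omega>) (config \<omega>)"
    using i0 by (subst (asm) nn_integral_0_iff_AE) (auto elim!: eventually_mono)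
  have "(\<integral>\<^sup>+\<omega>. pair_mass k (Suc r) (gibbs_density (\<lambda>\<sigma>. H \<sigma> \<omega>) (\<lambda>x. z x \<omega>) (\<lambda>p. u p \<omega>)) a b \<partial>M) =
    (\<integral>\<^sup>+\<omega>. branch_ratio a b r (energy \<omega>) (config \<omega>) \<partial>M)"
  proof (rule nn_integral_cong_AE)
    show "AE \<omega> in M. pair_mass k (Suc r) (gibbs_density (\<lambda>\<sigma>. H \<sigma> \<omega>) (\<lambda>x. z x \<omega>) (\<lambda>p. u p \<omega>)) a b = branch_ratio a b r (energy \<omega>) (config \<omega>)"
      using AE_pos_points reg
    proof eventually_elim
      fix \<omega> assume pos: "pos_points k (\<lambda>p. u p \<omega>)" and rg: "regular (energy \<omega>) (config \<omega>)"
      let ?w = "\<lambda>h. gibbs_weight N k t h (\<lambda>x. z x \<omega>) (\<lambda>p. u p \<omega>)"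
      have w: "?w (\<lambda>\<sigma>. H \<sigma> \<omega>) x = ?w (energy \<omega>) x" if "x \<in> spins N \<times> leaves k" for x
        by (rule gibbs_weight_cong[OF _ that]) (simp add: spin_energy_def)
      have s: "(\<Sum>\<^sub>\<infinity>x\<in>spins N \<times> leaves k. ?w (\<lambda>\<sigma>. H \<sigma> \<omega>) x) = (\<Sum>\<^sub>\<infinity>x\<in>spins N \<times> leaves k. ?w (energy \<omega>) x)"
        by (rule infsum_cong) (rule w)
      have "pair_mass k (Suc r) (gibbs_density (\<lambda>\<sigma>. H \<sigma> \<omega>) (\<lambda>x. z x \<omega>) (\<lambda>p. u p \<omega>)) a b =
        pair_mass k (Suc r) (gibbs_density (energy \<omega>) (\<lambda>x. z x \<omega>) (\<lambda>p. u p \<omega>)) a b"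
        unfolding pair_mass_def s by (intro nn_integral_cong) (simp add: w ab)
      also have "\<dots> = branch_ratio a b r (energy \<omega>) (config \<omega>)"
        unfolding config_eq by (rule pair_mass_branch_ratio[OF pos rg[unfolded config_eq] ab r])
      finally show "pair_mass k (Suc r) (gibbs_density (\<lambda>\<sigma>. H \<sigma> \<omega>) (\<lambda>x. z x \<omega>) (\<lambda>p. u p \<omega>)) a b =
        branch_ratio a b r (energy \<omega>) (config \<omega>)" .
    qed
  qed
  also have "\<dots> = (\<integral>\<^sup>+\<omega>. \<integral>\<^sup>+y. branch_ratio a b r (energy \<omega>) y \<partial>P \<partial>M)"
  proof (rule integral_energy_config)
    show "(\<lambda>p. branch_ratio a b r (fst p) (snd p)) \<in> borel_measurable (energy_borel \<Otimes>\<^sub>M config_borel)"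
      unfolding meas_eq by (rule branch_ratio_measurable) auto
  qed (rule dep_active(1)[OF r])
  also have "\<dots> = (\<integral>\<^sup>+\<omega>. ennreal (m (Suc r) - m r) * (\<integral>\<^sup>+c. Qd (Ae a) (Ae b) r r (updc 0 c (energy \<omega>, \<lambda>_. 0)) \<partial>col 0) \<partial>M)"
    by (simp only: integral_branch_ratio[OF ab r])
  also have "\<dots> = ennreal (m (Suc r) - m r) *
      (\<integral>\<^sup>+\<omega>. \<integral>\<^sup>+c. Qd (Ae a) (Ae b) r r (updc 0 c (energy \<omega>, \<lambda>_. 0)) \<partial>col 0 \<partial>M)"
  proof (rule nn_integral_cmult)
    interpret C: prob_space "col 0" by (rule prob_\<kappa>)
    have Q: "Qd (Ae a) (Ae b) r r \<in> borel_measurable state"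
      using Qd_measurable_le_1[OF Ae_measurable Ae_le[OF ab(1)] Ae_measurable Ae_le[OF ab(2)] r, of r] by simp
    have 1: "(\<lambda>p. energy (fst p)) \<in> measurable (M \<Otimes>\<^sub>M col 0) energy_borel"
      by (rule measurable_compose[OF measurable_fst em(1)])
    have 2: "(\<lambda>p. snd p) \<in> measurable (M \<Otimes>\<^sub>M col 0) seq_borel"
      using measurable_snd[of M "col 0"] by (simp add: measurable_cong_sets[OF refl sets_\<kappa>])
    have 3: "(\<lambda>x. \<lambda>_. 0) \<in> measurable (M \<Otimes>\<^sub>M col 0) matrix_borel"
      by (rule measurable_const) (simp add: space_PiM)
    have "(\<lambda>p. updc 0 (snd p) (energy (fst p), \<lambda>_. 0)) \<in> measurable (M \<Otimes>\<^sub>M col 0) state"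
      unfolding updc_def fst_conv snd_conv by (rule measurable_Pair[OF 1 setcol_measurable[OF 2 3]])
    from measurable_compose[OF this Q]
    show "(\<lambda>\<omega>. \<integral>\<^sup>+c. Qd (Ae a) (Ae b) r r (updc 0 c (energy \<omega>, \<lambda>_. 0)) \<partial>col 0) \<in> borel_measurable M"
      by (intro C.borel_measurable_nn_integral) (simp add: case_prod_unfold)
  qed
  finally show ?thesis .
qed

end

section \<open>The coupled matrices on the given probability space\<close>

lemma X_fun_energy_cong:
  assumes "\<And>\<sigma>. \<sigma> \<in> spins N \<Longrightarrow> h \<sigma> = h' \<sigma>"
  shows "X_fun N k \<xi> q m t h l z = X_fun N k \<xi> q m t h' l z"
proof (induction "k - l" arbitrary: l z)
  case 0
  then show ?case using assms by (simp add: X_fun.simps hamiltonian_def)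
next
  case (Suc n)
  then have "X_fun N k \<xi> q m t h (Suc l) z' = X_fun N k \<xi> q m t h' (Suc l) z'" for z' by simp
  then show ?case by (subst (1 2) X_fun.simps) (simp add: assms hamiltonian_def)
qed

text \<open>Here r is the depth of the branching node, so the copies separate from column
  \<open>Suc r\<close> on.\<close>

locale coupled_disorder = prob_space M + spin_params N k \<xi> q m t
  for M :: "'w measure" and N k \<xi> q m t +
  fixes H :: "(nat \<Rightarrow> real) \<Rightarrow> 'w \<Rightarrow> real" and entries :: "nat \<times> nat \<times> nat \<Rightarrow> 'w \<Rightarrow> real" and r :: nat
  assumes H_measurable: "\<And>\<sigma>. \<sigma> \<in> spins N \<Longrightarrow> H \<sigma> \<in> borel_measurable M"
    and r_less: "r < k"
    and coupled: "coupled_copies M N k \<xi> q (Suc r) entries"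
    and H_entries_indep: "indep_set (generated_events M (spins N) H) (generated_events M (copy_entries N k) entries)"
begin

abbreviation "energy \<equiv> spin_energy N H"

abbreviation "columns_borel \<equiv> PiM (UNIV :: (nat \<times> nat) set) (\<lambda>_. seq_borel)"

text \<open>The columns below \<open>Suc r\<close> of the second copy are those of the first one.\<close>

definition column_index :: "(nat \<times> nat) set" where
  "column_index = {1} \<times> {..k} \<union> {2} \<times> {Suc r..k}"

definition column :: "nat \<times> nat \<Rightarrow> 'w \<Rightarrow> nat \<Rightarrow> real" where
  "column j \<omega> i = (if i < N then entries (fst j, i, snd j) \<omega> else 0)"

definition columns :: "'w \<Rightarrow> nat \<times> nat \<Rightarrow> nat \<Rightarrow> real" where
  "columns \<omega> = (\<lambda>j. if j \<in> column_index then column j \<omega> else (\<lambda>_. 0))"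

lemma entries_gaussian:
  "independent_gaussians M ({1} \<times> {..<N} \<times> {..k} \<union> {2} \<times> {..<N} \<times> {Suc r..k}) (\<lambda>(j, i, l). column_var \<xi> q l) entries"
  using coupled by (simp add: coupled_copies_def)

lemma entries_index: "j \<in> column_index \<Longrightarrow> i < N \<Longrightarrow>
    (fst j, i, snd j) \<in> {1} \<times> {..<N} \<times> {..k} \<union> {2} \<times> {..<N} \<times> {Suc r..k}"
  by (auto simp: column_index_def)

lemma entries_measurable:
  "j \<in> column_index \<Longrightarrow> i < N \<Longrightarrow> entries (fst j, i, snd j) \<in> borel_measurable M"
  using entries_gaussian entries_index[of j i] unfolding independent_gaussians_def by blast

text \<open>The index set lists each shared column once, under copy 1, so the columns are disjoint
  groups of the independent entries.\<close>

lemma columns_indep: "indep_vars (\<lambda>_. seq_borel) column column_index"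
proof -
  let ?I = "{1} \<times> {..<N} \<times> {..k} \<union> {2} \<times> {..<N} \<times> {Suc r..k} :: (nat \<times> nat \<times> nat) set"
  let ?K = "\<lambda>j :: nat \<times> nat. {fst j} \<times> {..<N} \<times> {snd j}"
  let ?g = "\<lambda>j (f :: nat \<times> nat \<times> nat \<Rightarrow> real) i. if i < N then f (fst j, i, snd j) else 0"
  have gm: "?g j \<in> measurable (PiM (?K j) (\<lambda>_. borel)) seq_borel" for j
  proof (rule measurable_PiM_single')
    fix i show "(\<lambda>f. ?g j f i) \<in> borel_measurable (PiM (?K j) (\<lambda>_. borel))"
      by (cases "i < N") (auto intro: measurable_component_singleton)
  qed auto
  have zi: "indep_vars (\<lambda>_. borel) entries ?I"
    using entries_gaussian by (simp add: independent_gaussians_def)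
  have "indep_vars (\<lambda>_. seq_borel) (\<lambda>j \<omega>. ?g j (\<lambda>i\<in>?K j. entries i \<omega>)) column_index"
    by (rule indep_vars_group[OF zi _ _ gm]) (auto simp: column_index_def disjoint_family_on_def)
  also have "(\<lambda>j \<omega>. ?g j (\<lambda>i\<in>?K j. entries i \<omega>)) = column"
    by (auto simp: fun_eq_iff column_def)
  finally show ?thesis .
qed

lemma column_law_eq:
  assumes j: "j \<in> column_index"
  shows "distr M seq_borel (column j) = col (snd j)"
proof -
  have zi: "indep_vars (\<lambda>_. borel) entries ({1} \<times> {..<N} \<times> {..k} \<union> {2} \<times> {..<N} \<times> {Suc r..k})"
    using entries_gaussian by (simp add: independent_gaussians_def)
  have zl: "distr M borel (entries (fst j, i, snd j)) = centered_gaussian (column_var \<xi> q (snd j))" if "i < N" for i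
    using entries_gaussian entries_index[OF j that] unfolding independent_gaussians_def by fastforce
  have "indep_vars (\<lambda>_. borel) (\<lambda>i. entries (fst j, i, snd j)) {..<N}"
    by (rule indep_vars_reindex_inj[OF zi]) (use entries_index[OF j] in \<open>auto simp: inj_on_def\<close>)
  from distr_column[OF this zl] show ?thesis
    by (simp add: column_def[abs_def] col_def)
qed

lemma energy_columns:
  shows energy_measurable: "energy \<in> measurable M energy_borel"
    and columns_measurable: "columns \<in> measurable M columns_borel"
    and energy_columns_indep: "distr M energy_borel energy \<Otimes>\<^sub>M distr M columns_borel columns =
      distr M (energy_borel \<Otimes>\<^sub>M columns_borel) (\<lambda>\<omega>. (energy \<omega>, columns \<omega>))"
proof -
  show em: "energy \<in> measurable M energy_borel"
    by (rule spin_energy_measurable) (rule H_measurable)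
  show cm: "columns \<in> measurable M columns_borel"
  proof (rule measurable_PiM_single')
    fix j show "(\<lambda>\<omega>. columns \<omega> j) \<in> measurable M seq_borel"
    proof (rule measurable_PiM_single')
      fix i show "(\<lambda>\<omega>. columns \<omega> j i) \<in> borel_measurable M"
        using entries_measurable[of j i]
        by (cases "j \<in> column_index"; cases "i < N") (simp_all add: columns_def column_def)
    qed auto
  qed (auto simp: space_PiM)
  show "distr M energy_borel energy \<Otimes>\<^sub>M distr M columns_borel columns =
      distr M (energy_borel \<Otimes>\<^sub>M columns_borel) (\<lambda>\<omega>. (energy \<omega>, columns \<omega>))"
  proof (rule distr_pair_indep_set[OF H_entries_indep em cm])
    show "energy -` A \<inter> space M \<in> generated_events M (spins N) H" if A: "A \<in> sets energy_borel" for A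
      using A by (rule spin_energy_generated)
    let ?g = "\<lambda>(f :: nat \<times> nat \<times> nat \<Rightarrow> real) j i. if j \<in> column_index \<and> i < N then f (fst j, i, snd j) else 0"
    show "columns -` A \<inter> space M \<in> generated_events M (copy_entries N k) entries" if A: "A \<in> sets columns_borel" for A
    proof (rule generated_events_preimage[OF _ _ A])
      show "?g \<in> measurable (PiM (copy_entries N k) (\<lambda>_. borel)) columns_borel"
      proof (rule measurable_PiM_single')
        fix j show "(\<lambda>f. ?g f j) \<in> measurable (PiM (copy_entries N k) (\<lambda>_. borel)) seq_borel"
        proof (rule measurable_PiM_single')
          fix i show "(\<lambda>f. ?g f j i) \<in> borel_measurable (PiM (copy_entries N k) (\<lambda>_. borel))"
            using measurable_component_singleton[of "(fst j, i, snd j)" "copy_entries N k" "\<lambda>_. borel :: real measure"]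
            by (cases "j \<in> column_index \<and> i < N") (auto simp: column_index_def copy_entries_def)
        qed auto
      qed (auto simp: space_PiM)
      show "columns \<omega> = ?g (\<lambda>i\<in>copy_entries N k. entries i \<omega>)" for \<omega>
        by (auto simp: fun_eq_iff columns_def column_def column_index_def copy_entries_def)
    qed
  qed
qed

lemma integral_energy_columns:
  assumes f: "(\<lambda>p. f (fst p) (snd p)) \<in> borel_measurable (energy_borel \<Otimes>\<^sub>M columns_borel)"
    and d: "\<And>h. dep column_index (f h)"
  shows "(\<integral>\<^sup>+\<omega>. f (energy \<omega>) (columns \<omega>) \<partial>M) = (\<integral>\<^sup>+\<omega>. \<integral>\<^sup>+y. f (energy \<omega>) y \<partial>PiM UNIV (\<lambda>j. col (snd j)) \<partial>M)"
proof -
  have "(\<integral>\<^sup>+\<omega>. f (energy \<omega>) (columns \<omega>) \<partial>M) = (\<integral>\<^sup>+\<omega>. \<integral>\<^sup>+\<omega>'. f (energy \<omega>) (columns \<omega>') \<partial>M \<partial>M)"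
    by (rule nn_integral_pair_distr[OF energy_columns f])
  also have "\<dots> = (\<integral>\<^sup>+\<omega>. \<integral>\<^sup>+y. f (energy \<omega>) y \<partial>PiM UNIV (\<lambda>j. col (snd j)) \<partial>M)"
  proof (rule nn_integral_cong)
    fix \<omega>
    have "f (energy \<omega>) \<in> borel_measurable columns_borel"
      using measurable_compose[OF measurable_Pair1' f, of "energy \<omega>"] by (simp add: space_PiM)
    then show "(\<integral>\<^sup>+\<omega>'. f (energy \<omega>) (columns \<omega>') \<partial>M) = (\<integral>\<^sup>+y. f (energy \<omega>) y \<partial>PiM UNIV (\<lambda>j. col (snd j)))"
      unfolding columns_def
      by (intro nn_integral_config[OF columns_indep])
        (auto simp: space_PiM col_def prob_space_column_law sets_column_law d column_law_eq)
  qed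
  finally show ?thesis .
qed

end

context spin_cascade
begin

text \<open>The integrand of \<open>\<mu>_r\<close> for the indicator of the pair \<open>(a, b)\<close>.\<close>

definition coupled_integrand where
  "coupled_integrand a b r h y = (\<Prod>l\<in>{1..<Suc r}. Wc l (copy1 h y)) *
      (\<Prod>l\<in>{Suc r..k}. Wc l (copy1 h y) * Wc l (copy2 (Suc r) h y)) *
      (GG (Ae a) k (copy1 h y) * GG (Ae b) k (copy2 (Suc r) h y))"

lemma copy_pair_measurable:
  fixes f :: "nat \<Rightarrow> nat"
  shows "(\<lambda>p. (fst p, \<lambda>(i, l). snd p (f l, l) i)) \<in> measurable (energy_borel \<Otimes>\<^sub>M PiM UNIV (\<lambda>_. seq_borel)) state"
proof (intro measurable_Pair measurable_PiM_single' measurable_fst)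
  fix i :: "nat \<times> nat"
  have c: "(\<lambda>p. snd p j n) \<in> borel_measurable (energy_borel \<Otimes>\<^sub>M PiM UNIV (\<lambda>_. seq_borel))" for j :: "nat \<times> nat" and n
  proof -
    have "(\<lambda>p. snd p j) \<in> measurable (energy_borel \<Otimes>\<^sub>M PiM UNIV (\<lambda>_. seq_borel)) seq_borel"
      by (rule measurable_compose[OF measurable_snd]) (rule measurable_component_singleton, simp)
    then show ?thesis
      by (rule measurable_compose) (rule measurable_component_singleton, simp)
  qed
  show "(\<lambda>p. (case i of (i, l) \<Rightarrow> snd p (f l, l) i)) \<in> borel_measurable (energy_borel \<Otimes>\<^sub>M PiM UNIV (\<lambda>_. seq_borel))"
    using c by (cases i) simp
qed (auto simp: space_PiM)

lemma coupled_integrand_measurable: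
  assumes ab: "a \<in> spins N" "b \<in> spins N" and r: "r < k"
  shows "(\<lambda>p. coupled_integrand a b r (fst p) (snd p)) \<in> borel_measurable (energy_borel \<Otimes>\<^sub>M PiM UNIV (\<lambda>_. seq_borel))"
proof -
  have 1: "(\<lambda>p. copy1 (fst p) (snd p)) \<in> measurable (energy_borel \<Otimes>\<^sub>M PiM UNIV (\<lambda>_. seq_borel)) state"
    unfolding copy1_def by (rule copy_pair_measurable[of "\<lambda>_. 1"])
  have 2: "(\<lambda>p. copy2 (Suc r) (fst p) (snd p)) \<in> measurable (energy_borel \<Otimes>\<^sub>M PiM UNIV (\<lambda>_. seq_borel)) state"
    unfolding copy2_def by (rule copy_pair_measurable[of "\<lambda>l. if l < Suc r then 1 else 2"])
  have G: "GG (Ae c) k \<in> borel_measurable state" if "c \<in> spins N" for c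
    using GG_measurable_le_1[OF Ae_measurable Ae_le[OF that], of k] by simp
  show ?thesis
    unfolding coupled_integrand_def using r ab
    by (intro borel_measurable_times_ennreal borel_measurable_prod_ennreal
        measurable_compose[OF 1] measurable_compose[OF 2] Wc_measurable G) auto
qed

lemma coupled_integrand_agree:
  assumes r: "r < k"
    and x1: "agree N k (snd (copy1 h y)) (snd (copy1 h y'))"
    and x2: "agree N k (snd (copy2 (Suc r) h y)) (snd (copy2 (Suc r) h y'))"
  shows "coupled_integrand a b r h y = coupled_integrand a b r h y'"
proof -
  have W1: "Wc l (copy1 h y) = Wc l (copy1 h y')" if "l \<le> k" for l
    by (rule up_toD[OF Wc_up_to[OF that]]) (use agree_mono[OF x1 that] in \<open>simp_all add: copy1_def\<close>)
  have W2: "Wc l (copy2 (Suc r) h y) = Wc l (copy2 (Suc r) h y')" if "l \<le> k" for l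
    by (rule up_toD[OF Wc_up_to[OF that]]) (use agree_mono[OF x2 that] in \<open>simp_all add: copy2_def\<close>)
  have G1: "GG (Ae a) k (copy1 h y) = GG (Ae a) k (copy1 h y')"
    by (rule up_toD[OF GG_up_to[OF Ae_up_to order_refl] _ x1]) (simp add: copy1_def)
  have G2: "GG (Ae b) k (copy2 (Suc r) h y) = GG (Ae b) k (copy2 (Suc r) h y')"
    by (rule up_toD[OF GG_up_to[OF Ae_up_to order_refl] _ x2]) (simp add: copy2_def)
  show ?thesis
    unfolding coupled_integrand_def G1 G2 using r
    by (intro arg_cong2[where f="(*)"] prod.cong refl W1 W2) auto
qed

end

text \<open>Puts the coupled matrices and the cascade into one context, so that both sides of the
  identity are expressed by the same iterated averages \<open>Qd\<close>.\<close>

locale coupled_cascade = coupled_disorder + spin_cascade N k \<xi> q m t \<rho> for \<rho>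
begin

text \<open>The laws of the columns turn the expectation into an integral over \<open>Z.P\<close>,
  to which \<open>coupled_integral\<close> applies for each fixed realisation of the
  energies.\<close>

theorem integral_coupled_integrand:
  assumes ab: "a \<in> spins N" "b \<in> spins N"
  shows "(\<integral>\<^sup>+\<omega>. coupled_integrand a b r (energy \<omega>) (columns \<omega>) \<partial>M) =
    (\<integral>\<^sup>+\<omega>. \<integral>\<^sup>+c. Qd (Ae a) (Ae b) r r (updc 0 c (energy \<omega>, \<lambda>_. 0)) \<partial>col 0 \<partial>M)"
proof -
  have "(\<integral>\<^sup>+\<omega>. coupled_integrand a b r (energy \<omega>) (columns \<omega>) \<partial>M) =
    (\<integral>\<^sup>+\<omega>. \<integral>\<^sup>+y. coupled_integrand a b r (energy \<omega>) y \<partial>PiM UNIV (\<lambda>j. col (snd j)) \<partial>M)"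
  proof (rule integral_energy_columns[OF coupled_integrand_measurable[OF ab r_less]])
    show "dep column_index (coupled_integrand a b r h)" for h
    proof (rule depI)
      fix y y' :: "nat \<times> nat \<Rightarrow> nat \<Rightarrow> real" assume "\<And>j. j \<in> column_index \<Longrightarrow> y j = y' j"
      then have "l \<le> k \<Longrightarrow> y (1, l) = y' (1, l)" "Suc r \<le> l \<Longrightarrow> l \<le> k \<Longrightarrow> y (2, l) = y' (2, l)" for l
        by (auto simp: column_index_def)
      then show "coupled_integrand a b r h y = coupled_integrand a b r h y'"
        by (intro coupled_integrand_agree[OF r_less]) (auto simp: agree_def copy1_def copy2_def)
    qed
  qed
  also have "\<dots> = (\<integral>\<^sup>+\<omega>. \<integral>\<^sup>+y. coupled_integrand a b r (energy \<omega>) y \<partial>Z.P \<partial>M)"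
    unfolding Z.P_def unfolding col_of_def[abs_def] ..
  also have "\<dots> = (\<integral>\<^sup>+\<omega>. \<integral>\<^sup>+c. Qd (Ae a) (Ae b) r r (updc 0 c (energy \<omega>, \<lambda>_. 0)) \<partial>col 0 \<partial>M)"
    unfolding coupled_integrand_def
    by (intro nn_integral_cong coupled_integral r_less)
      (auto intro: Ae_measurable Ae_le[OF ab(1)] Ae_le[OF ab(2)] Ae_up_to)
  finally show ?thesis .
qed

text \<open>Identifies the extended nonnegative integrand with the real one behind
  \<open>mu\<close>: the padding of energies and columns is invisible to all factors, and the double
  partition sum is the product of two single ones.\<close>

lemma coupled_integrand_eq:
  fixes a b \<omega>
  defines "z1 \<equiv> \<lambda>(i, l). entries (1, i, l) \<omega>" and "z2 \<equiv> \<lambda>(i, l). entries (2, i, l) \<omega>" and "h \<equiv> \<lambda>\<sigma>. H \<sigma> \<omega>"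
  defines "W \<equiv> W_fun N k \<xi> q m t h"
  assumes \<omega>: "\<omega> \<in> space M" and ab: "a \<in> spins N" "b \<in> spins N"
  shows "coupled_integrand a b r (energy \<omega>) (columns \<omega>) =
    ennreal ((\<Prod>l\<in>{1..<Suc r}. W l z1) * (\<Prod>l\<in>{Suc r..k}. W l z1 * W l z2) *
      (exp (hamiltonian N t h (matrix_field k z1) a + hamiltonian N t h (matrix_field k z2) b) /
       ((\<Sum>\<sigma>1\<in>spins N. \<Sum>\<sigma>2\<in>spins N. exp (hamiltonian N t h (matrix_field k z1) \<sigma>1 + hamiltonian N t h (matrix_field k z2) \<sigma>2)))))"
proof -
  let ?x1 = "copy1 (energy \<omega>) (columns \<omega>)" and ?x2 = "copy2 (Suc r) (energy \<omega>) (columns \<omega>)"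
  have a1: "agree N k (snd ?x1) z1"
    by (auto simp: agree_def copy1_def columns_def column_def column_index_def z1_def)
  \<comment> \<open>For columns up to r the second copy is read off the first one, which is correct
    since the given matrices coincide there.\<close>
  have "entries (2, i, l) \<omega> = entries (1, i, l) \<omega>" if "i < N" "l < Suc r" for i l
    using coupled \<omega> that unfolding coupled_copies_def by blast
  then have a2: "agree N k (snd ?x2) z2"
    by (auto simp: agree_def copy2_def columns_def column_def column_index_def z2_def)
  have f: "fst ?x1 = energy \<omega>" "fst ?x2 = energy \<omega>" by (simp_all add: copy1_def copy2_def)
  have h: "energy \<omega> \<sigma> = h \<sigma>" if "\<sigma> \<in> spins N" for \<sigma>
    using that by (simp add: spin_energy_def h_def)
  have Xeq: "Xc l x = X_fun N k \<xi> q m t h l z'"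
    if "l \<le> k" "fst x = energy \<omega>" "agree N k (snd x) z'" for l x z'
  proof -
    have "Xc l x = X_fun N k \<xi> q m t (energy \<omega>) l z'"
      unfolding Xc_def that(2) by (rule X_fun_agree[OF that(1) agree_mono[OF that(3,1)]])
    also have "\<dots> = X_fun N k \<xi> q m t h l z'" by (rule X_fun_energy_cong) (rule h)
    finally show ?thesis .
  qed
  have W: "Wc l x = ennreal (W l z')" if "l \<le> k" "fst x = energy \<omega>" "agree N k (snd x) z'" for l x z'
    unfolding Wc_def W_def W_fun_def using that by (simp add: Xeq)
  have E: "hamiltonian N t (fst x) (matrix_field k (snd x)) \<sigma> = hamiltonian N t h (matrix_field k z') \<sigma>"
    if "fst x = energy \<omega>" "agree N k (snd x) z'" "\<sigma> \<in> spins N" for x z' \<sigma>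
  proof -
    have "hamiltonian N t (fst x) (matrix_field k (snd x)) \<sigma> = hamiltonian N t (fst x) (matrix_field k z') \<sigma>"
      by (rule hamiltonian_cong) (rule matrix_field_agree[OF that(2)])
    then show ?thesis using that h[OF that(3)] by (simp add: hamiltonian_def)
  qed
  have G: "GG (Ae c) k x = ennreal (exp (hamiltonian N t h (matrix_field k z') c) / (\<Sum>\<sigma>\<in>spins N. exp (hamiltonian N t h (matrix_field k z') \<sigma>)))"
    if "fst x = energy \<omega>" "agree N k (snd x) z'" "c \<in> spins N" for x z' c
  proof -
    have "partition_fun k x = (\<Sum>\<sigma>\<in>spins N. exp (hamiltonian N t h (matrix_field k z') \<sigma>))"
      unfolding partition_fun_def
      by (intro sum.cong refl arg_cong[where f=exp]) (rule E[OF that(1,2)])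
    then show ?thesis
      using partition_fun_pos[of k x] unfolding GG_k Ae_def E[OF that] by (simp add: divide_ennreal)
  qed
  have W0: "0 \<le> W l z'" for l z' by (simp add: W_def W_fun_def)
  let ?s = "\<lambda>z'. \<Sum>\<sigma>\<in>spins N. exp (hamiltonian N t h (matrix_field k z') \<sigma>)"
  have S: "(\<Sum>\<sigma>1\<in>spins N. \<Sum>\<sigma>2\<in>spins N. exp (hamiltonian N t h (matrix_field k z1) \<sigma>1 + hamiltonian N t h (matrix_field k z2) \<sigma>2)) = ?s z1 * ?s z2"
    by (simp add: exp_add sum_product)
  have P1: "(\<Prod>l\<in>{1..<Suc r}. Wc l ?x1) = ennreal (\<Prod>l\<in>{1..<Suc r}. W l z1)"
  proof -
    have "(\<Prod>l\<in>{1..<Suc r}. Wc l ?x1) = (\<Prod>l\<in>{1..<Suc r}. ennreal (W l z1))"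
      using r_less by (intro prod.cong refl W[OF _ f(1) a1]) auto
    then show ?thesis by (simp only: prod_ennreal W0)
  qed
  have P2: "(\<Prod>l\<in>{Suc r..k}. Wc l ?x1 * Wc l ?x2) = ennreal (\<Prod>l\<in>{Suc r..k}. W l z1 * W l z2)"
    by (subst prod_ennreal[symmetric])
      (auto intro!: prod.cong mult_nonneg_nonneg W0 simp: W[OF _ f(1) a1] W[OF _ f(2) a2] ennreal_mult W0)
  show ?thesis
    unfolding coupled_integrand_def P1 P2 G[OF f(1) a1 ab(1)] G[OF f(2) a2 ab(2)] S
    by (simp add: ennreal_mult[symmetric] W0 prod_nonneg sum_nonneg exp_add)
qed

end

section \<open>Return to real-valued integrals\<close>

lemma integrable_enn2real:
  assumes [measurable]: "g \<in> borel_measurable M"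
    and fin: "\<And>\<omega>. \<omega> \<in> space M \<Longrightarrow> g \<omega> < top" and int: "(\<integral>\<^sup>+\<omega>. g \<omega> \<partial>M) < top"
  shows "integrable M (\<lambda>\<omega>. enn2real (g \<omega>))" "(\<integral>\<omega>. enn2real (g \<omega>) \<partial>M) = enn2real (\<integral>\<^sup>+\<omega>. g \<omega> \<partial>M)"
proof -
  have eq: "(\<integral>\<^sup>+\<omega>. ennreal (enn2real (g \<omega>)) \<partial>M) = (\<integral>\<^sup>+\<omega>. g \<omega> \<partial>M)"
    by (intro nn_integral_cong) (simp add: fin)
  show "integrable M (\<lambda>\<omega>. enn2real (g \<omega>))"
    by (rule integrableI_nonneg) (use int in \<open>auto simp: eq\<close>)
  show "(\<integral>\<omega>. enn2real (g \<omega>) \<partial>M) = enn2real (\<integral>\<^sup>+\<omega>. g \<omega> \<partial>M)"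
    by (subst integral_eq_nn_integral) (auto simp: eq)
qed

text \<open>The signed coefficients D stay outside, so integrability is a matter of the nonnegative
  functions \<open>g a b\<close> alone.\<close>

lemma integral_sum_enn2real:
  fixes D :: "'s \<Rightarrow> 's \<Rightarrow> real"
  assumes "\<And>a b. a \<in> S \<Longrightarrow> b \<in> S \<Longrightarrow> g a b \<in> borel_measurable M"
    and "\<And>a b \<omega>. a \<in> S \<Longrightarrow> b \<in> S \<Longrightarrow> \<omega> \<in> space M \<Longrightarrow> g a b \<omega> < top"
    and "\<And>a b. a \<in> S \<Longrightarrow> b \<in> S \<Longrightarrow> (\<integral>\<^sup>+\<omega>. g a b \<omega> \<partial>M) < top"
  shows "(\<integral>\<omega>. (\<Sum>a\<in>S. \<Sum>b\<in>S. D a b * enn2real (g a b \<omega>)) \<partial>M) =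
    (\<Sum>a\<in>S. \<Sum>b\<in>S. D a b * enn2real (\<integral>\<^sup>+\<omega>. g a b \<omega> \<partial>M))"
proof -
  note I = integrable_enn2real[OF assms]
  have "(\<integral>\<omega>. (\<Sum>a\<in>S. \<Sum>b\<in>S. D a b * enn2real (g a b \<omega>)) \<partial>M) = (\<Sum>a\<in>S. \<integral>\<omega>. (\<Sum>b\<in>S. D a b * enn2real (g a b \<omega>)) \<partial>M)"
    by (intro Bochner_Integration.integral_sum Bochner_Integration.integrable_sum integrable_mult_right I(1))
  also have "\<dots> = (\<Sum>a\<in>S. \<Sum>b\<in>S. \<integral>\<omega>. D a b * enn2real (g a b \<omega>) \<partial>M)"
    by (intro sum.cong refl Bochner_Integration.integral_sum integrable_mult_right I(1))
  also have "\<dots> = (\<Sum>a\<in>S. \<Sum>b\<in>S. D a b * enn2real (\<integral>\<^sup>+\<omega>. g a b \<omega> \<partial>M))"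
    by (intro sum.cong refl) (simp add: I(2))
  finally show ?thesis .
qed

context disorder
begin

lemma leaf_node_measurable:
  assumes "\<alpha> \<in> leaves k" "l \<in> {1..k}"
  shows "u (take l \<alpha>) \<in> borel_measurable M"
proof -
  have "l - 1 < length \<alpha>" "Suc (l - 1) = l" using assms by (auto simp: leaves_def)
  then have "take l \<alpha> = take (l - 1) \<alpha> @ [\<alpha> ! (l - 1)]"
    using take_Suc_conv_app_nth[of "l - 1" \<alpha>] by simp
  moreover have "length (take (l - 1) \<alpha>) < k" using assms by (auto simp: leaves_def)
  ultimately show ?thesis using u_measurable[of "take (l - 1) \<alpha>"] by metis
qed

lemma gibbs_weight_measurable:
  assumes "x \<in> spins N \<times> leaves k"
  shows "(\<lambda>\<omega>. gibbs_weight N k t (\<lambda>\<sigma>. H \<sigma> \<omega>) (\<lambda>x. z x \<omega>) (\<lambda>p. u p \<omega>) x) \<in> borel_measurable M"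
proof -
  obtain \<sigma> \<alpha> where x: "x = (\<sigma>, \<alpha>)" "\<sigma> \<in> spins N" "\<alpha> \<in> leaves k" using assms by auto
  have v: "(\<lambda>\<omega>. cascade_v k (\<lambda>p. u p \<omega>) \<gamma>) \<in> borel_measurable M" if "\<gamma> \<in> leaves k" for \<gamma>
    unfolding cascade_v_def by (intro borel_measurable_prod leaf_node_measurable that)
  have V: "(\<lambda>\<omega>. \<Sum>\<^sub>\<infinity>\<gamma>\<in>leaves k. cascade_v k (\<lambda>p. u p \<omega>) \<gamma>) \<in> borel_measurable M"
    by (intro infsum_measurable countable_leaves v)
  have w: "(\<lambda>\<omega>. cascade_w k (\<lambda>p. u p \<omega>) \<alpha>) \<in> borel_measurable M"
    unfolding cascade_w_def by (intro borel_measurable_divide v V x)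
  have f: "(\<lambda>\<omega>. leaf_field k (\<lambda>x. z x \<omega>) \<alpha> i) \<in> borel_measurable M" if "i < N" for i
    unfolding leaf_field_def by (intro borel_measurable_sum z_measurable that) (use x in \<open>auto simp: leaves_def\<close>)
  have "(\<lambda>\<omega>. \<Sum>i<N. leaf_field k (\<lambda>x. z x \<omega>) \<alpha> i * \<sigma> i) \<in> borel_measurable M"
    by (intro borel_measurable_sum borel_measurable_times f borel_measurable_const) auto
  then have "(\<lambda>\<omega>. hamiltonian N t (\<lambda>\<sigma>. H \<sigma> \<omega>) (leaf_field k (\<lambda>x. z x \<omega>) \<alpha>) \<sigma>) \<in> borel_measurable M"
    unfolding hamiltonian_def using H_measurable[OF x(2)] by measurable
  then show ?thesis
    unfolding x gibbs_weight_def using w by simp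
qed

lemma pair_mass_measurable:
  assumes ab: "a \<in> spins N" "b \<in> spins N"
  shows "(\<lambda>\<omega>. pair_mass k (Suc r) (gibbs_density (\<lambda>\<sigma>. H \<sigma> \<omega>) (\<lambda>x. z x \<omega>) (\<lambda>p. u p \<omega>)) a b) \<in> borel_measurable M"
proof -
  have cS: "countable (spins N \<times> leaves k)"
    by (intro countable_SIGMA countable_finite finite_spins countable_leaves)
  have d: "(\<lambda>\<omega>. gibbs_density (\<lambda>\<sigma>. H \<sigma> \<omega>) (\<lambda>x. z x \<omega>) (\<lambda>p. u p \<omega>) x) \<in> borel_measurable M"
    if "x \<in> spins N \<times> leaves k" for x
    by (intro measurable_compose[OF _ measurable_ennreal] borel_measurable_divide infsum_measurable gibbs_weight_measurable cS that)
  show ?thesis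
    unfolding pair_mass_def
    by (intro nn_integral_count_space_measurable countable_leaves borel_measurable_times_ennreal d borel_measurable_const)
      (use ab in auto)
qed

end

text \<open>All iterated averages are at most 1 and are integrated under probability laws; this is
  the finiteness needed for the return to real integrals.\<close>

lemma (in coupled_cascade) coupled_integral_le_1:
  assumes ab: "a \<in> spins N" "b \<in> spins N"
  shows "(\<integral>\<^sup>+\<omega>. \<integral>\<^sup>+c. Qd (Ae a) (Ae b) r r (updc 0 c (energy \<omega>, \<lambda>_. 0)) \<partial>col 0 \<partial>M) \<le> 1"
proof -
  interpret C: prob_space "col 0" by (rule prob_\<kappa>)
  have "(\<integral>\<^sup>+\<omega>. \<integral>\<^sup>+c. Qd (Ae a) (Ae b) r r (updc 0 c (energy \<omega>, \<lambda>_. 0)) \<partial>col 0 \<partial>M) \<le> (\<integral>\<^sup>+\<omega>. \<integral>\<^sup>+c. 1 \<partial>col 0 \<partial>M)"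
    using Qd_measurable_le_1[OF Ae_measurable Ae_le[OF ab(1)] Ae_measurable Ae_le[OF ab(2)] r_less, of r]
    by (intro nn_integral_mono) (simp del: split_paired_All)
  also have "\<dots> = 1" by (simp add: C.emeasure_space_1 prob_space.emeasure_space_1[OF coupled_disorder.axioms(1)[OF coupled_disorder_axioms]])
  finally show ?thesis .
qed

text \<open>Both sides are finite combinations, with the same signed coefficients
  \<open>Delta\<close>, of expectations indexed by pairs of configurations. For each pair both
  expectations reduce to the same iterated average Q, up to the factor
  \<open>m r - m (r - 1)\<close>.\<close>

theorem theorem4:
  fixes M :: "'w measure"
    and N k r :: nat
    and \<xi> :: "real \<Rightarrow> real"
    and m q :: "nat \<Rightarrow> real"
    and t :: real
    and H :: "(nat \<Rightarrow> real) \<Rightarrow> 'w \<Rightarrow> real"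
    and z :: "nat list \<times> nat \<Rightarrow> 'w \<Rightarrow> real"
    and u :: "nat list \<Rightarrow> 'w \<Rightarrow> real"
    and Z :: "nat \<times> nat \<times> nat \<Rightarrow> 'w \<Rightarrow> real"
  assumes "prob_space M"
    and "1 \<le> N" and "1 \<le> k"
    and "smooth \<xi>" and "convex_on UNIV \<xi>" and "\<xi> 0 = 0"
    and "m 0 = 0" and "\<And>l. l < k \<Longrightarrow> m l < m (Suc l)" and "m k < 1"
    and "q 0 = 0" and "\<And>l. l \<le> k \<Longrightarrow> q l < q (Suc l)" and "q (Suc k) = 1"
    and "centered_gaussian_process M (spins N) H"
    and "\<And>\<sigma>1 \<sigma>2. \<sigma>1 \<in> spins N \<Longrightarrow> \<sigma>2 \<in> spins N \<Longrightarrow>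
           (\<integral>\<omega>. H \<sigma>1 \<omega> * H \<sigma>2 \<omega> \<partial>M) = real N * \<xi> (overlap N \<sigma>1 \<sigma>2)"
    and "derrida_ruelle_cascade M k m u"
    and "independent_gaussians M (tree_entries N k) (\<lambda>(p, i). column_var \<xi> q (length p)) z"
    and "prob_space.indep_sets M
           (\<lambda>b. [generated_events M (spins N) H,
                 generated_events M (tree_entries N k) z,
                 generated_events M (nodes k) u] ! b) {..<3}"
    and "0 \<le> t" and "t \<le> 1"
    and "1 \<le> r" and "r \<le> k"
    and "coupled_copies M N k \<xi> q r Z"
    and "prob_space.indep_set M
           (generated_events M (spins N) H) (generated_events M (copy_entries N k) Z)"
  shows "(\<integral>\<omega>. (let \<Gamma> = gibbs_measure N k t (\<lambda>\<sigma>. H \<sigma> \<omega>) (\<lambda>x. z x \<omega>) (\<lambda>p. u p \<omega>)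
                in integral\<^sup>L (\<Gamma> \<Otimes>\<^sub>M \<Gamma>)
                     (\<lambda>((\<sigma>1, \<alpha>), (\<sigma>2, \<beta>)).
                        Delta \<xi> (overlap N \<sigma>1 \<sigma>2) (q (wedge k \<alpha> \<beta>)) * of_bool (wedge k \<alpha> \<beta> = r))) \<partial>M)
         = (m r - m (r - 1)) *
           mu M N k \<xi> q m t H Z r (\<lambda>\<sigma>1 \<sigma>2. Delta \<xi> (overlap N \<sigma>1 \<sigma>2) (q r))"
proof -
  \<comment> \<open>Levels and depths differ by one: leaves whose \<open>wedge\<close> is r share a
    prefix of length r'.\<close>
  obtain r' where r: "r = Suc r'" "r' < k" using assms(20,21) by (cases r) auto
  have params: "spin_params k m" using assms(7-9) by (rule spin_params.intro)
  have Hm: "H \<sigma> \<in> borel_measurable M" if "\<sigma> \<in> spins N" for \<sigma>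
    using assms(13) that by (simp add: centered_gaussian_process_def)
  interpret D: disorder M N k \<xi> q m t H z u
    by (rule disorder.intro[OF assms(1) params disorder_axioms.intro[OF Hm assms(15-17)]])
  interpret C: coupled_disorder M N k \<xi> q m t H Z r'
    by (rule coupled_disorder.intro[OF assms(1) params coupled_disorder_axioms.intro[OF Hm r(2) assms(22)[unfolded r] assms(23)]])
  interpret CC: coupled_cascade M N k \<xi> q m t H Z r' D.seq_law
    by (rule coupled_cascade.intro[OF C.coupled_disorder_axioms D.spin_cascade_axioms])
  let ?D = "\<lambda>a b. Delta \<xi> (overlap N a b) (q r)"
  define Q where "Q a b = (\<integral>\<^sup>+\<omega>. \<integral>\<^sup>+c. D.Qd (D.Ae a) (D.Ae b) r' r' (D.updc 0 c (spin_energy N H \<omega>, \<lambda>_. 0)) \<partial>D.col 0 \<partial>M)" for a b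
  have Q1: "Q a b \<le> 1" if "a \<in> spins N" "b \<in> spins N" for a b
    unfolding Q_def by (rule CC.coupled_integral_le_1[OF that])
  define \<rho> where "\<rho> \<omega> = D.gibbs_density (\<lambda>\<sigma>. H \<sigma> \<omega>) (\<lambda>x. z x \<omega>) (\<lambda>p. u p \<omega>)" for \<omega>
  have fin: "finite_measure (point_measure (spins N \<times> leaves k) (\<rho> \<omega>))" for \<omega>
    unfolding \<rho>_def by (rule finite_point_measure_normalized)
  have mass: "(\<integral>\<^sup>+\<omega>. pair_mass k r (\<rho> \<omega>) a b \<partial>M) = ennreal (m r - m (r - 1)) * Q a b"
    if "a \<in> spins N" "b \<in> spins N" for a b
    using D.integral_pair_mass[OF that r(2)] by (simp add: \<rho>_def Q_def r(1))
  have "m r' < m r" using assms(8)[OF r(2)] r(1) by simp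
  then have m_pos: "0 \<le> m r - m (r - 1)" using r(1) by simp
  have "(\<integral>\<omega>. (let \<Gamma> = gibbs_measure N k t (\<lambda>\<sigma>. H \<sigma> \<omega>) (\<lambda>x. z x \<omega>) (\<lambda>p. u p \<omega>)
                in integral\<^sup>L (\<Gamma> \<Otimes>\<^sub>M \<Gamma>)
                     (\<lambda>((\<sigma>1, \<alpha>), (\<sigma>2, \<beta>)).
                        Delta \<xi> (overlap N \<sigma>1 \<sigma>2) (q (wedge k \<alpha> \<beta>)) * of_bool (wedge k \<alpha> \<beta> = r))) \<partial>M) =
    (\<integral>\<omega>. (\<Sum>a\<in>spins N. \<Sum>b\<in>spins N. ?D a b * enn2real (pair_mass k r (\<rho> \<omega>) a b)) \<partial>M)"
  proof (rule Bochner_Integration.integral_cong[OF refl])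
    fix \<omega>
    \<comment> \<open>On the event selected by the indicator the argument of q is r, so the
      coefficient depends on the spins alone.\<close>
    have "(\<lambda>((\<sigma>1, \<alpha>), (\<sigma>2, \<beta>)). Delta \<xi> (overlap N \<sigma>1 \<sigma>2) (q (wedge k \<alpha> \<beta>)) * of_bool (wedge k \<alpha> \<beta> = r)) =
      (\<lambda>((\<sigma>1, \<alpha>), (\<sigma>2, \<beta>)). ?D \<sigma>1 \<sigma>2 * of_bool (wedge k \<alpha> \<beta> = r))"
      by (auto simp: fun_eq_iff)
    then show "(let \<Gamma> = gibbs_measure N k t (\<lambda>\<sigma>. H \<sigma> \<omega>) (\<lambda>x. z x \<omega>) (\<lambda>p. u p \<omega>)
                in integral\<^sup>L (\<Gamma> \<Otimes>\<^sub>M \<Gamma>)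
                     (\<lambda>((\<sigma>1, \<alpha>), (\<sigma>2, \<beta>)).
                        Delta \<xi> (overlap N \<sigma>1 \<sigma>2) (q (wedge k \<alpha> \<beta>)) * of_bool (wedge k \<alpha> \<beta> = r))) =
      (\<Sum>a\<in>spins N. \<Sum>b\<in>spins N. ?D a b * enn2real (pair_mass k r (\<rho> \<omega>) a b))"
      using integral_point_measure_pair(1)[OF fin[of \<omega>], of ?D r]
      by (simp add: Let_def gibbs_measure_def \<rho>_def)
  qed
  also have "\<dots> = (\<Sum>a\<in>spins N. \<Sum>b\<in>spins N. ?D a b * enn2real (\<integral>\<^sup>+\<omega>. pair_mass k r (\<rho> \<omega>) a b \<partial>M))"
  proof (rule integral_sum_enn2real)
    fix a b assume ab: "a \<in> spins N" "b \<in> spins N"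
    show "(\<lambda>\<omega>. pair_mass k r (\<rho> \<omega>) a b) \<in> borel_measurable M"
      unfolding \<rho>_def r(1) by (rule D.pair_mass_measurable[OF ab])
    show "pair_mass k r (\<rho> \<omega>) a b < top" for \<omega>
      by (rule integral_point_measure_pair(2)[OF fin ab])
    show "(\<integral>\<^sup>+\<omega>. pair_mass k r (\<rho> \<omega>) a b \<partial>M) < top"
      using Q1[OF ab] by (auto simp: mass[OF ab] ennreal_mult_less_top intro: le_less_trans)
  qed
  also have "\<dots> = (m r - m (r - 1)) * (\<Sum>a\<in>spins N. \<Sum>b\<in>spins N. ?D a b * enn2real (Q a b))"
    unfolding sum_distrib_left
    by (intro sum.cong refl) (simp add: mass enn2real_mult enn2real_ennreal[OF m_pos] mult_ac del: One_nat_def)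
  \<comment> \<open>The common value Q, obtained from the cascade, is now expressed through the
    coupled copies.\<close>
  also have "(\<Sum>a\<in>spins N. \<Sum>b\<in>spins N. ?D a b * enn2real (Q a b)) =
      (\<Sum>a\<in>spins N. \<Sum>b\<in>spins N. ?D a b * enn2real (\<integral>\<^sup>+\<omega>. D.coupled_integrand a b r' (spin_energy N H \<omega>) (C.columns \<omega>) \<partial>M))"
    unfolding Q_def by (intro sum.cong refl) (simp add: CC.integral_coupled_integrand)
  also have "\<dots> = (\<integral>\<omega>. (\<Sum>a\<in>spins N. \<Sum>b\<in>spins N. ?D a b * enn2real (D.coupled_integrand a b r' (spin_energy N H \<omega>) (C.columns \<omega>))) \<partial>M)"
  proof (rule integral_sum_enn2real[symmetric])
    fix a b assume ab: "a \<in> spins N" "b \<in> spins N"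
    show "(\<lambda>\<omega>. D.coupled_integrand a b r' (spin_energy N H \<omega>) (C.columns \<omega>)) \<in> borel_measurable M"
      using measurable_compose[OF measurable_Pair[OF C.energy_measurable C.columns_measurable] D.coupled_integrand_measurable[OF ab r(2)]]
      by simp
    show "D.coupled_integrand a b r' (spin_energy N H \<omega>) (C.columns \<omega>) < top" if "\<omega> \<in> space M" for \<omega>
      by (simp only: CC.coupled_integrand_eq[OF that ab] ennreal_less_top)
    show "(\<integral>\<^sup>+\<omega>. D.coupled_integrand a b r' (spin_energy N H \<omega>) (C.columns \<omega>) \<partial>M) < top"
      using Q1[OF ab] unfolding CC.integral_coupled_integrand[OF ab] Q_def by (rule le_less_trans) simp
  qed
  also have "\<dots> = mu M N k \<xi> q m t H Z r ?D"
    unfolding mu_def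
  proof (rule Bochner_Integration.integral_cong[OF refl])
    fix \<omega> assume \<omega>: "\<omega> \<in> space M"
    define z1 z2 h where "z1 = (\<lambda>(i, l). Z (1, i, l) \<omega>)" and "z2 = (\<lambda>(i, l). Z (2, i, l) \<omega>)" and "h = (\<lambda>\<sigma>. H \<sigma> \<omega>)"
    define W where "W = W_fun N k \<xi> q m t h"
    let ?w = "(\<Prod>l\<in>{1..<r}. W l z1) * (\<Prod>l\<in>{r..k}. W l z1 * W l z2)"
    let ?e = "\<lambda>a b. exp (hamiltonian N t h (matrix_field k z1) a + hamiltonian N t h (matrix_field k z2) b)"
    let ?S = "\<Sum>a\<in>spins N. \<Sum>b\<in>spins N. ?e a b"
    have w0: "0 \<le> ?w" by (intro mult_nonneg_nonneg prod_nonneg) (simp_all add: W_def W_fun_def)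
    have S0: "0 \<le> ?S" by (intro sum_nonneg) simp
    have "enn2real (D.coupled_integrand a b r' (spin_energy N H \<omega>) (C.columns \<omega>)) = ?w * (?e a b / ?S)"
      if ab: "a \<in> spins N" "b \<in> spins N" for a b
      unfolding CC.coupled_integrand_eq[OF \<omega> ab] z1_def[symmetric] z2_def[symmetric] h_def[symmetric] W_def[symmetric] r(1)[symmetric]
      by (rule enn2real_ennreal) (intro mult_nonneg_nonneg[OF w0] divide_nonneg_nonneg S0 exp_ge_zero)
    then have "(\<Sum>a\<in>spins N. \<Sum>b\<in>spins N. ?D a b * enn2real (D.coupled_integrand a b r' (spin_energy N H \<omega>) (C.columns \<omega>))) =
      (\<Sum>a\<in>spins N. \<Sum>b\<in>spins N. ?w * (?D a b * ?e a b / ?S))"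
      by (intro sum.cong refl) (simp add: mult_ac)
    also have "\<dots> = ?w * gibbs2 N t h (matrix_field k z1) (matrix_field k z2) ?D"
      unfolding gibbs2_def by (simp only: sum_distrib_left sum_divide_distrib)
    finally show "(\<Sum>a\<in>spins N. \<Sum>b\<in>spins N. ?D a b * enn2real (D.coupled_integrand a b r' (spin_energy N H \<omega>) (C.columns \<omega>))) =
      (let h = (\<lambda>\<sigma>. H \<sigma> \<omega>); z1 = (\<lambda>(i, l). Z (1, i, l) \<omega>); z2 = (\<lambda>(i, l). Z (2, i, l) \<omega>); W = W_fun N k \<xi> q m t h
       in (\<Prod>l\<in>{1..<r}. W l z1) * (\<Prod>l\<in>{r..k}. W l z1 * W l z2) *
          gibbs2 N t h (matrix_field k z1) (matrix_field k z2) ?D)"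
      unfolding Let_def z1_def[symmetric] z2_def[symmetric] h_def[symmetric] W_def[symmetric] .
  qed
  finally show ?thesis .
qed

end
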